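(* Let $u$ solve $-\varepsilon\Delta u+cu=f$ in $\Omega=(0,1)\times(0,1)$, $u=0$ on $\partial\Omega$, and assume that $u$ has a decomposition $u=S+E$ into a smooth part and a layer part satisfying the derivative bounds listed in the context. Let $\hat N=\sqrt N$, and let $$u_{\hat N,\hat N}^N:=u_{N,\hat N}+u_{\hat N,N}-u_{\hat N,\hat N}$$ be the combination of the bilinear Galerkin solutions on the $N\times\sqrt N$, $\sqrt N\times N$ and $\sqrt N\times\sqrt N$ Shishkin meshes, with $\lambda_0\ge2.5$; let $u_{N,N}$ be the bilinear Galerkin solution on the $N\times N$ Shishkin mesh. Then there is a constant $C$ independent of $\varepsilon$ and $N$ such that $$\|u_{\hat N,\hat N}^N-u_{N,N}\|_b\le C\left(\varepsilon^{1/4}N^{-1/2}+N^{-1}\ln N\right),$$ where $\|v\|_b=\varepsilon^{1/4}|v|_1+\|v\|_0$.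
   Context: Here $0<\varepsilon\ll1$ is a small parameter, $c>0$ is a constant, $f$ is sufficiently smooth, $(\cdot,\cdot)$ and $\|\cdot\|_0$ are the $L_2(\Omega)$ inner product and norm, and $|\cdot|_1$ is the $H^1(\Omega)$ seminorm. Decomposition: $u=S+E$ with $E=\sum_{k=1}^4w_k+\sum_{k=1}^4z_k$, where $w_k$ are layer terms associated with the four sides and $z_k$ with the four corners. With a fixed $0<c^*<c$ and a constant $C$ independent of $\varepsilon$, for all $(x,y)\in\overline\Omega$ and $0\le m+n\le4$: $|\partial_x^m\partial_y^nS|\le C(1+\varepsilon^{1-(m+n)/2})$; for the term $w_1$ associated with the side $y=0$, $|\partial_x^m\partial_y^nw_1|\le C(1+\varepsilon^{1-m/2})\varepsilon^{-n/2}e^{-y\sqrt{c^*/\varepsilon}}$; for the term $z_1$ associated with the corner $(0,0)$, $|\partial_x^m\partial_y^nz_1|\le C\varepsilon^{-(m+n)/2}e^{-(x+y)\sqrt{c^*/\varepsilon}}$; and the analogous bounds hold for the other sides and corners. Meshes: $N$ is such that $\sqrt N$ is an integer divisible by 4, and $\lambda=\min\{1/4,\lambda_0\sqrt{\varepsilon/c^*}\,\ln N\}$ (the same $\lambda$ for all meshes involved). For $M\in\{N,\sqrt N\}$ the one-dimensional Shishkin mesh with $M$ intervals divides $[0,\lambda]$ and $[1-\lambda,1]$ uniformly into $M/4$ intervals each and $[\lambda,1-\lambda]$ uniformly into $M/2$ intervals. The $N_x\times N_y$ mesh is the tensor product of the one-dimensional mesh with $N_x$ intervals in $x$ and the one with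 $N_y$ intervals in $y$. Galerkin solutions: $V_{N_x,N_y}\subset H_0^1(\Omega)$ is the space of continuous piecewise bilinear functions on the $N_x\times N_y$ mesh vanishing on $\partial\Omega$, and $u_{N_x,N_y}\in V_{N_x,N_y}$ satisfies $\varepsilon(\nabla u_{N_x,N_y},\nabla v)+c(u_{N_x,N_y},v)=(f,v)$ for all $v\in V_{N_x,N_y}$. *)

theory Defs
  imports "HOL-Analysis.Analysis"
begin

section \<open>The unit square and functions of class $C^k$ on its closure\<close>

definition Omega :: "(real \<times> real) set"
  where "Omega = {0<..<1} \<times> {0<..<1}"

text \<open>Partial derivatives are taken within \<open>{0..1}\<close>: they are one-sided on the boundary of the
  square and the ordinary ones inside. Their values outside the closed square carry no meaning.\<close>

definition pdx :: "(real \<times> real \<Rightarrow> real) \<Rightarrow> real \<times> real \<Rightarrow> real"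
  where "pdx g = (\<lambda>(x, y). vector_derivative (\<lambda>t. g (t, y)) (at x within {0..1}))"

definition pdy :: "(real \<times> real \<Rightarrow> real) \<Rightarrow> real \<times> real \<Rightarrow> real"
  where "pdy g = (\<lambda>(x, y). vector_derivative (\<lambda>t. g (x, t)) (at y within {0..1}))"

definition pd :: "nat \<Rightarrow> nat \<Rightarrow> (real \<times> real \<Rightarrow> real) \<Rightarrow> real \<times> real \<Rightarrow> real"
  where "pd m n g = (pdx ^^ m) ((pdy ^^ n) g)"

fun Ck_closure :: "nat \<Rightarrow> (real \<times> real \<Rightarrow> real) \<Rightarrow> bool" where
  "Ck_closure 0 g \<longleftrightarrow> continuous_on (closure Omega) g"
| "Ck_closure (Suc k) g \<longleftrightarrow>
     continuous_on (closure Omega) g \<and>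
     (\<forall>(x, y) \<in> closure Omega.
        (\<lambda>t. g (t, y)) differentiable (at x within {0..1}) \<and>
        (\<lambda>t. g (x, t)) differentiable (at y within {0..1})) \<and>
     Ck_closure k (pdx g) \<and> Ck_closure k (pdy g)"

section \<open>$L_2$ and $H^1$\<close>

definition L2_inner :: "(real \<times> real \<Rightarrow> real) \<Rightarrow> (real \<times> real \<Rightarrow> real) \<Rightarrow> real"
  where "L2_inner g h = (LINT p:Omega|lebesgue. g p * h p)"

definition L2_nrm :: "(real \<times> real \<Rightarrow> real) \<Rightarrow> real"
  where "L2_nrm g = sqrt (L2_inner g g)"

definition in_L2 :: "(real \<times> real \<Rightarrow> real) \<Rightarrow> bool"
  where "in_L2 g \<longleftrightarrow> set_borel_measurable lebesgue Omega g \<and>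
                   set_integrable lebesgue Omega (\<lambda>p. (g p)\<^sup>2)"

text \<open>Weak derivatives, tested with compactly supported \<open>C\<^sup>1\<close> functions. Since \<open>Omega\<close> is bounded,
  the support condition says exactly that the support is a compact subset of \<open>Omega\<close>.\<close>

definition test_function :: "(real \<times> real \<Rightarrow> real) \<Rightarrow> bool"
  where "test_function \<phi> \<longleftrightarrow> Ck_closure 1 \<phi> \<and> closure {p \<in> Omega. \<phi> p \<noteq> 0} \<subseteq> Omega"

definition is_weak_dx :: "(real \<times> real \<Rightarrow> real) \<Rightarrow> (real \<times> real \<Rightarrow> real) \<Rightarrow> bool"
  where "is_weak_dx v g \<longleftrightarrow> in_L2 g \<and>
    (\<forall>\<phi>. test_function \<phi> \<longrightarrow> L2_inner v (pdx \<phi>) = - L2_inner g \<phi>)"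

definition is_weak_dy :: "(real \<times> real \<Rightarrow> real) \<Rightarrow> (real \<times> real \<Rightarrow> real) \<Rightarrow> bool"
  where "is_weak_dy v g \<longleftrightarrow> in_L2 g \<and>
    (\<forall>\<phi>. test_function \<phi> \<longrightarrow> L2_inner v (pdy \<phi>) = - L2_inner g \<phi>)"

text \<open>Representatives of the weak derivatives of \<open>v\<close>, which are unique up to null sets;
  meaningful only for \<open>v\<close> in \<open>H\<^sup>1(Omega)\<close>.\<close>

definition weak_dx :: "(real \<times> real \<Rightarrow> real) \<Rightarrow> real \<times> real \<Rightarrow> real"
  where "weak_dx v = (SOME g. is_weak_dx v g)"

definition weak_dy :: "(real \<times> real \<Rightarrow> real) \<Rightarrow> real \<times> real \<Rightarrow> real"
  where "weak_dy v = (SOME g. is_weak_dy v g)"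

definition grad_inner :: "(real \<times> real \<Rightarrow> real) \<Rightarrow> (real \<times> real \<Rightarrow> real) \<Rightarrow> real"
  where "grad_inner v w = L2_inner (weak_dx v) (weak_dx w) + L2_inner (weak_dy v) (weak_dy w)"

definition H1_seminorm :: "(real \<times> real \<Rightarrow> real) \<Rightarrow> real"
  where "H1_seminorm v = sqrt (grad_inner v v)"

definition balanced_norm :: "real \<Rightarrow> (real \<times> real \<Rightarrow> real) \<Rightarrow> real"
  where "balanced_norm \<epsilon> v = \<epsilon> powr (1/4) * H1_seminorm v + L2_nrm v"

section \<open>The boundary value problem and the decomposition of its solution\<close>

definition solves_bvp ::
    "real \<Rightarrow> real \<Rightarrow> (real \<times> real \<Rightarrow> real) \<Rightarrow> (real \<times> real \<Rightarrow> real) \<Rightarrow> bool"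
  where "solves_bvp \<epsilon> c f u \<longleftrightarrow>
    Ck_closure 2 u \<and>
    (\<forall>p \<in> Omega. - \<epsilon> * (pd 2 0 u p + pd 0 2 u p) + c * u p = f p) \<and>
    (\<forall>p \<in> frontier Omega. u p = 0)"

text \<open>The terms \<open>w 1\<close>, \<open>w 2\<close>, \<open>w 3\<close>, \<open>w 4\<close> belong to the sides \<open>y = 0\<close>, \<open>x = 1\<close>, \<open>y = 1\<close>, \<open>x = 0\<close>,
  and \<open>z 1\<close>, \<open>z 2\<close>, \<open>z 3\<close>, \<open>z 4\<close> to the corners \<open>(0,0)\<close>, \<open>(1,0)\<close>, \<open>(1,1)\<close>, \<open>(0,1)\<close>.\<close>

definition layer_decomposition ::
    "real \<Rightarrow> real \<Rightarrow> real \<Rightarrow> (real \<times> real \<Rightarrow> real) \<Rightarrow> (real \<times> real \<Rightarrow> real) \<Rightarrow>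
     (nat \<Rightarrow> real \<times> real \<Rightarrow> real) \<Rightarrow> (nat \<Rightarrow> real \<times> real \<Rightarrow> real) \<Rightarrow> bool"
  where "layer_decomposition cs C \<epsilon> u S w z \<longleftrightarrow>
    Ck_closure 4 S \<and> (\<forall>k\<in>{1..4}. Ck_closure 4 (w k) \<and> Ck_closure 4 (z k)) \<and>
    (\<forall>p \<in> closure Omega. u p = S p + ((\<Sum>k=1..4. w k p) + (\<Sum>k=1..4. z k p))) \<and>
    (\<forall>x y m n. (x, y) \<in> closure Omega \<and> m + n \<le> 4 \<longrightarrow>
      (let a = sqrt (cs / \<epsilon>) in
       \<bar>pd m n S (x, y)\<bar> \<le> C * (1 + \<epsilon> powr (1 - real (m + n) / 2)) \<and>
       \<bar>pd m n (w 1) (x, y)\<bar>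
         \<le> C * (1 + \<epsilon> powr (1 - real m / 2)) * \<epsilon> powr (- real n / 2) * exp (- y * a) \<and>
       \<bar>pd m n (w 2) (x, y)\<bar>
         \<le> C * (1 + \<epsilon> powr (1 - real n / 2)) * \<epsilon> powr (- real m / 2) * exp (- (1 - x) * a) \<and>
       \<bar>pd m n (w 3) (x, y)\<bar>
         \<le> C * (1 + \<epsilon> powr (1 - real m / 2)) * \<epsilon> powr (- real n / 2) * exp (- (1 - y) * a) \<and>
       \<bar>pd m n (w 4) (x, y)\<bar>
         \<le> C * (1 + \<epsilon> powr (1 - real n / 2)) * \<epsilon> powr (- real m / 2) * exp (- x * a) \<and>
       \<bar>pd m n (z 1) (x, y)\<bar>
         \<le> C * \<epsilon> powr (- real (m + n) / 2) * exp (- (x + y) * a) \<and>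
       \<bar>pd m n (z 2) (x, y)\<bar>
         \<le> C * \<epsilon> powr (- real (m + n) / 2) * exp (- ((1 - x) + y) * a) \<and>
       \<bar>pd m n (z 3) (x, y)\<bar>
         \<le> C * \<epsilon> powr (- real (m + n) / 2) * exp (- ((1 - x) + (1 - y)) * a) \<and>
       \<bar>pd m n (z 4) (x, y)\<bar>
         \<le> C * \<epsilon> powr (- real (m + n) / 2) * exp (- (x + (1 - y)) * a)))"

section \<open>Shishkin meshes and Galerkin solutions\<close>

definition transition :: "real \<Rightarrow> real \<Rightarrow> real \<Rightarrow> nat \<Rightarrow> real"
  where "transition cs lam0 \<epsilon> N = min (1/4) (lam0 * sqrt (\<epsilon> / cs) * ln (real N))"

text \<open>The \<open>i\<close>-th node (\<open>0 \<le> i \<le> M\<close>) of the mesh with \<open>M\<close> intervals, for \<open>M\<close> divisible by 4.\<close>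

definition shishkin_node :: "real \<Rightarrow> nat \<Rightarrow> nat \<Rightarrow> real"
  where "shishkin_node lam M i =
    (if i \<le> M div 4 then lam * (real i / (real M / 4))
     else if i \<le> 3 * (M div 4) then lam + (1 - 2 * lam) * ((real i - real M / 4) / (real M / 2))
     else (1 - lam) + lam * ((real i - 3 * real M / 4) / (real M / 4)))"

definition fe_space :: "real \<Rightarrow> nat \<Rightarrow> nat \<Rightarrow> (real \<times> real \<Rightarrow> real) set"
  where "fe_space lam Nx Ny = {v.
    continuous_on (closure Omega) v \<and>
    (\<forall>i<Nx. \<forall>j<Ny. \<exists>\<alpha> \<beta> \<gamma> \<delta>.
       \<forall>x \<in> {shishkin_node lam Nx i .. shishkin_node lam Nx (Suc i)}.
       \<forall>y \<in> {shishkin_node lam Ny j .. shishkin_node lam Ny (Suc j)}.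
         v (x, y) = \<alpha> + \<beta> * x + \<gamma> * y + \<delta> * (x * y)) \<and>
    (\<forall>p \<in> frontier Omega. v p = 0)}"

definition is_galerkin ::
    "real \<Rightarrow> real \<Rightarrow> (real \<times> real \<Rightarrow> real) \<Rightarrow> (real \<times> real \<Rightarrow> real) set \<Rightarrow>
     (real \<times> real \<Rightarrow> real) \<Rightarrow> bool"
  where "is_galerkin \<epsilon> c f V U \<longleftrightarrow>
    U \<in> V \<and> (\<forall>v \<in> V. \<epsilon> * grad_inner U v + c * L2_inner U v = L2_inner f v)"

end

theory Submission imports Defs
begin

text \<open>
  Let \<open>R\<^sub>M\<close> be the Ritz projection for \<open>-\<epsilon> v'' + c v\<close> on the one-dimensional mesh with \<open>M\<close> intervals that
  keeps the end values. The Galerkin solution on the \<open>M \<times> K\<close> mesh is close to \<open>R\<^sub>M R\<^sub>K u\<close>, where \<open>R\<^sub>M\<close> acts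
  in \<open>x\<close> and \<open>R\<^sub>K\<close> in \<open>y\<close>: by the orthogonality of the Ritz projections, the consistency error consists only of
  \<open>(1 - R\<^sub>M) u\<close>, measured by its \<open>y\<close>-derivative, and of \<open>R\<^sub>M (1 - R\<^sub>K) u\<close>, measured by its \<open>x\<close>-derivative.
  Both are of the claimed order already on the coarse meshes.
  In \<open>R\<^sub>M R\<^sub>K u = R\<^sub>M u - R\<^sub>M (1 - R\<^sub>K) u\<close> the terms \<open>R\<^sub>M u\<close>, which carry the large error in the
  \<open>x\<close>-derivative, cancel in the combination; for the \<open>y\<close>-derivative one exchanges the two directions.

  What remains is governed by interpolation errors of \<open>u\<close>, and these are bounded by products of one-dimensional
  layer profiles. The mixed interpolation error has a part that is small only in the maximum norm, and \<open>R\<^sub>M\<close> is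
  bounded from the maximum norm to the \<open>H\<^sup>1\<close> seminorm by testing with functions that are linear on blocks of
  cells; the square of this bound is of order \<open>M\<^sup>2 + \<epsilon>\<^bsup>-1/2\<^esup> ln N\<close>.
\<close>

section \<open>Functionals and iterated integrals on the unit square\<close>

text \<open>The obstacle is the weight in the balanced norm. The energy norm has
  \<open>\<epsilon> powr (1/2)\<close> in front of the seminorm, so the usual energy argument loses
  a factor \<open>\<epsilon> powr (-1/4)\<close>. Comparing with a product of Ritz projections
  avoids this: each projection removes the reaction term together with the diffusion in its own
  direction, so what survives of the consistency error carries the same factor \<epsilon> as the
  seminorm to be bounded, and \<epsilon> cancels.

  With \<open>n1 = 1 / sqrt N\<close>, \<open>r = \<epsilon> powr (-1/2)\<close> and
  \<open>L = ln N\<close>, everything is measured against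
  \<open>\<Theta> = n1\<^sup>2 + n1 ^ 4 * r * L\<^sup>2\<close>: squared seminorms have to be of
  order \<open>\<Theta>\<close>, squared L2 norms of order \<open>\<Theta> / r\<close>, and
  \<open>\<Theta> / r\<close> is at most the square of the claimed bound. The energy estimate for
  the discrete solution operator costs \<open>1 / \<epsilon> = r\<^sup>2\<close>. Layer terms can
  pay this, since a squared profile has an integral of order \<open>1 / r\<close>; an error of size
  \<open>n1\<^sup>2\<close> on the whole square cannot, and this forces the detour through the
  maximum norm.

  Weak derivatives enter the estimates only through \<open>grad_inner_brk\<close>; elsewhere
  difference quotients take their place.\<close>

lemma positive_form_solvable:
  fixes A :: "nat \<Rightarrow> nat \<Rightarrow> real"
  assumes "\<And>x. (\<exists>i<n. x i \<noteq> 0) \<Longrightarrow> (\<Sum>i<n. \<Sum>j<n. x i * A i j * x j) > 0"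
  shows "\<exists>x. \<forall>i<n. (\<Sum>j<n. A i j * x j) = r i"
  using assms
proof (induction n arbitrary: r)
  case 0
  then show ?case by simp
next
  case (Suc n)
  have "(\<Sum>i<n. \<Sum>j<n. x i * A i j * x j) > 0" if "\<exists>i<n. x i \<noteq> 0" for x
  proof -
    have "0 < (\<Sum>i<Suc n. \<Sum>j<Suc n. (x(n := 0)) i * A i j * (x(n := 0)) j)"
      using that by (intro Suc.prems) (metis fun_upd_other less_Suc_eq less_irrefl)
    then show ?thesis by simp
  qed
  note IH = Suc.IH[OF this]
  obtain x' where x': "\<And>i. i < n \<Longrightarrow> (\<Sum>j<n. A i j * x' j) = r i" using IH by blast
  obtain y where y: "\<And>i. i < n \<Longrightarrow> (\<Sum>j<n. A i j * y j) = - A i n"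
    using IH[where r = "\<lambda>i. - A i n"] by blast
  \<comment> \<open>\<open>z\<close> has last entry 1 and is annihilated by the first
    \<open>n\<close> rows, so \<open>d\<close> below is the value of the form at \<open>z\<close>
    and hence positive: it is the Schur complement of the leading block. Adding a multiple of
    \<open>z\<close> corrects the last equation and leaves the others alone.\<close>
  define z where "z = y(n := 1)"
  have z0: "(\<Sum>j<Suc n. A i j * z j) = 0" if "i < n" for i
    using y[OF that] by (simp add: z_def)
  define d where "d = (\<Sum>j<Suc n. A n j * z j)"
  have "0 < (\<Sum>i<Suc n. \<Sum>j<Suc n. z i * A i j * z j)"
    by (intro Suc.prems) (auto simp: z_def)
  also have "\<dots> = (\<Sum>i<Suc n. z i * (\<Sum>j<Suc n. A i j * z j))"
    by (simp only: sum_distrib_left mult.assoc)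
  also have "\<dots> = d" using z0 by (simp add: d_def z_def)
  finally have d: "d > 0" .
  define s where "s = (r n - (\<Sum>j<n. A n j * x' j)) / d"
  have "(\<Sum>j<Suc n. A i j * ((x'(n := 0)) j + s * z j)) = r i" if "i < Suc n" for i
  proof -
    have "(\<Sum>j<Suc n. A i j * ((x'(n := 0)) j + s * z j))
        = (\<Sum>j<n. A i j * x' j) + s * (\<Sum>j<Suc n. A i j * z j)"
    proof -
      have "(\<Sum>j<Suc n. A i j * ((x'(n := 0)) j + s * z j))
        = (\<Sum>j<Suc n. A i j * (x'(n := 0)) j) + s * (\<Sum>j<Suc n. A i j * z j)"
        by (simp only: distrib_left sum.distrib sum_distrib_left mult.left_commute)
      then show ?thesis by simp
    qed
    also have "\<dots> = r i"
    proof (cases "i = n")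
      case True
      then show ?thesis using d unfolding True d_def[symmetric] s_def by simp
    next
      case False
      then show ?thesis using that x' z0 by simp
    qed
    finally show ?thesis .
  qed
  then show ?case by (intro exI[of _ "\<lambda>j. (x'(n := 0)) j + s * z j"] allI impI)
qed

section \<open>Linear functionals on continuous functions on the unit interval\<close>

abbreviation cont :: "(real \<Rightarrow> real) \<Rightarrow> bool"
  where "cont f \<equiv> continuous_on {0..1} f"

definition ip :: "(real \<Rightarrow> real) \<Rightarrow> (real \<Rightarrow> real) \<Rightarrow> real"
  where "ip f g = integral {0..1} (\<lambda>x. f x * g x)"

lemma ip_integrable: "cont f \<Longrightarrow> cont g \<Longrightarrow> (\<lambda>x. f x * g x) integrable_on {0..1}"
  by (intro integrable_continuous_real continuous_intros)

lemma ip_cong: "(\<And>x. x \<in> {0..1} \<Longrightarrow> f x = f' x) \<Longrightarrow> (\<And>x. x \<in> {0..1} \<Longrightarrow> g x = g' x) \<Longrightarrow> ip f g = ip f' g'"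
  unfolding ip_def by (intro integral_cong) auto

lemma ip_commute: "ip f g = ip g f"
  by (simp add: ip_def mult.commute)

lemma ip_add_left: "cont f \<Longrightarrow> cont g \<Longrightarrow> cont h \<Longrightarrow> ip (\<lambda>x. f x + g x) h = ip f h + ip g h"
  unfolding ip_def by (simp add: ip_integrable distrib_right integral_add)

lemma ip_diff_left: "cont f \<Longrightarrow> cont g \<Longrightarrow> cont h \<Longrightarrow> ip (\<lambda>x. f x - g x) h = ip f h - ip g h"
  unfolding ip_def by (simp add: ip_integrable left_diff_distrib integral_diff)

lemma ip_scale_left: "ip (\<lambda>x. r * f x) h = r * ip f h"
  unfolding ip_def by (simp add: mult.assoc)

lemma ip_sum_left: "finite A \<Longrightarrow> (\<And>j. j \<in> A \<Longrightarrow> cont (g j)) \<Longrightarrow> cont h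
   \<Longrightarrow> ip (\<lambda>x. \<Sum>j\<in>A. r j * g j x) h = (\<Sum>j\<in>A. r j * ip (g j) h)"
  unfolding ip_def sum_distrib_right
  by (subst integral_sum) (auto intro!: integrable_continuous_real continuous_intros simp: mult.assoc)

lemma ip_sum_right: "finite A \<Longrightarrow> (\<And>j. j \<in> A \<Longrightarrow> cont (g j)) \<Longrightarrow> cont h
   \<Longrightarrow> ip h (\<lambda>x. \<Sum>j\<in>A. r j * g j x) = (\<Sum>j\<in>A. r j * ip h (g j))"
  using ip_sum_left[of A g h r] by (simp add: ip_commute)

lemma ip_self_nonneg: "ip f f \<ge> 0"
  unfolding ip_def
  by (cases "(\<lambda>x. f x * f x) integrable_on {0..1}") (auto simp: integral_nonneg not_integrable_integral)

lemma ip_diff_right: "cont f \<Longrightarrow> cont g \<Longrightarrow> cont h \<Longrightarrow> ip h (\<lambda>x. f x - g x) = ip h f - ip h g"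
  using ip_diff_left[of f g h] by (metis ip_commute)

lemma ip_young:
  assumes f: "cont f" and g: "cont g"
  shows "ip f g \<le> (ip f f + ip g g) / 2"
proof -
  have fg: "cont (\<lambda>x. f x - g x)" using f g by (intro continuous_intros)
  have "0 \<le> ip (\<lambda>x. f x - g x) (\<lambda>x. f x - g x)" by (rule ip_self_nonneg)
  also have "\<dots> = (ip f f - ip f g) - (ip g f - ip g g)"
    by (simp only: ip_diff_left[OF f g fg] ip_diff_right[OF f g f] ip_diff_right[OF f g g])
  finally show ?thesis using ip_commute[of g f] by simp
qed

text \<open>Evaluations, integrals against continuous weights and their combinations cover all nodal
  coefficients that occur. Generating the class inductively turns linearity, continuity in a
  parameter and Fubini into inductions over the construction, with no topology on the function
  space.\<close>

inductive lfun :: "((real \<Rightarrow> real) \<Rightarrow> real) \<Rightarrow> bool" where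
  ev: "p \<in> {0..1} \<Longrightarrow> lfun (\<lambda>f. f p)"
| intg: "cont h \<Longrightarrow> lfun (\<lambda>f. ip f h)"
| add: "lfun L \<Longrightarrow> lfun L' \<Longrightarrow> lfun (\<lambda>f. L f + L' f)"
| scale: "lfun L \<Longrightarrow> lfun (\<lambda>f. r * L f)"

lemma lfun_diff: "lfun L \<Longrightarrow> lfun L' \<Longrightarrow> lfun (\<lambda>f. L f - L' f)"
  using lfun.add[OF _ lfun.scale[of L' "-1"]] by simp

lemma lfun_zero: "lfun (\<lambda>f. 0)"
  using lfun.scale[OF lfun.ev[of 0], of 0] by simp

lemma lfun_sum: "(\<And>j. j \<in> A \<Longrightarrow> lfun (L j)) \<Longrightarrow> lfun (\<lambda>f. \<Sum>j\<in>A. L j f)"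
  by (induction A rule: infinite_finite_induct) (auto intro: lfun_zero lfun.add)

lemma lfun_scale': "lfun L \<Longrightarrow> lfun (\<lambda>f. L f * r)"
  using lfun.scale[of L r] by (simp add: mult.commute)

lemma lfun_cong: "lfun L \<Longrightarrow> (\<And>x. x \<in> {0..1} \<Longrightarrow> f x = g x) \<Longrightarrow> L f = L g"
proof (induction rule: lfun.induct)
  case (intg h)
  then show ?case by (intro ip_cong) auto
qed auto

lemma lfun_add: "lfun L \<Longrightarrow> cont f \<Longrightarrow> cont g \<Longrightarrow> L (\<lambda>x. f x + g x) = L f + L g"
  by (induction rule: lfun.induct) (auto simp: ip_add_left algebra_simps)

lemma lfun_cmult: "lfun L \<Longrightarrow> L (\<lambda>x. r * f x) = r * L f"
  by (induction rule: lfun.induct) (auto simp: ip_scale_left algebra_simps)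

lemma lfun_minus:
  assumes "lfun L" "cont f" "cont g"
  shows "L (\<lambda>x. f x - g x) = L f - L g"
proof -
  have "cont (\<lambda>x. -1 * g x)" using assms by (intro continuous_intros)
  from lfun_add[OF assms(1,2) this] have "L (\<lambda>x. f x + -1 * g x) = L f + -1 * L g"
    by (simp only: lfun_cmult[OF assms(1)])
  then show ?thesis by simp
qed

section \<open>Continuous functions on the closed square and iterated integration\<close>

definition cont2 :: "(real \<Rightarrow> real \<Rightarrow> real) \<Rightarrow> bool"
  where "cont2 k \<longleftrightarrow> continuous_on ({0..1} \<times> {0..1}) (\<lambda>p. k (fst p) (snd p))"

lemma cont2_row: "cont2 k \<Longrightarrow> x \<in> {0..1} \<Longrightarrow> cont (k x)"
  unfolding cont2_def
  by (rule continuous_on_compose2[of _ "\<lambda>p. k (fst p) (snd p)" _ "\<lambda>y. (x, y)", simplified])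
    (auto intro!: continuous_intros)

lemma cont2_col: "cont2 k \<Longrightarrow> y \<in> {0..1} \<Longrightarrow> cont (\<lambda>x. k x y)"
  unfolding cont2_def
  by (rule continuous_on_compose2[of _ "\<lambda>p. k (fst p) (snd p)" _ "\<lambda>x. (x, y)", simplified])
    (auto intro!: continuous_intros)

lemma cont2_flip: "cont2 k \<Longrightarrow> cont2 (\<lambda>x y. k y x)"
  unfolding cont2_def
  by (rule continuous_on_compose2[of _ "\<lambda>p. k (fst p) (snd p)" _ "\<lambda>p. (snd p, fst p)", simplified])
    (auto intro!: continuous_intros)

lemma cont2_arith:
  assumes "cont2 k" "cont2 l"
  shows "cont2 (\<lambda>x y. k x y + l x y)" "cont2 (\<lambda>x y. k x y - l x y)" "cont2 (\<lambda>x y. k x y * l x y)"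
    "cont2 (\<lambda>x y. max (k x y) (l x y))" "cont2 (\<lambda>x y. min (k x y) (l x y))" "cont2 (\<lambda>x y. - k x y)"
  using assms unfolding cont2_def by (auto intro!: continuous_intros)

lemma cont2_const: "cont2 (\<lambda>x y. r)"
  unfolding cont2_def by simp

lemma cont2_fst: "cont f \<Longrightarrow> cont2 (\<lambda>x y. f x)"
  unfolding cont2_def by (rule continuous_on_compose2[of _ f]) (auto intro!: continuous_intros)

lemma cont2_snd: "cont f \<Longrightarrow> cont2 (\<lambda>x y. f y)"
  unfolding cont2_def by (rule continuous_on_compose2[of _ f]) (auto intro!: continuous_intros)

lemma cont2_sum: "(\<And>j. j \<in> A \<Longrightarrow> cont2 (k j)) \<Longrightarrow> cont2 (\<lambda>x y. \<Sum>j\<in>A. k j x y)"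
  unfolding cont2_def by (auto intro!: continuous_intros)

lemma cont2_integral:
  assumes "cont2 k"
  shows "cont (\<lambda>x. integral {0..1} (k x))"
proof -
  have "continuous_on {0..1} (\<lambda>x. integral (cbox 0 1) (\<lambda>y. k x y))"
    using assms unfolding cont2_def
    by (intro integral_continuous_on_param) (auto simp: case_prod_beta cbox_interval)
  then show ?thesis by simp
qed

lemma cont2_ip:
  assumes "cont2 k" "cont h"
  shows "cont (\<lambda>y. ip (\<lambda>x. k x y) h)"
  unfolding ip_def
  using cont2_integral[OF cont2_flip[OF cont2_arith(3)[OF assms(1) cont2_fst[OF assms(2)]]]] .

lemma integral_swap:
  assumes "cont2 k"
  shows "integral {0..1} (\<lambda>x. integral {0..1} (\<lambda>y. k x y)) = integral {0..1} (\<lambda>y. integral {0..1} (\<lambda>x. k x y))"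
proof -
  have eq: "cbox (0::real, 0::real) (1, 1) = {0..1} \<times> {0..1}" by auto
  have "continuous_on (cbox (0::real,0::real) (1,1)) (\<lambda>(x, y). k x y)"
    unfolding eq using assms unfolding cont2_def by (simp add: case_prod_beta)
  from integral_swap_continuous[OF this] show ?thesis by simp
qed

lemma lfun_cont2: "lfun L \<Longrightarrow> cont2 k \<Longrightarrow> cont (\<lambda>y. L (\<lambda>x. k x y))"
proof (induction rule: lfun.induct)
  case (ev p)
  then show ?case by (auto dest: cont2_row)
next
  case (intg h)
  then show ?case by (rule_tac cont2_ip)
qed (auto intro!: continuous_intros)

lemma lfun_integral:
  assumes "lfun L" "cont2 k"
  shows "integral {0..1} (\<lambda>y. L (\<lambda>x. k x y)) = L (\<lambda>x. integral {0..1} (\<lambda>y. k x y))"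
  using assms
proof (induction rule: lfun.induct)
  case (intg h)
  have "integral {0..1} (\<lambda>x. integral {0..1} (\<lambda>y. k x y * h x))
      = integral {0..1} (\<lambda>y. integral {0..1} (\<lambda>x. k x y * h x))"
    by (rule integral_swap) (intro cont2_arith cont2_fst intg)
  then show ?case unfolding ip_def by simp
next
  case (add L L')
  then show ?case
    by (simp add: integral_add integrable_continuous_real lfun_cont2)
qed auto

text \<open>Fubini for functionals that act in different variables; it is the reason why projections
  in x and in y commute. Induction on \<open>L'\<close>: an evaluation is immediate, and an integral
  passes through \<open>L\<close> by \<open>lfun_integral\<close>, which rests on the exchange of
  two integrals.\<close>

lemma lfun_commute:
  assumes "lfun L" "lfun L'" "cont2 k"
  shows "L (\<lambda>x. L' (\<lambda>y. k x y)) = L' (\<lambda>y. L (\<lambda>x. k x y))"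
  using assms(2,3)
proof (induction rule: lfun.induct)
  case (intg h)
  have "L (\<lambda>x. integral {0..1} (\<lambda>y. h y * k x y)) = integral {0..1} (\<lambda>y. L (\<lambda>x. h y * k x y))"
    by (rule lfun_integral[symmetric, OF assms(1)]) (intro cont2_arith cont2_snd intg)
  moreover have "L (\<lambda>x. h y * k x y) = h y * L (\<lambda>x. k x y)" for y by (rule lfun_cmult[OF assms(1)])
  ultimately show ?case unfolding ip_def by (simp add: mult.commute)
next
  case (add L1 L2)
  have "L (\<lambda>x. L1 (k x) + L2 (k x)) = L (\<lambda>x. L1 (k x)) + L (\<lambda>x. L2 (k x))"
    by (rule lfun_add[OF assms(1)]) (intro lfun_cont2[OF _ cont2_flip[OF assms(3)]] add)+
  then show ?case by (simp only: add.IH[OF assms(3)])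
next
  case (scale L1 r)
  show ?case by (simp only: lfun_cmult[OF assms(1)] scale.IH[OF assms(3)])
qed auto

section \<open>Piecewise linear functions on a mesh\<close>

lemma exists_cell_upto:
  fixes t :: "nat \<Rightarrow> real"
  assumes "strict_mono t" "t 0 \<le> x" "x \<le> t (Suc n)"
  shows "\<exists>k\<le>n. t k \<le> x \<and> x \<le> t (Suc k)"
  using assms(3)
proof (induction n)
  case 0
  then show ?case using assms by auto
next
  case (Suc n)
  then show ?case by (cases "x \<le> t (Suc n)") (auto intro: le_SucI)
qed

lemma integral_rising:
  fixes p q :: real assumes "p < q"
  shows "integral {p..q} (\<lambda>x. (x - p) / (q - p)) = (q - p) / 2"
    "integral {p..q} (\<lambda>x. ((x - p) / (q - p))\<^sup>2) = (q - p) / 3"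
proof -
  have "((\<lambda>x. (x - p) / (q - p)) has_integral ((q - p)\<^sup>2 / (2 * (q - p)) - (p - p)\<^sup>2 / (2 * (q - p)))) {p..q}"
    using assms
    by (intro fundamental_theorem_of_calculus)
      (auto intro!: derivative_eq_intros simp: has_real_derivative_iff_has_vector_derivative[symmetric] power2_eq_square divide_simps, simp add: algebra_simps)
  from integral_unique[OF this]
  moreover have "d\<^sup>2 / (2 * d) = d / 2" if "d \<noteq> 0" for d :: real
    using that by (simp add: power2_eq_square)
  ultimately show "integral {p..q} (\<lambda>x. (x - p) / (q - p)) = (q - p) / 2"
    using assms by (simp only:) simp
  have "((\<lambda>x. ((x - p) / (q - p))\<^sup>2) has_integral ((q - p)^3 / (3 * (q - p)\<^sup>2) - (p - p)^3 / (3 * (q - p)\<^sup>2))) {p..q}"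
    using assms
    by (intro fundamental_theorem_of_calculus)
      (auto intro!: derivative_eq_intros simp: has_real_derivative_iff_has_vector_derivative[symmetric] power_divide, simp add: power4_eq_xxxx power2_eq_square)
  from integral_unique[OF this]
  show "integral {p..q} (\<lambda>x. ((x - p) / (q - p))\<^sup>2) = (q - p) / 3"
    using assms by (simp add: power2_eq_square power3_eq_cube)
qed

lemma integral_falling:
  fixes p q :: real assumes "p < q"
  shows "integral {p..q} (\<lambda>x. (q - x) / (q - p)) = (q - p) / 2"
    "integral {p..q} (\<lambda>x. ((q - x) / (q - p))\<^sup>2) = (q - p) / 3"
proof -
  have "((\<lambda>x. (q - x) / (q - p)) has_integral (- ((q - q)\<^sup>2 / (2 * (q - p))) - (- ((q - p)\<^sup>2 / (2 * (q - p)))))) {p..q}"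
    using assms
    by (intro fundamental_theorem_of_calculus)
      (auto intro!: derivative_eq_intros simp: has_real_derivative_iff_has_vector_derivative[symmetric] power2_eq_square divide_simps, simp add: algebra_simps)
  from integral_unique[OF this]
  moreover have "d\<^sup>2 / (2 * d) = d / 2" if "d \<noteq> 0" for d :: real
    using that by (simp add: power2_eq_square)
  ultimately show "integral {p..q} (\<lambda>x. (q - x) / (q - p)) = (q - p) / 2"
    using assms by (simp only:) simp
  have "((\<lambda>x. ((q - x) / (q - p))\<^sup>2) has_integral (- ((q - q)^3 / (3 * (q - p)\<^sup>2)) - (- ((q - p)^3 / (3 * (q - p)\<^sup>2))))) {p..q}"
    using assms
    by (intro fundamental_theorem_of_calculus)
      (auto intro!: derivative_eq_intros simp: has_real_derivative_iff_has_vector_derivative[symmetric] power_divide, simp add: power4_eq_xxxx power2_eq_square)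
  from integral_unique[OF this]
  show "integral {p..q} (\<lambda>x. ((q - x) / (q - p))\<^sup>2) = (q - p) / 3"
    using assms by (simp add: power2_eq_square power3_eq_cube)
qed

text \<open>The nodes form a strictly increasing sequence over all naturals that runs on past 1
  after index \<open>M\<close>. Node comparisons therefore carry no index bounds, and the last hat
  function has a right neighbour like any other.\<close>

locale mesh =
  fixes t :: "nat \<Rightarrow> real" and M :: nat
  assumes mono: "strict_mono t" and t0: "t 0 = 0" and tM: "t M = 1"
begin

lemma M_pos: "M > 0"
  using t0 tM by (cases M) auto

lemma t_less [simp]: "t i < t j \<longleftrightarrow> i < j" and t_le [simp]: "t i \<le> t j \<longleftrightarrow> i \<le> j"
  and t_eq [simp]: "t i = t j \<longleftrightarrow> i = j"
  using mono by (simp_all add: strict_mono_less strict_mono_less_eq strict_mono_eq)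

lemma t_in: "i \<le> M \<Longrightarrow> t i \<in> {0..1}"
  using t_le[of 0 i] t_le[of i M] t0 tM by simp

lemma cell_sub: "k < M \<Longrightarrow> x \<in> {t k..t (Suc k)} \<Longrightarrow> x \<in> {0..1}"
  using t_in[of k] t_in[of "Suc k"] by auto

lemma cell_subset: "k < M \<Longrightarrow> {t k..t (Suc k)} \<subseteq> {0..1}"
  using cell_sub by blast

lemma ex_cell: "x \<in> {0..1} \<Longrightarrow> \<exists>k<M. x \<in> {t k..t (Suc k)}"
proof -
  assume "x \<in> {0..1}"
  then obtain k where "k \<le> M - 1" "t k \<le> x" "x \<le> t (Suc k)"
    using exists_cell_upto[OF mono, of x "M - 1"] M_pos t0 tM by auto
  then show ?thesis using M_pos by (intro exI[of _ k]) auto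
qed

text \<open>Max and min make continuity immediate; the affine formulas on cells are derived below.
  Only index 0 lacks a left neighbour, and there the constant 1 replaces the left ramp.\<close>

definition hat :: "nat \<Rightarrow> real \<Rightarrow> real"
  where "hat i x = max 0 (min (if i = 0 then 1 else (x - t (i - 1)) / (t i - t (i - 1)))
                              ((t (Suc i) - x) / (t (Suc i) - t i)))"

lemma cont_hat: "cont (hat i)"
proof (cases "i = 0")
  case True
  have "t (Suc i) - t i \<noteq> 0" by simp
  then show ?thesis unfolding hat_def using True by (auto intro!: continuous_intros)
next
  case False
  have "t (Suc i) - t i \<noteq> 0" "t i - t (i - 1) \<noteq> 0" using False by simp_all
  then show ?thesis unfolding hat_def using False by (auto intro!: continuous_intros)
qed

lemma hat_left: "x \<in> {t k..t (Suc k)} \<Longrightarrow> hat k x = (t (Suc k) - x) / (t (Suc k) - t k)"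
proof -
  assume x: "x \<in> {t k..t (Suc k)}"
  have 1: "(t (Suc k) - x) / (t (Suc k) - t k) \<le> 1" "0 \<le> (t (Suc k) - x) / (t (Suc k) - t k)"
    using x t_less[of k "Suc k"] by (auto simp: divide_le_eq)
  have 2: "k \<noteq> 0 \<Longrightarrow> 1 \<le> (x - t (k - 1)) / (t k - t (k - 1))"
    using x t_less[of "k - 1" k] by (auto simp: le_divide_eq simp del: t_less)
  show ?thesis unfolding hat_def
  proof (cases "k = 0")
    case False
    then show "max 0 (min (if k = 0 then 1 else (x - t (k - 1)) / (t k - t (k - 1))) ((t (Suc k) - x) / (t (Suc k) - t k))) = (t (Suc k) - x) / (t (Suc k) - t k)"
      using 1 2[OF False] by (simp only: if_False max_absorb2 min_absorb2 order_trans[OF 1(1) 2[OF False]])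
  qed (use 1 in simp)
qed

lemma hat_right: "x \<in> {t k..t (Suc k)} \<Longrightarrow> hat (Suc k) x = (x - t k) / (t (Suc k) - t k)"
proof -
  assume x: "x \<in> {t k..t (Suc k)}"
  have 1: "(x - t k) / (t (Suc k) - t k) \<le> 1" "0 \<le> (x - t k) / (t (Suc k) - t k)"
    using x t_less[of k "Suc k"] by (auto simp: divide_le_eq)
  have 2: "1 \<le> (t (Suc (Suc k)) - x) / (t (Suc (Suc k)) - t (Suc k))"
    using x t_less[of "Suc k" "Suc (Suc k)"] by (auto simp: le_divide_eq simp del: t_less)
  have "hat (Suc k) x = max 0 (min ((x - t k) / (t (Suc k) - t k)) ((t (Suc (Suc k)) - x) / (t (Suc (Suc k)) - t (Suc k))))"
    by (simp add: hat_def)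
  then show ?thesis using 1 2 by linarith
qed

lemma hat_other:
  assumes x: "x \<in> {t k..t (Suc k)}" and "i \<noteq> k" "i \<noteq> Suc k"
  shows "hat i x = 0"
proof (cases "i < k")
  case True
  then have "t (Suc i) \<le> t k" by simp
  then have "(t (Suc i) - x) / (t (Suc i) - t i) \<le> 0"
    using x t_less[of i "Suc i"] by (auto simp: divide_le_0_iff simp del: t_less t_le)
  then show ?thesis unfolding hat_def by simp
next
  case False
  then have "Suc k \<le> i - 1" "i \<noteq> 0" using assms by auto
  then have "t (Suc k) \<le> t (i - 1)" by simp
  then have "(x - t (i - 1)) / (t i - t (i - 1)) \<le> 0"
    using x t_less[of "i - 1" i] \<open>i \<noteq> 0\<close> by (auto simp: divide_le_0_iff simp del: t_less t_le)
  then show ?thesis unfolding hat_def using \<open>i \<noteq> 0\<close> by simp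
qed

lemma hat_nonneg: "0 \<le> hat i x"
  by (simp add: hat_def)

lemma hat_node: "hat i (t j) = (if i = j then 1 else 0)"
proof (cases j)
  case 0
  then show ?thesis using hat_left[of "t 0" 0] hat_right[of "t 0" 0] hat_other[of "t 0" 0 i]
    by (cases "i = 0"; cases "i = Suc 0") auto
next
  case (Suc k)
  then show ?thesis using hat_left[of "t (Suc k)" k] hat_right[of "t (Suc k)" k] hat_other[of "t (Suc k)" k i]
    by (cases "i = k"; cases "i = Suc k") auto
qed

definition pl :: "(nat \<Rightarrow> real) \<Rightarrow> real \<Rightarrow> real"
  where "pl v x = (\<Sum>i\<le>M. v i * hat i x)"

lemma cont_pl: "cont (pl v)"
  unfolding pl_def by (intro continuous_intros cont_hat)

lemma pl_cell:
  assumes "k < M" "x \<in> {t k..t (Suc k)}"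
  shows "pl v x = v k * ((t (Suc k) - x) / (t (Suc k) - t k)) + v (Suc k) * ((x - t k) / (t (Suc k) - t k))"
proof -
  have "pl v x = (\<Sum>i\<in>{k, Suc k}. v i * hat i x)"
    unfolding pl_def using assms by (intro sum.mono_neutral_right) (auto simp: hat_other)
  then show ?thesis using assms hat_left hat_right by simp
qed

lemma pl_cell':
  assumes "k < M" "x \<in> {t k..t (Suc k)}"
  shows "pl v x = v k + (v (Suc k) - v k) / (t (Suc k) - t k) * (x - t k)"
proof -
  have "t (Suc k) - t k \<noteq> 0" by simp
  then show ?thesis unfolding pl_cell[OF assms] by (simp add: divide_simps) (simp add: algebra_simps)
qed

lemma pl_node: "i \<le> M \<Longrightarrow> pl v (t i) = v i"
proof -
  assume "i \<le> M"
  have "pl v (t i) = (\<Sum>j\<in>{i}. v j * hat j (t i))"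
    unfolding pl_def using \<open>i \<le> M\<close> by (intro sum.mono_neutral_right) (auto simp: hat_node)
  then show ?thesis by (simp add: hat_node)
qed

lemma pl_end: "pl v 0 = v 0" "pl v 1 = v M"
  using pl_node[of 0 v] pl_node[of M v] t0 tM by auto

lemma pl_bound:
  assumes "\<And>i. i \<le> M \<Longrightarrow> \<bar>v i\<bar> \<le> B" "x \<in> {0..1}"
  shows "\<bar>pl v x\<bar> \<le> B"
proof -
  obtain k where k: "k < M" "x \<in> {t k..t (Suc k)}" using ex_cell assms(2) by blast
  have h: "t (Suc k) - t k > 0" by simp
  define s where "s = (x - t k) / (t (Suc k) - t k)"
  have s: "0 \<le> s" "s \<le> 1" using k h unfolding s_def by (auto simp: divide_le_eq)
  have "(t (Suc k) - x) / (t (Suc k) - t k) = 1 - s"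
    using h unfolding s_def by (simp add: field_simps)
  then have "pl v x = v k * (1 - s) + v (Suc k) * s"
    using pl_cell[OF k] s_def by simp
  then have "\<bar>pl v x\<bar> \<le> \<bar>v k\<bar> * (1 - s) + \<bar>v (Suc k)\<bar> * s"
    using s abs_triangle_ineq[of "v k * (1 - s)" "v (Suc k) * s"] by (simp add: abs_mult)
  also have "\<dots> \<le> B * (1 - s) + B * s"
    using s k assms(1) by (intro add_mono mult_right_mono) auto
  finally show ?thesis by (simp add: algebra_simps)
qed

definition is_pl :: "(real \<Rightarrow> real) \<Rightarrow> bool"
  where "is_pl f \<longleftrightarrow> (\<forall>x\<in>{0..1}. f x = pl (\<lambda>i. f (t i)) x)"

lemma is_pl_pl: "is_pl (pl v)"
  unfolding is_pl_def
proof (intro ballI)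
  fix x
  show "pl v x = pl (\<lambda>i. pl v (t i)) x"
    by (subst (2) pl_def) (simp add: pl_node, simp add: pl_def)
qed

lemma is_pl_cont: "is_pl f \<Longrightarrow> cont f"
  using cont_pl[of "\<lambda>i. f (t i)"] continuous_on_cong[of "{0..1}" "{0..1}" f] unfolding is_pl_def by auto

lemma is_pl_cellI:
  assumes "\<And>k. k < M \<Longrightarrow> \<exists>\<alpha> \<beta>. \<forall>x\<in>{t k..t (Suc k)}. f x = \<alpha> + \<beta> * x"
  shows "is_pl f"
  unfolding is_pl_def
proof (intro ballI)
  fix x :: real assume "x \<in> {0..1}"
  then obtain k where k: "k < M" "x \<in> {t k..t (Suc k)}" using ex_cell by blast
  obtain \<alpha> \<beta> where ab: "\<forall>x\<in>{t k..t (Suc k)}. f x = \<alpha> + \<beta> * x" using assms k by blast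
  have h: "t (Suc k) - t k \<noteq> 0" by simp
  have e: "f (t k) = \<alpha> + \<beta> * t k" "f (t (Suc k)) = \<alpha> + \<beta> * t (Suc k)" "f x = \<alpha> + \<beta> * x"
    using ab k by auto
  have "(f (t (Suc k)) - f (t k)) / (t (Suc k) - t k) = \<beta>"
    unfolding e using h by (simp add: field_simps)
  then show "f x = pl (\<lambda>i. f (t i)) x" unfolding pl_cell'[OF k] by (simp add: e algebra_simps)
qed

lemma is_pl_cellD:
  assumes "is_pl f" "k < M" "x \<in> {t k..t (Suc k)}"
  shows "f x = f (t k) + (f (t (Suc k)) - f (t k)) / (t (Suc k) - t k) * (x - t k)"
  using pl_cell'[OF assms(2,3)] assms cell_sub unfolding is_pl_def by auto

lemma is_pl_combine: "is_pl f \<Longrightarrow> is_pl g \<Longrightarrow> is_pl (\<lambda>x. r * f x + s * g x)"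
  unfolding is_pl_def pl_def by (auto simp: sum_distrib_left sum.distrib algebra_simps)

lemma is_pl_diff: "is_pl f \<Longrightarrow> is_pl g \<Longrightarrow> is_pl (\<lambda>x. f x - g x)"
  using is_pl_combine[of f g 1 "-1"] by simp

lemma integral_upto:
  assumes "cont f" "n \<le> M"
  shows "integral {0..t n} f = (\<Sum>k<n. integral {t k..t (Suc k)} f)"
  using assms(2)
proof (induction n)
  case 0
  then show ?case by (simp add: t0)
next
  case (Suc n)
  have "integral {0..t n} f + integral {t n..t (Suc n)} f = integral {0..t (Suc n)} f"
    using Suc.prems t_in[of n] t_in[of "Suc n"]
    by (intro Henstock_Kurzweil_Integration.integral_combine integrable_continuous_real continuous_on_subset[OF assms(1)]) auto
  then show ?case using Suc by simp
qed

lemma integral_cells: "cont f \<Longrightarrow> integral {0..1} f = (\<Sum>k<M. integral {t k..t (Suc k)} f)"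
  using integral_upto[of f M] tM by simp

text \<open>On a cell the hat is either zero or a full ramp, and a ramp of length h has integral h/2
  and squared integral h/3. The ratio 2/3 does not depend on the widths of the two neighbouring
  cells, which makes the constant in \<open>max_node_bound\<close> independent of the mesh.\<close>

lemma hat_integrals:
  assumes "i \<le> M"
  shows "ip (hat i) (hat i) = 2 / 3 * integral {0..1} (hat i)" "integral {0..1} (hat i) > 0"
proof -
  have rel: "integral {t k..t (Suc k)} (\<lambda>x. hat i x * hat i x) = 2 / 3 * integral {t k..t (Suc k)} (hat i)"
    and pos: "i \<in> {k, Suc k} \<Longrightarrow> integral {t k..t (Suc k)} (hat i) > 0"
    and nonneg: "integral {t k..t (Suc k)} (hat i) \<ge> 0" for k
  proof -
    have h: "t k < t (Suc k)" by simp
    then have h': "t (Suc k) - t k > 0" by simp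
    consider "i = k" | "i = Suc k" | "i \<noteq> k" "i \<noteq> Suc k" by blast
    then have "integral {t k..t (Suc k)} (\<lambda>x. hat i x * hat i x) = 2 / 3 * integral {t k..t (Suc k)} (hat i)
      \<and> (i \<in> {k, Suc k} \<longrightarrow> integral {t k..t (Suc k)} (hat i) > 0) \<and> integral {t k..t (Suc k)} (hat i) \<ge> 0"
    proof (cases)
      case 1
      have "integral {t k..t (Suc k)} (hat i) = (t (Suc k) - t k) / 2"
        unfolding 1 integral_falling(1)[OF h, symmetric] by (intro integral_cong hat_left)
      moreover have "integral {t k..t (Suc k)} (\<lambda>x. hat i x * hat i x) = (t (Suc k) - t k) / 3"
        unfolding 1 integral_falling(2)[OF h, symmetric]
        by (intro integral_cong) (simp only: hat_left power2_eq_square)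
      ultimately show ?thesis using h' by (simp del: t_less)
    next
      case 2
      have "integral {t k..t (Suc k)} (hat i) = (t (Suc k) - t k) / 2"
        unfolding 2 integral_rising(1)[OF h, symmetric] by (intro integral_cong hat_right)
      moreover have "integral {t k..t (Suc k)} (\<lambda>x. hat i x * hat i x) = (t (Suc k) - t k) / 3"
        unfolding 2 integral_rising(2)[OF h, symmetric]
        by (intro integral_cong) (simp only: hat_right power2_eq_square)
      ultimately show ?thesis using h' by (simp del: t_less)
    next
      case 3
      have "integral {t k..t (Suc k)} (hat i) = integral {t k..t (Suc k)} (\<lambda>x. 0)"
        by (intro integral_cong) (simp add: hat_other[OF _ 3])
      moreover have "integral {t k..t (Suc k)} (\<lambda>x. hat i x * hat i x) = integral {t k..t (Suc k)} (\<lambda>x. 0)"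
        by (intro integral_cong) (simp add: hat_other[OF _ 3])
      ultimately show ?thesis using 3 by simp
    qed
    then show "integral {t k..t (Suc k)} (\<lambda>x. hat i x * hat i x) = 2 / 3 * integral {t k..t (Suc k)} (hat i)"
      "i \<in> {k, Suc k} \<Longrightarrow> integral {t k..t (Suc k)} (hat i) > 0" "integral {t k..t (Suc k)} (hat i) \<ge> 0"
      by auto
  qed
  have c2: "cont (\<lambda>x. hat i x * hat i x)" by (intro continuous_intros cont_hat)
  show "ip (hat i) (hat i) = 2 / 3 * integral {0..1} (hat i)"
    unfolding ip_def integral_cells[OF c2] integral_cells[OF cont_hat] by (simp add: rel sum_distrib_left)
  define k where "k = (if i < M then i else i - 1)"
  have k: "k < M" "i \<in> {k, Suc k}" using assms M_pos unfolding k_def by auto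
  show "integral {0..1} (hat i) > 0" unfolding integral_cells[OF cont_hat]
    by (rule sum_pos2[of _ k]) (use k pos nonneg in auto)
qed

text \<open>The L2 product of the derivatives of the two piecewise linear interpolants. For smooth
  \<open>f\<close> and piecewise linear \<open>g\<close> it is also the integral of
  \<open>f' * g'\<close>, because \<open>g'\<close> is constant on cells and \<open>f'\<close>
  integrates to an increment. Only nodal values enter, so an interpolation error is orthogonal to
  everything.\<close>

definition af :: "(real \<Rightarrow> real) \<Rightarrow> (real \<Rightarrow> real) \<Rightarrow> real"
  where "af f g = (\<Sum>i<M. (f (t (Suc i)) - f (t i)) * (g (t (Suc i)) - g (t i)) / (t (Suc i) - t i))"

lemma af_commute: "af f g = af g f"
  unfolding af_def by (simp add: mult.commute)

lemma af_add_left: "af (\<lambda>x. f x + g x) h = af f h + af g h"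
  unfolding af_def sum.distrib[symmetric] by (intro sum.cong) (simp_all add: algebra_simps add_divide_distrib diff_divide_distrib)

lemma af_diff_left: "af (\<lambda>x. f x - g x) h = af f h - af g h"
  unfolding af_def sum_subtractf[symmetric] by (intro sum.cong) (simp_all add: algebra_simps add_divide_distrib diff_divide_distrib)

lemma af_scale_left: "af (\<lambda>x. r * f x) h = r * af f h"
  unfolding af_def sum_distrib_left by (intro sum.cong) (simp_all add: algebra_simps)

lemma af_sum_left: "finite A \<Longrightarrow> af (\<lambda>x. \<Sum>j\<in>A. r j * f j x) h = (\<Sum>j\<in>A. r j * af (f j) h)"
proof (induction A rule: finite_induct)
  case empty
  then show ?case by (simp add: af_def)
next
  case (insert j A)
  then show ?case by (simp add: af_add_left af_scale_left)
qed

lemma af_sum_right: "finite A \<Longrightarrow> af h (\<lambda>x. \<Sum>j\<in>A. r j * f j x) = (\<Sum>j\<in>A. r j * af h (f j))"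
  using af_sum_left[of A r f h] by (simp add: af_commute)

lemma af_self_nonneg: "af f f \<ge> 0"
  unfolding af_def by (intro sum_nonneg) (auto simp: less_imp_le)

lemma af_self_sq: "af f f = (\<Sum>i<M. (f (t (Suc i)) - f (t i))\<^sup>2 / (t (Suc i) - t i))"
  unfolding af_def by (simp add: power2_eq_square)

lemma af_cong: "(\<And>i. i \<le> M \<Longrightarrow> f (t i) = f' (t i)) \<Longrightarrow> (\<And>i. i \<le> M \<Longrightarrow> g (t i) = g' (t i)) \<Longrightarrow> af f g = af f' g'"
  unfolding af_def by (intro sum.cong) auto

lemma af_young: "af f g \<le> (af f f + af g g) / 2"
proof -
  have "0 \<le> af (\<lambda>x. f x - g x) (\<lambda>x. f x - g x)" by (rule af_self_nonneg)
  also have "\<dots> = af f f - 2 * af f g + af g g"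
    using af_commute[of f "\<lambda>x. f x - g x"] af_commute[of g "\<lambda>x. f x - g x"]
    by (simp add: af_diff_left) (simp add: af_commute)
  finally show ?thesis by simp
qed

lemma af_zero_imp:
  assumes "af f f = 0" "i \<le> M"
  shows "f (t i) = f 0"
  using assms(2)
proof (induction i)
  case 0
  then show ?case by (simp add: t0)
next
  case (Suc i)
  have "\<forall>i\<in>{..<M}. (f (t (Suc i)) - f (t i))\<^sup>2 / (t (Suc i) - t i) = 0"
    using assms(1) unfolding af_self_sq
    by (subst (asm) sum_nonneg_eq_0_iff) (auto simp: less_imp_le)
  then have "(f (t (Suc i)) - f (t i))\<^sup>2 / (t (Suc i) - t i) = 0" using Suc.prems by auto
  then have "f (t (Suc i)) = f (t i)" by simp
  then show ?case using Suc by simp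
qed

end

section \<open>The one-dimensional discrete problem\<close>

text \<open>Interpolation, the discrete solution operator and the Ritz projection have this finite
  rank form. For such operators, continuity in a parameter and the exchange with functionals or
  operators in the other variable reduce to facts about \<open>lfun\<close>.\<close>

definition fin_op :: "((real \<Rightarrow> real) \<Rightarrow> real \<Rightarrow> real) \<Rightarrow> bool"
  where "fin_op T \<longleftrightarrow> (\<exists>(n::nat) \<rho> \<phi>. (\<forall>j<n. lfun (\<rho> j) \<and> cont (\<phi> j)) \<and>
    (\<forall>f. cont f \<longrightarrow> (\<forall>x. T f x = (\<Sum>j<n. \<rho> j f * \<phi> j x))))"

lemma fin_opE:
  assumes "fin_op T"
  obtains n :: nat and \<rho> \<phi> where "\<And>j. j < n \<Longrightarrow> lfun (\<rho> j)" "\<And>j. j < n \<Longrightarrow> cont (\<phi> j)"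
    "\<And>f x. cont f \<Longrightarrow> T f x = (\<Sum>j<n. \<rho> j f * \<phi> j x)"
  using assms unfolding fin_op_def by metis

lemma fin_op_cont: "fin_op T \<Longrightarrow> cont f \<Longrightarrow> cont (T f)"
proof (erule fin_opE)
  fix n :: nat and \<rho> and \<phi> :: "nat \<Rightarrow> real \<Rightarrow> real"
  assume "cont f" and phi: "\<And>j. j < n \<Longrightarrow> cont (\<phi> j)" and T: "\<And>f x. cont f \<Longrightarrow> T f x = (\<Sum>j<n. \<rho> j f * \<phi> j x)"
  have "T f = (\<lambda>x. \<Sum>j<n. \<rho> j f * \<phi> j x)" using T[OF \<open>cont f\<close>] by blast
  then show ?thesis using phi by (auto intro!: continuous_intros)
qed

lemma fin_op_cong:
  assumes "fin_op T" "cont f" "\<And>x. x \<in> {0..1} \<Longrightarrow> f x = g x"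
  shows "T f x = T g x"
  using assms(1)
proof (rule fin_opE)
  fix n :: nat and \<rho> and \<phi> :: "nat \<Rightarrow> real \<Rightarrow> real"
  assume rho: "\<And>j. j < n \<Longrightarrow> lfun (\<rho> j)" and T: "\<And>f x. cont f \<Longrightarrow> T f x = (\<Sum>j<n. \<rho> j f * \<phi> j x)"
  have "cont g" by (rule continuous_on_eq[OF assms(2,3)])
  have "\<rho> j f = \<rho> j g" if "j < n" for j using lfun_cong[OF rho[OF that]] assms(3) by blast
  then show ?thesis unfolding T[OF assms(2)] T[OF \<open>cont g\<close>] by simp
qed

lemma fin_op_diff:
  assumes "fin_op T" "cont f" "cont g"
  shows "T (\<lambda>x. f x - g x) x = T f x - T g x"
  using assms(1)
proof (rule fin_opE)
  fix n :: nat and \<rho> and \<phi> :: "nat \<Rightarrow> real \<Rightarrow> real"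
  assume rho: "\<And>j. j < n \<Longrightarrow> lfun (\<rho> j)" and T: "\<And>f x. cont f \<Longrightarrow> T f x = (\<Sum>j<n. \<rho> j f * \<phi> j x)"
  have c: "cont (\<lambda>x. f x - g x)" using assms by (intro continuous_intros)
  have "\<rho> j (\<lambda>x. f x - g x) = \<rho> j f - \<rho> j g" if "j < n" for j using lfun_minus[OF rho[OF that] assms(2,3)] .
  then show ?thesis unfolding T[OF assms(2)] T[OF assms(3)] T[OF c] by (simp add: left_diff_distrib sum_subtractf)
qed

lemma fin_op_add:
  assumes "fin_op T" "cont f" "cont g"
  shows "T (\<lambda>x. f x + g x) x = T f x + T g x"
  using assms(1)
proof (rule fin_opE)
  fix n :: nat and \<rho> and \<phi> :: "nat \<Rightarrow> real \<Rightarrow> real"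
  assume rho: "\<And>j. j < n \<Longrightarrow> lfun (\<rho> j)" and T: "\<And>f x. cont f \<Longrightarrow> T f x = (\<Sum>j<n. \<rho> j f * \<phi> j x)"
  have c: "cont (\<lambda>x. f x + g x)" using assms by (intro continuous_intros)
  have "\<rho> j (\<lambda>x. f x + g x) = \<rho> j f + \<rho> j g" if "j < n" for j using lfun_add[OF rho[OF that] assms(2,3)] .
  then show ?thesis unfolding T[OF assms(2)] T[OF assms(3)] T[OF c] by (simp add: distrib_right sum.distrib)
qed

lemma fin_op_zero: "fin_op T \<Longrightarrow> T (\<lambda>x. 0) x = 0"
  using fin_op_diff[of T "\<lambda>x. 0" "\<lambda>x. 0" x] by simp

lemma fin_op_cmult:
  assumes "fin_op T" "cont f"
  shows "T (\<lambda>x. r * f x) x = r * T f x"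
  using assms(1)
proof (rule fin_opE)
  fix n :: nat and \<rho> and \<phi> :: "nat \<Rightarrow> real \<Rightarrow> real"
  assume rho: "\<And>j. j < n \<Longrightarrow> lfun (\<rho> j)" and T: "\<And>f x. cont f \<Longrightarrow> T f x = (\<Sum>j<n. \<rho> j f * \<phi> j x)"
  have c: "cont (\<lambda>x. r * f x)" using assms by (intro continuous_intros)
  have "\<rho> j (\<lambda>x. r * f x) = r * \<rho> j f" if "j < n" for j by (rule lfun_cmult[OF rho[OF that]])
  then show ?thesis unfolding T[OF assms(2)] T[OF c] by (simp add: sum_distrib_left mult.assoc)
qed

lemma fin_op_cont2:
  assumes "fin_op T" "cont2 k"
  shows "cont2 (\<lambda>x y. T (\<lambda>s. k s y) x)"
  using assms(1)
proof (rule fin_opE)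
  fix n :: nat and \<rho> and \<phi> :: "nat \<Rightarrow> real \<Rightarrow> real"
  assume rho: "\<And>j. j < n \<Longrightarrow> lfun (\<rho> j)" and phi: "\<And>j. j < n \<Longrightarrow> cont (\<phi> j)"
    and T: "\<And>f x. cont f \<Longrightarrow> T f x = (\<Sum>j<n. \<rho> j f * \<phi> j x)"
  have "cont2 (\<lambda>x y. \<rho> j (\<lambda>s. k s y) * \<phi> j x)" if "j < n" for j
    by (rule cont2_arith(3)[OF cont2_snd[OF lfun_cont2[OF rho[OF that] assms(2)]] cont2_fst[OF phi[OF that]]])
  then have "cont2 (\<lambda>x y. \<Sum>j<n. \<rho> j (\<lambda>s. k s y) * \<phi> j x)"
    by (intro cont2_sum) auto
  then show ?thesis unfolding cont2_def
    by (rule continuous_on_eq) (auto simp: T cont2_col[OF assms(2)])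
qed

lemma fin_op_lfun:
  assumes "fin_op T" "lfun L" "cont2 k"
  shows "L (\<lambda>y. T (\<lambda>s. k s y) x) = T (\<lambda>s. L (\<lambda>y. k s y)) x"
  using assms(1)
proof (rule fin_opE)
  fix n :: nat and \<rho> and \<phi> :: "nat \<Rightarrow> real \<Rightarrow> real"
  assume rho: "\<And>j. j < n \<Longrightarrow> lfun (\<rho> j)" and T: "\<And>f x. cont f \<Longrightarrow> T f x = (\<Sum>j<n. \<rho> j f * \<phi> j x)"
  have "L (\<lambda>y. T (\<lambda>s. k s y) x) = L (\<lambda>y. \<Sum>j<n. \<phi> j x * \<rho> j (\<lambda>s. k s y))"
    by (rule lfun_cong[OF assms(2)]) (simp add: T cont2_col[OF assms(3)] mult.commute)
  also have "\<dots> = (\<Sum>j<n. \<phi> j x * L (\<lambda>y. \<rho> j (\<lambda>s. k s y)))"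
    using rho
  proof (induction n)
    case 0
    have "L (\<lambda>x. 0 * x) = 0 * L (\<lambda>x. x)" by (rule lfun_cmult[OF assms(2)])
    then show ?case by simp
  next
    case (Suc n)
    have c: "j < Suc n \<Longrightarrow> cont (\<lambda>y. \<phi> j x * \<rho> j (\<lambda>s. k s y))" for j
      using lfun_cont2[OF Suc.prems assms(3)] by (auto intro!: continuous_intros)
    have "L (\<lambda>y. (\<Sum>j<n. \<phi> j x * \<rho> j (\<lambda>s. k s y)) + \<phi> n x * \<rho> n (\<lambda>s. k s y))
      = L (\<lambda>y. \<Sum>j<n. \<phi> j x * \<rho> j (\<lambda>s. k s y)) + L (\<lambda>y. \<phi> n x * \<rho> n (\<lambda>s. k s y))"
      using c by (intro lfun_add[OF assms(2)]) (auto intro!: continuous_on_sum)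
    then show ?case using Suc by (simp add: lfun_cmult[OF assms(2)])
  qed
  also have "\<dots> = (\<Sum>j<n. \<rho> j (\<lambda>s. L (\<lambda>y. k s y)) * \<phi> j x)"
    using lfun_commute[OF assms(2) rho cont2_flip[OF assms(3)]] by (simp add: mult.commute)
  also have "\<dots> = T (\<lambda>s. L (\<lambda>y. k s y)) x"
    using lfun_cont2[OF assms(2) cont2_flip[OF assms(3)]] by (simp add: T)
  finally show ?thesis .
qed

text \<open>Expanding \<open>T'\<close> leaves finitely many functionals in the second variable, and
  each of them passes through \<open>T\<close> by \<open>fin_op_lfun\<close>.\<close>

lemma fin_op_commute:
  assumes "fin_op T" "fin_op T'" "cont2 k"
  shows "T (\<lambda>s. T' (k s) y) x = T' (\<lambda>r. T (\<lambda>s. k s r) x) y"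
  using assms(2)
proof (rule fin_opE)
  fix n :: nat and \<rho> and \<phi> :: "nat \<Rightarrow> real \<Rightarrow> real"
  assume rho: "\<And>j. j < n \<Longrightarrow> lfun (\<rho> j)" and T': "\<And>f x. cont f \<Longrightarrow> T' f x = (\<Sum>j<n. \<rho> j f * \<phi> j x)"
  have ev: "cont (\<lambda>s. \<rho> j (k s))" if "j < n" for j
    using lfun_cont2[OF rho[OF that] cont2_flip[OF assms(3)]] .
  have "T (\<lambda>s. T' (k s) y) x = T (\<lambda>s. \<Sum>j<n. \<phi> j y * \<rho> j (k s)) x"
    by (rule fin_op_cong[OF assms(1), symmetric])
      (auto intro!: continuous_intros ev simp: T' cont2_row[OF assms(3)] mult.commute)
  also have "\<dots> = (\<Sum>j<n. \<phi> j y * T (\<lambda>s. \<rho> j (k s)) x)"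
    using ev
  proof (induction n)
    case 0
    then show ?case by (simp add: fin_op_zero[OF assms(1)])
  next
    case (Suc n)
    have "T (\<lambda>s. (\<Sum>j<n. \<phi> j y * \<rho> j (k s)) + \<phi> n y * \<rho> n (k s)) x
      = T (\<lambda>s. \<Sum>j<n. \<phi> j y * \<rho> j (k s)) x + T (\<lambda>s. \<phi> n y * \<rho> n (k s)) x"
      using Suc.prems by (intro fin_op_add[OF assms(1)]) (auto intro!: continuous_intros)
    then show ?case using Suc by (simp add: fin_op_cmult[OF assms(1)])
  qed
  also have "\<dots> = (\<Sum>j<n. \<rho> j (\<lambda>r. T (\<lambda>s. k s r) x) * \<phi> j y)"
    using fin_op_lfun[OF assms(1) rho assms(3)] by (simp add: mult.commute)
  also have "\<dots> = T' (\<lambda>r. T (\<lambda>s. k s r) x) y"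
  proof -
    have "cont (\<lambda>r. T (\<lambda>s. k s r) x)"
      using assms(1)
    proof (rule fin_opE)
      fix n :: nat and \<rho> and \<phi> :: "nat \<Rightarrow> real \<Rightarrow> real"
      assume rho: "\<And>j. j < n \<Longrightarrow> lfun (\<rho> j)" and T: "\<And>f x. cont f \<Longrightarrow> T f x = (\<Sum>j<n. \<rho> j f * \<phi> j x)"
      have "cont (\<lambda>r. \<rho> j (\<lambda>s. k s r))" if "j < n" for j by (rule lfun_cont2[OF rho[OF that] assms(3)])
      then have "cont (\<lambda>r. \<Sum>j<n. \<rho> j (\<lambda>s. k s r) * \<phi> j x)"
        by (auto intro!: continuous_intros)
      then show ?thesis by (rule continuous_on_eq) (simp add: T cont2_col[OF assms(3)])
    qed
    then show ?thesis by (simp add: T')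
  qed
  finally show ?thesis .
qed

section \<open>Interpolation and piecewise linear functions with zero end values\<close>

context mesh begin

definition interp :: "(real \<Rightarrow> real) \<Rightarrow> real \<Rightarrow> real"
  where "interp f = pl (\<lambda>i. f (t i))"

lemma fin_opI:
  assumes "\<And>j. j \<le> M \<Longrightarrow> lfun (\<rho> j)" "\<And>f x. cont f \<Longrightarrow> T f x = pl (\<lambda>j. \<rho> j f) x"
  shows "fin_op T"
  unfolding fin_op_def
  by (rule exI[of _ "Suc M"], rule exI[of _ \<rho>], rule exI[of _ hat])
    (use assms in \<open>auto simp: less_Suc_eq_le cont_hat pl_def lessThan_Suc_atMost\<close>)

lemma fin_op_interp: "fin_op interp"
  by (rule fin_opI[of "\<lambda>j f. f (t j)"]) (auto simp: interp_def intro: lfun.ev t_in)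

lemma cont_interp: "cont (interp f)"
  unfolding interp_def by (rule cont_pl)

lemma interp_node: "i \<le> M \<Longrightarrow> interp f (t i) = f (t i)"
  by (simp add: interp_def pl_node)

lemma lfun_af: "lfun (\<lambda>f. af f v)"
proof -
  have "lfun (\<lambda>f. \<Sum>i<M. (f (t (Suc i)) - f (t i)) * ((v (t (Suc i)) - v (t i)) / (t (Suc i) - t i)))"
    by (intro lfun_sum lfun_scale' lfun_diff lfun.ev t_in) auto
  then show ?thesis unfolding af_def by simp
qed

definition V0 :: "(real \<Rightarrow> real) set"
  where "V0 = {v. is_pl v \<and> v 0 = 0 \<and> v 1 = 0}"

lemma sum_nodes: "(\<Sum>i\<le>M. f i) = f 0 + (\<Sum>i<M - 1. f (Suc i)) + (f M :: real)"
proof -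
  have "(\<Sum>i\<le>Suc n. f i) = f 0 + (\<Sum>i<n. f (Suc i)) + f (Suc n)" for n
    by (simp only: sum.atMost_Suc_shift) (simp only: lessThan_Suc_atMost[symmetric] sum.lessThan_Suc add.assoc)
  from this[of "M - 1"] show ?thesis using M_pos by simp
qed

lemma V0_expand:
  assumes "v \<in> V0" "x \<in> {0..1}"
  shows "v x = (\<Sum>i<M - 1. v (t (Suc i)) * hat (Suc i) x)"
  using assms sum_nodes[of "\<lambda>i. v (t i) * hat i x"] t0 tM unfolding V0_def is_pl_def pl_def by auto

lemma V0_cont: "v \<in> V0 \<Longrightarrow> cont v"
  unfolding V0_def using is_pl_cont by auto

lemma hat_comb_V0: "(\<lambda>x. \<Sum>i<M - 1. r i * hat (Suc i) x) \<in> V0"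
proof -
  define r' where "r' i = (if i = 0 \<or> i = M then 0 else r (i - 1))" for i
  have "(\<lambda>x. \<Sum>i<M - 1. r i * hat (Suc i) x) = pl r'"
  proof
    fix x
    have "pl r' x = (\<Sum>i<M - 1. r' (Suc i) * hat (Suc i) x)"
      unfolding pl_def sum_nodes by (simp add: r'_def)
    also have "\<dots> = (\<Sum>i<M - 1. r i * hat (Suc i) x)" by (intro sum.cong) (auto simp: r'_def)
    finally show "(\<Sum>i<M - 1. r i * hat (Suc i) x) = pl r' x" by simp
  qed
  then show ?thesis unfolding V0_def using is_pl_pl pl_end[of r'] by (simp add: r'_def)
qed

lemma pl_V0: "v 0 = 0 \<Longrightarrow> v M = 0 \<Longrightarrow> pl v \<in> V0"
  unfolding V0_def using is_pl_pl pl_end[of v] by simp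

lemma hat_V0: "i < M - 1 \<Longrightarrow> hat (Suc i) \<in> V0"
  using hat_comb_V0[of "\<lambda>j. if j = i then 1 else 0"] by (simp add: if_distrib[of "\<lambda>x. x * _"] cong: if_cong)

end

section \<open>The one-dimensional bilinear form and its discrete solution operator\<close>

locale ritz = mesh +
  fixes \<epsilon> c :: real
  assumes eps: "\<epsilon> > 0" and c: "c > 0"
begin

definition bf :: "(real \<Rightarrow> real) \<Rightarrow> (real \<Rightarrow> real) \<Rightarrow> real"
  where "bf f g = \<epsilon> * af f g + c * ip f g"

lemma lfun_bf: "cont v \<Longrightarrow> lfun (\<lambda>f. bf f v)"
  unfolding bf_def by (intro lfun.add lfun.scale lfun_af lfun.intg)

lemma bf_sum_right: "finite A \<Longrightarrow> (\<And>j. j \<in> A \<Longrightarrow> cont (g j)) \<Longrightarrow> cont h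
   \<Longrightarrow> bf h (\<lambda>x. \<Sum>j\<in>A. r j * g j x) = (\<Sum>j\<in>A. r j * bf h (g j))"
  unfolding bf_def by (simp add: af_sum_right ip_sum_right sum.distrib sum_distrib_left algebra_simps)

lemma bf_commute: "bf f g = bf g f"
  unfolding bf_def by (simp add: af_commute ip_commute)

lemma bf_sum_left: "finite A \<Longrightarrow> (\<And>j. j \<in> A \<Longrightarrow> cont (g j)) \<Longrightarrow> cont h
   \<Longrightarrow> bf (\<lambda>x. \<Sum>j\<in>A. r j * g j x) h = (\<Sum>j\<in>A. r j * bf (g j) h)"
  using bf_sum_right[of A g h r] by (simp add: bf_commute)

lemma bf_cong: "(\<And>x. x \<in> {0..1} \<Longrightarrow> f x = f' x) \<Longrightarrow> (\<And>x. x \<in> {0..1} \<Longrightarrow> g x = g' x) \<Longrightarrow> bf f g = bf f' g'"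
  unfolding bf_def using af_cong[of f f' g g'] ip_cong[of f f' g g'] t_in by simp

text \<open>Strictness comes from the stiffness part: \<open>af v v = 0\<close> would make
  \<open>v\<close> constant on the nodes, hence zero because \<open>v 0 = 0\<close>, while one nodal
  value is \<open>x i \<noteq> 0\<close>.\<close>

lemma bf_definite:
  assumes "\<exists>i<M - 1. x i \<noteq> 0"
  shows "(\<Sum>i<M - 1. \<Sum>j<M - 1. x i * bf (hat (Suc i)) (hat (Suc j)) * x j) > 0"
proof -
  define v where "v = (\<lambda>s. \<Sum>i<M - 1. x i * hat (Suc i) s)"
  have cv: "cont v" unfolding v_def by (intro continuous_intros cont_hat)
  obtain i where i: "i < M - 1" "x i \<noteq> 0" using assms by blast
  have "v (t (Suc i)) = x i"
    unfolding v_def using i by (simp add: hat_node if_distrib cong: if_cong)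
  moreover have "v 0 = 0" using hat_comb_V0[of x] unfolding v_def V0_def by simp
  ultimately have "af v v \<noteq> 0" using af_zero_imp[of v "Suc i"] i M_pos by fastforce
  then have "af v v > 0" using af_self_nonneg[of v] by simp
  then have "bf v v > 0" unfolding bf_def using eps c ip_self_nonneg[of v]
    by (simp add: add_pos_nonneg)
  also have "bf v v = (\<Sum>i<M - 1. x i * bf (hat (Suc i)) v)"
    by (subst (1) v_def, rule bf_sum_left) (auto intro: cont_hat cv)
  also have "\<dots> = (\<Sum>i<M - 1. x i * (\<Sum>j<M - 1. x j * bf (hat (Suc i)) (hat (Suc j))))"
    unfolding v_def by (subst bf_sum_right) (auto intro: cont_hat)
  also have "\<dots> = (\<Sum>i<M - 1. \<Sum>j<M - 1. x i * bf (hat (Suc i)) (hat (Suc j)) * x j)"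
    by (simp add: sum_distrib_left mult_ac)
  finally show ?thesis .
qed

text \<open>Column \<open>l\<close> of the inverse of the system matrix, chosen once and
  independently of the data. The discrete solution then depends on the data through finitely many
  integrals, so its linearity and finite rank are visible from the formula.\<close>

definition green :: "nat \<Rightarrow> nat \<Rightarrow> real"
  where "green l = (SOME g. \<forall>i<M - 1. (\<Sum>j<M - 1. bf (hat (Suc i)) (hat (Suc j)) * g j) = (if i = l then 1 else 0))"

lemma green: "i < M - 1 \<Longrightarrow> (\<Sum>j<M - 1. bf (hat (Suc i)) (hat (Suc j)) * green l j) = (if i = l then 1 else 0)"
  using someI_ex[OF positive_form_solvable[OF bf_definite, where r = "\<lambda>i. if i = l then 1 else 0"]]
  unfolding green_def by auto

definition solve_nodal :: "nat \<Rightarrow> (real \<Rightarrow> real) \<Rightarrow> real"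
  where "solve_nodal j \<kappa> = (\<Sum>l<M - 1. green l j * (c * ip \<kappa> (hat (Suc l))))"

text \<open>The solution operator of the discrete problem \<open>bf (solve \<kappa>) v = c * ip \<kappa> v\<close>.\<close>

definition solve :: "(real \<Rightarrow> real) \<Rightarrow> real \<Rightarrow> real"
  where "solve \<kappa> x = (\<Sum>j<M - 1. solve_nodal j \<kappa> * hat (Suc j) x)"

lemma solve_V0: "solve \<kappa> \<in> V0"
  unfolding solve_def[abs_def] by (rule hat_comb_V0)

lemma lfun_solve_nodal: "lfun (solve_nodal j)"
  unfolding solve_nodal_def[abs_def] by (intro lfun_sum lfun.scale lfun.intg cont_hat)

lemma fin_op_solve: "fin_op solve"
  unfolding fin_op_def
  by (rule exI[of _ "M - 1"], rule exI[of _ solve_nodal], rule exI[of _ "\<lambda>j. hat (Suc j)"])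
    (auto simp: lfun_solve_nodal cont_hat solve_def)

lemma solve_hat:
  assumes "i < M - 1"
  shows "bf (solve \<kappa>) (hat (Suc i)) = c * ip \<kappa> (hat (Suc i))"
proof -
  have "bf (solve \<kappa>) (hat (Suc i)) = (\<Sum>j<M - 1. solve_nodal j \<kappa> * bf (hat (Suc i)) (hat (Suc j)))"
    unfolding solve_def[abs_def] by (subst bf_sum_left) (auto intro: cont_hat simp: bf_commute)
  also have "\<dots> = (\<Sum>j<M - 1. \<Sum>l<M - 1. (c * ip \<kappa> (hat (Suc l))) * (bf (hat (Suc i)) (hat (Suc j)) * green l j))"
    unfolding solve_nodal_def sum_distrib_right by (intro sum.cong refl) (simp add: mult_ac)
  also have "\<dots> = (\<Sum>l<M - 1. (c * ip \<kappa> (hat (Suc l))) * (\<Sum>j<M - 1. bf (hat (Suc i)) (hat (Suc j)) * green l j))"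
    by (subst sum.swap) (simp add: sum_distrib_left)
  also have "\<dots> = (\<Sum>l<M - 1. (c * ip \<kappa> (hat (Suc l))) * (if i = l then 1 else 0))"
    by (simp only: green[OF assms])
  also have "\<dots> = c * ip \<kappa> (hat (Suc i))" using assms by (simp add: if_distrib[of "\<lambda>x. _ * x"] cong: if_cong)
  finally show ?thesis .
qed

lemma solve_weak:
  assumes "v \<in> V0" "cont \<kappa>"
  shows "bf (solve \<kappa>) v = c * ip \<kappa> v"
proof -
  let ?v = "\<lambda>x. \<Sum>i<M - 1. v (t (Suc i)) * hat (Suc i) x"
  have "bf (solve \<kappa>) v = bf (solve \<kappa>) ?v" using V0_expand[OF assms(1)] by (intro bf_cong) auto
  also have "\<dots> = (\<Sum>i<M - 1. v (t (Suc i)) * (c * ip \<kappa> (hat (Suc i))))"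
    by (subst bf_sum_right) (auto intro: cont_hat V0_cont[OF solve_V0] simp: solve_hat)
  also have "\<dots> = c * ip \<kappa> ?v"
    by (subst ip_sum_right) (auto intro: cont_hat assms simp: sum_distrib_left mult_ac)
  also have "ip \<kappa> ?v = ip \<kappa> v" by (intro ip_cong) (simp_all only: V0_expand[OF assms(1), symmetric])
  finally show ?thesis .
qed

text \<open>Testing with the solution itself and Young's inequality. The second bound is the one
  that costs \<open>c / \<epsilon>\<close>.\<close>

lemma solve_energy:
  assumes "cont \<kappa>"
  shows "ip (solve \<kappa>) (solve \<kappa>) \<le> ip \<kappa> \<kappa>" "\<epsilon> * af (solve \<kappa>) (solve \<kappa>) \<le> c * ip \<kappa> \<kappa>"
proof -
  let ?z = "solve \<kappa>"
  have "\<epsilon> * af ?z ?z + c * ip ?z ?z = c * ip \<kappa> ?z"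
    using solve_weak[OF solve_V0 assms] unfolding bf_def .
  also have "\<dots> \<le> c * ((ip \<kappa> \<kappa> + ip ?z ?z) / 2)"
    using c by (intro mult_left_mono ip_young assms V0_cont solve_V0) auto
  finally have *: "\<epsilon> * af ?z ?z + c * ip ?z ?z / 2 \<le> c * ip \<kappa> \<kappa> / 2" by (simp add: field_simps)
  have nn: "0 \<le> \<epsilon> * af ?z ?z" "0 \<le> c * ip ?z ?z" "0 \<le> c * ip \<kappa> \<kappa>"
    using eps c af_self_nonneg ip_self_nonneg by auto
  then have "c * ip ?z ?z \<le> c * ip \<kappa> \<kappa>" using * by linarith
  then show "ip ?z ?z \<le> ip \<kappa> \<kappa>" using c by simp
  show "\<epsilon> * af ?z ?z \<le> c * ip \<kappa> \<kappa>" using * nn by linarith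
qed

lemma max_node_bound:
  assumes xi: "\<xi> \<in> V0" "cont \<kappa>" "\<And>v. v \<in> V0 \<Longrightarrow> bf \<xi> v = c * ip \<kappa> v"
    and \<kappa>: "\<And>x. x \<in> {0..1} \<Longrightarrow> \<bar>\<kappa> x\<bar> \<le> \<beta>"
    and k: "k \<le> M" "\<And>i. i \<le> M \<Longrightarrow> \<bar>\<xi> (t i)\<bar> \<le> \<xi> (t k)"
  shows "\<xi> (t k) \<le> 3 * \<beta>"
proof (cases "\<xi> (t k) = 0")
  case True
  then show ?thesis using \<kappa>[of 0] by simp
next
  case False
  define X where "X = \<xi> (t k)"
  have X: "X > 0" using False k(2)[of k] k(1) unfolding X_def by simp
  have "k \<noteq> 0" "k \<noteq> M" using False xi(1) t0 tM unfolding V0_def by (metis (mono_tags, lifting) mem_Collect_eq)+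
  then obtain i where i: "k = Suc i" "i < M - 1" using k by (cases k) auto
  have hV: "hat k \<in> V0" using hat_V0 i by simp
  have "af \<xi> (hat k) \<ge> 0"
    unfolding af_def
  proof (intro sum_nonneg)
    fix j assume j: "j \<in> {..<M}"
    have "(\<xi> (t (Suc j)) - \<xi> (t j)) * (hat k (t (Suc j)) - hat k (t j)) \<ge> 0"
      using k(2)[of j] k(2)[of "Suc j"] j by (auto simp: hat_node)
    then show "(\<xi> (t (Suc j)) - \<xi> (t j)) * (hat k (t (Suc j)) - hat k (t j)) / (t (Suc j) - t j) \<ge> 0"
      by (simp add: less_imp_le)
  qed
  then have "c * ip \<xi> (hat k) \<le> c * ip \<kappa> (hat k)"
    using xi(3)[OF hV] mult_nonneg_nonneg[of \<epsilon> "af \<xi> (hat k)"] eps unfolding bf_def by linarith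
  then have 1: "ip \<xi> (hat k) \<le> ip \<kappa> (hat k)" using c by simp
  \<comment> \<open>Beside node \<open>k\<close> the function \<xi> interpolates between
    \<open>X\<close> and a value not below \<open>-X\<close>, so it lies above
    \<open>X * (2 * hat k x - 1)\<close>; this is multiplied by the hat.\<close>
  have lower: "X * (2 * (hat k x * hat k x) - hat k x) \<le> \<xi> x * hat k x" if x: "x \<in> {0..1}" for x
  proof -
    obtain j where j: "j < M" "x \<in> {t j..t (Suc j)}" using ex_cell x by blast
    have h: "t (Suc j) - t j > 0" by simp
    define s where "s = (x - t j) / (t (Suc j) - t j)"
    have s: "0 \<le> s" "s \<le> 1" using j h unfolding s_def by (auto simp: divide_le_eq)
    have s': "(t (Suc j) - x) / (t (Suc j) - t j) = 1 - s"
      using h unfolding s_def by (simp add: field_simps)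
    have xx: "\<xi> x = \<xi> (t j) * (1 - s) + \<xi> (t (Suc j)) * s"
      using pl_cell[OF j] xi(1) x s_def s' unfolding V0_def is_pl_def by auto
    have B: "-X \<le> \<xi> (t j)" "-X \<le> \<xi> (t (Suc j))"
      using k(2)[of j] k(2)[of "Suc j"] j unfolding X_def by auto
    consider "k = j" | "k = Suc j" | "k \<noteq> j" "k \<noteq> Suc j" by blast
    then have "X * (2 * hat k x - 1) \<le> \<xi> x \<or> hat k x = 0"
    proof cases
      case 1
      have "hat k x = 1 - s" using hat_left j(2) s' 1 by simp
      moreover have "\<xi> (t (Suc j)) * s \<ge> - X * s" using s B by (intro mult_right_mono) auto
      moreover have "\<xi> (t j) = X" using 1 X_def by simp
      ultimately have "X * (2 * (1 - s) - 1) \<le> \<xi> x" unfolding xx by (simp add: algebra_simps)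
      then show ?thesis using \<open>hat k x = 1 - s\<close> by simp
    next
      case 2
      have "hat k x = s" using hat_right j(2) s_def 2 by simp
      moreover have "\<xi> (t j) * (1 - s) \<ge> - X * (1 - s)" using s B by (intro mult_right_mono) auto
      moreover have "\<xi> (t (Suc j)) = X" using 2 X_def by simp
      ultimately have "X * (2 * s - 1) \<le> \<xi> x" unfolding xx by (simp add: algebra_simps)
      then show ?thesis using \<open>hat k x = s\<close> by simp
    next
      case 3
      then show ?thesis using hat_other j by simp
    qed
    then show ?thesis
    proof
      assume "X * (2 * hat k x - 1) \<le> \<xi> x"
      from mult_right_mono[OF this hat_nonneg[of k x]] show ?thesis by (simp add: algebra_simps)
    qed simp
  qed
  \<comment> \<open>By the ratio 2/3 the integral is \<open>2 * (2/3) - 1 = 1/3\<close> of that of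
    \<open>X * hat k\<close>: the source of the constant 3.\<close>
  have "X / 3 * integral {0..1} (hat k) = integral {0..1} (\<lambda>x. X * (2 * (hat k x * hat k x) - hat k x))"
  proof -
    have "integral {0..1} (\<lambda>x. X * (2 * (hat k x * hat k x) - hat k x))
      = X * (2 * ip (hat k) (hat k) - integral {0..1} (hat k))"
      unfolding ip_def integral_mult_right[symmetric]
      by (subst Henstock_Kurzweil_Integration.integral_diff[symmetric])
        (auto intro!: integrable_continuous_real continuous_intros cont_hat)
    then show ?thesis using hat_integrals(1)[OF k(1)] by auto
  qed
  also have "\<dots> \<le> ip \<xi> (hat k)"
    unfolding ip_def using lower
    by (intro integral_le integrable_continuous_real continuous_intros cont_hat V0_cont[OF xi(1)]) auto
  also have "\<dots> \<le> ip \<kappa> (hat k)" by (rule 1)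
  also have "\<dots> \<le> \<beta> * integral {0..1} (hat k)"
  proof -
    have "ip \<kappa> (hat k) \<le> integral {0..1} (\<lambda>x. \<beta> * hat k x)"
      unfolding ip_def using \<kappa> hat_nonneg
      by (intro integral_le integrable_continuous_real continuous_intros cont_hat assms(2) mult_right_mono)
        (auto simp: abs_le_iff)
    then show ?thesis by simp
  qed
  finally show ?thesis using hat_integrals(2)[OF k(1)] unfolding X_def by simp
qed

lemma solve_sup:
  assumes "cont \<kappa>" "\<And>x. x \<in> {0..1} \<Longrightarrow> \<bar>\<kappa> x\<bar> \<le> \<beta>" "x \<in> {0..1}"
  shows "\<bar>solve \<kappa> x\<bar> \<le> 3 * \<beta>"
proof -
  let ?z = "solve \<kappa>"
  have "\<exists>k\<in>{..M}. \<forall>i\<in>{..M}. \<bar>?z (t i)\<bar> \<le> \<bar>?z (t k)\<bar>"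
    using Max_in[of "(\<lambda>i. \<bar>?z (t i)\<bar>) ` {..M}"] Max_ge[of "(\<lambda>i. \<bar>?z (t i)\<bar>) ` {..M}"] by fastforce
  then obtain k where k: "k \<le> M" "\<And>i. i \<le> M \<Longrightarrow> \<bar>?z (t i)\<bar> \<le> \<bar>?z (t k)\<bar>" by auto
  have "\<bar>?z (t k)\<bar> \<le> 3 * \<beta>"
  proof (cases "?z (t k) \<ge> 0")
    case True
    then show ?thesis
      using max_node_bound[OF solve_V0 assms(1) solve_weak[OF _ assms(1)] assms(2) k(1)] k by simp
  next
    case False
    have V: "(\<lambda>x. - ?z x) \<in> V0" using solve_V0[of \<kappa>] is_pl_combine[of ?z ?z "-1" 0] unfolding V0_def by simp
    have c': "cont (\<lambda>x. - \<kappa> x)" by (intro continuous_intros assms(1))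
    have "bf (\<lambda>x. - ?z x) v = c * ip (\<lambda>x. - \<kappa> x) v" if "v \<in> V0" for v
    proof -
      have "lfun (\<lambda>f. bf f v)" "lfun (\<lambda>f. ip f v)" using V0_cont[OF that] lfun_bf lfun.intg by auto
      from this[THEN lfun_cmult, of "-1"] solve_weak[OF that assms(1)] show ?thesis by simp
    qed
    from max_node_bound[OF V c' this _ k(1)] k(2) assms(2) False show ?thesis by auto
  qed
  moreover have "?z x = pl (\<lambda>i. ?z (t i)) x" using solve_V0[of \<kappa>] assms(3) unfolding V0_def is_pl_def by auto
  ultimately show ?thesis using pl_bound[OF _ assms(3), of "\<lambda>i. ?z (t i)" "3 * \<beta>"] k by fastforce
qed

end

section \<open>Double integrals, and one-dimensional energies integrated over the other
  variable\<close>

lemma integral_mono_cont: "cont f \<Longrightarrow> cont g \<Longrightarrow> (\<And>x. x \<in> {0..1} \<Longrightarrow> f x \<le> g x) \<Longrightarrow> integral {0..1} f \<le> integral {0..1} g"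
  by (intro integral_le integrable_continuous_real) auto

lemma sq_sum_le: "((a::real) + b)\<^sup>2 \<le> 2 * a\<^sup>2 + 2 * b\<^sup>2" "((a::real) - b)\<^sup>2 \<le> 2 * a\<^sup>2 + 2 * b\<^sup>2"
  using zero_le_power2[of "a - b"] zero_le_power2[of "a + b"] by (auto simp: power2_eq_square algebra_simps)

text \<open>The squared deviation of \<open>g\<close> from its mean \<open>m\<close> has a
  nonnegative integral.\<close>

lemma cauchy_schwarz_integral:
  fixes g :: "real \<Rightarrow> real"
  assumes "a < b" "continuous_on {a..b} g"
  shows "(integral {a..b} g)\<^sup>2 \<le> (b - a) * integral {a..b} (\<lambda>x. (g x)\<^sup>2)"
proof -
  define m where "m = integral {a..b} g / (b - a)"
  have i: "g integrable_on {a..b}" "(\<lambda>x. (g x)\<^sup>2) integrable_on {a..b}" "(\<lambda>x. 2 * m * g x) integrable_on {a..b}"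
    "(\<lambda>x. (g x)\<^sup>2 - 2 * m * g x) integrable_on {a..b}"
    using assms by (intro integrable_continuous_real continuous_intros; simp)+
  have "0 \<le> integral {a..b} (\<lambda>x. (g x - m)\<^sup>2)"
    using assms by (intro integral_nonneg integrable_continuous_real continuous_intros) auto
  also have "(\<lambda>x. (g x - m)\<^sup>2) = (\<lambda>x. ((g x)\<^sup>2 - 2 * m * g x) + m\<^sup>2)"
    by (auto simp: power2_eq_square algebra_simps)
  also have "integral {a..b} \<dots> = integral {a..b} (\<lambda>x. (g x)\<^sup>2) - 2 * m * integral {a..b} g + m\<^sup>2 * (b - a)"
  proof -
    have "integral {a..b} (\<lambda>x. ((g x)\<^sup>2 - 2 * m * g x) + m\<^sup>2)
        = integral {a..b} (\<lambda>x. (g x)\<^sup>2 - 2 * m * g x) + integral {a..b} (\<lambda>x. m\<^sup>2)"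
      by (rule Henstock_Kurzweil_Integration.integral_add) (use i in auto)
    also have "integral {a..b} (\<lambda>x. (g x)\<^sup>2 - 2 * m * g x)
        = integral {a..b} (\<lambda>x. (g x)\<^sup>2) - integral {a..b} (\<lambda>x. 2 * m * g x)"
      by (rule Henstock_Kurzweil_Integration.integral_diff) (use i in auto)
    finally show ?thesis using assms(1) by simp
  qed
  also have "\<dots> = integral {a..b} (\<lambda>x. (g x)\<^sup>2) - (integral {a..b} g)\<^sup>2 / (b - a)"
  proof -
    have md: "m * (b - a) = integral {a..b} g" using assms(1) unfolding m_def by simp
    have "m\<^sup>2 * (b - a) = m * integral {a..b} g" by (simp only: power2_eq_square mult.assoc md)
    moreover have "(integral {a..b} g)\<^sup>2 / (b - a) = m * integral {a..b} g" by (simp add: m_def power2_eq_square)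
    ultimately show ?thesis by simp
  qed
  finally show ?thesis using assms(1) by (simp add: field_simps)
qed

definition II :: "(real \<Rightarrow> real \<Rightarrow> real) \<Rightarrow> real"
  where "II k = integral {0..1} (\<lambda>x. integral {0..1} (k x))"

lemma II_flip: "cont2 k \<Longrightarrow> II (\<lambda>x y. k y x) = II k"
  unfolding II_def using integral_swap[of k] by simp

lemma II_mono: "cont2 k \<Longrightarrow> cont2 l \<Longrightarrow> (\<And>x y. x \<in> {0..1} \<Longrightarrow> y \<in> {0..1} \<Longrightarrow> k x y \<le> l x y) \<Longrightarrow> II k \<le> II l"
  unfolding II_def by (intro integral_mono_cont cont2_integral) (auto intro!: integral_mono_cont dest: cont2_row)

lemma II_cong: "(\<And>x y. x \<in> {0..1} \<Longrightarrow> y \<in> {0..1} \<Longrightarrow> k x y = l x y) \<Longrightarrow> II k = II l"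
  unfolding II_def by (intro integral_cong) auto

lemma II_add:
  assumes "cont2 k" "cont2 l" shows "II (\<lambda>x y. k x y + l x y) = II k + II l"
proof -
  have "II (\<lambda>x y. k x y + l x y) = integral {0..1} (\<lambda>x. integral {0..1} (k x) + integral {0..1} (l x))"
    unfolding II_def using assms
    by (intro integral_cong Henstock_Kurzweil_Integration.integral_add integrable_continuous_real cont2_row) auto
  then show ?thesis unfolding II_def
    using assms by (simp add: integral_add integrable_continuous_real cont2_integral)
qed

lemma II_cmult: "II (\<lambda>x y. r * k x y) = r * II k"
  unfolding II_def by simp

lemma II_const: "II (\<lambda>x y. r) = r"
  unfolding II_def by simp

lemma cont2_power2: "cont2 k \<Longrightarrow> cont2 (\<lambda>x y. (k x y)\<^sup>2)"
  using cont2_arith(3)[of k k] by (simp add: power2_eq_square)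

lemma cont2_cmult: "cont2 k \<Longrightarrow> cont2 (\<lambda>x y. r * k x y)"
  by (rule cont2_arith(3)[OF cont2_const])

lemma II_nonneg: "cont2 k \<Longrightarrow> (\<And>x y. x \<in> {0..1} \<Longrightarrow> y \<in> {0..1} \<Longrightarrow> 0 \<le> k x y) \<Longrightarrow> 0 \<le> II k"
  using II_mono[OF cont2_const[of 0], of k] by (simp add: II_const)

lemma II_sq_add:
  assumes "cont2 k" "cont2 l"
  shows "II (\<lambda>x y. (k x y + l x y)\<^sup>2) \<le> 2 * II (\<lambda>x y. (k x y)\<^sup>2) + 2 * II (\<lambda>x y. (l x y)\<^sup>2)"
    "II (\<lambda>x y. (k x y - l x y)\<^sup>2) \<le> 2 * II (\<lambda>x y. (k x y)\<^sup>2) + 2 * II (\<lambda>x y. (l x y)\<^sup>2)"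
proof -
  have "II (\<lambda>x y. (k x y + l x y)\<^sup>2) \<le> II (\<lambda>x y. 2 * (k x y)\<^sup>2 + 2 * (l x y)\<^sup>2)"
    using assms by (intro II_mono cont2_power2 cont2_arith(1) cont2_cmult sq_sum_le)
  moreover have "II (\<lambda>x y. (k x y - l x y)\<^sup>2) \<le> II (\<lambda>x y. 2 * (k x y)\<^sup>2 + 2 * (l x y)\<^sup>2)"
    using assms by (intro II_mono cont2_power2 cont2_arith(1,2) cont2_cmult sq_sum_le)
  moreover have "II (\<lambda>x y. 2 * (k x y)\<^sup>2 + 2 * (l x y)\<^sup>2) = 2 * II (\<lambda>x y. (k x y)\<^sup>2) + 2 * II (\<lambda>x y. (l x y)\<^sup>2)"
    using assms by (simp add: II_add cont2_cmult cont2_power2 II_cmult)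
  ultimately show "II (\<lambda>x y. (k x y + l x y)\<^sup>2) \<le> 2 * II (\<lambda>x y. (k x y)\<^sup>2) + 2 * II (\<lambda>x y. (l x y)\<^sup>2)"
    "II (\<lambda>x y. (k x y - l x y)\<^sup>2) \<le> 2 * II (\<lambda>x y. (k x y)\<^sup>2) + 2 * II (\<lambda>x y. (l x y)\<^sup>2)" by linarith+
qed

lemma fin_op_cont2': "fin_op T \<Longrightarrow> cont2 k \<Longrightarrow> cont2 (\<lambda>x y. T (k x) y)"
  using cont2_flip[OF fin_op_cont2[OF _ cont2_flip]] .

context mesh begin

lemma cont_af: "cont2 k \<Longrightarrow> cont2 l \<Longrightarrow> cont (\<lambda>y. af (\<lambda>x. k x y) (\<lambda>x. l x y))"
proof -
  assume kl: "cont2 k" "cont2 l"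
  have "cont (k (t i))" "cont (l (t i))" if "i \<le> M" for i using kl t_in[OF that] cont2_row by auto
  then show ?thesis unfolding af_def by (auto intro!: continuous_intros)
qed

text \<open>For functions piecewise linear in x this is the L2 product of the x-derivatives. The
  y-direction uses the same notion on the other mesh, with the arguments flipped.\<close>

definition brk :: "(real \<Rightarrow> real \<Rightarrow> real) \<Rightarrow> (real \<Rightarrow> real \<Rightarrow> real) \<Rightarrow> real"
  where "brk k l = integral {0..1} (\<lambda>y. af (\<lambda>x. k x y) (\<lambda>x. l x y))"

lemma brk_nonneg: "0 \<le> brk k k"
  unfolding brk_def
  by (cases "(\<lambda>y. af (\<lambda>x. k x y) (\<lambda>x. k x y)) integrable_on {0..1}")
    (auto simp: integral_nonneg af_self_nonneg not_integrable_integral)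

lemma brk_diff_left: "cont2 k \<Longrightarrow> cont2 k' \<Longrightarrow> cont2 l \<Longrightarrow> brk (\<lambda>x y. k x y - k' x y) l = brk k l - brk k' l"
  unfolding brk_def af_diff_left
  by (intro Henstock_Kurzweil_Integration.integral_diff integrable_continuous_real cont_af)

lemma brk_young: "cont2 k \<Longrightarrow> cont2 l \<Longrightarrow> brk k l \<le> (brk k k + brk l l) / 2"
proof -
  assume kl: "cont2 k" "cont2 l"
  note i = integrable_continuous_real[OF cont_af]
  have "brk k l \<le> integral {0..1} (\<lambda>y. (af (\<lambda>x. k x y) (\<lambda>x. k x y) + af (\<lambda>x. l x y) (\<lambda>x. l x y)) / 2)"
    unfolding brk_def using kl by (intro integral_mono_cont continuous_intros cont_af af_young) auto
  also have "\<dots> = (brk k k + brk l l) / 2"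
    unfolding brk_def using kl by (simp add: integral_add i)
  finally show ?thesis .
qed

lemma af_sq_add: "af (\<lambda>x. f x + g x) (\<lambda>x. f x + g x) \<le> 2 * af f f + 2 * af g g"
  "af (\<lambda>x. f x - g x) (\<lambda>x. f x - g x) \<le> 2 * af f f + 2 * af g g"
proof -
  have "0 \<le> af (\<lambda>x. f x - g x) (\<lambda>x. f x - g x)" "0 \<le> af (\<lambda>x. f x + g x) (\<lambda>x. f x + g x)"
    by (rule af_self_nonneg)+
  moreover have "af (\<lambda>x. f x - g x) (\<lambda>x. f x - g x) = af f f - 2 * af f g + af g g"
    using af_commute[of f "\<lambda>x. f x - g x"] af_commute[of g "\<lambda>x. f x - g x"]
    by (simp add: af_diff_left) (simp add: af_commute)
  moreover have "af (\<lambda>x. f x + g x) (\<lambda>x. f x + g x) = af f f + 2 * af f g + af g g"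
    using af_commute[of f "\<lambda>x. f x + g x"] af_commute[of g "\<lambda>x. f x + g x"]
    by (simp add: af_add_left) (simp add: af_commute)
  ultimately show "af (\<lambda>x. f x + g x) (\<lambda>x. f x + g x) \<le> 2 * af f f + 2 * af g g"
    "af (\<lambda>x. f x - g x) (\<lambda>x. f x - g x) \<le> 2 * af f f + 2 * af g g" by linarith+
qed

lemma brk_sq_add:
  assumes "cont2 k" "cont2 l"
  shows "brk (\<lambda>x y. k x y + l x y) (\<lambda>x y. k x y + l x y) \<le> 2 * brk k k + 2 * brk l l" (is ?A)
    "brk (\<lambda>x y. k x y - l x y) (\<lambda>x y. k x y - l x y) \<le> 2 * brk k k + 2 * brk l l" (is ?B)
proof -
  note i = integrable_continuous_real[OF cont_af]
  let ?J = "integral {0..1} (\<lambda>y. 2 * af (\<lambda>x. k x y) (\<lambda>x. k x y) + 2 * af (\<lambda>x. l x y) (\<lambda>x. l x y))"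
  have "brk (\<lambda>x y. k x y + l x y) (\<lambda>x y. k x y + l x y) \<le> ?J"
    unfolding brk_def using assms by (intro integral_mono_cont continuous_intros cont_af af_sq_add cont2_arith) auto
  moreover have "brk (\<lambda>x y. k x y - l x y) (\<lambda>x y. k x y - l x y) \<le> ?J"
    unfolding brk_def using assms by (intro integral_mono_cont continuous_intros cont_af af_sq_add cont2_arith) auto
  moreover have "?J = 2 * brk k k + 2 * brk l l"
    unfolding brk_def using assms by (simp add: integral_add i)
  ultimately show ?A ?B by linarith+
qed

lemma brk_cong: "(\<And>x y. x \<in> {0..1} \<Longrightarrow> y \<in> {0..1} \<Longrightarrow> k x y = k' x y) \<Longrightarrow>
  (\<And>x y. x \<in> {0..1} \<Longrightarrow> y \<in> {0..1} \<Longrightarrow> l x y = l' x y) \<Longrightarrow> brk k l = brk k' l'"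
  unfolding brk_def using t_in by (intro integral_cong af_cong) auto

text \<open>An increment is the integral of the derivative; Cauchy-Schwarz is applied on each
  cell.\<close>

lemma af_le_deriv:
  assumes "cont f'" "\<And>x. x \<in> {0..1} \<Longrightarrow> (f has_vector_derivative f' x) (at x within {0..1})"
  shows "af f f \<le> integral {0..1} (\<lambda>x. (f' x)\<^sup>2)"
proof -
  have "af f f \<le> (\<Sum>i<M. integral {t i..t (Suc i)} (\<lambda>x. (f' x)\<^sup>2))"
    unfolding af_self_sq
  proof (intro sum_mono)
    fix i assume i: "i \<in> {..<M}"
    have h: "t i < t (Suc i)" by simp
    have sub: "{t i..t (Suc i)} \<subseteq> {0..1}" using cell_subset i by simp
    have c: "continuous_on {t i..t (Suc i)} f'" using assms(1) sub continuous_on_subset by blast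
    have "(f' has_integral (f (t (Suc i)) - f (t i))) {t i..t (Suc i)}"
      using h sub assms(2)
      by (intro fundamental_theorem_of_calculus) (auto intro: has_vector_derivative_within_subset[OF _ sub])
    then have "f (t (Suc i)) - f (t i) = integral {t i..t (Suc i)} f'" by (simp add: integral_unique)
    with cauchy_schwarz_integral[OF h c] h
    show "(f (t (Suc i)) - f (t i))\<^sup>2 / (t (Suc i) - t i) \<le> integral {t i..t (Suc i)} (\<lambda>x. (f' x)\<^sup>2)"
      by (simp add: pos_divide_le_eq mult.commute del: t_less)
  qed
  also have "\<dots> = integral {0..1} (\<lambda>x. (f' x)\<^sup>2)"
    by (rule integral_cells[symmetric]) (intro continuous_intros assms(1))
  finally show ?thesis .
qed

lemma brk_le_deriv:
  assumes "cont2 k" "cont2 k'"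
    "\<And>x y. x \<in> {0..1} \<Longrightarrow> y \<in> {0..1} \<Longrightarrow> ((\<lambda>x. k x y) has_vector_derivative k' x y) (at x within {0..1})"
  shows "brk k k \<le> II (\<lambda>x y. (k' x y)\<^sup>2)"
proof -
  have "af (\<lambda>x. k x y) (\<lambda>x. k x y) \<le> integral {0..1} (\<lambda>x. (k' x y)\<^sup>2)" if "y \<in> {0..1}" for y
    by (rule af_le_deriv[OF cont2_col[OF assms(2) that] assms(3)[OF _ that]])
  from integral_mono_cont[OF cont_af[OF assms(1) assms(1)] cont2_integral[OF cont2_flip[OF cont2_power2[OF assms(2)]]] this]
  have "brk k k \<le> II (\<lambda>y x. (k' x y)\<^sup>2)"
    unfolding brk_def II_def .
  then show ?thesis using II_flip[OF cont2_power2[OF assms(2)]] by simp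
qed

text \<open>Increments in \<open>y\<close> of \<open>k - T\<^sub>x k\<close> are the errors of \<open>T\<close> applied to the increments of \<open>k\<close>.\<close>

lemma brk_op_error:
  assumes T: "fin_op T" "fin_op T'" and k: "cont2 k"
    and le: "\<And>f. cont f \<Longrightarrow> ip (\<lambda>y. f y - T f y) (\<lambda>y. f y - T f y) \<le> r * ip (\<lambda>y. f y - T' f y) (\<lambda>y. f y - T' f y)"
  shows "brk (\<lambda>x y. k x y - T (k x) y) (\<lambda>x y. k x y - T (k x) y)
    \<le> r * brk (\<lambda>x y. k x y - T' (k x) y) (\<lambda>x y. k x y - T' (k x) y)"
proof -
  define g where "g i y = k (t (Suc i)) y - k (t i) y" for i y
  have kn: "cont (k (t i))" if "i \<le> M" for i using cont2_row[OF k t_in[OF that]] .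
  have g: "cont (g i)" if "i < M" for i unfolding g_def using kn that by (intro continuous_intros) auto
  have eq: "brk (\<lambda>x y. k x y - T (k x) y) (\<lambda>x y. k x y - T (k x) y)
      = (\<Sum>i<M. ip (\<lambda>y. g i y - T (g i) y) (\<lambda>y. g i y - T (g i) y) / (t (Suc i) - t i))" if T: "fin_op T" for T
  proof -
    have inc: "(k (t (Suc i)) y - T (k (t (Suc i))) y) - (k (t i) y - T (k (t i)) y) = g i y - T (g i) y" if "i < M" for i y
      using fin_op_diff[OF T kn kn, of "Suc i" i y] that unfolding g_def by simp
    have c: "cont (\<lambda>y. g i y - T (g i) y)" if "i < M" for i
      by (intro continuous_intros g[OF that] fin_op_cont[OF T])
    have "brk (\<lambda>x y. k x y - T (k x) y) (\<lambda>x y. k x y - T (k x) y)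
      = integral {0..1} (\<lambda>y. \<Sum>i<M. (g i y - T (g i) y) * (g i y - T (g i) y) / (t (Suc i) - t i))"
      unfolding brk_def af_def by (intro integral_cong sum.cong refl) (simp add: inc)
    also have "\<dots> = (\<Sum>i<M. integral {0..1} (\<lambda>y. (g i y - T (g i) y) * (g i y - T (g i) y) / (t (Suc i) - t i)))"
      by (intro integral_sum integrable_continuous_real continuous_intros c) auto
    finally show ?thesis unfolding ip_def by simp
  qed
  show ?thesis unfolding eq[OF T(1)] eq[OF T(2)] sum_distrib_left
  proof (intro sum_mono)
    fix i assume "i \<in> {..<M}"
    then have "cont (g i)" using g by simp
    from divide_right_mono[OF le[OF this], of "t (Suc i) - t i"]
    show "ip (\<lambda>y. g i y - T (g i) y) (\<lambda>y. g i y - T (g i) y) / (t (Suc i) - t i)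
      \<le> r * (ip (\<lambda>y. g i y - T' (g i) y) (\<lambda>y. g i y - T' (g i) y) / (t (Suc i) - t i))"
      by (simp add: less_imp_le)
  qed
qed

end

section \<open>From the maximum norm to the energy, and the Ritz projection\<close>

context ritz begin

text \<open>The test function is \<open>solve \<kappa>\<close> minus its chord over the block, and
  zero outside. The stiffness term then returns the energy on the block minus that of the chord, and
  the load is bounded by maximum norms times the block length. By \<open>solve_sup\<close> the
  solution is at most \<open>3 * \<beta>\<close>; hence \<open>6 * \<beta>\<close> for the jump and
  the test function and \<open>4 * \<beta>\<close> for \<open>\<kappa> - solve \<kappa>\<close>. The
  two terms balance for blocks of length about \<open>sqrt \<epsilon>\<close>.\<close>

lemma solve_block:
  assumes "cont \<kappa>" and \<kappa>: "\<And>x. x \<in> {0..1} \<Longrightarrow> \<bar>\<kappa> x\<bar> \<le> \<beta>" and pq: "p < q" "q \<le> M"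
  shows "(\<Sum>i=p..<q. (solve \<kappa> (t (Suc i)) - solve \<kappa> (t i))\<^sup>2 / (t (Suc i) - t i))
    \<le> \<beta>\<^sup>2 * (36 / (t q - t p) + 24 * c * (t q - t p) / \<epsilon>)"
proof -
  let ?z = "solve \<kappa>"
  define L where "L = t q - t p"
  have L: "L > 0" using pq by (simp add: L_def)
  have \<beta>: "\<beta> \<ge> 0" using \<kappa>[of 0] by simp
  define s where "s = (?z (t q) - ?z (t p)) / L"
  define l where "l x = ?z (t p) + s * (x - t p)" for x
  \<comment> \<open>The difference to the chord vanishes at both block ends, so cutting it off there
    creates no increments outside the block.\<close>
  define v where "v = pl (\<lambda>i. if p \<le> i \<and> i \<le> q then ?z (t i) - l (t i) else 0)"
  have zb: "\<bar>?z x\<bar> \<le> 3 * \<beta>" if "x \<in> {0..1}" for x by (rule solve_sup[OF assms(1) \<kappa> that])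
  have lb: "\<bar>l (t i)\<bar> \<le> 3 * \<beta>" if "p \<le> i" "i \<le> q" for i
  proof -
    define \<theta> where "\<theta> = (t i - t p) / L"
    have \<theta>: "0 \<le> \<theta>" "\<theta> \<le> 1" using L that unfolding \<theta>_def L_def by (auto simp: divide_le_eq)
    have "l (t i) = ?z (t p) * (1 - \<theta>) + ?z (t q) * \<theta>"
      using L unfolding l_def s_def \<theta>_def by (simp add: field_simps)
    then have "\<bar>l (t i)\<bar> \<le> \<bar>?z (t p)\<bar> * (1 - \<theta>) + \<bar>?z (t q)\<bar> * \<theta>"
      using \<theta> abs_triangle_ineq[of "?z (t p) * (1 - \<theta>)" "?z (t q) * \<theta>"] by (simp add: abs_mult)
    also have "\<dots> \<le> 3 * \<beta> * (1 - \<theta>) + 3 * \<beta> * \<theta>"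
      using \<theta> pq by (intro add_mono mult_right_mono zb t_in) auto
    finally show ?thesis by (simp add: algebra_simps)
  qed
  have vn: "v (t i) = (if p \<le> i \<and> i \<le> q then ?z (t i) - l (t i) else 0)" if "i \<le> M" for i
    using that by (simp add: v_def pl_node)
  have lpq: "l (t p) = ?z (t p)" "l (t q) = ?z (t q)" using L by (auto simp: l_def s_def L_def)
  have zends: "?z 0 = 0" "?z 1 = 0" using solve_V0[of \<kappa>] unfolding V0_def by auto
  have "v \<in> V0" unfolding v_def
  proof (rule pl_V0)
    show "(if p \<le> 0 \<and> 0 \<le> q then ?z (t 0) - l (t 0) else 0) = 0" using lpq by auto
    show "(if p \<le> M \<and> M \<le> q then ?z (t M) - l (t M) else 0) = 0" using lpq pq by auto
  qed
  from solve_weak[OF this assms(1)] have eq: "\<epsilon> * af ?z v = c * ip (\<lambda>x. \<kappa> x - ?z x) v"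
    unfolding bf_def using ip_diff_left[OF assms(1) V0_cont[OF solve_V0] V0_cont[OF \<open>v \<in> V0\<close>], of \<kappa>]
    by (simp add: right_diff_distrib)
  have vb: "\<bar>v x\<bar> \<le> 6 * \<beta>" if "x \<in> {0..1}" for x
    unfolding v_def
  proof (rule pl_bound[OF _ that])
    fix i assume "i \<le> M"
    then show "\<bar>if p \<le> i \<and> i \<le> q then ?z (t i) - l (t i) else 0\<bar> \<le> 6 * \<beta>"
      using lb[of i] zb[OF t_in[of i]] \<beta> by auto
  qed
  have "af ?z v = (\<Sum>i=p..<q. (?z (t (Suc i)) - ?z (t i)) * (v (t (Suc i)) - v (t i)) / (t (Suc i) - t i))"
    unfolding af_def
  proof (intro sum.mono_neutral_right ballI)
    fix i assume i: "i \<in> {..<M} - {p..<q}"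
    then have "v (t i) = 0" "v (t (Suc i)) = 0"
      using vn[of i] vn[of "Suc i"] lpq pq by (auto simp: not_less le_Suc_eq)
    then show "(?z (t (Suc i)) - ?z (t i)) * (v (t (Suc i)) - v (t i)) / (t (Suc i) - t i) = 0" by simp
  qed (use pq in auto)
  also have "\<dots> = (\<Sum>i=p..<q. (?z (t (Suc i)) - ?z (t i))\<^sup>2 / (t (Suc i) - t i) - s * (?z (t (Suc i)) - ?z (t i)))"
  proof (intro sum.cong refl)
    fix i assume i: "i \<in> {p..<q}"
    have h: "t (Suc i) - t i \<noteq> 0" by simp
    have d: "v (t (Suc i)) - v (t i) = (?z (t (Suc i)) - ?z (t i)) - s * (t (Suc i) - t i)"
      using i pq vn[of i] vn[of "Suc i"] by (auto simp: l_def algebra_simps)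
    show "(?z (t (Suc i)) - ?z (t i)) * (v (t (Suc i)) - v (t i)) / (t (Suc i) - t i)
      = (?z (t (Suc i)) - ?z (t i))\<^sup>2 / (t (Suc i) - t i) - s * (?z (t (Suc i)) - ?z (t i))"
      unfolding d using h by (simp add: divide_simps) (simp add: power2_eq_square algebra_simps)
  qed
  also have "\<dots> = (\<Sum>i=p..<q. (?z (t (Suc i)) - ?z (t i))\<^sup>2 / (t (Suc i) - t i)) - (?z (t q) - ?z (t p))\<^sup>2 / L"
  proof -
    have "(\<Sum>i=p..<q. s * (?z (t (Suc i)) - ?z (t i))) = s * (?z (t q) - ?z (t p))"
      using sum_Suc_diff'[of p q "\<lambda>i. ?z (t i)"] pq by (simp add: sum_distrib_left[symmetric])
    also have "\<dots> = (?z (t q) - ?z (t p))\<^sup>2 / L" by (simp add: s_def power2_eq_square)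
    finally show ?thesis by (simp only: sum_subtractf)
  qed
  finally have af_eq: "(\<Sum>i=p..<q. (?z (t (Suc i)) - ?z (t i))\<^sup>2 / (t (Suc i) - t i))
    = af ?z v + (?z (t q) - ?z (t p))\<^sup>2 / L" by simp
  have "(?z (t q) - ?z (t p))\<^sup>2 \<le> (6 * \<beta>)\<^sup>2"
    using zb[OF t_in[of p]] zb[OF t_in[of q]] pq \<beta> by (intro power2_le_iff_abs_le[THEN iffD2]) auto
  then have jump: "(?z (t q) - ?z (t p))\<^sup>2 / L \<le> 36 * \<beta>\<^sup>2 / L"
    using L by (intro divide_right_mono) (auto simp: power2_eq_square)
  have cc: "cont (\<lambda>x. (\<kappa> x - ?z x) * v x)"
    by (intro continuous_intros assms(1) V0_cont solve_V0 \<open>v \<in> V0\<close>)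
  have "ip (\<lambda>x. \<kappa> x - ?z x) v \<le> (\<Sum>i<M. if p \<le> i \<and> i < q then 24 * \<beta>\<^sup>2 * (t (Suc i) - t i) else 0)"
    unfolding ip_def integral_cells[OF cc]
  proof (intro sum_mono)
    fix i assume "i \<in> {..<M}"
    then have i: "i < M" by simp
    have ci: "continuous_on {t i..t (Suc i)} (\<lambda>x. (\<kappa> x - ?z x) * v x)"
      using cc cell_subset[OF i] continuous_on_subset by blast
    show "integral {t i..t (Suc i)} (\<lambda>x. (\<kappa> x - ?z x) * v x) \<le> (if p \<le> i \<and> i < q then 24 * \<beta>\<^sup>2 * (t (Suc i) - t i) else 0)"
    proof (cases "p \<le> i \<and> i < q")
      case True
      have b: "(\<kappa> x - ?z x) * v x \<le> 24 * \<beta>\<^sup>2" if "x \<in> {t i..t (Suc i)}" for x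
      proof -
        have x: "x \<in> {0..1}" using cell_sub[OF i that] .
        have "(\<kappa> x - ?z x) * v x \<le> \<bar>\<kappa> x - ?z x\<bar> * \<bar>v x\<bar>" by (metis abs_ge_self abs_mult)
        also have "\<dots> \<le> (4 * \<beta>) * (6 * \<beta>)" using zb[OF x] vb[OF x] \<kappa>[OF x] by (intro mult_mono) auto
        finally show ?thesis by (simp add: power2_eq_square)
      qed
      have "integral {t i..t (Suc i)} (\<lambda>x. (\<kappa> x - ?z x) * v x) \<le> integral {t i..t (Suc i)} (\<lambda>x. 24 * \<beta>\<^sup>2)"
        using b by (intro integral_le integrable_continuous_real ci continuous_intros) auto
      also have "\<dots> = 24 * \<beta>\<^sup>2 * (t (Suc i) - t i)" by (simp add: less_imp_le mult.commute)
      finally show ?thesis using True by simp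
    next
      case False
      then have z: "v (t i) = 0" "v (t (Suc i)) = 0"
        using i vn[of i] vn[of "Suc i"] lpq pq by (auto simp: not_less le_Suc_eq)
      have "v x = 0" if "x \<in> {t i..t (Suc i)}" for x
        using is_pl_cellD[of v i x] \<open>v \<in> V0\<close> i that z unfolding V0_def by simp
      then have "integral {t i..t (Suc i)} (\<lambda>x. (\<kappa> x - ?z x) * v x) = integral {t i..t (Suc i)} (\<lambda>x. 0)"
        by (intro integral_cong) auto
      then show ?thesis using False by simp
    qed
  qed
  also have "\<dots> = (\<Sum>i=p..<q. 24 * \<beta>\<^sup>2 * (t (Suc i) - t i))"
    using pq by (intro sum.mono_neutral_cong_right) auto
  also have "\<dots> = 24 * \<beta>\<^sup>2 * L"
    using pq by (simp add: sum_distrib_left[symmetric] sum_Suc_diff' L_def)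
  finally have "\<epsilon> * af ?z v \<le> c * (24 * \<beta>\<^sup>2 * L)"
    unfolding eq using c by (intro mult_left_mono) auto
  then have "af ?z v \<le> \<beta>\<^sup>2 * (24 * c * L / \<epsilon>)" using eps by (simp add: field_simps)
  then show ?thesis unfolding af_eq L_def[symmetric] using jump by (simp add: algebra_simps)
qed

text \<open>The interpolation error vanishes at the nodes, so only the reaction term sees it, and
  the interpolant has to be corrected by the discrete solution whose load is that error. In this
  form \<open>f - rproj f\<close> is \<open>res\<close> applied to the interpolation error, and
  \<open>res\<close> is bounded both in L2 and in the maximum norm.\<close>

definition rproj :: "(real \<Rightarrow> real) \<Rightarrow> real \<Rightarrow> real"
  where "rproj f x = interp f x + solve (\<lambda>s. f s - interp f s) x"

definition res :: "(real \<Rightarrow> real) \<Rightarrow> real \<Rightarrow> real"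
  where "res f x = f x - solve f x"

lemma rproj_error: "f x - rproj f x = res (\<lambda>s. f s - interp f s) x"
  unfolding rproj_def res_def by simp

lemma solve_pl: "solve \<kappa> x = pl (\<lambda>j. if j = 0 \<or> j = M then 0 else solve_nodal (j - 1) \<kappa>) x"
  unfolding pl_def sum_nodes solve_def by (auto intro!: sum.cong)

text \<open>The interpolant inside the load is expanded into nodal values of \<open>f\<close>, so
  that each ingredient is visibly an evaluation of \<open>f\<close> or an integral of
  \<open>f\<close> against a hat.\<close>

definition rproj_nodal :: "nat \<Rightarrow> (real \<Rightarrow> real) \<Rightarrow> real"
  where "rproj_nodal j f = f (t j) + (if j = 0 \<or> j = M then 0 else
     (\<Sum>l<M - 1. green l (j - 1) * (c * (ip f (hat (Suc l)) - (\<Sum>i\<le>M. f (t i) * ip (hat i) (hat (Suc l)))))))"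

lemma lfun_rproj_nodal:
  assumes "j \<le> M" shows "lfun (rproj_nodal j)"
proof -
  have 1: "lfun (\<lambda>f. \<Sum>i\<le>M. f (t i) * ip (hat i) (hat (Suc l)))" for l
    by (intro lfun_sum lfun_scale' lfun.ev t_in) simp
  have 2: "lfun (\<lambda>f. green l (j - 1) * (c * (ip f (hat (Suc l)) - (\<Sum>i\<le>M. f (t i) * ip (hat i) (hat (Suc l))))))" for l
    by (intro lfun.scale lfun_diff[OF lfun.intg[OF cont_hat] 1])
  have 3: "lfun (\<lambda>f. if j = 0 \<or> j = M then 0 else
     (\<Sum>l<M - 1. green l (j - 1) * (c * (ip f (hat (Suc l)) - (\<Sum>i\<le>M. f (t i) * ip (hat i) (hat (Suc l)))))))"
  proof (cases "j = 0 \<or> j = M")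
    case False
    show ?thesis by (simp only: False if_False) (rule lfun_sum[OF 2])
  qed (simp add: lfun_zero)
  show ?thesis unfolding rproj_nodal_def[abs_def] by (rule lfun.add[OF lfun.ev[OF t_in[OF assms]] 3])
qed

lemma fin_op_rproj: "fin_op rproj"
proof (rule fin_opI[OF lfun_rproj_nodal])
  fix f :: "real \<Rightarrow> real" and x assume f: "cont f"
  have 1: "ip (\<lambda>s. f s - interp f s) (hat (Suc l)) = ip f (hat (Suc l)) - (\<Sum>i\<le>M. f (t i) * ip (hat i) (hat (Suc l)))" for l
    unfolding ip_diff_left[OF f cont_interp cont_hat]
    by (simp add: interp_def pl_def[abs_def] ip_sum_left cont_hat)
  have "rproj f x = (\<Sum>j\<le>M. f (t j) * hat j x)
      + (\<Sum>j\<le>M. (if j = 0 \<or> j = M then 0 else solve_nodal (j - 1) (\<lambda>s. f s - interp f s)) * hat j x)"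
    unfolding rproj_def solve_pl interp_def pl_def ..
  also have "\<dots> = pl (\<lambda>j. rproj_nodal j f) x"
    unfolding sum.distrib[symmetric] pl_def solve_nodal_def 1 rproj_nodal_def
    by (simp only: distrib_right)
  finally show "rproj f x = pl (\<lambda>j. rproj_nodal j f) x" .
qed

lemma is_pl_rproj: "is_pl (rproj f)"
proof -
  have "is_pl (interp f)" unfolding interp_def by (rule is_pl_pl)
  moreover have "is_pl (solve (\<lambda>s. f s - interp f s))" using solve_V0 unfolding V0_def by auto
  ultimately show ?thesis using is_pl_combine[of "interp f" "solve (\<lambda>s. f s - interp f s)" 1 1]
    unfolding rproj_def[abs_def] by simp
qed

lemma rproj_ends: "rproj f 0 = f 0" "rproj f 1 = f 1"
  using solve_V0[of "\<lambda>s. f s - interp f s"] pl_end[of "\<lambda>i. f (t i)"] t0 tM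
  unfolding rproj_def interp_def V0_def by auto

lemma cont_err: "cont f \<Longrightarrow> cont (\<lambda>s. f s - interp f s)"
  by (intro continuous_intros cont_interp)

lemma rproj_orth:
  assumes "v \<in> V0" "cont f"
  shows "bf (\<lambda>x. f x - rproj f x) v = 0"
proof -
  let ?e = "\<lambda>s. f s - interp f s"
  have "af ?e v = af (\<lambda>x. 0) v" by (intro af_cong) (auto simp: interp_node)
  also have "\<dots> = 0" by (simp add: af_def)
  finally have a: "bf ?e v = c * ip ?e v" unfolding bf_def by simp
  have "bf (\<lambda>x. f x - rproj f x) v = bf (\<lambda>x. ?e x - solve ?e x) v" unfolding rproj_def diff_diff_add ..
  also have "\<dots> = bf ?e v - bf (solve ?e) v"
    by (rule lfun_minus[OF lfun_bf[OF V0_cont[OF assms(1)]]])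
      (intro cont_err assms(2) V0_cont[OF solve_V0])+
  finally show ?thesis using a solve_weak[OF assms(1) cont_err[OF assms(2)]] by simp
qed

lemma ip_self_sq: "ip f f = integral {0..1} (\<lambda>x. (f x)\<^sup>2)"
  by (simp add: ip_def power2_eq_square)

lemma res_L2:
  assumes "cont f"
  shows "ip (res f) (res f) \<le> 4 * ip f f"
proof -
  have cs: "cont (solve f)" using V0_cont[OF solve_V0] .
  have "ip (res f) (res f) \<le> integral {0..1} (\<lambda>x. 2 * (f x)\<^sup>2 + 2 * (solve f x)\<^sup>2)"
    unfolding ip_self_sq res_def by (intro integral_mono_cont continuous_intros assms cs sq_sum_le)
  also have "\<dots> = 2 * ip f f + 2 * ip (solve f) (solve f)"
    unfolding ip_self_sq
    by (subst Henstock_Kurzweil_Integration.integral_add) (auto intro!: integrable_continuous_real continuous_intros assms cs)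
  finally show ?thesis using solve_energy(1)[OF assms] by simp
qed

lemma res_sup:
  assumes "cont f" "\<And>x. x \<in> {0..1} \<Longrightarrow> \<bar>f x\<bar> \<le> B" "x \<in> {0..1}"
  shows "\<bar>res f x\<bar> \<le> 4 * B"
  using solve_sup[OF assms] assms(2)[OF assms(3)] unfolding res_def by linarith

lemma rproj_L2: "cont f \<Longrightarrow> ip (\<lambda>x. f x - rproj f x) (\<lambda>x. f x - rproj f x) \<le> 4 * ip (\<lambda>x. f x - interp f x) (\<lambda>x. f x - interp f x)"
  unfolding rproj_error using res_L2[OF cont_err] .

lemma af_rproj: "af (rproj f) (rproj f) \<le> 2 * af f f + 2 * af (solve (\<lambda>s. f s - interp f s)) (solve (\<lambda>s. f s - interp f s))"
proof -
  have "af (interp f) (interp f) = af f f" by (intro af_cong) (auto simp: interp_node)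
  then show ?thesis unfolding rproj_def[abs_def] using af_sq_add(1)[of "interp f" "solve (\<lambda>s. f s - interp f s)"] by simp
qed

end

section \<open>Projection errors in two dimensions\<close>

lemma II_alt: "cont2 k \<Longrightarrow> II k = integral {0..1} (\<lambda>y. integral {0..1} (\<lambda>x. k x y))"
  unfolding II_def by (rule integral_swap)

locale ritz2 = X: ritz s M \<epsilon> c + Y: ritz t K \<epsilon> c for s t M K \<epsilon> c
begin

definition gap :: "(real \<Rightarrow> real \<Rightarrow> real) \<Rightarrow> real \<Rightarrow> real \<Rightarrow> real"
  where "gap u x y = u x y - Y.rproj (u x) y"

definition mix :: "(real \<Rightarrow> real \<Rightarrow> real) \<Rightarrow> real \<Rightarrow> real \<Rightarrow> real"
  where "mix u x y = X.rproj (\<lambda>s. gap u s y) x"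

definition err1 :: "(real \<Rightarrow> real \<Rightarrow> real) \<Rightarrow> real \<Rightarrow> real \<Rightarrow> real"
  where "err1 u x y = u x y - X.interp (\<lambda>s. u s y) x"

definition err2 :: "(real \<Rightarrow> real \<Rightarrow> real) \<Rightarrow> real \<Rightarrow> real \<Rightarrow> real"
  where "err2 u x y = err1 u x y - Y.interp (err1 u x) y"

definition eta :: "(real \<Rightarrow> real \<Rightarrow> real) \<Rightarrow> real \<Rightarrow> real \<Rightarrow> real"
  where "eta u x y = gap u x y - X.interp (\<lambda>s. gap u s y) x"

lemma cont2_gap: "cont2 u \<Longrightarrow> cont2 (gap u)"
  unfolding gap_def[abs_def] by (rule cont2_arith(2)[OF _ fin_op_cont2'[OF Y.fin_op_rproj]])

lemma cont2_mix: "cont2 u \<Longrightarrow> cont2 (mix u)"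
  unfolding mix_def[abs_def] by (rule fin_op_cont2[OF X.fin_op_rproj cont2_gap])

lemma cont2_err1: "cont2 u \<Longrightarrow> cont2 (err1 u)"
  unfolding err1_def[abs_def] by (rule cont2_arith(2)[OF _ fin_op_cont2[OF X.fin_op_interp]])

lemma cont2_err2: "cont2 u \<Longrightarrow> cont2 (err2 u)"
  unfolding err2_def[abs_def] by (rule cont2_arith(2)[OF cont2_err1 fin_op_cont2'[OF Y.fin_op_interp cont2_err1]])

lemma cont2_eta: "cont2 u \<Longrightarrow> cont2 (eta u)"
  unfolding eta_def[abs_def] by (rule cont2_arith(2)[OF cont2_gap fin_op_cont2[OF X.fin_op_interp cont2_gap]])

lemma cont2_res: "cont2 k \<Longrightarrow> cont2 (\<lambda>x y. Y.res (k x) y)"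
  unfolding Y.res_def by (rule cont2_arith(2)[OF _ fin_op_cont2'[OF Y.fin_op_solve]])

text \<open>Operators in different variables commute, so the x-interpolation error of the
  y-projection error is the y-projection error of the x-interpolation error, and
  \<open>rproj_error\<close> turns the latter into \<open>res\<close> of the mixed interpolation
  error.\<close>

lemma eta_eq:
  assumes u: "cont2 u" and xy: "x \<in> {0..1}" "y \<in> {0..1}"
  shows "eta u x y = Y.res (err2 u x) y"
proof -
  have "X.interp (\<lambda>s. gap u s y) x = X.interp (\<lambda>s. u s y) x - X.interp (\<lambda>s. Y.rproj (u s) y) x"
    unfolding gap_def
    by (rule fin_op_diff[OF X.fin_op_interp cont2_col[OF u xy(2)]
          cont2_col[OF fin_op_cont2'[OF Y.fin_op_rproj u] xy(2)]])
  also have "X.interp (\<lambda>s. Y.rproj (u s) y) x = Y.rproj (\<lambda>r. X.interp (\<lambda>s. u s r) x) y"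
    by (rule fin_op_commute[OF X.fin_op_interp Y.fin_op_rproj u])
  finally have "eta u x y = err1 u x y - (Y.rproj (u x) y - Y.rproj (\<lambda>r. X.interp (\<lambda>s. u s r) x) y)"
    unfolding eta_def gap_def err1_def by simp
  also have "Y.rproj (u x) y - Y.rproj (\<lambda>r. X.interp (\<lambda>s. u s r) x) y = Y.rproj (err1 u x) y"
    unfolding err1_def[abs_def]
    by (rule fin_op_diff[OF Y.fin_op_rproj cont2_row[OF u xy(1)]
          cont2_row[OF fin_op_cont2[OF X.fin_op_interp u] xy(1)], symmetric])
  finally show ?thesis unfolding Y.rproj_error err2_def[abs_def] .
qed

context
  fixes u F :: "real \<Rightarrow> real \<Rightarrow> real" and B Q :: real
  assumes u: "cont2 u" and F: "cont2 F" "\<And>x y. x \<in> {0..1} \<Longrightarrow> y \<in> {0..1} \<Longrightarrow> 0 \<le> F x y" and B: "0 \<le> B"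
    and bound: "\<And>x y. x \<in> {0..1} \<Longrightarrow> y \<in> {0..1} \<Longrightarrow> \<bar>err2 u x y\<bar> \<le> F x y + B"
    and Q: "\<And>\<kappa> \<beta>. cont \<kappa> \<Longrightarrow> (\<And>x. x \<in> {0..1} \<Longrightarrow> \<bar>\<kappa> x\<bar> \<le> \<beta>) \<Longrightarrow> X.af (X.solve \<kappa>) (X.solve \<kappa>) \<le> Q * \<beta>\<^sup>2"
begin

text \<open>Clamping \<open>err2 u\<close> between \<open>-F\<close> and \<open>F\<close> preserves
  continuity and leaves a remainder of modulus at most \<open>B\<close>. The linear map
  \<open>res\<close> in y is applied to both pieces, with its L2 bound for the first and its maximum
  norm bound for the second.\<close>

lemma eta_split:
  obtains h1 h2 where "cont2 h1" "cont2 h2"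
    "\<And>x y. x \<in> {0..1} \<Longrightarrow> y \<in> {0..1} \<Longrightarrow> eta u x y = h1 x y + h2 x y"
    "II (\<lambda>x y. (h1 x y)\<^sup>2) \<le> 4 * II (\<lambda>x y. (F x y)\<^sup>2)"
    "\<And>x y. x \<in> {0..1} \<Longrightarrow> y \<in> {0..1} \<Longrightarrow> \<bar>h2 x y\<bar> \<le> 4 * B"
proof -
  define k1 where "k1 x y = max (- F x y) (min (F x y) (err2 u x y))" for x y
  define k2 where "k2 x y = err2 u x y - k1 x y" for x y
  note e2 = cont2_err2[OF u]
  have c1: "cont2 k1" unfolding k1_def[abs_def] by (rule cont2_arith(4)[OF cont2_arith(6)[OF F(1) F(1)] cont2_arith(5)[OF F(1) e2]])
  have c2: "cont2 k2" unfolding k2_def[abs_def] by (rule cont2_arith(2)[OF e2 c1])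
  have b1: "\<bar>k1 x y\<bar> \<le> F x y" and b2: "\<bar>k2 x y\<bar> \<le> B" if "x \<in> {0..1}" "y \<in> {0..1}" for x y
    using bound[OF that] F(2)[OF that] B unfolding k1_def k2_def by (auto simp: max_def min_def abs_le_iff)
  define h1 where "h1 x y = Y.res (k1 x) y" for x y
  define h2 where "h2 x y = Y.res (k2 x) y" for x y
  have h1: "cont2 h1" unfolding h1_def[abs_def] by (rule cont2_res[OF c1])
  have h2: "cont2 h2" unfolding h2_def[abs_def] by (rule cont2_res[OF c2])
  have sum: "eta u x y = h1 x y + h2 x y" if xy: "x \<in> {0..1}" "y \<in> {0..1}" for x y
  proof -
    have "Y.solve (k2 x) y = Y.solve (err2 u x) y - Y.solve (k1 x) y"
      unfolding k2_def[abs_def] by (rule fin_op_diff[OF Y.fin_op_solve cont2_row[OF e2 xy(1)] cont2_row[OF c1 xy(1)]])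
    then show ?thesis unfolding eta_eq[OF u xy] h1_def h2_def Y.res_def by (simp add: k2_def)
  qed
  have "II (\<lambda>x y. (h1 x y)\<^sup>2) \<le> II (\<lambda>x y. 4 * (k1 x y)\<^sup>2)"
    unfolding II_def
  proof (rule integral_mono_cont[OF cont2_integral[OF cont2_power2[OF h1]] cont2_integral[OF cont2_cmult[OF cont2_power2[OF c1]]]])
    fix x :: real assume "x \<in> {0..1}"
    from Y.res_L2[OF cont2_row[OF c1 this]]
    show "integral {0..1} (\<lambda>y. (h1 x y)\<^sup>2) \<le> integral {0..1} (\<lambda>y. 4 * (k1 x y)\<^sup>2)"
      unfolding Y.ip_self_sq h1_def by simp
  qed
  also have "\<dots> \<le> II (\<lambda>x y. 4 * (F x y)\<^sup>2)"
    using b1 by (intro II_mono cont2_cmult cont2_power2 c1 F mult_left_mono) (auto simp: abs_le_square_iff[symmetric] F(2))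
  finally have n1: "II (\<lambda>x y. (h1 x y)\<^sup>2) \<le> 4 * II (\<lambda>x y. (F x y)\<^sup>2)" by (simp only: II_cmult)
  have n2: "\<bar>h2 x y\<bar> \<le> 4 * B" if xy: "x \<in> {0..1}" "y \<in> {0..1}" for x y
    unfolding h2_def by (rule Y.res_sup[OF cont2_row[OF c2 xy(1)] b2[OF xy(1)] xy(2)])
  show ?thesis by (rule that[OF h1 h2 sum n1 n2])
qed

text \<open>\<open>X.rproj\<close> is interpolation, which keeps the discrete energy, plus the
  discrete solution with load \<open>eta u\<close>. The piece of the load that is small in L2 goes
  through the energy estimate at the cost \<open>c / \<epsilon>\<close>, the piece that is small
  pointwise through the bound with \<open>Q\<close>.\<close>

lemma brk_mix:
  "X.brk (mix u) (mix u) \<le> 2 * X.brk (gap u) (gap u) + 16 * (c / \<epsilon>) * II (\<lambda>x y. (F x y)\<^sup>2) + 64 * Q * B\<^sup>2"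
proof -
  obtain h1 h2 where h: "cont2 h1" "cont2 h2"
    and sum: "\<And>x y. x \<in> {0..1} \<Longrightarrow> y \<in> {0..1} \<Longrightarrow> eta u x y = h1 x y + h2 x y"
    and n1: "II (\<lambda>x y. (h1 x y)\<^sup>2) \<le> 4 * II (\<lambda>x y. (F x y)\<^sup>2)"
    and n2: "\<And>x y. x \<in> {0..1} \<Longrightarrow> y \<in> {0..1} \<Longrightarrow> \<bar>h2 x y\<bar> \<le> 4 * B"
    by (rule eta_split, rule that, assumption+)
  note g = cont2_gap[OF u]
  have pt: "X.af (\<lambda>x. mix u x y) (\<lambda>x. mix u x y)
      \<le> (2 * X.af (\<lambda>x. gap u x y) (\<lambda>x. gap u x y) + 4 * (c / \<epsilon>) * integral {0..1} (\<lambda>x. (h1 x y)\<^sup>2)) + 64 * Q * B\<^sup>2"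
    if y: "y \<in> {0..1}" for y
  proof -
    let ?S1 = "X.solve (\<lambda>x. h1 x y)" and ?S2 = "X.solve (\<lambda>x. h2 x y)" and ?S = "X.solve (\<lambda>x. eta u x y)"
    have c1: "cont (\<lambda>x. h1 x y)" and c2: "cont (\<lambda>x. h2 x y)" using cont2_col h y by auto
    have S: "?S x = ?S1 x + ?S2 x" for x
      using fin_op_cong[OF X.fin_op_solve cont2_col[OF cont2_eta[OF u] y], of "\<lambda>x. h1 x y + h2 x y"] sum y
        fin_op_add[OF X.fin_op_solve c1 c2] by simp
    have "X.af ?S ?S \<le> 2 * X.af ?S1 ?S1 + 2 * X.af ?S2 ?S2"
      using X.af_sq_add(1)[of ?S1 ?S2] S by presburger
    moreover have "X.af ?S1 ?S1 \<le> c / \<epsilon> * integral {0..1} (\<lambda>x. (h1 x y)\<^sup>2)"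
      using X.solve_energy(2)[OF c1] X.eps unfolding X.ip_self_sq by (simp add: field_simps)
    moreover have "X.af ?S2 ?S2 \<le> Q * (4 * B)\<^sup>2" by (rule Q[OF c2 n2[OF _ y]])
    moreover have "X.af (\<lambda>x. mix u x y) (\<lambda>x. mix u x y) \<le> 2 * X.af (\<lambda>x. gap u x y) (\<lambda>x. gap u x y) + 2 * X.af ?S ?S"
      unfolding mix_def eta_def by (rule X.af_rproj)
    ultimately show ?thesis by (simp add: power2_eq_square)
  qed
  note ci = cont2_integral[OF cont2_flip[OF cont2_power2[OF h(1)]]]
  have c1: "cont (\<lambda>y. 2 * X.af (\<lambda>x. gap u x y) (\<lambda>x. gap u x y))"
    by (intro continuous_on_mult continuous_on_const X.cont_af[OF g g])
  have c2: "cont (\<lambda>y. 4 * (c / \<epsilon>) * integral {0..1} (\<lambda>x. (h1 x y)\<^sup>2))"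
    by (intro continuous_on_mult continuous_on_const ci)
  note c12 = continuous_on_add[OF c1 c2]
  have "X.brk (mix u) (mix u) \<le> integral {0..1} (\<lambda>y. (2 * X.af (\<lambda>x. gap u x y) (\<lambda>x. gap u x y)
      + 4 * (c / \<epsilon>) * integral {0..1} (\<lambda>x. (h1 x y)\<^sup>2)) + 64 * Q * B\<^sup>2)"
    unfolding X.brk_def
    by (rule integral_mono_cont[OF X.cont_af[OF cont2_mix[OF u] cont2_mix[OF u]] continuous_on_add[OF c12 continuous_on_const] pt])
  also have "\<dots> = integral {0..1} (\<lambda>y. 2 * X.af (\<lambda>x. gap u x y) (\<lambda>x. gap u x y)
      + 4 * (c / \<epsilon>) * integral {0..1} (\<lambda>x. (h1 x y)\<^sup>2)) + 64 * Q * B\<^sup>2"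
    by (subst Henstock_Kurzweil_Integration.integral_add[OF integrable_continuous_real[OF c12] integrable_continuous_real[OF continuous_on_const]]) simp
  also have "integral {0..1} (\<lambda>y. 2 * X.af (\<lambda>x. gap u x y) (\<lambda>x. gap u x y)
      + 4 * (c / \<epsilon>) * integral {0..1} (\<lambda>x. (h1 x y)\<^sup>2)) = 2 * X.brk (gap u) (gap u) + 4 * (c / \<epsilon>) * II (\<lambda>x y. (h1 x y)\<^sup>2)"
    unfolding X.brk_def II_alt[OF cont2_power2[OF h(1)]]
    by (subst Henstock_Kurzweil_Integration.integral_add[OF integrable_continuous_real[OF c1] integrable_continuous_real[OF c2]]) simp
  also have "4 * (c / \<epsilon>) * II (\<lambda>x y. (h1 x y)\<^sup>2) \<le> 4 * (c / \<epsilon>) * (4 * II (\<lambda>x y. (F x y)\<^sup>2))"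
    using X.eps X.c by (intro mult_left_mono n1) auto
  finally show ?thesis by simp
qed

lemma L2_gap: "II (\<lambda>x y. (gap u x y)\<^sup>2) \<le> 4 * II (\<lambda>x y. (u x y - Y.interp (u x) y)\<^sup>2)"
proof -
  note g = cont2_gap[OF u] and g' = cont2_arith(2)[OF u fin_op_cont2'[OF Y.fin_op_interp u]]
  have "II (\<lambda>x y. (gap u x y)\<^sup>2) \<le> II (\<lambda>x y. 4 * (u x y - Y.interp (u x) y)\<^sup>2)"
    unfolding II_def
  proof (rule integral_mono_cont[OF cont2_integral[OF cont2_power2[OF g]] cont2_integral[OF cont2_cmult[OF cont2_power2[OF g']]]])
    fix x :: real assume "x \<in> {0..1}"
    from Y.rproj_L2[OF cont2_row[OF u this]]
    show "integral {0..1} (\<lambda>y. (gap u x y)\<^sup>2) \<le> integral {0..1} (\<lambda>y. 4 * (u x y - Y.interp (u x) y)\<^sup>2)"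
      unfolding Y.ip_self_sq gap_def by simp
  qed
  then show ?thesis by (simp only: II_cmult)
qed

lemma L2_mix:
  "II (\<lambda>x y. (mix u x y)\<^sup>2) \<le> 16 * II (\<lambda>x y. (u x y - Y.interp (u x) y)\<^sup>2) + 48 * II (\<lambda>x y. (F x y)\<^sup>2) + 192 * B\<^sup>2"
proof -
  obtain h1 h2 where h: "cont2 h1" "cont2 h2"
    and sum: "\<And>x y. x \<in> {0..1} \<Longrightarrow> y \<in> {0..1} \<Longrightarrow> eta u x y = h1 x y + h2 x y"
    and n1: "II (\<lambda>x y. (h1 x y)\<^sup>2) \<le> 4 * II (\<lambda>x y. (F x y)\<^sup>2)"
    and n2: "\<And>x y. x \<in> {0..1} \<Longrightarrow> y \<in> {0..1} \<Longrightarrow> \<bar>h2 x y\<bar> \<le> 4 * B"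
    by (rule eta_split, rule that, assumption+)
  note e = cont2_eta[OF u] and g = cont2_gap[OF u]
  have "II (\<lambda>x y. (h2 x y)\<^sup>2) \<le> II (\<lambda>x y. (4 * B)\<^sup>2)"
  proof (rule II_mono[OF cont2_power2[OF h(2)] cont2_const])
    fix x y :: real assume "x \<in> {0..1}" "y \<in> {0..1}"
    from n2[OF this] B have "\<bar>h2 x y\<bar> \<le> \<bar>4 * B\<bar>" by simp
    then show "(h2 x y)\<^sup>2 \<le> (4 * B)\<^sup>2" by (simp only: abs_le_square_iff)
  qed
  then have "II (\<lambda>x y. (h2 x y)\<^sup>2) \<le> 16 * B\<^sup>2" by (simp add: II_const power_mult_distrib)
  moreover have "II (\<lambda>x y. (eta u x y)\<^sup>2) = II (\<lambda>x y. (h1 x y + h2 x y)\<^sup>2)"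
    by (rule II_cong) (simp add: sum)
  ultimately have E: "II (\<lambda>x y. (eta u x y)\<^sup>2) \<le> 8 * II (\<lambda>x y. (F x y)\<^sup>2) + 32 * B\<^sup>2"
    using II_sq_add(1)[OF h] n1 by simp
  let ?S = "\<lambda>x y. X.solve (\<lambda>s. eta u s y) x"
  have S: "cont2 ?S" by (rule fin_op_cont2[OF X.fin_op_solve e])
  have S2: "II (\<lambda>x y. (?S x y)\<^sup>2) \<le> II (\<lambda>x y. (eta u x y)\<^sup>2)"
    unfolding II_alt[OF cont2_power2[OF S]] II_alt[OF cont2_power2[OF e]]
  proof (rule integral_mono_cont[OF cont2_integral[OF cont2_flip[OF cont2_power2[OF S]]] cont2_integral[OF cont2_flip[OF cont2_power2[OF e]]]])
    fix y :: real assume "y \<in> {0..1}"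
    from X.solve_energy(1)[OF cont2_col[OF e this]]
    show "integral {0..1} (\<lambda>x. (?S x y)\<^sup>2) \<le> integral {0..1} (\<lambda>x. (eta u x y)\<^sup>2)" unfolding X.ip_self_sq .
  qed
  \<comment> \<open>The interpolant of \<open>gap u\<close> is written as \<open>gap u\<close> minus
    its interpolation error; the last term is the correction that the Ritz projection adds.\<close>
  have "mix u x y = (gap u x y - eta u x y) + ?S x y" for x y
    unfolding mix_def X.rproj_def eta_def by simp
  then have "II (\<lambda>x y. (mix u x y)\<^sup>2) = II (\<lambda>x y. ((gap u x y - eta u x y) + ?S x y)\<^sup>2)" by simp
  also have "\<dots> \<le> 2 * II (\<lambda>x y. (gap u x y - eta u x y)\<^sup>2) + 2 * II (\<lambda>x y. (?S x y)\<^sup>2)"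
    by (rule II_sq_add(1)[OF cont2_arith(2)[OF g e] S])
  finally show ?thesis using II_sq_add(2)[OF g e] S2 E L2_gap by linarith
qed

end

lemma brk_gap:
  assumes "cont2 u"
  shows "X.brk (gap u) (gap u) \<le> 4 * X.brk (\<lambda>x y. u x y - Y.interp (u x) y) (\<lambda>x y. u x y - Y.interp (u x) y)"
  unfolding gap_def[abs_def] by (rule X.brk_op_error[OF Y.fin_op_rproj Y.fin_op_interp assms Y.rproj_L2])

text \<open>The finite element space described by slices, the form in which one-dimensional
  orthogonality applies. The link with cellwise bilinear functions is given by
  \<open>Vh_if_bilinear\<close> and \<open>bilinear_if_Vh\<close>.\<close>

definition Vh :: "(real \<Rightarrow> real \<Rightarrow> real) set"
  where "Vh = {v. cont2 v \<and> (\<forall>y\<in>{0..1}. (\<lambda>x. v x y) \<in> X.V0) \<and> (\<forall>x\<in>{0..1}. v x \<in> Y.V0)}"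

text \<open>Built from difference quotients, so any continuous first argument is admissible. On
  discrete functions it is the Galerkin form (\<open>grad_inner_brk\<close>); with the exact
  solution in the first slot it is the load (\<open>load_eq_Bform\<close>).\<close>

definition Bform :: "(real \<Rightarrow> real \<Rightarrow> real) \<Rightarrow> (real \<Rightarrow> real \<Rightarrow> real) \<Rightarrow> real"
  where "Bform g v = \<epsilon> * (X.brk g v + Y.brk (\<lambda>y x. g x y) (\<lambda>y x. v x y)) + c * II (\<lambda>x y. g x y * v x y)"

definition proj :: "(real \<Rightarrow> real \<Rightarrow> real) \<Rightarrow> real \<Rightarrow> real \<Rightarrow> real"
  where "proj u x y = X.rproj (\<lambda>s. Y.rproj (u s) y) x"

definition gapx :: "(real \<Rightarrow> real \<Rightarrow> real) \<Rightarrow> real \<Rightarrow> real \<Rightarrow> real"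
  where "gapx u x y = u x y - X.rproj (\<lambda>s. u s y) x"

lemma cont2_gapx: "cont2 u \<Longrightarrow> cont2 (gapx u)"
  unfolding gapx_def[abs_def] by (rule cont2_arith(2)[OF _ fin_op_cont2[OF X.fin_op_rproj]])

lemma cont2_proj: "cont2 u \<Longrightarrow> cont2 (proj u)"
  unfolding proj_def[abs_def] by (rule fin_op_cont2[OF X.fin_op_rproj fin_op_cont2'[OF Y.fin_op_rproj]])

lemma proj_commute: "cont2 u \<Longrightarrow> proj u x y = Y.rproj (\<lambda>r. X.rproj (\<lambda>s. u s r) x) y"
  unfolding proj_def by (rule fin_op_commute[OF X.fin_op_rproj Y.fin_op_rproj])

lemma proj_error:
  assumes "cont2 u" "y \<in> {0..1}"
  shows "u x y - proj u x y = gapx u x y + mix u x y"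
proof -
  have "mix u x y = X.rproj (\<lambda>s. u s y) x - proj u x y"
    unfolding mix_def gap_def proj_def
    by (rule fin_op_diff[OF X.fin_op_rproj cont2_col[OF assms] cont2_col[OF fin_op_cont2'[OF Y.fin_op_rproj assms(1)] assms(2)]])
  then show ?thesis unfolding gapx_def by simp
qed

lemma proj_Vh:
  assumes u: "cont2 u"
    and z: "\<And>x. x \<in> {0..1} \<Longrightarrow> u x 0 = 0 \<and> u x 1 = 0 \<and> u 0 x = 0 \<and> u 1 x = 0"
  shows "proj u \<in> Vh"
proof -
  have zero: "X.rproj f x = 0" if "\<And>s. s \<in> {0..1} \<Longrightarrow> f s = 0" for f x
    using fin_op_cong[OF X.fin_op_rproj, of "\<lambda>s. 0" f x] that by (simp add: fin_op_zero[OF X.fin_op_rproj])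
  have zeroY: "Y.rproj f x = 0" if "\<And>s. s \<in> {0..1} \<Longrightarrow> f s = 0" for f x
    using fin_op_cong[OF Y.fin_op_rproj, of "\<lambda>s. 0" f x] that by (simp add: fin_op_zero[OF Y.fin_op_rproj])
  have "(\<lambda>x. proj u x y) \<in> X.V0" if "y \<in> {0..1}" for y
    unfolding X.V0_def proj_def using X.is_pl_rproj X.rproj_ends zeroY[of "u 0"] zeroY[of "u 1"] z by auto
  moreover have "proj u x \<in> Y.V0" if "x \<in> {0..1}" for x
    unfolding Y.V0_def proj_commute[OF u, abs_def] using Y.is_pl_rproj Y.rproj_ends zero[of "\<lambda>s. u s 0"] zero[of "\<lambda>s. u s 1"] z by auto
  ultimately show ?thesis unfolding Vh_def using cont2_proj[OF u] by simp
qed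

lemma Vh_diff: "v \<in> Vh \<Longrightarrow> w \<in> Vh \<Longrightarrow> (\<lambda>x y. v x y - w x y) \<in> Vh"
  unfolding Vh_def X.V0_def Y.V0_def
  by (auto intro: cont2_arith X.is_pl_diff Y.is_pl_diff)

lemma Bform_diff_left:
  assumes "cont2 g" "cont2 g'" "cont2 v"
  shows "Bform (\<lambda>x y. g x y - g' x y) v = Bform g v - Bform g' v"
proof -
  have "II (\<lambda>x y. (g x y - g' x y) * v x y) + II (\<lambda>x y. g' x y * v x y) = II (\<lambda>x y. (g x y - g' x y) * v x y + g' x y * v x y)"
    using assms by (intro II_add[symmetric] cont2_arith)
  also have "\<dots> = II (\<lambda>x y. g x y * v x y)" by (simp add: algebra_simps)
  finally have "II (\<lambda>x y. (g x y - g' x y) * v x y) = II (\<lambda>x y. g x y * v x y) - II (\<lambda>x y. g' x y * v x y)" by simp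
  then show ?thesis unfolding Bform_def X.brk_diff_left[OF assms] Y.brk_diff_left[OF assms[THEN cont2_flip]]
    by (simp only: right_diff_distrib distrib_left)
qed

lemma Bform_add_left:
  assumes "cont2 g" "cont2 g'" "cont2 v"
  shows "Bform (\<lambda>x y. g x y + g' x y) v = Bform g v + Bform g' v"
  using Bform_diff_left[of "\<lambda>x y. g x y + g' x y" g' v] assms cont2_arith(1)[OF assms(1,2)] by simp

lemma Bform_cong: "(\<And>x y. x \<in> {0..1} \<Longrightarrow> y \<in> {0..1} \<Longrightarrow> g x y = g' x y) \<Longrightarrow> Bform g v = Bform g' v"
  unfolding Bform_def using X.brk_cong[of g g' v v] Y.brk_cong[of "\<lambda>y x. g x y" "\<lambda>y x. g' x y"]
    II_cong[of "\<lambda>x y. g x y * v x y" "\<lambda>x y. g' x y * v x y"] by simp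

text \<open>For fixed y, \<open>gapx u\<close> is a Ritz projection error in x and \<open>v\<close>
  a discrete test function, so x-diffusion and reaction cancel under the y-integral.\<close>

lemma Bform_gapx:
  assumes u: "cont2 u" and v: "v \<in> Vh"
  shows "Bform (gapx u) v = \<epsilon> * Y.brk (\<lambda>y x. gapx u x y) (\<lambda>y x. v x y)"
proof -
  note g = cont2_gapx[OF u]
  have cv: "cont2 v" using v unfolding Vh_def by simp
  note gv = cont2_arith(3)[OF g cv]
  have "\<epsilon> * X.brk (gapx u) v + c * II (\<lambda>x y. gapx u x y * v x y)
    = integral {0..1} (\<lambda>y. \<epsilon> * X.af (\<lambda>x. gapx u x y) (\<lambda>x. v x y) + c * integral {0..1} (\<lambda>x. gapx u x y * v x y))"
    unfolding X.brk_def II_alt[OF gv]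
    by (subst Henstock_Kurzweil_Integration.integral_add)
      (auto intro!: integrable_continuous_real continuous_on_mult continuous_on_const X.cont_af[OF g cv] cont2_integral[OF cont2_flip[OF gv]])
  also have "\<dots> = integral {0..1} (\<lambda>y::real. 0)"
  proof (rule integral_cong)
    fix y :: real assume y: "y \<in> {0..1}"
    have "(\<lambda>x. v x y) \<in> X.V0" using v y unfolding Vh_def by simp
    from X.rproj_orth[OF this cont2_col[OF u y]]
    show "\<epsilon> * X.af (\<lambda>x. gapx u x y) (\<lambda>x. v x y) + c * integral {0..1} (\<lambda>x. gapx u x y * v x y) = 0"
      unfolding X.bf_def ip_def gapx_def .
  qed
  finally show ?thesis unfolding Bform_def by (simp add: distrib_left)
qed

text \<open>For fixed x, the functional \<open>Y.bf\<close> against \<open>v x\<close> acts in y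
  only, so it passes through \<open>X.rproj\<close>, where it meets \<open>gap u s\<close> and gives
  zero for every s.\<close>

lemma Bform_mix:
  assumes u: "cont2 u" and v: "v \<in> Vh"
  shows "Bform (mix u) v = \<epsilon> * X.brk (mix u) v"
proof -
  note g = cont2_mix[OF u]
  have cv: "cont2 v" using v unfolding Vh_def by simp
  note gv = cont2_arith(3)[OF g cv]
  have "\<epsilon> * Y.brk (\<lambda>y x. mix u x y) (\<lambda>y x. v x y) + c * II (\<lambda>x y. mix u x y * v x y)
    = integral {0..1} (\<lambda>x. \<epsilon> * Y.af (mix u x) (v x) + c * integral {0..1} (\<lambda>y. mix u x y * v x y))"
    unfolding Y.brk_def II_def
    by (subst Henstock_Kurzweil_Integration.integral_add)
      (auto intro!: integrable_continuous_real continuous_on_mult continuous_on_const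
        Y.cont_af[OF cont2_flip[OF g] cont2_flip[OF cv]] cont2_integral[OF gv])
  also have "\<dots> = integral {0..1} (\<lambda>y::real. 0)"
  proof (rule integral_cong)
    fix x :: real assume x: "x \<in> {0..1}"
    have vx: "v x \<in> Y.V0" using v x unfolding Vh_def by simp
    have orth: "Y.bf (gap u s) (v x) = 0" if "s \<in> {0..1}" for s
      unfolding gap_def[abs_def] by (rule Y.rproj_orth[OF vx cont2_row[OF u that]])
    have L: "lfun (\<lambda>f. Y.bf f (v x))" by (rule Y.lfun_bf[OF Y.V0_cont[OF vx]])
    have "Y.bf (mix u x) (v x) = X.rproj (\<lambda>s. Y.bf (gap u s) (v x)) x"
      unfolding mix_def[abs_def] by (rule fin_op_lfun[OF X.fin_op_rproj L cont2_gap[OF u]])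
    also have "\<dots> = X.rproj (\<lambda>s. 0) x"
      by (rule fin_op_cong[OF X.fin_op_rproj, symmetric]) (auto simp: orth)
    also have "\<dots> = 0" by (rule fin_op_zero[OF X.fin_op_rproj])
    finally show "\<epsilon> * Y.af (mix u x) (v x) + c * integral {0..1} (\<lambda>y. mix u x y * v x y) = 0"
      unfolding Y.bf_def ip_def .
  qed
  finally show ?thesis unfolding Bform_def by (simp add: distrib_left)
qed

text \<open>Both surviving parts of the consistency error are diffusion terms with the factor
  \<epsilon>, like the seminorm in \<open>Bform \<xi> \<xi>\<close>. Young's inequality absorbs the
  seminorm of \<xi> and \<epsilon> cancels; in the L2 bound it remains as a gain.\<close>

lemma galerkin_close_to_proj:
  assumes u: "cont2 u"
    and z: "\<And>x. x \<in> {0..1} \<Longrightarrow> u x 0 = 0 \<and> u x 1 = 0 \<and> u 0 x = 0 \<and> u 1 x = 0"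
    and U: "U \<in> Vh" "\<And>v. v \<in> Vh \<Longrightarrow> Bform U v = Bform u v"
  defines "\<xi> \<equiv> \<lambda>x y. U x y - proj u x y"
  defines "T \<equiv> Y.brk (\<lambda>y x. gapx u x y) (\<lambda>y x. gapx u x y) + X.brk (mix u) (mix u)"
  shows "X.brk \<xi> \<xi> + Y.brk (\<lambda>y x. \<xi> x y) (\<lambda>y x. \<xi> x y) \<le> T" "II (\<lambda>x y. (\<xi> x y)\<^sup>2) \<le> \<epsilon> / (2 * c) * T"
proof -
  have chi: "\<xi> \<in> Vh" unfolding \<xi>_def by (rule Vh_diff[OF U(1) proj_Vh[OF u z]])
  then have cchi: "cont2 \<xi>" unfolding Vh_def by simp
  have cU: "cont2 U" using U(1) unfolding Vh_def by simp
  note g = cont2_gapx[OF u] and m = cont2_mix[OF u]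
  have "Bform \<xi> \<xi> = Bform U \<xi> - Bform (proj u) \<xi>"
    unfolding \<xi>_def by (rule Bform_diff_left[OF cU cont2_proj[OF u] cchi[unfolded \<xi>_def]])
  also have "\<dots> = Bform u \<xi> - Bform (proj u) \<xi>" using U(2)[OF chi] by simp
  also have "\<dots> = Bform (\<lambda>x y. u x y - proj u x y) \<xi>"
    by (rule Bform_diff_left[OF u cont2_proj[OF u] cchi, symmetric])
  also have "\<dots> = Bform (\<lambda>x y. gapx u x y + mix u x y) \<xi>"
    by (rule Bform_cong) (simp add: proj_error[OF u])
  also have "\<dots> = \<epsilon> * (Y.brk (\<lambda>y x. gapx u x y) (\<lambda>y x. \<xi> x y) + X.brk (mix u) \<xi>)"
    unfolding Bform_add_left[OF g m cchi] Bform_gapx[OF u chi] Bform_mix[OF u chi] by (simp add: distrib_left)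
  also have "\<dots> \<le> \<epsilon> * ((Y.brk (\<lambda>y x. gapx u x y) (\<lambda>y x. gapx u x y) + Y.brk (\<lambda>y x. \<xi> x y) (\<lambda>y x. \<xi> x y)) / 2
       + (X.brk (mix u) (mix u) + X.brk \<xi> \<xi>) / 2)"
    using X.eps by (intro mult_left_mono add_mono Y.brk_young[OF cont2_flip[OF g] cont2_flip[OF cchi]] X.brk_young[OF m cchi]) auto
  finally have "\<epsilon> * (X.brk \<xi> \<xi> + Y.brk (\<lambda>y x. \<xi> x y) (\<lambda>y x. \<xi> x y)) + 2 * c * II (\<lambda>x y. (\<xi> x y)\<^sup>2) \<le> \<epsilon> * T"
    unfolding Bform_def T_def by (simp add: power2_eq_square field_simps)
  moreover have "0 \<le> \<epsilon> * (X.brk \<xi> \<xi> + Y.brk (\<lambda>y x. \<xi> x y) (\<lambda>y x. \<xi> x y))"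
    using X.eps X.brk_nonneg[of \<xi>] Y.brk_nonneg[of "\<lambda>y x. \<xi> x y"] by simp
  moreover have "0 \<le> 2 * c * II (\<lambda>x y. (\<xi> x y)\<^sup>2)"
    using X.c II_nonneg[OF cont2_power2[OF cchi]] by simp
  ultimately have 1: "\<epsilon> * (X.brk \<xi> \<xi> + Y.brk (\<lambda>y x. \<xi> x y) (\<lambda>y x. \<xi> x y)) \<le> \<epsilon> * T"
    and 2: "2 * c * II (\<lambda>x y. (\<xi> x y)\<^sup>2) \<le> \<epsilon> * T" by linarith+
  from 1 show "X.brk \<xi> \<xi> + Y.brk (\<lambda>y x. \<xi> x y) (\<lambda>y x. \<xi> x y) \<le> T" using X.eps by simp
  from 2 show "II (\<lambda>x y. (\<xi> x y)\<^sup>2) \<le> \<epsilon> / (2 * c) * T" using X.c by (simp add: field_simps)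
qed

end

section \<open>Weak derivatives\<close>

text \<open>Boxes are stable under intersection and generate the Borel sets, so a Dynkin argument
  extends the vanishing to all Borel sets, and densities are unique. Before that, \<open>D\<close>
  is replaced by a Borel representative.\<close>

lemma AE_zero_if_box_integrals_zero:
  fixes D :: "real \<times> real \<Rightarrow> real"
  assumes D: "integrable lebesgue D" and zero: "\<And>a b. (LINT p|lebesgue. indicator (box a b) p * D p) = 0"
  shows "AE p in lebesgue. D p = 0"
proof -
  obtain D' where D'[measurable]: "D' \<in> borel_measurable lborel" and ae: "AE p in lborel. D p = D' p"
    using completion_ex_borel_measurable_real[OF borel_measurable_integrable[OF D]] by blast
  have ae': "AE p in lebesgue. D p = D' p" using ae by (rule AE_completion)
  have mD'[measurable]: "D' \<in> borel_measurable lebesgue" by (rule measurable_completion[OF D'])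
  have iL: "integrable lebesgue D'"
    by (rule integrable_cong_AE_imp[OF D mD']) (use ae' in auto)
  have iD': "integrable lborel D'"
    using iL by (simp add: integrable_completion)
  have box: "(LINT p|lborel. indicator (box a b) p * D' p) = 0" for a b
  proof -
    have "(LINT p|lborel. indicator (box a b) p * D' p) = (LINT p|lebesgue. indicator (box a b) p * D' p)"
      by (rule integral_completion[symmetric]) simp
    also have "\<dots> = (LINT p|lebesgue. indicator (box a b) p * D p)"
    proof (rule integral_cong_AE)
      show "(\<lambda>p. indicator (box a b) p * D p) \<in> borel_measurable lebesgue"
        using borel_measurable_integrable[OF D] by (intro borel_measurable_times borel_measurable_indicator) auto
      show "(\<lambda>p. indicator (box a b) p * D' p) \<in> borel_measurable lebesgue"
        by (intro borel_measurable_times borel_measurable_indicator mD') auto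
      show "AE p in lebesgue. indicator (box a b) p * D' p = indicator (box a b) p * D p" using ae' by auto
    qed
    finally show ?thesis using zero by simp
  qed
  \<comment> \<open>The complement step of the Dynkin argument uses the integral over the whole
    plane, which is reached by growing boxes.\<close>
  have tot: "(LINT p|lborel. D' p) = 0"
  proof -
    let ?A = "\<lambda>n::nat. box (- (real n *\<^sub>R One)) (real n *\<^sub>R One) :: (real \<times> real) set"
    have "(\<lambda>n. LINT p|lborel. indicator (?A n) p * D' p) \<longlonglongrightarrow> (LINT p|lborel. D' p)"
    proof (rule integral_dominated_convergence[where w = "\<lambda>p. \<bar>D' p\<bar>"])
      show "AE p in lborel. (\<lambda>n. indicator (?A n) p * D' p) \<longlonglongrightarrow> D' p"
      proof (rule AE_I2)
        fix p :: "real \<times> real"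
        have "p \<in> (\<Union>n. ?A n)" unfolding UN_box_eq_UNIV by simp
        then obtain n where n: "p \<in> ?A n" by blast
        have "indicator (?A m) p * D' p = D' p" if "m \<ge> n" for m
        proof -
          have "p \<in> ?A m" using n that by (force simp: box_def inner_simps)
          then show ?thesis by simp
        qed
        then have "eventually (\<lambda>m. indicator (?A m) p * D' p = D' p) sequentially"
          unfolding eventually_sequentially by blast
        then show "(\<lambda>n. indicator (?A n) p * D' p) \<longlonglongrightarrow> D' p" by (rule tendsto_eventually)
      qed
    qed (use iD' in \<open>auto simp: indicator_def\<close>)
    then show ?thesis unfolding box by (simp add: LIMSEQ_const_iff)
  qed
  have all: "(LINT p|lborel. indicator A p * D' p) = 0" if "A \<in> sets borel" for A
  proof -
    let ?G = "range (\<lambda>(a, b). box a b :: (real \<times> real) set)"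
    have "Int_stable ?G" "?G \<subseteq> Pow UNIV" by (auto simp: Int_stable_def box_Int_box)
    moreover have "A \<in> sigma_sets UNIV ?G"
      using that by (subst (asm) borel_eq_box) (simp add: sets_measure_of)
    ultimately show ?thesis
    proof (induction rule: sigma_sets_induct_disjoint)
      case (basic A)
      then show ?case using box by auto
    next
      case empty
      then show ?case by simp
    next
      case (compl A)
      have A: "A \<in> sets lborel" using compl(1) borel_eq_box by (metis sets_lborel sets_measure_of top_greatest Pow_UNIV)
      have "(LINT p|lborel. indicator (UNIV - A) p * D' p) = (LINT p|lborel. D' p - indicator A p * D' p)"
        by (rule Bochner_Integration.integral_cong) (auto simp: indicator_def)
      also have "\<dots> = (LINT p|lborel. D' p) - (LINT p|lborel. indicator A p * D' p)"
        using integrable_mult_indicator[OF A iD'] by (intro Bochner_Integration.integral_diff iD') simp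
      finally show ?case using tot compl by simp
    next
      case (union A)
      have A: "A i \<in> sets lborel" for i using union(2) borel_eq_box by (metis (no_types, lifting) range_subsetD sets_lborel sets_measure_of top_greatest Pow_UNIV)
      have "(LINT p:(\<Union>i. A i)|lborel. D' p) = (\<Sum>i. (LINT p:(A i)|lborel. D' p))"
      proof (rule lebesgue_integral_countable_add[OF A])
        show "i \<noteq> j \<Longrightarrow> A i \<inter> A j = {}" for i j using union(1) by (auto simp: disjoint_family_on_def)
        have "(\<Union>i. A i) \<in> sets lborel" using A by blast
        then show "set_integrable lborel (\<Union>i. A i) D'" unfolding set_integrable_def
          by (rule integrable_mult_indicator[OF _ iD'])
      qed
      then show ?case using union(3) unfolding set_lebesgue_integral_def by simp
    qed
  qed
  have "AE p in lborel. D' p = (\<lambda>p. 0) p"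
    by (rule density_unique_real[OF iD']) (auto simp: set_lebesgue_integral_def all)
  with ae have "AE p in lborel. D p = 0" by auto
  then show ?thesis by (rule AE_completion)
qed

section \<open>The closed square, one-sided derivatives and test functions\<close>

lemma closure_Omega: "closure Omega = {0..1} \<times> {0..1}"
  unfolding Omega_def by (simp add: closure_Times closure_greaterThanLessThan)

lemma Omega_box: "Omega = box (0, 0) (1, 1)"
  unfolding Omega_def box_prod by simp

lemma frontier_Omega: "frontier Omega = {0..1} \<times> {0..1} - Omega"
proof -
  have "open Omega" unfolding Omega_def by (intro open_Times) auto
  then show ?thesis unfolding frontier_def closure_Omega by (simp add: interior_open)
qed

lemma vector_derivative_unit:
  "x \<in> {0..1} \<Longrightarrow> (f has_vector_derivative d) (at x within {0..1}) \<Longrightarrow> vector_derivative f (at x within {0..1}) = d"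
  for f :: "real \<Rightarrow> real"
  using vector_derivative_within_cbox[of 0 1 x f d] by (simp add: cbox_interval)

lemma pdx_eqI: "x \<in> {0..1} \<Longrightarrow> ((\<lambda>t. g (t, y)) has_vector_derivative d) (at x within {0..1}) \<Longrightarrow> pdx g (x, y) = d"
  unfolding pdx_def by (simp add: vector_derivative_unit)

lemma pdy_eqI: "y \<in> {0..1} \<Longrightarrow> ((\<lambda>t. g (x, t)) has_vector_derivative d) (at y within {0..1}) \<Longrightarrow> pdy g (x, y) = d"
  unfolding pdy_def by (simp add: vector_derivative_unit)

lemma Ck_cont: "Ck_closure k g \<Longrightarrow> continuous_on (closure Omega) g"
  by (cases k) auto

lemma Ck_pdx: "Ck_closure (Suc k) g \<Longrightarrow> x \<in> {0..1} \<Longrightarrow> y \<in> {0..1} \<Longrightarrow>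
    ((\<lambda>t. g (t, y)) has_vector_derivative pdx g (x, y)) (at x within {0..1})"
  unfolding pdx_def by (auto simp: closure_Omega vector_derivative_works[symmetric])

lemma Ck_pdy: "Ck_closure (Suc k) g \<Longrightarrow> x \<in> {0..1} \<Longrightarrow> y \<in> {0..1} \<Longrightarrow>
    ((\<lambda>t. g (x, t)) has_vector_derivative pdy g (x, y)) (at y within {0..1})"
  unfolding pdy_def by (auto simp: closure_Omega vector_derivative_works[symmetric])

text \<open>Squaring the positive part removes its kink: at 0 the difference quotient is at most
  \<open>\<bar>h\<bar>\<close>. The bumps below are products of such squares.\<close>

lemma max_sq_deriv: "((\<lambda>s::real. (max 0 s)\<^sup>2) has_real_derivative 2 * max 0 s) (at s)"
proof -
  consider "s < 0" | "s = 0" | "s > 0" by linarith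
  then show ?thesis
  proof cases
    case 1
    have "((\<lambda>s::real. 0) has_real_derivative 2 * max 0 s) (at s)" using 1 by simp
    then show ?thesis
      by (rule has_field_derivative_transform_within_open[of _ _ _ "{..<0}"]) (use 1 in auto)
  next
    case 2
    have "((\<lambda>h::real. (max 0 h)\<^sup>2 / h) \<longlongrightarrow> 0) (at 0)"
    proof (rule Lim_null_comparison[where g = "\<lambda>h. \<bar>h\<bar>"])
      show "\<forall>\<^sub>F h in at 0. norm ((max 0 h)\<^sup>2 / h) \<le> \<bar>h\<bar>" for h :: real
        by (auto simp: max_def power2_eq_square)
      show "((\<lambda>h::real. \<bar>h\<bar>) \<longlongrightarrow> 0) (at 0)" by (intro tendsto_eq_intros) auto
    qed
    then show ?thesis using 2 by (simp add: DERIV_def)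
  next
    case 3
    have "((\<lambda>s::real. s\<^sup>2) has_real_derivative 2 * max 0 s) (at s)"
      using 3 by (auto intro!: derivative_eq_intros)
    then show ?thesis
      by (rule has_field_derivative_transform_within_open[of _ _ _ "{0<..}"]) (use 3 in auto)
  qed
qed

definition bump :: "real \<Rightarrow> real \<Rightarrow> real \<Rightarrow> real"
  where "bump a b x = (max 0 (x - a))\<^sup>2 * (max 0 (b - x))\<^sup>2"

definition bump' :: "real \<Rightarrow> real \<Rightarrow> real \<Rightarrow> real"
  where "bump' a b x = 2 * max 0 (x - a) * (max 0 (b - x))\<^sup>2 - (max 0 (x - a))\<^sup>2 * (2 * max 0 (b - x))"

lemma bump_deriv: "(bump a b has_real_derivative bump' a b x) (at x)"
  unfolding bump_def[abs_def] bump'_def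
  by (rule derivative_eq_intros DERIV_chain2[OF max_sq_deriv] refl)+ simp

lemma bump_pos_iff: "bump a b x \<noteq> 0 \<longleftrightarrow> a < x \<and> x < b"
  unfolding bump_def by (auto simp: max_def)

lemma bump_range: "0 \<le> a \<Longrightarrow> b \<le> 1 \<Longrightarrow> x \<in> {0..1} \<Longrightarrow> 0 \<le> bump a b x \<and> bump a b x \<le> 1"
proof -
  assume a: "0 \<le> a" "b \<le> 1" "x \<in> {0..1}"
  have "(max 0 (x - a))\<^sup>2 \<le> 1" "(max 0 (b - x))\<^sup>2 \<le> 1" using a by (auto simp: power_le_one_iff max_def)
  then show ?thesis unfolding bump_def using mult_mono[of "(max 0 (x - a))\<^sup>2" 1 "(max 0 (b - x))\<^sup>2" 1] by simp
qed

lemma cont_bump: "continuous_on A (bump a b)" "continuous_on A (bump' a b)"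
  unfolding bump_def[abs_def] bump'_def[abs_def] by (intro continuous_intros)+

text \<open>For \<open>n \<rightarrow> \<infinity>\<close> these converge to the indicator function of an open box.\<close>

definition box_test :: "nat \<Rightarrow> real \<Rightarrow> real \<Rightarrow> real \<Rightarrow> real \<Rightarrow> real \<times> real \<Rightarrow> real"
  where "box_test n a b c d = (\<lambda>(x, y). 1 - (1 - bump a b x * bump c d y) ^ n)"

lemma box_test_Pair: "box_test n a b c d (x, y) = 1 - (1 - bump a b x * bump c d y) ^ n"
  by (simp add: box_test_def)

lemma test_function_box_test:
  assumes "0 < a" "a < b" "b < 1" "0 < c" "c < d" "d < 1"
  shows "test_function (box_test n a b c d)"
proof -
  let ?f = "box_test n a b c d"
  define gx where "gx p = real n * (1 - bump a b (fst p) * bump c d (snd p)) ^ (n - 1) * (bump' a b (fst p) * bump c d (snd p))" for p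
  define gy where "gy p = real n * (1 - bump a b (fst p) * bump c d (snd p)) ^ (n - 1) * (bump a b (fst p) * bump' c d (snd p))" for p
  have dx: "((\<lambda>t. ?f (t, y)) has_vector_derivative gx (x, y)) (at x within {0..1})" for x y
    unfolding has_real_derivative_iff_has_vector_derivative[symmetric] box_test_Pair gx_def
    by (rule derivative_eq_intros DERIV_subset[OF bump_deriv subset_UNIV] refl | simp)+
  have dy: "((\<lambda>t. ?f (x, t)) has_vector_derivative gy (x, y)) (at y within {0..1})" for x y
    unfolding has_real_derivative_iff_has_vector_derivative[symmetric] box_test_Pair gy_def
    by (rule derivative_eq_intros DERIV_subset[OF bump_deriv subset_UNIV] refl | simp)+
  have b: "continuous_on A (\<lambda>p. bump a b (fst p))" "continuous_on A (\<lambda>p. bump' a b (fst p))"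
    "continuous_on A (\<lambda>p. bump c d (snd p))" "continuous_on A (\<lambda>p. bump' c d (snd p))" for A :: "(real \<times> real) set"
    by (intro continuous_on_compose2[OF cont_bump(1)[of UNIV]] continuous_on_compose2[OF cont_bump(2)[of UNIV]] continuous_intros; simp)+
  have cf: "continuous_on A ?f" for A
    unfolding box_test_def case_prod_beta by (intro continuous_intros b)
  have cx: "continuous_on A gx" for A unfolding gx_def[abs_def] by (intro continuous_intros b)
  have cy: "continuous_on A gy" for A unfolding gy_def[abs_def] by (intro continuous_intros b)
  have ex: "pdx ?f p = gx p" and ey: "pdy ?f p = gy p" if "p \<in> closure Omega" for p
    using that pdx_eqI[OF _ dx] pdy_eqI[OF _ dy] unfolding closure_Omega by (cases p; auto)+
  have 1: "Ck_closure 1 ?f"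
    unfolding One_nat_def Ck_closure.simps
  proof (intro conjI)
    show "continuous_on (closure Omega) (pdx ?f)"
      by (rule continuous_on_eq[OF cx]) (simp add: ex)
    show "continuous_on (closure Omega) (pdy ?f)"
      by (rule continuous_on_eq[OF cy]) (simp add: ey)
    show "\<forall>(x, y)\<in>closure Omega. (\<lambda>t. ?f (t, y)) differentiable at x within {0..1} \<and> (\<lambda>t. ?f (x, t)) differentiable at y within {0..1}"
      using dx[THEN differentiableI_vector] dy[THEN differentiableI_vector] by auto
  qed (rule cf)
  have "{p \<in> Omega. ?f p \<noteq> 0} \<subseteq> {a..b} \<times> {c..d}"
  proof
    fix p assume "p \<in> {p \<in> Omega. ?f p \<noteq> 0}"
    then have "bump a b (fst p) \<noteq> 0" "bump c d (snd p) \<noteq> 0" by (auto simp: box_test_def case_prod_beta)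
    then show "p \<in> {a..b} \<times> {c..d}" unfolding bump_pos_iff by (auto simp: mem_Times_iff)
  qed
  then have "closure {p \<in> Omega. ?f p \<noteq> 0} \<subseteq> {a..b} \<times> {c..d}"
    by (intro closure_minimal closed_Times) auto
  also have "\<dots> \<subseteq> Omega" unfolding Omega_def using assms by auto
  finally show ?thesis unfolding test_function_def using 1 by simp
qed

lemma in_L2_integrable:
  assumes "in_L2 d" shows "integrable lebesgue (\<lambda>p. indicator Omega p * d p)"
proof (rule Bochner_Integration.integrable_bound[where f = "\<lambda>p. indicator Omega p + indicator Omega p * (d p)\<^sup>2"])
  have O: "Omega \<in> lmeasurable" unfolding Omega_box by simp
  show "integrable lebesgue (\<lambda>p. indicator Omega p + indicator Omega p * (d p)\<^sup>2)"
    using assms O unfolding in_L2_def set_integrable_def fmeasurable_def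
    by (intro Bochner_Integration.integrable_add) auto
  show "(\<lambda>p. indicator Omega p * d p) \<in> borel_measurable lebesgue"
    using assms unfolding in_L2_def set_borel_measurable_def by simp
  have "\<bar>z\<bar> \<le> 1 + z\<^sup>2" for z :: real
    using zero_le_power2[of "\<bar>z\<bar> - 1"] by (simp add: power2_eq_square algebra_simps abs_if split: if_splits)
  then show "AE p in lebesgue. norm (indicator Omega p * d p) \<le> norm (indicator Omega p + indicator Omega p * (d p)\<^sup>2)"
    by (auto simp: indicator_def)
qed

text \<open>The fundamental lemma of the calculus of variations. For a box that keeps away from the
  boundary, the product \<open>q\<close> of the bumps lies in (0, 1] on the box and is 0 elsewhere
  in \<open>Omega\<close>, so \<open>1 - (1 - q) ^ n\<close> tends to the indicator; dominated
  convergence with the bound \<open>\<bar>D\<bar>\<close> shows that the integral over the box is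
  zero.\<close>

lemma AE_zero_if_orthogonal_to_tests:
  assumes d: "integrable lebesgue (\<lambda>p. indicator Omega p * d p)"
    and orth: "\<And>\<phi>. test_function \<phi> \<Longrightarrow> L2_inner d \<phi> = 0"
  shows "AE p in lebesgue. p \<in> Omega \<longrightarrow> d p = 0"
proof -
  define D where "D p = indicator Omega p * d p" for p
  have D: "integrable lebesgue D" using d unfolding D_def[abs_def] .
  have Dm: "D \<in> borel_measurable lebesgue" using D by auto
  have absD: "integrable lebesgue (\<lambda>p. \<bar>D p\<bar>)" using D by simp
  have inside: "(LINT p|lebesgue. indicator (box (a, c) (b, e)) p * D p) = 0"
    if "0 < a" "b < 1" "0 < c" "e < 1" for a b c e
  proof (cases "a < b \<and> c < e")
    case False
    then have "box (a, c) (b, e) = {}" unfolding box_prod by auto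
    then show ?thesis by simp
  next
    case True
    let ?f = "\<lambda>n. box_test n a b c e"
    have "(\<lambda>n. LINT p|lebesgue. D p * ?f n p) \<longlonglongrightarrow> (LINT p|lebesgue. indicator (box (a, c) (b, e)) p * D p)"
    proof (rule integral_dominated_convergence[where w = "\<lambda>p. \<bar>D p\<bar>"])
      show "(\<lambda>p. indicator (box (a, c) (b, e)) p * D p) \<in> borel_measurable lebesgue"
        by (intro borel_measurable_times borel_measurable_indicator Dm) auto
      have "continuous_on UNIV (?f n)" for n
        unfolding box_test_def case_prod_beta
        by (intro continuous_intros continuous_on_compose2[OF cont_bump(1)[of UNIV]]; simp)
      then have "?f n \<in> borel_measurable lebesgue" for n
        by (intro measurable_completion) (simp add: borel_measurable_continuous_onI)
      then show "(\<lambda>p. D p * ?f n p) \<in> borel_measurable lebesgue" for n by (intro borel_measurable_times Dm)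
      have r: "0 \<le> bump a b (fst p) * bump c e (snd p) \<and> bump a b (fst p) * bump c e (snd p) \<le> 1" if "p \<in> Omega" for p
        using bump_range[of a b "fst p"] bump_range[of c e "snd p"] that \<open>0 < a\<close> \<open>b < 1\<close> \<open>0 < c\<close> \<open>e < 1\<close>
        unfolding Omega_def by (auto intro: mult_le_one)
      show "AE p in lebesgue. (\<lambda>n. D p * ?f n p) \<longlonglongrightarrow> indicator (box (a, c) (b, e)) p * D p"
      proof (rule AE_I2)
        fix p :: "real \<times> real"
        let ?q = "bump a b (fst p) * bump c e (snd p)"
        show "(\<lambda>n. D p * ?f n p) \<longlonglongrightarrow> indicator (box (a, c) (b, e)) p * D p"
        proof (cases "p \<in> Omega")
          case False
          then show ?thesis by (simp add: D_def)
        next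
          case True
          show ?thesis
          proof (cases "?q = 0")
            case q: True
            then have "p \<notin> box (a, c) (b, e)" using bump_pos_iff[of a b "fst p"] bump_pos_iff[of c e "snd p"]
              unfolding box_prod by (auto simp: mem_Times_iff)
            moreover have "?f n p = 0" for n unfolding box_test_def case_prod_beta q by simp
            ultimately show ?thesis by simp
          next
            case q: False
            then have "p \<in> box (a, c) (b, e)" using bump_pos_iff[of a b "fst p"] bump_pos_iff[of c e "snd p"]
              unfolding box_prod by (auto simp: mem_Times_iff)
            moreover have "(\<lambda>n. D p * (1 - (1 - ?q) ^ n)) \<longlonglongrightarrow> D p * (1 - 0)"
              using r[OF True] q by (intro tendsto_intros LIMSEQ_power_zero) (auto simp: less_le)
            ultimately show ?thesis by (simp add: box_test_def case_prod_beta)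
          qed
        qed
      qed
      show "AE p in lebesgue. norm (D p * ?f n p) \<le> \<bar>D p\<bar>" for n
      proof (rule AE_I2)
        fix p
        have "\<bar>?f n p\<bar> \<le> 1" if "p \<in> Omega"
        proof -
          have "0 \<le> (1 - bump a b (fst p) * bump c e (snd p)) ^ n" "(1 - bump a b (fst p) * bump c e (snd p)) ^ n \<le> 1"
            using r[OF that] by (auto intro: power_le_one)
          then show ?thesis by (simp add: box_test_def case_prod_beta)
        qed
        then show "norm (D p * ?f n p) \<le> \<bar>D p\<bar>"
          by (cases "p \<in> Omega") (auto simp: D_def abs_mult intro!: mult_left_le)
      qed
    qed (rule absD)
    moreover have "(LINT p|lebesgue. D p * ?f n p) = 0" for n
      using orth[OF test_function_box_test[of a b c e n]] True that
      unfolding L2_inner_def set_lebesgue_integral_def D_def by (simp add: mult.assoc)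
    ultimately show ?thesis by (simp add: LIMSEQ_const_iff)
  qed
  have "(LINT p|lebesgue. indicator (box a b) p * D p) = 0" for a b
  proof -
    \<comment> \<open>The part of a general box inside \<open>Omega\<close> is exhausted by boxes
      that keep the distance \<open>r n\<close> from the boundary.\<close>
    define r where "r n = inverse (real (Suc n))" for n
    define B where "B n = box (max (fst a) (r n), max (snd a) (r n)) (min (fst b) (1 - r n), min (snd b) (1 - r n))" for n
    have r: "r \<longlonglongrightarrow> 0" unfolding r_def[abs_def] by (rule LIMSEQ_inverse_real_of_nat)
    have r0: "0 < r n" for n unfolding r_def by simp
    have "(\<lambda>n. LINT p|lebesgue. indicator (B n) p * D p) \<longlonglongrightarrow> (LINT p|lebesgue. indicator (box a b) p * D p)"
    proof (rule integral_dominated_convergence[where w = "\<lambda>p. \<bar>D p\<bar>"])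
      show "(\<lambda>p. indicator (box a b) p * D p) \<in> borel_measurable lebesgue"
        by (intro borel_measurable_times borel_measurable_indicator Dm) auto
      show "(\<lambda>p. indicator (B n) p * D p) \<in> borel_measurable lebesgue" for n unfolding B_def
        by (intro borel_measurable_times borel_measurable_indicator Dm) auto
      show "AE p in lebesgue. norm (indicator (B n) p * D p) \<le> \<bar>D p\<bar>" for n by (auto simp: indicator_def)
      show "AE p in lebesgue. (\<lambda>n. indicator (B n) p * D p) \<longlonglongrightarrow> indicator (box a b) p * D p"
      proof (rule AE_I2)
        fix p :: "real \<times> real"
        show "(\<lambda>n. indicator (B n) p * D p) \<longlonglongrightarrow> indicator (box a b) p * D p"
        proof (cases "p \<in> Omega \<and> p \<in> box a b")
          case False
          have "p \<notin> B n" if "p \<in> Omega" for n using False that unfolding B_def box_prod by (auto simp: mem_Times_iff)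
          then have "indicator (B n) p * D p = 0" for n unfolding D_def by (cases "p \<in> Omega") auto
          moreover have "indicator (box a b) p * D p = 0" using False unfolding D_def by (auto simp: indicator_def)
          ultimately show ?thesis by (simp only: tendsto_const)
        next
          case True
          then have "0 < min (min (fst p) (1 - fst p)) (min (snd p) (1 - snd p))" unfolding Omega_def by auto
          from order_tendstoD(2)[OF r this]
          have "eventually (\<lambda>n. indicator (B n) p * D p = indicator (box a b) p * D p) sequentially"
          proof eventually_elim
            case (elim n)
            then have "p \<in> B n" using True unfolding B_def box_prod by (auto simp: mem_Times_iff)
            then show ?case using True by simp
          qed
          then show ?thesis by (rule tendsto_eventually)
        qed
      qed
    qed (rule absD)
    moreover have "(LINT p|lebesgue. indicator (B n) p * D p) = 0" for n
      unfolding B_def using r0[of n] by (intro inside) (auto simp: min_def max_def)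
    ultimately show ?thesis by (simp add: LIMSEQ_const_iff)
  qed
  from AE_zero_if_box_integrals_zero[OF D this] have "AE p in lebesgue. D p = 0" .
  then show ?thesis by eventually_elim (auto simp: D_def)
qed

section \<open>Lebesgue integrals of functions that are continuous on open boxes\<close>

lemma cont2_iff: "cont2 (\<lambda>x y. g (x, y)) \<longleftrightarrow> continuous_on (closure Omega) g"
  unfolding cont2_def closure_Omega by simp

lemma box_integral:
  fixes k :: "real \<times> real \<Rightarrow> real"
  assumes k: "continuous_on (cbox (a, c) (b, d)) k"
  shows "integrable lebesgue (\<lambda>p. indicator (box (a, c) (b, d)) p * k p)"
    "(LINT p|lebesgue. indicator (box (a, c) (b, d)) p * k p) = integral {a..b} (\<lambda>x. integral {c..d} (\<lambda>y. k (x, y)))"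
proof -
  have s: "set_integrable lebesgue (box (a, c) (b, d)) k"
    by (rule set_integrable_subset[OF absolutely_integrable_continuous[OF k]]) (auto simp: box_subset_cbox)
  then show "integrable lebesgue (\<lambda>p. indicator (box (a, c) (b, d)) p * k p)"
    unfolding set_integrable_def by simp
  have "(LINT p|lebesgue. indicator (box (a, c) (b, d)) p * k p) = integral (box (a, c) (b, d)) k"
    using set_lebesgue_integral_eq_integral(2)[OF s] unfolding set_lebesgue_integral_def by simp
  also have "\<dots> = integral {a..b} (\<lambda>x. integral {c..d} (\<lambda>y. k (x, y)))"
    unfolding integral_open_interval integral_prod_continuous[OF k] by (simp add: cbox_interval)
  finally show "(LINT p|lebesgue. indicator (box (a, c) (b, d)) p * k p) = integral {a..b} (\<lambda>x. integral {c..d} (\<lambda>y. k (x, y)))" .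
qed

lemma unit_cbox: "cbox (0, 0) (1, 1) = closure Omega"
  unfolding closure_Omega cbox_Pair_eq by (simp add: cbox_interval)

lemma L2_inner_II:
  assumes "continuous_on (closure Omega) g" "continuous_on (closure Omega) h"
  shows "L2_inner g h = II (\<lambda>x y. g (x, y) * h (x, y))"
proof -
  have "continuous_on (cbox (0, 0) (1, 1)) (\<lambda>p. g p * h p)" unfolding unit_cbox using assms by (intro continuous_intros)
  from box_integral(2)[OF this] show ?thesis
    unfolding L2_inner_def set_lebesgue_integral_def Omega_box II_def by simp
qed

text \<open>Meant for disjoint open boxes: on box \<open>R i\<close> it is \<open>k i\<close>, and
  on the mesh lines, a null set, it is zero. The weak derivatives of discrete functions have this
  shape.\<close>

definition step :: "(nat \<Rightarrow> (real \<times> real) set) \<Rightarrow> nat \<Rightarrow> (nat \<Rightarrow> real \<times> real \<Rightarrow> real) \<Rightarrow> real \<times> real \<Rightarrow> real"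
  where "step R n k p = (\<Sum>i<n. indicator (R i) p * k i p)"

locale open_boxes =
  fixes lo hi :: "nat \<Rightarrow> real \<times> real" and n :: nat
  assumes disj: "\<And>i j. i < n \<Longrightarrow> j < n \<Longrightarrow> i \<noteq> j \<Longrightarrow> box (lo i) (hi i) \<inter> box (lo j) (hi j) = {}"
    and sub: "\<And>i. i < n \<Longrightarrow> cbox (lo i) (hi i) \<subseteq> closure Omega" "\<And>i. i < n \<Longrightarrow> box (lo i) (hi i) \<subseteq> Omega"
begin

abbreviation R :: "nat \<Rightarrow> (real \<times> real) set"
  where "R i \<equiv> box (lo i) (hi i)"

lemma step_integral:
  assumes k: "\<And>i. i < n \<Longrightarrow> continuous_on (closure Omega) (k i)"
  shows "integrable lebesgue (\<lambda>p. indicator Omega p * step R n k p)"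
    "(LINT p|lebesgue. indicator Omega p * step R n k p)
      = (\<Sum>i<n. integral {fst (lo i)..fst (hi i)} (\<lambda>x. integral {snd (lo i)..snd (hi i)} (\<lambda>y. k i (x, y))))"
proof -
  have c: "continuous_on (cbox (lo i) (hi i)) (k i)" if "i < n" for i
    using k[OF that] sub(1)[OF that] continuous_on_subset by blast
  have eq: "indicator Omega p * step R n k p = (\<Sum>i<n. indicator (R i) p * k i p)" for p
    unfolding step_def sum_distrib_left using sub(2) by (intro sum.cong) (auto simp: indicator_def)
  have i: "integrable lebesgue (\<lambda>p. indicator (R i) p * k i p)" if "i < n" for i
    using box_integral(1)[of "fst (lo i)" "snd (lo i)" "fst (hi i)" "snd (hi i)"] c[OF that] by simp
  then show "integrable lebesgue (\<lambda>p. indicator Omega p * step R n k p)" unfolding eq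
    by (intro Bochner_Integration.integrable_sum) auto
  show "(LINT p|lebesgue. indicator Omega p * step R n k p)
      = (\<Sum>i<n. integral {fst (lo i)..fst (hi i)} (\<lambda>x. integral {snd (lo i)..snd (hi i)} (\<lambda>y. k i (x, y))))"
    unfolding eq
  proof (subst Bochner_Integration.integral_sum)
    show "(\<Sum>j<n. LINT p|lebesgue. indicator (R j) p * k j p)
      = (\<Sum>i<n. integral {fst (lo i)..fst (hi i)} (\<lambda>x. integral {snd (lo i)..snd (hi i)} (\<lambda>y. k i (x, y))))"
    proof (intro sum.cong refl)
      fix j assume "j \<in> {..<n}"
      then show "(LINT p|lebesgue. indicator (R j) p * k j p)
        = integral {fst (lo j)..fst (hi j)} (\<lambda>x. integral {snd (lo j)..snd (hi j)} (\<lambda>y. k j (x, y)))"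
        using box_integral(2)[of "fst (lo j)" "snd (lo j)" "fst (hi j)" "snd (hi j)"] c by simp
    qed
  qed (use i in auto)
qed

lemma step_mult: "step R n k p * step R n l p = step R n (\<lambda>i p. k i p * l i p) p"
proof (cases "\<exists>i<n. p \<in> R i")
  case True
  then obtain i where i: "i < n" "p \<in> R i" by blast
  have one: "step R n k p = k i p" for k
  proof -
    have "step R n k p = (\<Sum>j\<in>{i}. indicator (R j) p * k j p)"
      unfolding step_def using i disj by (intro sum.mono_neutral_right) (auto simp: indicator_def)
    then show ?thesis using i by simp
  qed
  show ?thesis unfolding one ..
next
  case False
  then have "step R n k p = 0" for k unfolding step_def by (intro sum.neutral) (auto simp: indicator_def)
  then show ?thesis by simp
qed

lemma step_mult_right: "step R n k p * g p = step R n (\<lambda>i p. k i p * g p) p"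
  unfolding step_def by (simp add: sum_distrib_right mult.assoc)

lemma step_in_L2:
  assumes k: "\<And>i. i < n \<Longrightarrow> continuous_on (closure Omega) (k i)"
  shows "in_L2 (step R n k)"
  unfolding in_L2_def set_borel_measurable_def set_integrable_def
proof
  show "(\<lambda>p. indicator Omega p *\<^sub>R step R n k p) \<in> borel_measurable lebesgue"
    using step_integral(1)[OF k] by auto
  have "integrable lebesgue (\<lambda>p. indicator Omega p * step R n (\<lambda>i p. k i p * k i p) p)"
    by (rule step_integral(1)) (intro continuous_intros k)
  then show "integrable lebesgue (\<lambda>p. indicator Omega p *\<^sub>R (step R n k p)\<^sup>2)"
    by (simp add: power2_eq_square step_mult)
qed

lemma L2_inner_step:
  assumes k: "\<And>i. i < n \<Longrightarrow> continuous_on (closure Omega) (k i)" and g: "continuous_on (closure Omega) g"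
  shows "L2_inner (step R n k) g
      = (\<Sum>i<n. integral {fst (lo i)..fst (hi i)} (\<lambda>x. integral {snd (lo i)..snd (hi i)} (\<lambda>y. k i (x, y) * g (x, y))))"
  unfolding L2_inner_def set_lebesgue_integral_def step_mult_right real_scaleR_def
  by (rule step_integral(2)) (intro continuous_intros k g)

lemma L2_inner_step_step:
  assumes k: "\<And>i. i < n \<Longrightarrow> continuous_on (closure Omega) (k i)"
    and l: "\<And>i. i < n \<Longrightarrow> continuous_on (closure Omega) (l i)"
  shows "L2_inner (step R n k) (step R n l)
      = (\<Sum>i<n. integral {fst (lo i)..fst (hi i)} (\<lambda>x. integral {snd (lo i)..snd (hi i)} (\<lambda>y. k i (x, y) * l i (x, y))))"
  unfolding L2_inner_def set_lebesgue_integral_def step_mult real_scaleR_def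
  by (rule step_integral(2)) (intro continuous_intros k l)

end

lemma L2_inner_integrable:
  assumes g: "in_L2 g" and \<phi>: "continuous_on (closure Omega) \<phi>"
  shows "integrable lebesgue (\<lambda>p. indicator Omega p * (g p * \<phi> p))"
proof -
  have "bounded (\<phi> ` closure Omega)"
    using compact_continuous_image[OF \<phi>] by (intro compact_imp_bounded) (simp add: closure_Omega compact_Times)
  then obtain B where B: "\<And>p. p \<in> Omega \<Longrightarrow> \<bar>\<phi> p\<bar> \<le> B"
    using closure_subset unfolding bounded_iff by (metis image_eqI real_norm_def subsetD)
  have "continuous_on (cbox (0, 0) (1, 1)) \<phi>" using \<phi> unfolding unit_cbox .
  from borel_measurable_integrable[OF box_integral(1)[OF this]]
  have m1: "(\<lambda>p. indicator Omega p * \<phi> p) \<in> borel_measurable lebesgue" unfolding Omega_box .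
  have m2: "(\<lambda>p. indicator Omega p * g p) \<in> borel_measurable lebesgue"
    using in_L2_integrable[OF g] by auto
  show ?thesis
  proof (rule Bochner_Integration.integrable_bound[OF integrable_mult_right[OF in_L2_integrable[OF g], of "\<bar>B\<bar>"]])
    have "(\<lambda>p. (indicator Omega p * g p) * (indicator Omega p * \<phi> p)) \<in> borel_measurable lebesgue"
      by (intro borel_measurable_times m1 m2)
    also have "(\<lambda>p. (indicator Omega p * g p) * (indicator Omega p * \<phi> p)) = (\<lambda>p. indicator Omega p * (g p * \<phi> p))"
      by (auto simp: indicator_def)
    finally show "(\<lambda>p. indicator Omega p * (g p * \<phi> p)) \<in> borel_measurable lebesgue" .
    show "AE p in lebesgue. norm (indicator Omega p * (g p * \<phi> p)) \<le> norm (\<bar>B\<bar> * (indicator Omega p * g p))"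
    proof (rule AE_I2)
      fix p
      have "\<bar>g p\<bar> * \<bar>\<phi> p\<bar> \<le> \<bar>g p\<bar> * \<bar>B\<bar>" if "p \<in> Omega" using B[OF that] by (intro mult_left_mono) auto
      then show "norm (indicator Omega p * (g p * \<phi> p)) \<le> norm (\<bar>B\<bar> * (indicator Omega p * g p))"
        by (auto simp: indicator_def abs_mult mult.commute)
    qed
  qed
qed

lemma tested_equal_imp_AE_equal:
  assumes "in_L2 g" "in_L2 h" "\<And>\<phi>. test_function \<phi> \<Longrightarrow> L2_inner g \<phi> = L2_inner h \<phi>"
  shows "AE p in lebesgue. p \<in> Omega \<longrightarrow> g p = h p"
proof -
  have "AE p in lebesgue. p \<in> Omega \<longrightarrow> g p - h p = 0"
  proof (rule AE_zero_if_orthogonal_to_tests)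
    have "integrable lebesgue (\<lambda>p. indicator Omega p * g p - indicator Omega p * h p)"
      by (rule Bochner_Integration.integrable_diff[OF in_L2_integrable[OF assms(1)] in_L2_integrable[OF assms(2)]])
    then show "integrable lebesgue (\<lambda>p. indicator Omega p * (g p - h p))"
      by (simp add: right_diff_distrib)
    fix \<phi> assume t: "test_function \<phi>"
    then have c: "continuous_on (closure Omega) \<phi>" unfolding test_function_def using Ck_cont by blast
    have "L2_inner (\<lambda>p. g p - h p) \<phi> = L2_inner g \<phi> - L2_inner h \<phi>"
      unfolding L2_inner_def set_lebesgue_integral_def real_scaleR_def
      by (subst Bochner_Integration.integral_diff[symmetric, OF L2_inner_integrable[OF assms(1) c] L2_inner_integrable[OF assms(2) c]])
        (simp add: algebra_simps)
    then show "L2_inner (\<lambda>p. g p - h p) \<phi> = 0" using assms(3)[OF t] by simp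
  qed
  then show ?thesis by eventually_elim auto
qed

lemma L2_inner_AE_cong:
  assumes "in_L2 g" "in_L2 g'" "in_L2 h" "in_L2 h'"
    "AE p in lebesgue. p \<in> Omega \<longrightarrow> g p = g' p" "AE p in lebesgue. p \<in> Omega \<longrightarrow> h p = h' p"
  shows "L2_inner g h = L2_inner g' h'"
proof -
  have m: "(\<lambda>p. indicator Omega p * (g p * h p)) \<in> borel_measurable lebesgue" if "in_L2 g" "in_L2 h" for g h
  proof -
    have "(\<lambda>p. (indicator Omega p * g p) * (indicator Omega p * h p)) \<in> borel_measurable lebesgue"
      by (rule borel_measurable_times[OF borel_measurable_integrable[OF in_L2_integrable[OF that(1)]]
            borel_measurable_integrable[OF in_L2_integrable[OF that(2)]]])
    also have "(\<lambda>p. (indicator Omega p * g p) * (indicator Omega p * h p)) = (\<lambda>p. indicator Omega p * (g p * h p))"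
      by (auto simp: indicator_def)
    finally show ?thesis .
  qed
  show ?thesis
    unfolding L2_inner_def set_lebesgue_integral_def real_scaleR_def
  proof (rule integral_cong_AE[OF m[OF assms(1,3)] m[OF assms(2,4)]])
    show "AE p in lebesgue. indicator Omega p * (g p * h p) = indicator Omega p * (g' p * h' p)"
      using assms(5,6) by eventually_elim (auto simp: indicator_def)
  qed
qed

section \<open>Slopes and cellwise integration by parts\<close>

context mesh begin

definition slope :: "(real \<Rightarrow> real) \<Rightarrow> nat \<Rightarrow> real"
  where "slope f i = (f (t (Suc i)) - f (t i)) / (t (Suc i) - t i)"

text \<open>Integration by parts on each cell; the end terms telescope because \<open>f * g\<close>
  has one value per node. It serves twice: with a test function as \<open>g\<close> it identifies
  weak derivatives, with a first derivative of the exact solution as \<open>g\<close> it evaluates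
  the load.\<close>

lemma pl_by_parts:
  assumes f: "is_pl f" and g': "cont g'"
    and d: "\<And>x. x \<in> {0..1} \<Longrightarrow> (g has_vector_derivative g' x) (at x within {0..1})"
  shows "integral {0..1} (\<lambda>x. f x * g' x) = f 1 * g 1 - f 0 * g 0 - (\<Sum>i<M. slope f i * integral {t i..t (Suc i)} g)"
proof -
  have cg: "cont g" by (rule continuous_on_vector_derivative) (rule d)
  have c: "cont (\<lambda>x. f x * g' x)" by (intro continuous_intros is_pl_cont f g')
  have cell: "integral {t i..t (Suc i)} (\<lambda>x. f x * g' x)
      = (f (t (Suc i)) * g (t (Suc i)) - f (t i) * g (t i)) - slope f i * integral {t i..t (Suc i)} g" if i: "i < M" for i
  proof -
    note sub = cell_subset[OF i]
    let ?l = "\<lambda>x. f (t i) + slope f i * (x - t i)"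
    have fl: "f x = ?l x" if "x \<in> {t i..t (Suc i)}" for x
      using is_pl_cellD[OF f i that] unfolding slope_def .
    have "((\<lambda>x. slope f i * g x + ?l x * g' x) has_integral (?l (t (Suc i)) * g (t (Suc i)) - ?l (t i) * g (t i))) {t i..t (Suc i)}"
    proof (rule fundamental_theorem_of_calculus)
      fix x assume x: "x \<in> {t i..t (Suc i)}"
      have "(g has_vector_derivative g' x) (at x within {t i..t (Suc i)})"
        by (rule has_vector_derivative_within_subset[OF d sub]) (use x sub in auto)
      then have g: "(g has_real_derivative g' x) (at x within {t i..t (Suc i)})"
        by (simp add: has_real_derivative_iff_has_vector_derivative)
      show "((\<lambda>x. ?l x * g x) has_vector_derivative slope f i * g x + ?l x * g' x) (at x within {t i..t (Suc i)})"
        unfolding has_real_derivative_iff_has_vector_derivative[symmetric]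
        by (rule derivative_eq_intros g refl | simp)+
    qed simp
    from integral_unique[OF this]
    have "integral {t i..t (Suc i)} (\<lambda>x. slope f i * g x + ?l x * g' x)
      = f (t (Suc i)) * g (t (Suc i)) - f (t i) * g (t i)"
      using fl[of "t i"] fl[of "t (Suc i)"] by simp
    moreover have "integral {t i..t (Suc i)} (\<lambda>x. slope f i * g x + ?l x * g' x)
      = slope f i * integral {t i..t (Suc i)} g + integral {t i..t (Suc i)} (\<lambda>x. ?l x * g' x)"
    proof (subst Henstock_Kurzweil_Integration.integral_add)
      show "(\<lambda>x. slope f i * g x) integrable_on {t i..t (Suc i)}" "(\<lambda>x. ?l x * g' x) integrable_on {t i..t (Suc i)}"
        by (intro integrable_continuous_real continuous_intros continuous_on_subset[OF cg sub] continuous_on_subset[OF g' sub])+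
    qed simp
    moreover have "integral {t i..t (Suc i)} (\<lambda>x. f x * g' x) = integral {t i..t (Suc i)} (\<lambda>x. ?l x * g' x)"
      by (rule integral_cong) (simp only: fl)
    ultimately show ?thesis by simp
  qed
  have "integral {0..1} (\<lambda>x. f x * g' x) = (\<Sum>i<M. (f (t (Suc i)) * g (t (Suc i)) - f (t i) * g (t i)) - slope f i * integral {t i..t (Suc i)} g)"
    unfolding integral_cells[OF c] by (intro sum.cong) (auto simp: cell)
  also have "\<dots> = f (t M) * g (t M) - f (t 0) * g (t 0) - (\<Sum>i<M. slope f i * integral {t i..t (Suc i)} g)"
    by (subst sum_subtractf) (simp only: sum_lessThan_telescope[of "\<lambda>i. f (t i) * g (t i)"])
  finally show ?thesis using t0 tM by simp
qed

lemma cont_slope: "cont2 k \<Longrightarrow> i < M \<Longrightarrow> cont (\<lambda>y. slope (\<lambda>x. k x y) i)"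
  unfolding slope_def using cont2_row[of k] t_in[of i] t_in[of "Suc i"] by (auto intro!: continuous_intros)

lemma af_slope: "af f g = (\<Sum>i<M. (t (Suc i) - t i) * (slope f i * slope g i))"
proof -
  have "a * b / h = h * ((a / h) * (b / h))" if "h \<noteq> 0" for a b h :: real using that by simp
  then show ?thesis unfolding af_def slope_def by (intro sum.cong refl) simp
qed

lemma brk_slope:
  assumes "cont2 k" "cont2 l"
  shows "brk k l = (\<Sum>i<M. (t (Suc i) - t i) * integral {0..1} (\<lambda>y. slope (\<lambda>x. k x y) i * slope (\<lambda>x. l x y) i))"
  unfolding brk_def af_slope
  by (subst integral_sum)
    (auto intro!: integrable_continuous_real continuous_on_mult continuous_on_const cont_slope assms)

end

lemma rect_integral:
  assumes g: "continuous_on (closure Omega) g" and ab: "{a..b} \<subseteq> {0..1}"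
  shows "integral {a..b} (\<lambda>x. integral {0..1} (\<lambda>y. g (x, y))) = integral {0..1} (\<lambda>y. integral {a..b} (\<lambda>x. g (x, y)))" (is ?A)
    "cont (\<lambda>y. integral {a..b} (\<lambda>x. g (x, y)))" (is ?B)
    "integral {0..1} (\<lambda>x. integral {a..b} (\<lambda>y. g (x, y))) = integral {a..b} (\<lambda>y. integral {0..1} (\<lambda>x. g (x, y)))" (is ?C)
    "cont (\<lambda>x. integral {a..b} (\<lambda>y. g (x, y)))" (is ?D)
proof -
  have eq: "(\<lambda>(x, y). g (x, y)) = g" by auto
  have "cbox (a, 0) (b, 1) \<subseteq> closure Omega" "cbox (0, a) (1, b) \<subseteq> closure Omega"
    unfolding closure_Omega cbox_Pair_eq using ab by (intro Sigma_mono; simp add: cbox_interval)+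
  note sub = continuous_on_subset[OF g this(1)] continuous_on_subset[OF g this(2)]
  have "continuous_on (cbox (a, 0) (b, 1)) (\<lambda>(x, y). g (x, y))" unfolding eq by (rule sub)
  from integral_swap_continuous[OF this] show ?A by (simp add: cbox_interval)
  have "continuous_on (cbox (0, a) (1, b)) (\<lambda>(x, y). g (x, y))" unfolding eq by (rule sub)
  from integral_swap_continuous[OF this] show ?C by (simp add: cbox_interval)
  have "continuous_on ({0..1} \<times> cbox a b) (\<lambda>p. g (snd p, fst p))"
    by (rule continuous_on_compose2[OF g]) (use ab in \<open>auto intro!: continuous_intros simp: closure_Omega cbox_interval\<close>)
  then have "cont (\<lambda>y. integral (cbox a b) (\<lambda>x. g (x, y)))"
    by (intro integral_continuous_on_param) (simp add: case_prod_beta)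
  then show ?B by (simp add: cbox_interval)
  have "continuous_on ({0..1} \<times> cbox a b) (\<lambda>p. g (fst p, snd p))"
    by (rule continuous_on_compose2[OF g]) (use ab in \<open>auto intro!: continuous_intros simp: closure_Omega cbox_interval\<close>)
  then have "cont (\<lambda>x. integral (cbox a b) (\<lambda>y. g (x, y)))"
    by (intro integral_continuous_on_param) (simp add: case_prod_beta)
  then show ?D by (simp add: cbox_interval)
qed

lemma frontier_Omega_iff: "(x, y) \<in> frontier Omega \<longleftrightarrow> x \<in> {0..1} \<and> y \<in> {0..1} \<and> (x = 0 \<or> x = 1 \<or> y = 0 \<or> y = 1)"
  unfolding frontier_Omega unfolding Omega_def by auto

lemma cont2_pair: "continuous_on (closure Omega) g \<Longrightarrow> cont2 (\<lambda>x y. g (x, y))"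
  by (simp add: cont2_iff)

lemma closure_cont_fst: "cont f \<Longrightarrow> continuous_on (closure Omega) (\<lambda>p. f (fst p))"
  unfolding closure_Omega by (rule continuous_on_compose2[of _ f]) (auto intro!: continuous_intros)

lemma closure_cont_snd: "cont f \<Longrightarrow> continuous_on (closure Omega) (\<lambda>p. f (snd p))"
  unfolding closure_Omega by (rule continuous_on_compose2[of _ f]) (auto intro!: continuous_intros)

text \<open>Testing determines a weak derivative up to null sets, so the representative picked by
  \<open>SOME\<close> can be exchanged for an explicit one.\<close>

lemma is_weak_dx_unique:
  assumes "is_weak_dx v g"
  shows "in_L2 (weak_dx v)" "AE p in lebesgue. p \<in> Omega \<longrightarrow> weak_dx v p = g p"
proof -
  have w: "is_weak_dx v (weak_dx v)" unfolding weak_dx_def using assms by (rule someI[where P = "is_weak_dx v"])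
  then show "in_L2 (weak_dx v)" unfolding is_weak_dx_def by blast
  show "AE p in lebesgue. p \<in> Omega \<longrightarrow> weak_dx v p = g p"
    using w assms unfolding is_weak_dx_def by (intro tested_equal_imp_AE_equal) auto
qed

lemma is_weak_dy_unique:
  assumes "is_weak_dy v g"
  shows "in_L2 (weak_dy v)" "AE p in lebesgue. p \<in> Omega \<longrightarrow> weak_dy v p = g p"
proof -
  have w: "is_weak_dy v (weak_dy v)" unfolding weak_dy_def using assms by (rule someI[where P = "is_weak_dy v"])
  then show "in_L2 (weak_dy v)" unfolding is_weak_dy_def by blast
  show "AE p in lebesgue. p \<in> Omega \<longrightarrow> weak_dy v p = g p"
    using w assms unfolding is_weak_dy_def by (intro tested_equal_imp_AE_equal) auto
qed

lemma L2_inner_weak_dx: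
  assumes "is_weak_dx v g" "is_weak_dx w h"
  shows "L2_inner (weak_dx v) (weak_dx w) = L2_inner g h"
  using assms is_weak_dx_unique[OF assms(1)] is_weak_dx_unique[OF assms(2)]
  unfolding is_weak_dx_def by (intro L2_inner_AE_cong) auto

lemma L2_inner_weak_dy:
  assumes "is_weak_dy v g" "is_weak_dy w h"
  shows "L2_inner (weak_dy v) (weak_dy w) = L2_inner g h"
  using assms is_weak_dy_unique[OF assms(1)] is_weak_dy_unique[OF assms(2)]
  unfolding is_weak_dy_def by (intro L2_inner_AE_cong) auto

context mesh begin

lemma cells_disjoint: "i \<noteq> j \<Longrightarrow> {t i<..<t (Suc i)} \<inter> {t j<..<t (Suc j)} = {}"
proof -
  have "{t i<..<t (Suc i)} \<inter> {t j<..<t (Suc j)} = {}" if "i < j" for i j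
  proof -
    have "t (Suc i) \<le> t j" using that by simp
    then show ?thesis by (auto simp del: t_le)
  qed
  then show "i \<noteq> j \<Longrightarrow> ?thesis" by (metis Int_commute linorder_neqE_nat)
qed

lemma open_cell_subset: "k < M \<Longrightarrow> {t k<..<t (Suc k)} \<subseteq> {0<..<1}"
  using t_in[of k] t_in[of "Suc k"] by auto

end

lemma integral_strip:
  fixes k :: "real \<Rightarrow> real"
  assumes "a \<le> b"
  shows "integral {0..1} (\<lambda>x. integral {a..b} (\<lambda>y. k x)) = (b - a) * integral {0..1} k"
    "integral {a..b} (\<lambda>x. integral {0..1} k) = (b - a) * integral {0..1} k"
  using assms by (simp_all add: mult.commute)

section \<open>Weak derivatives and Galerkin products of discrete functions\<close>

context ritz2 begin

text \<open>Strips of full height rather than mesh rectangles: the x-slope of a discrete function is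
  constant in x on a strip and continuous in y over the whole height.\<close>

sublocale XB: open_boxes "\<lambda>i. (s i, 0)" "\<lambda>i. (s (Suc i), 1)" M
proof
  show "i < M \<Longrightarrow> j < M \<Longrightarrow> i \<noteq> j \<Longrightarrow> box (s i, 0::real) (s (Suc i), 1) \<inter> box (s j, 0) (s (Suc j), 1) = {}" for i j
    using X.cells_disjoint[of i j] unfolding box_prod by auto
  show "i < M \<Longrightarrow> cbox (s i, 0) (s (Suc i), 1) \<subseteq> closure Omega" for i
    using X.cell_subset[of i] unfolding closure_Omega cbox_Pair_eq by (auto simp: cbox_interval)
  show "i < M \<Longrightarrow> box (s i, 0) (s (Suc i), 1) \<subseteq> Omega" for i
    using X.open_cell_subset[of i] unfolding Omega_def box_prod by auto
qed

sublocale YB: open_boxes "\<lambda>j. (0, t j)" "\<lambda>j. (1, t (Suc j))" K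
proof
  show "i < K \<Longrightarrow> j < K \<Longrightarrow> i \<noteq> j \<Longrightarrow> box (0::real, t i) (1, t (Suc i)) \<inter> box (0, t j) (1, t (Suc j)) = {}" for i j
    using Y.cells_disjoint[of i j] unfolding box_prod by auto
  show "i < K \<Longrightarrow> cbox (0, t i) (1, t (Suc i)) \<subseteq> closure Omega" for i
    using Y.cell_subset[of i] unfolding closure_Omega cbox_Pair_eq by (auto simp: cbox_interval)
  show "i < K \<Longrightarrow> box (0, t i) (1, t (Suc i)) \<subseteq> Omega" for i
    using Y.open_cell_subset[of i] unfolding Omega_def box_prod by auto
qed

definition dX :: "(real \<times> real \<Rightarrow> real) \<Rightarrow> nat \<Rightarrow> real \<times> real \<Rightarrow> real"
  where "dX v i p = X.slope (\<lambda>x. v (x, snd p)) i"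

definition dY :: "(real \<times> real \<Rightarrow> real) \<Rightarrow> nat \<Rightarrow> real \<times> real \<Rightarrow> real"
  where "dY v j p = Y.slope (\<lambda>y. v (fst p, y)) j"

lemma cont_dX: "continuous_on (closure Omega) v \<Longrightarrow> i < M \<Longrightarrow> continuous_on (closure Omega) (dX v i)"
  unfolding dX_def[abs_def] by (rule closure_cont_snd) (rule X.cont_slope[OF cont2_pair])

lemma cont_dY: "continuous_on (closure Omega) v \<Longrightarrow> j < K \<Longrightarrow> continuous_on (closure Omega) (dY v j)"
  unfolding dY_def[abs_def] by (rule closure_cont_fst) (rule Y.cont_slope[OF cont2_flip[OF cont2_pair]])

lemma Vh_cont: "(\<lambda>x y. v (x, y)) \<in> Vh \<Longrightarrow> continuous_on (closure Omega) v"
  unfolding Vh_def by (simp add: cont2_iff)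

lemma weak_dx_step:
  assumes v: "(\<lambda>x y. v (x, y)) \<in> Vh"
  shows "is_weak_dx v (step XB.R M (dX v))"
  unfolding is_weak_dx_def
proof (intro conjI allI impI)
  note cv = Vh_cont[OF v]
  show "in_L2 (step XB.R M (dX v))" by (rule XB.step_in_L2) (rule cont_dX[OF cv])
  fix \<phi> assume "test_function \<phi>"
  then have C1: "Ck_closure (Suc 0) \<phi>" unfolding test_function_def by simp
  then have cp: "continuous_on (closure Omega) \<phi>" "continuous_on (closure Omega) (pdx \<phi>)" by auto
  have sl: "X.slope (\<lambda>x. v (x, y)) i * integral {s i..s (Suc i)} (\<lambda>x. \<phi> (x, y))
      = integral {s i..s (Suc i)} (\<lambda>x. dX v i (x, y) * \<phi> (x, y))" for i y
    by (simp add: dX_def)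
  have c: "continuous_on (closure Omega) (\<lambda>p. dX v i p * \<phi> p)" if "i < M" for i
    by (intro continuous_intros cont_dX[OF cv that] cp)
  have "L2_inner v (pdx \<phi>) = integral {0..1} (\<lambda>y. integral {0..1} (\<lambda>x. v (x, y) * pdx \<phi> (x, y)))"
    unfolding L2_inner_II[OF cv cp(2)] by (rule II_alt[OF cont2_arith(3)[OF cont2_pair[OF cv] cont2_pair[OF cp(2)]]])
  also have "\<dots> = integral {0..1} (\<lambda>y. - (\<Sum>i<M. integral {s i..s (Suc i)} (\<lambda>x. dX v i (x, y) * \<phi> (x, y))))"
  proof (rule integral_cong)
    fix y :: real assume y: "y \<in> {0..1}"
    have V: "(\<lambda>x. v (x, y)) \<in> X.V0" using v y unfolding Vh_def by simp
    then have pl: "X.is_pl (\<lambda>x. v (x, y))" and z: "v (0, y) = 0" "v (1, y) = 0" unfolding X.V0_def by auto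
    from X.pl_by_parts[OF pl cont2_col[OF cont2_pair[OF cp(2)] y] Ck_pdx[OF C1 _ y]]
    show "integral {0..1} (\<lambda>x. v (x, y) * pdx \<phi> (x, y)) = - (\<Sum>i<M. integral {s i..s (Suc i)} (\<lambda>x. dX v i (x, y) * \<phi> (x, y)))"
      unfolding sl using z by simp
  qed
  also have "\<dots> = - (\<Sum>i<M. integral {0..1} (\<lambda>y. integral {s i..s (Suc i)} (\<lambda>x. dX v i (x, y) * \<phi> (x, y))))"
    unfolding Henstock_Kurzweil_Integration.integral_neg
    by (subst integral_sum) (auto intro!: integrable_continuous_real rect_integral(2)[OF c X.cell_subset])
  also have "\<dots> = - (\<Sum>i<M. integral {s i..s (Suc i)} (\<lambda>x. integral {0..1} (\<lambda>y. dX v i (x, y) * \<phi> (x, y))))"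
    by (intro arg_cong[of _ _ uminus] sum.cong refl rect_integral(1)[OF c X.cell_subset, symmetric]) auto
  also have "\<dots> = - L2_inner (step XB.R M (dX v)) \<phi>"
    using XB.L2_inner_step[of "dX v" \<phi>, OF cont_dX[OF cv] cp(1)] by simp
  finally show "L2_inner v (pdx \<phi>) = - L2_inner (step XB.R M (dX v)) \<phi>" .
qed

lemma weak_dy_step:
  assumes v: "(\<lambda>x y. v (x, y)) \<in> Vh"
  shows "is_weak_dy v (step YB.R K (dY v))"
  unfolding is_weak_dy_def
proof (intro conjI allI impI)
  note cv = Vh_cont[OF v]
  show "in_L2 (step YB.R K (dY v))" by (rule YB.step_in_L2) (rule cont_dY[OF cv])
  fix \<phi> assume "test_function \<phi>"
  then have C1: "Ck_closure (Suc 0) \<phi>" unfolding test_function_def by simp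
  then have cp: "continuous_on (closure Omega) \<phi>" "continuous_on (closure Omega) (pdy \<phi>)" by auto
  have sl: "Y.slope (\<lambda>y. v (x, y)) j * integral {t j..t (Suc j)} (\<lambda>y. \<phi> (x, y))
      = integral {t j..t (Suc j)} (\<lambda>y. dY v j (x, y) * \<phi> (x, y))" for j x
    by (simp add: dY_def)
  have c: "continuous_on (closure Omega) (\<lambda>p. dY v j p * \<phi> p)" if "j < K" for j
    by (intro continuous_intros cont_dY[OF cv that] cp)
  have "L2_inner v (pdy \<phi>) = integral {0..1} (\<lambda>x. integral {0..1} (\<lambda>y. v (x, y) * pdy \<phi> (x, y)))"
    unfolding L2_inner_II[OF cv cp(2)] II_def ..
  also have "\<dots> = integral {0..1} (\<lambda>x. - (\<Sum>j<K. integral {t j..t (Suc j)} (\<lambda>y. dY v j (x, y) * \<phi> (x, y))))"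
  proof (rule integral_cong)
    fix x :: real assume x: "x \<in> {0..1}"
    have V: "(\<lambda>y. v (x, y)) \<in> Y.V0" using v x unfolding Vh_def by simp
    then have pl: "Y.is_pl (\<lambda>y. v (x, y))" and z: "v (x, 0) = 0" "v (x, 1) = 0" unfolding Y.V0_def by auto
    from Y.pl_by_parts[OF pl cont2_row[OF cont2_pair[OF cp(2)] x] Ck_pdy[OF C1 x]]
    show "integral {0..1} (\<lambda>y. v (x, y) * pdy \<phi> (x, y)) = - (\<Sum>j<K. integral {t j..t (Suc j)} (\<lambda>y. dY v j (x, y) * \<phi> (x, y)))"
      unfolding sl using z by simp
  qed
  also have "\<dots> = - (\<Sum>j<K. integral {0..1} (\<lambda>x. integral {t j..t (Suc j)} (\<lambda>y. dY v j (x, y) * \<phi> (x, y))))"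
    unfolding Henstock_Kurzweil_Integration.integral_neg
    by (subst integral_sum) (auto intro!: integrable_continuous_real rect_integral(4)[OF c Y.cell_subset])
  also have "\<dots> = - L2_inner (step YB.R K (dY v)) \<phi>"
    using YB.L2_inner_step[of "dY v" \<phi>, OF cont_dY[OF cv] cp(1)] by simp
  finally show "L2_inner v (pdy \<phi>) = - L2_inner (step YB.R K (dY v)) \<phi>" .
qed

text \<open>A slope does not depend on the variable of differentiation within its strip, so each
  strip contributes its width times a one-dimensional integral; \<open>brk_slope\<close> is the same
  sum.\<close>

lemma grad_inner_brk:
  assumes v: "(\<lambda>x y. v (x, y)) \<in> Vh" and w: "(\<lambda>x y. w (x, y)) \<in> Vh"
  shows "grad_inner v w = X.brk (\<lambda>x y. v (x, y)) (\<lambda>x y. w (x, y)) + Y.brk (\<lambda>y x. v (x, y)) (\<lambda>y x. w (x, y))"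
proof -
  note cv = Vh_cont[OF v] and cw = Vh_cont[OF w]
  have "L2_inner (weak_dx v) (weak_dx w) = X.brk (\<lambda>x y. v (x, y)) (\<lambda>x y. w (x, y))"
    unfolding L2_inner_weak_dx[OF weak_dx_step[OF v] weak_dx_step[OF w]]
      X.brk_slope[OF cont2_pair[OF cv] cont2_pair[OF cw]]
      XB.L2_inner_step_step[of "dX v" "dX w", OF cont_dX[OF cv] cont_dX[OF cw], simplified] dX_def fst_conv snd_conv
    by (intro sum.cong refl integral_strip(2)) (simp add: less_imp_le)
  moreover have "L2_inner (weak_dy v) (weak_dy w) = Y.brk (\<lambda>y x. v (x, y)) (\<lambda>y x. w (x, y))"
    unfolding L2_inner_weak_dy[OF weak_dy_step[OF v] weak_dy_step[OF w]]
      Y.brk_slope[OF cont2_flip[OF cont2_pair[OF cv]] cont2_flip[OF cont2_pair[OF cw]]]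
      YB.L2_inner_step_step[of "dY v" "dY w", OF cont_dY[OF cv] cont_dY[OF cw], simplified] dY_def fst_conv snd_conv
    by (intro sum.cong refl integral_strip(1)) (simp add: less_imp_le)
  ultimately show ?thesis unfolding grad_inner_def by simp
qed

lemma Vh_if_bilinear:
  assumes c: "continuous_on (closure Omega) v"
    and b: "\<And>i j. i < M \<Longrightarrow> j < K \<Longrightarrow> \<exists>\<alpha> \<beta> \<gamma> \<delta>. \<forall>x\<in>{s i..s (Suc i)}. \<forall>y\<in>{t j..t (Suc j)}. v (x, y) = \<alpha> + \<beta> * x + \<gamma> * y + \<delta> * (x * y)"
    and z: "\<And>p. p \<in> frontier Omega \<Longrightarrow> v p = 0"
  shows "(\<lambda>x y. v (x, y)) \<in> Vh"
proof -
  have fr: "v (0, y) = 0" "v (1, y) = 0" "v (y, 0) = 0" "v (y, 1) = 0" if "y \<in> {0..1}" for y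
    using that by (auto intro!: z simp: frontier_Omega_iff)
  have "X.is_pl (\<lambda>x. v (x, y))" if y: "y \<in> {0..1}" for y
  proof (rule X.is_pl_cellI)
    fix i assume i: "i < M"
    obtain j where j: "j < K" "y \<in> {t j..t (Suc j)}" using Y.ex_cell[OF y] by blast
    obtain \<alpha> \<beta> \<gamma> \<delta> where "\<forall>x\<in>{s i..s (Suc i)}. \<forall>y\<in>{t j..t (Suc j)}. v (x, y) = \<alpha> + \<beta> * x + \<gamma> * y + \<delta> * (x * y)"
      using b[OF i j(1)] by blast
    then show "\<exists>\<alpha> \<beta>. \<forall>x\<in>{s i..s (Suc i)}. v (x, y) = \<alpha> + \<beta> * x"
      using j by (intro exI[of _ "\<alpha> + \<gamma> * y"] exI[of _ "\<beta> + \<delta> * y"]) (auto simp: algebra_simps)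
  qed
  moreover have "Y.is_pl (\<lambda>y. v (x, y))" if x: "x \<in> {0..1}" for x
  proof (rule Y.is_pl_cellI)
    fix j assume j: "j < K"
    obtain i where i: "i < M" "x \<in> {s i..s (Suc i)}" using X.ex_cell[OF x] by blast
    obtain \<alpha> \<beta> \<gamma> \<delta> where "\<forall>x\<in>{s i..s (Suc i)}. \<forall>y\<in>{t j..t (Suc j)}. v (x, y) = \<alpha> + \<beta> * x + \<gamma> * y + \<delta> * (x * y)"
      using b[OF i(1) j] by blast
    then show "\<exists>\<alpha> \<beta>. \<forall>y\<in>{t j..t (Suc j)}. v (x, y) = \<alpha> + \<beta> * y"
      using i by (intro exI[of _ "\<alpha> + \<beta> * x"] exI[of _ "\<gamma> + \<delta> * x"]) (auto simp: algebra_simps)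
  qed
  ultimately show ?thesis unfolding Vh_def X.V0_def Y.V0_def using fr cont2_pair[OF c] by auto
qed

lemma bilinear_if_Vh:
  assumes k: "k \<in> Vh" and i: "i < M" and j: "j < K"
  shows "\<exists>\<alpha> \<beta> \<gamma> \<delta>. \<forall>x\<in>{s i..s (Suc i)}. \<forall>y\<in>{t j..t (Suc j)}. k x y = \<alpha> + \<beta> * x + \<gamma> * y + \<delta> * (x * y)"
proof -
  have lin: "\<exists>a b. \<forall>y\<in>{t j..t (Suc j)}. k x y = a + b * y" if "x \<in> {0..1}" for x
  proof -
    have pl: "Y.is_pl (k x)" using k that unfolding Vh_def Y.V0_def by auto
    define b where "b = (k x (t (Suc j)) - k x (t j)) / (t (Suc j) - t j)"
    have "k x y = (k x (t j) - b * t j) + b * y" if "y \<in> {t j..t (Suc j)}" for y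
    proof -
      have "k x y = k x (t j) + b * (y - t j)" using Y.is_pl_cellD[OF pl j that] unfolding b_def .
      then show ?thesis by (simp add: right_diff_distrib)
    qed
    then show ?thesis by blast
  qed
  \<comment> \<open>The function is affine in x between the two vertical sides of the cell and
    affine in y on each of them; interpolating these two affine traces in x gives the bilinear
    expression.\<close>
  obtain a b where ab: "\<forall>y\<in>{t j..t (Suc j)}. k (s i) y = a + b * y" using lin[OF X.t_in[of i]] i by auto
  obtain a' b' where ab': "\<forall>y\<in>{t j..t (Suc j)}. k (s (Suc i)) y = a' + b' * y" using lin[OF X.t_in[of "Suc i"]] i by auto
  define h where "h = s (Suc i) - s i"
  have "k x y = (a - (a' - a) / h * s i) + (a' - a) / h * x + (b - (b' - b) / h * s i) * y + (b' - b) / h * (x * y)"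
    if x: "x \<in> {s i..s (Suc i)}" and y: "y \<in> {t j..t (Suc j)}" for x y
  proof -
    have "X.is_pl (\<lambda>x. k x y)" using k Y.cell_sub[OF j y] unfolding Vh_def X.V0_def by auto
    from X.is_pl_cellD[OF this i x] have "k x y = (a + b * y) + ((a' + b' * y) - (a + b * y)) / h * (x - s i)"
      using ab ab' y unfolding h_def by simp
    also have "((a' + b' * y) - (a + b * y)) / h = (a' - a) / h + (b' - b) / h * y"
      by (simp add: add_divide_distrib diff_divide_distrib left_diff_distrib)
    also have "(a + b * y) + (P + Q * y) * (x - s i) = (a - P * s i) + P * x + (b - Q * s i) * y + Q * (x * y)" for P Q
      by (simp add: algebra_simps)
    finally show ?thesis .
  qed
  then show ?thesis by blast
qed

lemma Vh_frontier:
  assumes "k \<in> Vh" "p \<in> frontier Omega"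
  shows "k (fst p) (snd p) = 0"
  using assms unfolding Vh_def X.V0_def Y.V0_def by (cases p) (auto simp: frontier_Omega_iff)

text \<open>One integration by parts in each direction leaves slopes of \<open>v\<close> times cell
  integrals of first derivatives of \<open>u\<close>. These integrals are increments of
  \<open>u\<close>, which is exactly the difference quotient form.\<close>

lemma load_eq_Bform:
  assumes bvp: "solves_bvp \<epsilon> c f u" and v: "(\<lambda>x y. v (x, y)) \<in> Vh"
  shows "L2_inner f v = Bform (\<lambda>x y. u (x, y)) (\<lambda>x y. v (x, y))"
proof -
  note cv = Vh_cont[OF v]
  have C2: "Ck_closure (Suc (Suc 0)) u" using bvp unfolding solves_bvp_def by (simp add: numeral_2_eq_2)
  then have C1: "Ck_closure (Suc 0) (pdx u)" "Ck_closure (Suc 0) (pdy u)"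
    and cu: "continuous_on (closure Omega) u" by auto
  then have cxx: "continuous_on (closure Omega) (pdx (pdx u))" and cyy: "continuous_on (closure Omega) (pdy (pdy u))"
    by auto
  \<comment> \<open>The differential equation is known on the open square only; \<open>F\<close>
    agrees with \<open>f\<close> there and is continuous up to the boundary.\<close>
  define F where "F p = - \<epsilon> * (pdx (pdx u) p + pdy (pdy u) p) + c * u p" for p
  have cF: "continuous_on (closure Omega) F" unfolding F_def[abs_def] by (intro continuous_intros cxx cyy cu)
  have Ff: "F p = f p" if "p \<in> Omega" for p
    using bvp that unfolding solves_bvp_def pd_def F_def by (simp add: numeral_2_eq_2)
  have "L2_inner f v = L2_inner F v"
    unfolding L2_inner_def set_lebesgue_integral_def
    by (rule Bochner_Integration.integral_cong) (auto simp: indicator_def Ff)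
  also have "\<dots> = II (\<lambda>x y. F (x, y) * v (x, y))" by (rule L2_inner_II[OF cF cv])
  also have "\<dots> = II (\<lambda>x y. - \<epsilon> * (v (x, y) * pdx (pdx u) (x, y)) + (- \<epsilon> * (v (x, y) * pdy (pdy u) (x, y)) + c * (u (x, y) * v (x, y))))"
    unfolding F_def by (rule II_cong) (simp add: algebra_simps)
  also have "\<dots> = - \<epsilon> * II (\<lambda>x y. v (x, y) * pdx (pdx u) (x, y)) + (- \<epsilon> * II (\<lambda>x y. v (x, y) * pdy (pdy u) (x, y)) + c * II (\<lambda>x y. u (x, y) * v (x, y)))"
  proof -
    note a = cont2_cmult[OF cont2_arith(3)[OF cont2_pair[OF cv] cont2_pair[OF cxx]], of "- \<epsilon>"]
    note b = cont2_cmult[OF cont2_arith(3)[OF cont2_pair[OF cv] cont2_pair[OF cyy]], of "- \<epsilon>"]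
    note d = cont2_cmult[OF cont2_arith(3)[OF cont2_pair[OF cu] cont2_pair[OF cv]], of c]
    show ?thesis unfolding II_add[OF a cont2_arith(1)[OF b d]] II_add[OF b d] II_cmult ..
  qed
  also have "II (\<lambda>x y. v (x, y) * pdx (pdx u) (x, y)) = - X.brk (\<lambda>x y. u (x, y)) (\<lambda>x y. v (x, y))"
    unfolding II_alt[OF cont2_arith(3)[OF cont2_pair[OF cv] cont2_pair[OF cxx]]] X.brk_def
      Henstock_Kurzweil_Integration.integral_neg[symmetric]
  proof (rule integral_cong)
    fix y :: real assume y: "y \<in> {0..1}"
    have V: "(\<lambda>x. v (x, y)) \<in> X.V0" using v y unfolding Vh_def by simp
    then have pl: "X.is_pl (\<lambda>x. v (x, y))" and z: "v (0, y) = 0" "v (1, y) = 0" unfolding X.V0_def by auto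
    have cell: "integral {s i..s (Suc i)} (\<lambda>x. pdx u (x, y)) = u (s (Suc i), y) - u (s i, y)" if "i < M" for i
    proof (rule integral_unique, rule fundamental_theorem_of_calculus)
      fix x assume "x \<in> {s i..s (Suc i)}"
      then show "((\<lambda>x. u (x, y)) has_vector_derivative pdx u (x, y)) (at x within {s i..s (Suc i)})"
        using Ck_pdx[OF C2 X.cell_sub[OF that] y] X.cell_subset[OF that] has_vector_derivative_within_subset by blast
    qed (simp add: less_imp_le)
    from X.pl_by_parts[OF pl cont2_col[OF cont2_pair[OF cxx] y] Ck_pdx[OF C1(1) _ y]]
    have "integral {0..1} (\<lambda>x. v (x, y) * pdx (pdx u) (x, y))
      = - (\<Sum>i<M. X.slope (\<lambda>x. v (x, y)) i * integral {s i..s (Suc i)} (\<lambda>x. pdx u (x, y)))"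
      using z by simp
    also have "\<dots> = - X.af (\<lambda>x. u (x, y)) (\<lambda>x. v (x, y))"
      unfolding X.af_def X.slope_def by (intro arg_cong[of _ _ uminus] sum.cong refl) (simp add: cell)
    finally show "integral {0..1} (\<lambda>x. v (x, y) * pdx (pdx u) (x, y)) = - X.af (\<lambda>x. u (x, y)) (\<lambda>x. v (x, y))" .
  qed
  also have "II (\<lambda>x y. v (x, y) * pdy (pdy u) (x, y)) = - Y.brk (\<lambda>y x. u (x, y)) (\<lambda>y x. v (x, y))"
    unfolding II_def Y.brk_def Henstock_Kurzweil_Integration.integral_neg[symmetric]
  proof (rule integral_cong)
    fix x :: real assume x: "x \<in> {0..1}"
    have V: "(\<lambda>y. v (x, y)) \<in> Y.V0" using v x unfolding Vh_def by simp
    then have pl: "Y.is_pl (\<lambda>y. v (x, y))" and z: "v (x, 0) = 0" "v (x, 1) = 0" unfolding Y.V0_def by auto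
    have cell: "integral {t j..t (Suc j)} (\<lambda>y. pdy u (x, y)) = u (x, t (Suc j)) - u (x, t j)" if "j < K" for j
    proof (rule integral_unique, rule fundamental_theorem_of_calculus)
      fix y assume "y \<in> {t j..t (Suc j)}"
      then show "((\<lambda>y. u (x, y)) has_vector_derivative pdy u (x, y)) (at y within {t j..t (Suc j)})"
        using Ck_pdy[OF C2 x Y.cell_sub[OF that]] Y.cell_subset[OF that] has_vector_derivative_within_subset by blast
    qed (simp add: less_imp_le)
    from Y.pl_by_parts[OF pl cont2_row[OF cont2_pair[OF cyy] x] Ck_pdy[OF C1(2) x]]
    have "integral {0..1} (\<lambda>y. v (x, y) * pdy (pdy u) (x, y))
      = - (\<Sum>j<K. Y.slope (\<lambda>y. v (x, y)) j * integral {t j..t (Suc j)} (\<lambda>y. pdy u (x, y)))"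
      using z by simp
    also have "\<dots> = - Y.af (\<lambda>y. u (x, y)) (\<lambda>y. v (x, y))"
      unfolding Y.af_def Y.slope_def by (intro arg_cong[of _ _ uminus] sum.cong refl) (simp add: cell)
    finally show "integral {0..1} (\<lambda>y. v (x, y) * pdy (pdy u) (x, y)) = - Y.af (\<lambda>y. u (x, y)) (\<lambda>y. v (x, y))" .
  qed
  finally show ?thesis unfolding Bform_def by (simp add: distrib_left)
qed

end

section \<open>Shishkin meshes and interpolation\<close>

context
  fixes lam :: real and q :: nat
  assumes lam: "0 < lam" "lam \<le> 1/4" and q: "0 < q"
begin

private abbreviation "node \<equiv> shishkin_node lam (4 * q)"

lemma node_eq:
  "node i = (if i \<le> q then lam * (real i / real q)
     else if i \<le> 3 * q then lam + (1 - 2 * lam) * ((real i - real q) / (2 * real q))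
     else (1 - lam) + lam * ((real i - 3 * real q) / real q))"
  unfolding shishkin_node_def by simp

lemma node_values: "node 0 = 0" "node q = lam" "node (3 * q) = 1 - lam" "node (4 * q) = 1"
  using q unfolding node_eq by (auto simp: field_simps)

lemma node_width:
  "node (Suc i) - node i = (if q \<le> i \<and> i < 3 * q then (1 - 2 * lam) / (2 * real q) else lam / real q)"
proof -
  have q': "real q > 0" using q by simp
  consider "i < q" | "i = q" | "q < i" "i < 3 * q" | "i = 3 * q" | "3 * q < i" by linarith
  then show ?thesis
  proof cases
    case 1
    then show ?thesis using q' unfolding node_eq by (simp add: divide_simps algebra_simps)
  next
    case 2
    then show ?thesis using q' q unfolding node_eq by (simp add: divide_simps algebra_simps)
  next
    case 3
    then show ?thesis using q' unfolding node_eq by (simp add: divide_simps algebra_simps)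
  next
    case 4
    then show ?thesis using q' q unfolding node_eq by (simp add: divide_simps algebra_simps)
  next
    case 5
    then show ?thesis using q' unfolding node_eq by (simp add: divide_simps algebra_simps)
  qed
qed

lemma shishkin_mesh: "mesh node (4 * q)"
proof
  show "strict_mono node"
    unfolding strict_mono_Suc_iff
  proof
    fix i
    have "0 < node (Suc i) - node i" unfolding node_width using lam q by auto
    then show "node i < node (Suc i)" by simp
  qed
qed (simp_all add: node_values)

text \<open>Each of the three uniform parts is refined separately; this gives nested meshes because
  both share the same \<open>lam\<close>.\<close>

lemma node_refine: "r > 0 \<Longrightarrow> shishkin_node lam (4 * (q * r)) (i * r) = node i"
proof -
  assume r: "r > 0"
  have "a * real r / (b * real r) = a / b" for a b :: real using r by simp
  from this[of "real i" "real q"] this[of "real i - real q" "2 * real q"] this[of "real i - 3 * real q" "real q"]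
  have "real (i * r) / real (q * r) = real i / real q"
    "(real (i * r) - real (q * r)) / (2 * real (q * r)) = (real i - real q) / (2 * real q)"
    "(real (i * r) - 3 * real (q * r)) / real (q * r) = (real i - 3 * real q) / real q"
    by (simp_all only: of_nat_mult left_diff_distrib mult.assoc)
  moreover have "i * r \<le> 3 * (q * r) \<longleftrightarrow> i \<le> 3 * q" using mult_le_cancel2[of i r "3 * q"] r by (simp only: mult.assoc) simp
  moreover have "i * r \<le> q * r \<longleftrightarrow> i \<le> q" using r by simp
  ultimately show ?thesis unfolding shishkin_node_def by simp
qed

end

section \<open>Interpolation errors on a single cell\<close>

context mesh begin

lemma interp_convex:
  assumes k: "k < M" "x \<in> {t k..t (Suc k)}"
  obtains \<theta> where "0 \<le> \<theta>" "\<theta> \<le> 1" "x - t k = \<theta> * (t (Suc k) - t k)"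
    "f x - interp f x = (1 - \<theta>) * (f x - f (t k)) + \<theta> * (f x - f (t (Suc k)))"
proof -
  have h: "t (Suc k) - t k > 0" by simp
  define \<theta> where "\<theta> = (x - t k) / (t (Suc k) - t k)"
  have 1: "0 \<le> \<theta>" "\<theta> \<le> 1" using k h unfolding \<theta>_def by (auto simp: divide_le_eq)
  have 2: "x - t k = \<theta> * (t (Suc k) - t k)" using h unfolding \<theta>_def by simp
  have "(t (Suc k) - x) / (t (Suc k) - t k) = 1 - \<theta>" using h unfolding \<theta>_def by (simp add: field_simps)
  then have "interp f x = f (t k) * (1 - \<theta>) + f (t (Suc k)) * \<theta>"
    unfolding interp_def pl_cell[OF k] \<theta>_def by simp
  then show ?thesis using that[OF 1 2] by (simp add: algebra_simps)
qed

lemma interp_err_max: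
  assumes k: "k < M" "x \<in> {t k..t (Suc k)}"
    and B: "\<bar>f x - f (t k)\<bar> \<le> B" "\<bar>f x - f (t (Suc k))\<bar> \<le> B"
  shows "\<bar>f x - interp f x\<bar> \<le> B"
proof -
  obtain \<theta> where \<theta>: "0 \<le> \<theta>" "\<theta> \<le> 1"
    "f x - interp f x = (1 - \<theta>) * (f x - f (t k)) + \<theta> * (f x - f (t (Suc k)))"
    using interp_convex[OF k] by metis
  have "\<bar>f x - interp f x\<bar> \<le> (1 - \<theta>) * \<bar>f x - f (t k)\<bar> + \<theta> * \<bar>f x - f (t (Suc k))\<bar>"
    unfolding \<theta>(3) using abs_triangle_ineq[of "(1 - \<theta>) * (f x - f (t k))" "\<theta> * (f x - f (t (Suc k)))"] \<theta>
    by (simp add: abs_mult)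
  also have "\<dots> \<le> (1 - \<theta>) * B + \<theta> * B" using B \<theta> by (intro add_mono mult_left_mono) auto
  finally show ?thesis by (simp add: algebra_simps)
qed

lemma interp_err_0:
  assumes k: "k < M" "x \<in> {t k..t (Suc k)}" and B: "\<And>z. z \<in> {t k..t (Suc k)} \<Longrightarrow> \<bar>f z\<bar> \<le> B"
  shows "\<bar>f x - interp f x\<bar> \<le> 2 * B"
proof (rule interp_err_max[OF k])
  have "\<bar>f x\<bar> \<le> B" "\<bar>f (t k)\<bar> \<le> B" "\<bar>f (t (Suc k))\<bar> \<le> B" using B k by auto
  then show "\<bar>f x - f (t k)\<bar> \<le> 2 * B" "\<bar>f x - f (t (Suc k))\<bar> \<le> 2 * B" by linarith+
qed

lemma cell_mvt:
  assumes k: "k < M" and d: "\<And>x. x \<in> {0..1} \<Longrightarrow> (f has_vector_derivative f' x) (at x within {0..1})"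
    and ab: "a \<le> b" "{a..b} \<subseteq> {t k..t (Suc k)}"
  obtains z where "z \<in> {t k..t (Suc k)}" "f b - f a = f' z * (b - a)"
proof -
  have sub: "{a..b} \<subseteq> {0..1}" using ab cell_subset[OF k] by blast
  have "\<exists>z\<in>{a..b}. f b - f a = (\<lambda>h. h * f' z) (b - a)"
  proof (rule mvt_very_simple[OF ab(1)])
    fix z assume "a \<le> z" "z \<le> b"
    then have "z \<in> {0..1}" using sub by auto
    from has_vector_derivative_within_subset[OF d[OF this] sub]
    show "(f has_derivative (\<lambda>h. h * f' z)) (at z within {a..b})"
      unfolding has_vector_derivative_def by simp
  qed
  then obtain z where z: "z \<in> {a..b}" "f b - f a = (b - a) * f' z" by blast
  show ?thesis by (rule that[of z]) (use z ab in \<open>auto simp: mult.commute\<close>)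
qed

lemma interp_err_1:
  assumes k: "k < M" "x \<in> {t k..t (Suc k)}"
    and d: "\<And>x. x \<in> {0..1} \<Longrightarrow> (f has_vector_derivative f' x) (at x within {0..1})"
    and B: "\<And>z. z \<in> {t k..t (Suc k)} \<Longrightarrow> \<bar>f' z\<bar> \<le> B"
  shows "\<bar>f x - interp f x\<bar> \<le> (t (Suc k) - t k) * B"
proof (rule interp_err_max[OF k])
  have B0: "0 \<le> B" using B[OF k(2)] by linarith
  obtain z where z: "z \<in> {t k..t (Suc k)}" "f x - f (t k) = f' z * (x - t k)"
    using cell_mvt[OF k(1) d, of "t k" x] k by auto
  obtain z' where z': "z' \<in> {t k..t (Suc k)}" "f (t (Suc k)) - f x = f' z' * (t (Suc k) - x)"
    using cell_mvt[OF k(1) d, of x "t (Suc k)"] k by auto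
  have "\<bar>f x - f (t k)\<bar> \<le> B * (t (Suc k) - t k)"
    unfolding z(2) abs_mult using B[OF z(1)] B0 k by (intro mult_mono) auto
  then show "\<bar>f x - f (t k)\<bar> \<le> (t (Suc k) - t k) * B" by (simp add: mult.commute)
  have "\<bar>f (t (Suc k)) - f x\<bar> \<le> B * (t (Suc k) - t k)"
    unfolding z'(2) abs_mult using B[OF z'(1)] B0 k by (intro mult_mono) auto
  then show "\<bar>f x - f (t (Suc k))\<bar> \<le> (t (Suc k) - t k) * B" by (simp add: mult.commute abs_minus_commute)
qed

text \<open>By the mean value theorem the error is \<open>(f' z - f' z') * (x - t k)\<close> with
  two points of the cell, and applying it once more bounds the difference of the derivatives by
  \<open>B\<close> times the width. The constant 1 is not sharp.\<close>

lemma interp_err_2: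
  assumes k: "k < M" "x \<in> {t k..t (Suc k)}"
    and d: "\<And>x. x \<in> {0..1} \<Longrightarrow> (f has_vector_derivative f' x) (at x within {0..1})"
    and d2: "\<And>x. x \<in> {0..1} \<Longrightarrow> (f' has_vector_derivative f'' x) (at x within {0..1})"
    and B: "\<And>z. z \<in> {t k..t (Suc k)} \<Longrightarrow> \<bar>f'' z\<bar> \<le> B"
  shows "\<bar>f x - interp f x\<bar> \<le> (t (Suc k) - t k)\<^sup>2 * B"
proof -
  define h where "h = t (Suc k) - t k"
  have h: "h > 0" by (simp add: h_def)
  have B0: "0 \<le> B" using B[OF k(2)] by linarith
  obtain z where z: "z \<in> {t k..t (Suc k)}" "f x - f (t k) = f' z * (x - t k)"
    using cell_mvt[OF k(1) d, of "t k" x] k by auto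
  obtain z' where z': "z' \<in> {t k..t (Suc k)}" "f (t (Suc k)) - f (t k) = f' z' * (t (Suc k) - t k)"
    using cell_mvt[OF k(1) d, of "t k" "t (Suc k)"] by auto
  have "\<bar>f' z - f' z'\<bar> \<le> B * h"
  proof -
    have "\<bar>f' v - f' w\<bar> \<le> B * h" if le: "v \<le> w" and vw: "v \<in> {t k..t (Suc k)}" "w \<in> {t k..t (Suc k)}" for v w
    proof -
      obtain y where y: "y \<in> {t k..t (Suc k)}" "f' w - f' v = f'' y * (w - v)"
        using cell_mvt[OF k(1) d2 le] vw by auto
      have "\<bar>f' w - f' v\<bar> \<le> B * h"
        unfolding y(2) abs_mult h_def using B[OF y(1)] B0 vw le by (intro mult_mono) auto
      then show ?thesis by (simp add: abs_minus_commute)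
    qed
    from this[of z z'] this[of z' z] show ?thesis using z(1) z'(1) by (cases "z \<le> z'") (auto simp: abs_minus_commute)
  qed
  moreover have "f x - interp f x = (f' z - f' z') * (x - t k)"
  proof -
    have "interp f x = f (t k) + (f (t (Suc k)) - f (t k)) / (t (Suc k) - t k) * (x - t k)"
      unfolding interp_def by (rule pl_cell'[OF k])
    also have "(f (t (Suc k)) - f (t k)) / (t (Suc k) - t k) = f' z'" unfolding z'(2) using h by (simp add: h_def)
    finally show ?thesis using z(2) by (simp add: algebra_simps)
  qed
  ultimately have "\<bar>f x - interp f x\<bar> \<le> (B * h) * h"
    unfolding abs_mult using k B0 h by (auto simp: abs_mult h_def intro!: mult_mono)
  then show ?thesis by (simp add: h_def power2_eq_square algebra_simps)
qed

end

text \<open>Fine cell \<open>j\<close> lies in coarse cell \<open>j div r\<close>, where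
  \<open>f\<close> has constant slope; grouping the fine cells in blocks of \<open>r\<close>
  restores the coarse sum. This allows functions from different meshes to be measured on the finest
  one.\<close>

lemma (in mesh) refined_af:
  assumes fine: "mesh t' (M * r)" and r: "\<And>i. t' (i * r) = t i" and f: "is_pl f"
  shows "mesh.af t' (M * r) f f = af f f" "mesh.is_pl t' (M * r) f"
proof -
  interpret F: mesh t' "M * r" by (rule fine)
  have r0: "r > 0" using F.M_pos by simp
  have in_cell: "t' j \<in> {t (j div r)..t (Suc (j div r))} \<and> t' (Suc j) \<in> {t (j div r)..t (Suc (j div r))}" for j
  proof -
    have 1: "j div r * r \<le> j" by simp
    have 2: "Suc j \<le> Suc (j div r) * r"
      using r0 by (metis Suc_leI dividend_less_div_times mult.commute mult_Suc add.commute)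
    show ?thesis unfolding r[symmetric] atLeastAtMost_iff F.t_le using 1 2 by (auto intro: le_SucI)
  qed
  have div_less: "j < M * r \<Longrightarrow> j div r < M" for j using less_mult_imp_div_less by blast
  have lin: "f (t' (Suc j)) - f (t' j) = (f (t (Suc i)) - f (t i)) / (t (Suc i) - t i) * (t' (Suc j) - t' j)"
    if "j < M * r" "i = j div r" for i j
  proof -
    define S where "S = (f (t (Suc i)) - f (t i)) / (t (Suc i) - t i)"
    have e: "f x = f (t i) + S * (x - t i)" if "x \<in> {t i..t (Suc i)}" for x
      using is_pl_cellD[OF f _ that] div_less[OF \<open>j < M * r\<close>] \<open>i = j div r\<close> unfolding S_def by blast
    have "t' j \<in> {t i..t (Suc i)}" "t' (Suc j) \<in> {t i..t (Suc i)}"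
      using in_cell[of j] \<open>i = j div r\<close> by simp_all
    from e[OF this(1)] e[OF this(2)] have "f (t' (Suc j)) - f (t' j) = S * (t' (Suc j) - t' j)"
      by (simp add: algebra_simps)
    then show ?thesis unfolding S_def .
  qed
  let ?sl = "\<lambda>i. (f (t (Suc i)) - f (t i)) / (t (Suc i) - t i)"
  have "F.af f f = (\<Sum>j<M * r. ?sl (j div r) * ?sl (j div r) * (t' (Suc j) - t' j))"
    unfolding F.af_def
  proof (intro sum.cong refl)
    fix j assume "j \<in> {..<M * r}"
    then have j: "j < M * r" by simp
    have "t' (Suc j) - t' j \<noteq> 0" by simp
    then show "(f (t' (Suc j)) - f (t' j)) * (f (t' (Suc j)) - f (t' j)) / (t' (Suc j) - t' j)
      = ?sl (j div r) * ?sl (j div r) * (t' (Suc j) - t' j)"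
      unfolding lin[OF j refl] by simp
  qed
  also have "\<dots> = (\<Sum>i<M. \<Sum>j=i * r..<i * r + r. ?sl (j div r) * ?sl (j div r) * (t' (Suc j) - t' j))"
    by (rule sum.nat_group[symmetric])
  also have "\<dots> = (\<Sum>i<M. ?sl i * ?sl i * (t (Suc i) - t i))"
  proof (intro sum.cong refl)
    fix i
    have "(\<Sum>j=i * r..<i * r + r. ?sl (j div r) * ?sl (j div r) * (t' (Suc j) - t' j))
        = (\<Sum>j=i * r..<i * r + r. ?sl i * ?sl i * (t' (Suc j) - t' j))"
    proof (intro sum.cong refl)
      fix j assume "j \<in> {i * r..<i * r + r}"
      then have "j div r = i" using r0 by (intro div_nat_eqI) (auto simp: mult.commute)
      then show "?sl (j div r) * ?sl (j div r) * (t' (Suc j) - t' j) = ?sl i * ?sl i * (t' (Suc j) - t' j)" by simp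
    qed
    also have "\<dots> = ?sl i * ?sl i * (t' (i * r + r) - t' (i * r))"
      by (simp only: sum_distrib_left[symmetric]) (simp add: sum_Suc_diff'[of "i * r" "i * r + r" t'])
    also have "t' (i * r + r) = t (Suc i)" using r[of "Suc i"] by (simp add: add.commute)
    finally show "(\<Sum>j=i * r..<i * r + r. ?sl (j div r) * ?sl (j div r) * (t' (Suc j) - t' j)) = ?sl i * ?sl i * (t (Suc i) - t i)"
      unfolding r .
  qed
  also have "\<dots> = af f f"
    unfolding af_def
  proof (intro sum.cong refl)
    fix i
    have "d / h * (d / h) * h = d * d / h" if "h \<noteq> 0" for h d :: real using that by simp
    moreover have "t (Suc i) - t i \<noteq> 0" by simp
    ultimately show "?sl i * ?sl i * (t (Suc i) - t i) = (f (t (Suc i)) - f (t i)) * (f (t (Suc i)) - f (t i)) / (t (Suc i) - t i)"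
      by simp
  qed
  finally show "F.af f f = af f f" .
  show "F.is_pl f"
  proof (rule F.is_pl_cellI)
    fix j assume j: "j < M * r"
    let ?i = "j div r"
    have "f x = (f (t ?i) - ?sl ?i * t ?i) + ?sl ?i * x" if "x \<in> {t' j..t' (Suc j)}" for x
    proof -
      have "x \<in> {t ?i..t (Suc ?i)}" using that in_cell[of j] by auto
      from is_pl_cellD[OF f div_less[OF j] this] show ?thesis by (simp add: right_diff_distrib)
    qed
    then show "\<exists>\<alpha> \<beta>. \<forall>x\<in>{t' j..t' (Suc j)}. f x = \<alpha> + \<beta> * x" by blast
  qed
qed

section \<open>Layer components\<close>

text \<open>Schwarz's theorem up to the boundary: \<open>g (z, v) - g (0, v)\<close> is the integral
  of \<open>pdx g\<close>; differentiate in v under the integral, then in z by the fundamental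
  theorem. Since \<open>pd\<close> takes the y-derivatives first, this is what identifies the
  y-derivative of an x-derivative.\<close>

lemma pd_commute:
  assumes g: "Ck_closure (Suc (Suc 0)) g" and x: "x \<in> {0..1}" and y: "y \<in> {0..1}"
  shows "pdy (pdx g) (x, y) = pdx (pdy g) (x, y)"
proof -
  have C1: "Ck_closure (Suc 0) (pdx g)" using g by simp
  have cyx: "cont2 (\<lambda>x y. pdy (pdx g) (x, y))" using C1 by (simp add: cont2_iff)
  have cx: "cont2 (\<lambda>x y. pdx g (x, y))" using C1 by (simp add: cont2_iff)
  have incr: "pdy g (z, y) = pdy g (0, y) + integral {0..z} (\<lambda>s. pdy (pdx g) (s, y))" if z: "z \<in> {0..1}" for z
  proof -
    have sub: "{0..z} \<subseteq> {0..1}" using z by auto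
    have ftc: "integral (cbox 0 z) (\<lambda>s. pdx g (s, v)) = g (z, v) - g (0, v)" if v: "v \<in> {0..1}" for v
    proof -
      have "((\<lambda>s. pdx g (s, v)) has_integral (g (z, v) - g (0, v))) {0..z}"
      proof (rule fundamental_theorem_of_calculus)
        fix s assume "s \<in> {0..z}"
        then have "s \<in> {0..1}" using sub by auto
        from has_vector_derivative_within_subset[OF Ck_pdx[OF g this v] sub]
        show "((\<lambda>s. g (s, v)) has_vector_derivative pdx g (s, v)) (at s within {0..z})" .
      qed (use z in simp)
      then show ?thesis by (simp add: integral_unique cbox_interval)
    qed
    have "((\<lambda>v. integral (cbox 0 z) (\<lambda>s. pdx g (s, v))) has_vector_derivative integral (cbox 0 z) (\<lambda>s. pdy (pdx g) (s, y)))
        (at y within {0..1})"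
    proof (rule leibniz_rule_vector_derivative)
      show "((\<lambda>v. pdx g (s, v)) has_vector_derivative pdy (pdx g) (s, v)) (at v within {0..1})"
        if "v \<in> {0..1}" "s \<in> cbox 0 z" for v s
        using Ck_pdy[OF C1] that sub by (auto simp: cbox_interval)
      show "(\<lambda>s. pdx g (s, v)) integrable_on cbox 0 z" if "v \<in> {0..1}" for v
        unfolding cbox_interval by (intro integrable_continuous_real continuous_on_subset[OF cont2_col[OF cx that] sub])
      show "continuous_on ({0..1} \<times> cbox 0 z) (\<lambda>(v, s). pdy (pdx g) (s, v))"
      proof -
        have "{0..1} \<times> cbox 0 z \<subseteq> {0..1} \<times> {0..1}" using sub by (intro Sigma_mono) (simp_all add: cbox_interval)
        from continuous_on_subset[OF cont2_flip[OF cyx, unfolded cont2_def] this] show ?thesis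
          by (simp add: case_prod_beta)
      qed
    qed (use y in auto)
    then have "((\<lambda>v. g (z, v) - g (0, v)) has_vector_derivative integral (cbox 0 z) (\<lambda>s. pdy (pdx g) (s, y))) (at y within {0..1})"
      by (rule has_vector_derivative_transform[OF y, rotated]) (rule ftc[symmetric])
    moreover have "((\<lambda>v. g (z, v) - g (0, v)) has_vector_derivative pdy g (z, y) - pdy g (0, y)) (at y within {0..1})"
      by (intro has_vector_derivative_diff Ck_pdy[OF g] z y) simp
    ultimately have "integral (cbox 0 z) (\<lambda>s. pdy (pdx g) (s, y)) = pdy g (z, y) - pdy g (0, y)"
      using vector_derivative_unit[OF y] by metis
    then show ?thesis by (simp add: cbox_interval)
  qed
  have "((\<lambda>z. pdy g (0, y) + integral {0..z} (\<lambda>s. pdy (pdx g) (s, y))) has_vector_derivative 0 + pdy (pdx g) (x, y)) (at x within {0..1})"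
    by (intro has_vector_derivative_add has_vector_derivative_const integral_has_vector_derivative cont2_col[OF cyx y] x)
  then have "((\<lambda>z. pdy g (z, y)) has_vector_derivative 0 + pdy (pdx g) (x, y)) (at x within {0..1})"
    by (rule has_vector_derivative_transform[OF x, rotated]) (rule incr)
  then have "((\<lambda>z. pdy g (z, y)) has_vector_derivative pdy (pdx g) (x, y)) (at x within {0..1})" by simp
  then show ?thesis using pdx_eqI[OF x, of "pdy g" y] by simp
qed

lemma Ck_Suc: "Ck_closure (Suc k) g \<Longrightarrow> Ck_closure k g"
proof (induction k arbitrary: g)
  case (Suc k)
  note P = Suc.prems[unfolded Ck_closure.simps(2)[of "Suc k"]]
  show ?case unfolding Ck_closure.simps(2)[of k]
    using P Suc.IH[of "pdx g"] Suc.IH[of "pdy g"] by blast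
qed simp

text \<open>A function together with its derivatives as an indexed family. Exchanging x and y
  becomes a swap of indices and arguments (\<open>jet_flip\<close>), without relating
  \<open>pdx\<close> and \<open>pdy\<close> of a flipped function.\<close>

definition jet :: "(nat \<Rightarrow> nat \<Rightarrow> real \<Rightarrow> real \<Rightarrow> real) \<Rightarrow> bool"
  where "jet d \<longleftrightarrow> cont2 (d 0 0) \<and> cont2 (d 1 0) \<and> cont2 (d 0 1) \<and>
    (\<forall>m\<le>1. \<forall>n\<le>1. \<forall>x\<in>{0..1}. \<forall>y\<in>{0..1}.
      ((\<lambda>s. d m n s y) has_vector_derivative d (Suc m) n x y) (at x within {0..1}) \<and>
      ((\<lambda>s. d m n x s) has_vector_derivative d m (Suc n) x y) (at y within {0..1}))"

lemma jet_flip: "jet d \<Longrightarrow> jet (\<lambda>m n x y. d n m y x)"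
  unfolding jet_def by (auto intro: cont2_flip)

lemma jet_dx: "jet d \<Longrightarrow> m \<le> 1 \<Longrightarrow> n \<le> 1 \<Longrightarrow> x \<in> {0..1} \<Longrightarrow> y \<in> {0..1} \<Longrightarrow>
  ((\<lambda>s. d m n s y) has_vector_derivative d (Suc m) n x y) (at x within {0..1})"
  unfolding jet_def by blast

lemma jet_dy: "jet d \<Longrightarrow> m \<le> 1 \<Longrightarrow> n \<le> 1 \<Longrightarrow> x \<in> {0..1} \<Longrightarrow> y \<in> {0..1} \<Longrightarrow>
  ((\<lambda>s. d m n x s) has_vector_derivative d m (Suc n) x y) (at y within {0..1})"
  unfolding jet_def by blast

lemma jet_cont: "jet d \<Longrightarrow> cont2 (d 0 0)" "jet d \<Longrightarrow> cont2 (d 1 0)" "jet d \<Longrightarrow> cont2 (d 0 1)"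
  unfolding jet_def by auto

lemma jet_pd:
  assumes g: "Ck_closure 4 g"
  shows "jet (\<lambda>m n x y. pd m n g (x, y))"
proof -
  have C4: "Ck_closure (Suc (Suc (Suc (Suc 0)))) g"   proof -
    have "4 = Suc (Suc (Suc (Suc 0)))" by simp
    with g show ?thesis by (simp only:)
  qed
  have y: "Ck_closure (Suc (Suc (Suc 0))) ((pdy ^^ n) g)" if "n \<le> 1" for n
    using that C4 Ck_Suc[OF C4] by (cases n) auto
  have xy: "Ck_closure (Suc (Suc 0)) (pd m n g)" if "m \<le> 1" "n \<le> 1" for m n
    using that y[OF that(2)] Ck_Suc[OF y[OF that(2)]] unfolding pd_def by (cases m) auto
  have c: "cont2 (\<lambda>x y. pd m n g (x, y))" if "m \<le> 1" "n \<le> 1" for m n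
    using Ck_cont[OF xy[OF that]] by (simp add: cont2_iff)
  have dx: "((\<lambda>s. pd m n g (s, v)) has_vector_derivative pd (Suc m) n g (u, v)) (at u within {0..1})"
    if "m \<le> 1" "n \<le> 1" "u \<in> {0..1}" "v \<in> {0..1}" for m n u v
    using Ck_pdx[OF xy[OF that(1,2)] that(3,4)] unfolding pd_def by simp
  have dy: "((\<lambda>s. pd m n g (u, s)) has_vector_derivative pd m (Suc n) g (u, v)) (at v within {0..1})"
    if "m \<le> 1" "n \<le> 1" "u \<in> {0..1}" "v \<in> {0..1}" for m n u v
  proof -
    have "pdy (pd m n g) (u, v) = pd m (Suc n) g (u, v)"
      using pd_commute[OF Ck_Suc[OF y[OF that(2)]] that(3,4)] that(1) unfolding pd_def by (cases m) auto
    then show ?thesis using Ck_pdy[OF xy[OF that(1,2)] that(3,4)] by simp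
  qed
  show ?thesis unfolding jet_def using c dx dy by auto
qed

text \<open>The number of factors \<open>\<epsilon> powr (-1/2)\<close> that one derivative costs:
  none in a smooth direction, one across a layer.\<close>

definition expn :: "nat \<Rightarrow> nat" where "expn i = (if i = 0 then 0 else 1)"

definition prof :: "real \<Rightarrow> nat \<Rightarrow> real \<Rightarrow> real"
  where "prof a i x = (if i = 0 then 1 else if i = 1 then exp (- (a * x)) else exp (- (a * (1 - x))))"

text \<open>The component with index \<open>(i, j)\<close> has the profile \<open>i\<close> in \<open>x\<close> and \<open>j\<close> in \<open>y\<close>:
  index \<open>0\<close> stands for smooth behaviour, \<open>1\<close> for a layer at \<open>0\<close> and \<open>2\<close> for a layer at \<open>1\<close>;
  \<open>r\<close> is \<open>\<epsilon>\<^bsup>-1/2\<^esup>\<close>.\<close>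

definition layer_bound :: "real \<Rightarrow> real \<Rightarrow> real \<Rightarrow> nat \<Rightarrow> nat \<Rightarrow> (nat \<Rightarrow> nat \<Rightarrow> real \<Rightarrow> real \<Rightarrow> real) \<Rightarrow> bool"
  where "layer_bound D r a i j d \<longleftrightarrow> (\<forall>m n. (m + n \<le> 2 \<or> (m = 1 \<and> n = 2 \<or> m = 2 \<and> n = 1) \<and> \<not> (i = 0 \<and> j = 0)) \<longrightarrow>
    (\<forall>x\<in>{0..1}. \<forall>y\<in>{0..1}. \<bar>d m n x y\<bar> \<le> D * r ^ (expn i * m + expn j * n) * prof a i x * prof a j y))"

definition decomposed :: "real \<Rightarrow> real \<Rightarrow> real \<Rightarrow> (real \<Rightarrow> real \<Rightarrow> real) \<Rightarrow> bool"
  where "decomposed D r a u \<longleftrightarrow> (\<exists>g. (\<forall>i<3. \<forall>j<3. jet (g i j) \<and> layer_bound D r a i j (g i j)) \<and>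
     (\<forall>x\<in>{0..1}. \<forall>y\<in>{0..1}. u x y = (\<Sum>i<3. \<Sum>j<3. g i j 0 0 x y)))"

lemma layer_bound_flip:
  assumes "layer_bound D r a i j d" shows "layer_bound D r a j i (\<lambda>m n x y. d n m y x)"
  unfolding layer_bound_def
proof (intro allI impI ballI)
  fix m n :: nat and x y :: real
  assume mn: "m + n \<le> 2 \<or> (m = 1 \<and> n = 2 \<or> m = 2 \<and> n = 1) \<and> \<not> (j = 0 \<and> i = 0)" and xy: "x \<in> {0..1}" "y \<in> {0..1}"
  have "n + m \<le> 2 \<or> (n = 1 \<and> m = 2 \<or> n = 2 \<and> m = 1) \<and> \<not> (i = 0 \<and> j = 0)" using mn by auto
  then have "\<bar>d n m y x\<bar> \<le> D * r ^ (expn i * n + expn j * m) * prof a i y * prof a j x"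
    using assms xy unfolding layer_bound_def by blast
  then show "\<bar>d n m y x\<bar> \<le> D * r ^ (expn j * m + expn i * n) * prof a j x * prof a i y"
    by (simp add: mult_ac add.commute)
qed

lemma decomposedE:
  assumes "decomposed D r a u"
  obtains g where "\<And>i j. i < 3 \<Longrightarrow> j < 3 \<Longrightarrow> jet (g i j)" "\<And>i j. i < 3 \<Longrightarrow> j < 3 \<Longrightarrow> layer_bound D r a i j (g i j)"
    "\<And>x y. x \<in> {0..1} \<Longrightarrow> y \<in> {0..1} \<Longrightarrow> u x y = (\<Sum>i<3. \<Sum>j<3. g i j 0 0 x y)"
proof -
  from assms obtain g where G: "(\<forall>i<3. \<forall>j<3. jet (g i j) \<and> layer_bound D r a i j (g i j)) \<and>
     (\<forall>x\<in>{0..1}. \<forall>y\<in>{0..1}. u x y = (\<Sum>i<3. \<Sum>j<3. g i j 0 0 x y))"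
    unfolding decomposed_def by (rule exE)
  show ?thesis by (rule that[of g]) (use G in simp_all)
qed

text \<open>A factor \<open>1 + \<epsilon> powr (1 - l/2)\<close> is at most 2 as long as
  \<open>l \<le> 2\<close>. For side layers \<open>l\<close> counts only derivatives along the
  layer, so the mixed third derivatives are still covered; for the smooth part \<open>l\<close> is
  the total order, which is why \<open>layer_bound\<close> excludes them there.\<close>

lemma layer_bound_pd:
  assumes C: "0 \<le> C" and eps: "0 < \<epsilon>" "\<epsilon> \<le> 1"
    and b: "\<And>m n x y. m + n \<le> 4 \<Longrightarrow> x \<in> {0..1} \<Longrightarrow> y \<in> {0..1} \<Longrightarrow>
      \<bar>pd m n g (x, y)\<bar> \<le> C * ((if i = 0 \<and> j = 0 then 1 + \<epsilon> powr (1 - real (m + n) / 2)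
         else if i = 0 then 1 + \<epsilon> powr (1 - real m / 2) else if j = 0 then 1 + \<epsilon> powr (1 - real n / 2) else 1)
         * (\<epsilon> powr (- real (expn i * m + expn j * n) / 2))) * (prof a i x * prof a j y)"
  shows "layer_bound (2 * C) (\<epsilon> powr (- 1 / 2)) a i j (\<lambda>m n x y. pd m n g (x, y))"
  unfolding layer_bound_def
proof (intro allI impI ballI)
  fix m n :: nat and x y :: real
  assume mn: "m + n \<le> 2 \<or> (m = 1 \<and> n = 2 \<or> m = 2 \<and> n = 1) \<and> \<not> (i = 0 \<and> j = 0)" and xy: "x \<in> {0..1}" "y \<in> {0..1}"
  let ?p = "expn i * m + expn j * n"
  have le1: "\<epsilon> powr s \<le> 1" if "s \<ge> 0" for s using powr_mono_both[of 0 s \<epsilon> 1] eps that powr_le1 by auto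
  let ?f = "if i = 0 \<and> j = 0 then 1 + \<epsilon> powr (1 - real (m + n) / 2)
         else if i = 0 then 1 + \<epsilon> powr (1 - real m / 2) else if j = 0 then 1 + \<epsilon> powr (1 - real n / 2) else (1::real)"
  have f: "?f \<le> 2"
    using mn le1[of "1 - real (m + n) / 2"] le1[of "1 - real m / 2"] le1[of "1 - real n / 2"] by auto
  have pw: "\<epsilon> powr (- real ?p / 2) = (\<epsilon> powr (- 1 / 2)) ^ ?p"
  proof -
    have "(\<epsilon> powr (- 1 / 2)) ^ p = \<epsilon> powr (- real p / 2)" for p
      using powr_realpow[of "\<epsilon> powr (- 1 / 2)" p, symmetric] eps by (simp add: powr_powr)
    then show ?thesis by (simp only:)
  qed
  have pr: "0 \<le> prof a i x * prof a j y" by (simp add: prof_def)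
  have "\<bar>pd m n g (x, y)\<bar> \<le> C * (?f * (\<epsilon> powr (- real ?p / 2))) * (prof a i x * prof a j y)"
    using mn by (intro b xy) auto
  also have "\<dots> \<le> C * (2 * (\<epsilon> powr (- real ?p / 2))) * (prof a i x * prof a j y)"
    using f C pr by (intro mult_right_mono mult_left_mono) auto
  finally show "\<bar>pd m n g (x, y)\<bar> \<le> 2 * C * (\<epsilon> powr (- 1 / 2)) ^ ?p * prof a i x * prof a j y"
    unfolding pw by (simp add: mult_ac)
qed

lemma decomposed_if_layer_decomposition:
  assumes ld: "layer_decomposition cs C \<epsilon> u S w z" and eps: "0 < \<epsilon>" "\<epsilon> \<le> 1"
  shows "0 \<le> C" "decomposed (2 * C) (\<epsilon> powr (- 1 / 2)) (sqrt (cs / \<epsilon>)) (\<lambda>x y. u (x, y))"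
proof -
  let ?a = "sqrt (cs / \<epsilon>)"
  have ck: "Ck_closure 4 S" "\<And>k. k \<in> {1..4} \<Longrightarrow> Ck_closure 4 (w k)" "\<And>k. k \<in> {1..4} \<Longrightarrow> Ck_closure 4 (z k)"
    and us: "\<And>p. p \<in> closure Omega \<Longrightarrow> u p = S p + ((\<Sum>k=1..4. w k p) + (\<Sum>k=1..4. z k p))"
    using ld unfolding layer_decomposition_def by auto
  have bd: "let a = ?a in
       \<bar>pd m n S (x, y)\<bar> \<le> C * (1 + \<epsilon> powr (1 - real (m + n) / 2)) \<and>
       \<bar>pd m n (w 1) (x, y)\<bar>
         \<le> C * (1 + \<epsilon> powr (1 - real m / 2)) * \<epsilon> powr (- real n / 2) * exp (- y * a) \<and>
       \<bar>pd m n (w 2) (x, y)\<bar>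
         \<le> C * (1 + \<epsilon> powr (1 - real n / 2)) * \<epsilon> powr (- real m / 2) * exp (- (1 - x) * a) \<and>
       \<bar>pd m n (w 3) (x, y)\<bar>
         \<le> C * (1 + \<epsilon> powr (1 - real m / 2)) * \<epsilon> powr (- real n / 2) * exp (- (1 - y) * a) \<and>
       \<bar>pd m n (w 4) (x, y)\<bar>
         \<le> C * (1 + \<epsilon> powr (1 - real n / 2)) * \<epsilon> powr (- real m / 2) * exp (- x * a) \<and>
       \<bar>pd m n (z 1) (x, y)\<bar>
         \<le> C * \<epsilon> powr (- real (m + n) / 2) * exp (- (x + y) * a) \<and>
       \<bar>pd m n (z 2) (x, y)\<bar>
         \<le> C * \<epsilon> powr (- real (m + n) / 2) * exp (- ((1 - x) + y) * a) \<and>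
       \<bar>pd m n (z 3) (x, y)\<bar>
         \<le> C * \<epsilon> powr (- real (m + n) / 2) * exp (- ((1 - x) + (1 - y)) * a) \<and>
       \<bar>pd m n (z 4) (x, y)\<bar>
         \<le> C * \<epsilon> powr (- real (m + n) / 2) * exp (- (x + (1 - y)) * a)"
    if "m + n \<le> 4" "x \<in> {0..1}" "y \<in> {0..1}" for m n x y
    using ld that unfolding layer_decomposition_def closure_Omega by blast
  note bd = bd[unfolded Let_def]
  have "0 \<le> C * (1 + \<epsilon> powr (1 - real (0 + 0) / 2))"
    using bd[of 0 0 0 0] by (auto intro: order_trans[OF abs_ge_zero])
  moreover have "0 < 1 + \<epsilon> powr (1 - real (0 + 0) / 2)" by (simp add: add_pos_nonneg)
  ultimately show C: "0 \<le> C" by (simp add: zero_le_mult_iff)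
  \<comment> \<open>The first index is the behaviour in x, the second that in y: \<open>w 4\<close>
    and \<open>w 2\<close> are layers at x = 0 and x = 1, \<open>w 1\<close> and \<open>w 3\<close>
    at y = 0 and y = 1, and both indices are nonzero for corners.\<close>
  define G where "G i j = (if i = 0 then (if j = 0 then S else if j = 1 then w 1 else w 3)
     else if i = 1 then (if j = 0 then w 4 else if j = 1 then z 1 else z 4)
     else (if j = 0 then w 2 else if j = 1 then z 2 else z 3))" for i j :: nat
  have lb: "layer_bound (2 * C) (\<epsilon> powr (- 1 / 2)) ?a i j (\<lambda>m n x y. pd m n (G i j) (x, y))" if "i < 3" "j < 3" for i j
  proof (rule layer_bound_pd[OF C eps])
    fix m n :: nat and x y :: real
    assume mn: "m + n \<le> 4" and xy: "x \<in> {0..1}" "y \<in> {0..1}"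
    have e: "exp (- v * ?a) = exp (- (?a * v))" and e': "exp (- (?a * (v + v'))) = exp (- (?a * v)) * exp (- (?a * v'))" for v v'
      by (simp_all add: exp_add[symmetric] algebra_simps)
    note B = bd[OF mn xy, unfolded e]
    have ij: "i = 0 \<or> i = 1 \<or> i = 2" "j = 0 \<or> j = 1 \<or> j = 2" using \<open>i < 3\<close> \<open>j < 3\<close> by auto
    have ac: "p * q * r' * s' = p * (q * r') * (1 * s')" "p * q * r' * s' = p * (q * r') * (s' * 1)"
      "p * r' * (s' * q) = p * (1 * r') * (s' * q)" for p q r' s' :: real by simp_all
    have B0: "\<bar>pd m n S (x, y)\<bar> \<le> C * ((1 + \<epsilon> powr (1 - real (m + n) / 2)) * \<epsilon> powr (- real 0 / 2)) * (1 * 1)"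
      using B eps by simp
    have B1: "\<bar>pd m n (w 1) (x, y)\<bar> \<le> C * ((1 + \<epsilon> powr (1 - real m / 2)) * \<epsilon> powr (- real n / 2)) * (1 * exp (- (?a * y)))"
      "\<bar>pd m n (w 3) (x, y)\<bar> \<le> C * ((1 + \<epsilon> powr (1 - real m / 2)) * \<epsilon> powr (- real n / 2)) * (1 * exp (- (?a * (1 - y))))"
      using B unfolding ac(1) by blast+
    have B2: "\<bar>pd m n (w 4) (x, y)\<bar> \<le> C * ((1 + \<epsilon> powr (1 - real n / 2)) * \<epsilon> powr (- real m / 2)) * (exp (- (?a * x)) * 1)"
      "\<bar>pd m n (w 2) (x, y)\<bar> \<le> C * ((1 + \<epsilon> powr (1 - real n / 2)) * \<epsilon> powr (- real m / 2)) * (exp (- (?a * (1 - x))) * 1)"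
      using B unfolding ac(2) by blast+
    have B3: "\<bar>pd m n (z 1) (x, y)\<bar> \<le> C * (1 * \<epsilon> powr (- real (m + n) / 2)) * (exp (- (?a * x)) * exp (- (?a * y)))"
      "\<bar>pd m n (z 2) (x, y)\<bar> \<le> C * (1 * \<epsilon> powr (- real (m + n) / 2)) * (exp (- (?a * (1 - x))) * exp (- (?a * y)))"
      "\<bar>pd m n (z 3) (x, y)\<bar> \<le> C * (1 * \<epsilon> powr (- real (m + n) / 2)) * (exp (- (?a * (1 - x))) * exp (- (?a * (1 - y))))"
      "\<bar>pd m n (z 4) (x, y)\<bar> \<le> C * (1 * \<epsilon> powr (- real (m + n) / 2)) * (exp (- (?a * x)) * exp (- (?a * (1 - y))))"
      using B by (simp_all only: mult_1_left e')
    have ex: "expn 0 * m + expn 0 * n = 0" "expn 0 * m + expn 1 * n = n" "expn 0 * m + expn 2 * n = n"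
      "expn 1 * m + expn 0 * n = m" "expn 2 * m + expn 0 * n = m" "expn 1 * m + expn 1 * n = m + n"
      "expn 1 * m + expn 2 * n = m + n" "expn 2 * m + expn 1 * n = m + n" "expn 2 * m + expn 2 * n = m + n"
      by (simp_all add: expn_def)
    have G: "G 0 0 = S" "G 0 1 = w 1" "G 0 2 = w 3" "G 1 0 = w 4" "G 1 1 = z 1" "G 1 2 = z 4" "G 2 0 = w 2" "G 2 1 = z 2" "G 2 2 = z 3"
      by (simp_all add: G_def)
    have p: "prof ?a 0 v = 1" "prof ?a 1 v = exp (- (?a * v))" "prof ?a 2 v = exp (- (?a * (1 - v)))" for v
      by (simp_all add: prof_def)
    have nz: "(1::nat) = 0 \<longleftrightarrow> False" "(2::nat) = 0 \<longleftrightarrow> False" by simp_all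
    show "\<bar>pd m n (G i j) (x, y)\<bar> \<le> C * ((if i = 0 \<and> j = 0 then 1 + \<epsilon> powr (1 - real (m + n) / 2)
         else if i = 0 then 1 + \<epsilon> powr (1 - real m / 2) else if j = 0 then 1 + \<epsilon> powr (1 - real n / 2) else 1)
         * (\<epsilon> powr (- real (expn i * m + expn j * n) / 2))) * (prof ?a i x * prof ?a j y)"
      using ij
      by (elim disjE)
        (simp_all only: ex G p nz simp_thms if_True if_False HOL.refl B0 B1 B2 B3)
  qed
  have "jet (\<lambda>m n x y. pd m n (G i j) (x, y))" if "i < 3" "j < 3" for i j
    by (rule jet_pd) (auto simp: G_def intro: ck)
  moreover have "u (x, y) = (\<Sum>i<3. \<Sum>j<3. pd 0 0 (G i j) (x, y))" if "x \<in> {0..1}" "y \<in> {0..1}" for x y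
    using us[of "(x, y)"] that
    by (simp add: closure_Omega pd_def G_def numeral_eq_Suc atLeastAtMostSuc_conv)
  ultimately show "decomposed (2 * C) (\<epsilon> powr (- 1 / 2)) ?a (\<lambda>x y. u (x, y))"
    unfolding decomposed_def using lb
    by (intro exI[of _ "\<lambda>i j m n x y. pd m n (G i j) (x, y)"] conjI allI impI ballI) assumption+
qed

section \<open>Bounds for the interpolation errors\<close>

lemma prof_pos: "0 < prof a i x"
  by (simp add: prof_def)

lemma prof_le_1: "0 \<le> a \<Longrightarrow> x \<in> {0..1} \<Longrightarrow> prof a i x \<le> 1"
  by (simp add: prof_def)

lemma cont_prof: "cont (prof a i)"
proof -
  consider "i = 0" | "i = 1" | "i \<noteq> 0" "i \<noteq> 1" by blast
  then show ?thesis unfolding prof_def[abs_def] by cases (auto intro!: continuous_intros)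
qed

lemma (in mesh) interp_sum: "interp (\<lambda>z. \<Sum>j\<in>S. f j z) x = (\<Sum>j\<in>S. interp (f j) x)"
  unfolding interp_def pl_def sum_distrib_right by (rule sum.swap)

lemma (in mesh) interp_cong: "(\<And>z. z \<in> {0..1} \<Longrightarrow> f z = g z) \<Longrightarrow> interp f x = interp g x"
  unfolding interp_def pl_def using t_in by (intro sum.cong) auto

text \<open>In every cell either the layers are resolved or they are negligible.\<close>

locale layer_mesh = mesh +
  fixes a r A \<delta> \<nu> H :: real
  assumes a: "0 < a" and r: "0 \<le> r" and A: "0 \<le> A" and \<delta>: "0 \<le> \<delta>" and \<nu>: "0 \<le> \<nu>"
    and width: "\<And>k. k < M \<Longrightarrow> t (Suc k) - t k \<le> H"
    and cell: "\<And>k. k < M \<Longrightarrow>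
      ((t (Suc k) - t k) * a \<le> A \<and> (t (Suc k) - t k)\<^sup>2 * r\<^sup>2 \<le> \<delta>) \<or>
      (\<forall>x\<in>{t k..t (Suc k)}. exp (- (a * x)) \<le> \<nu> \<and> exp (- (a * (1 - x))) \<le> \<nu>)"
begin

lemma H_nonneg: "0 \<le> H"
proof -
  have "0 < t (Suc 0) - t 0" by simp
  then show ?thesis using width[OF M_pos] by linarith
qed

text \<open>Size of an interpolation error when only the size of the function is used: a profile
  survives up to the floor \<nu>, which accounts for cells that do not resolve the layer.\<close>

definition stab :: "nat \<Rightarrow> real \<Rightarrow> real"
  where "stab i x = (if i = 0 then 1 else prof a i x + \<nu>)"

text \<open>Size of an interpolation error when second derivatives are used: the squared mesh width
  for smooth behaviour; for a layer, the gain \<delta> on resolving cells and the floor \<nu>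
  elsewhere.\<close>

definition tau :: "nat \<Rightarrow> real \<Rightarrow> real"
  where "tau i x = (if i = 0 then H\<^sup>2 else \<delta> * prof a i x + \<nu>)"

text \<open>On a resolving cell \<open>a\<close> times the width is at most \<open>A\<close>, so the
  exponentials vary there by at most the factor \<open>exp A\<close>.\<close>

lemma prof_cell_cases:
  assumes k: "k < M" and x: "x \<in> {t k..t (Suc k)}" and "i \<noteq> 0"
  obtains "\<And>z. z \<in> {t k..t (Suc k)} \<Longrightarrow> prof a i z \<le> exp A * prof a i x" "(t (Suc k) - t k)\<^sup>2 * r\<^sup>2 \<le> \<delta>"
    | "\<And>z. z \<in> {t k..t (Suc k)} \<Longrightarrow> prof a i z \<le> \<nu>"
proof (cases "\<forall>x\<in>{t k..t (Suc k)}. exp (- (a * x)) \<le> \<nu> \<and> exp (- (a * (1 - x))) \<le> \<nu>")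
  case True
  show ?thesis by (rule that(2)) (use True \<open>i \<noteq> 0\<close> in \<open>auto simp: prof_def\<close>)
next
  case False
  then have h: "(t (Suc k) - t k) * a \<le> A" "(t (Suc k) - t k)\<^sup>2 * r\<^sup>2 \<le> \<delta>" using cell[OF k] by auto
  have "prof a i z \<le> exp A * prof a i x" if z: "z \<in> {t k..t (Suc k)}" for z
  proof -
    have "a * (x - z) \<le> a * (t (Suc k) - t k)" "a * (z - x) \<le> a * (t (Suc k) - t k)"
      using x z a by (auto intro!: mult_left_mono)
    then have "a * (x - z) \<le> A" "a * (z - x) \<le> A" using h(1) by (auto simp: mult.commute)
    then have "- (a * z) \<le> A + - (a * x)" "- (a * (1 - z)) \<le> A + - (a * (1 - x))"
      by (auto simp: algebra_simps)
    then show ?thesis using \<open>i \<noteq> 0\<close> by (simp add: prof_def exp_add[symmetric])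
  qed
  then show ?thesis using h(2) that(1) by blast
qed

lemma exp_A: "1 \<le> exp A" using A by simp

lemma err_stable:
  assumes D: "0 \<le> D" and f: "\<And>z. z \<in> {0..1} \<Longrightarrow> \<bar>f z\<bar> \<le> D * prof a i z" and x: "x \<in> {0..1}"
  shows "\<bar>f x - interp f x\<bar> \<le> 2 * exp A * D * stab i x"
proof -
  obtain k where k: "k < M" "x \<in> {t k..t (Suc k)}" using ex_cell x by blast
  have f': "\<bar>f z\<bar> \<le> D * prof a i z" if "z \<in> {t k..t (Suc k)}" for z using f cell_sub[OF k(1) that] by blast
  show ?thesis
  proof (cases "i = 0")
    case True
    have "\<bar>f x - interp f x\<bar> \<le> 2 * D"
      by (rule interp_err_0[OF k]) (use f' True in \<open>auto simp: prof_def\<close>)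
    also have "\<dots> \<le> 2 * exp A * D" using mult_right_mono[OF exp_A, of "2 * D"] D by (simp add: mult_ac)
    finally show ?thesis using True by (simp add: stab_def)
  next
    case False
    from k(1) k(2) False show ?thesis
    proof (rule prof_cell_cases)
      assume p: "\<And>z. z \<in> {t k..t (Suc k)} \<Longrightarrow> prof a i z \<le> exp A * prof a i x"
      have "\<bar>f x - interp f x\<bar> \<le> 2 * (D * (exp A * prof a i x))"
        by (rule interp_err_0[OF k]) (rule order_trans[OF f' mult_left_mono[OF p D]])
      also have "\<dots> \<le> 2 * exp A * D * (prof a i x + \<nu>)"
        using D \<nu> by (simp add: algebra_simps)
      finally show ?thesis using False by (simp add: stab_def)
    next
      assume p: "\<And>z. z \<in> {t k..t (Suc k)} \<Longrightarrow> prof a i z \<le> \<nu>"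
      have "\<bar>f x - interp f x\<bar> \<le> 2 * (D * \<nu>)"
        by (rule interp_err_0[OF k]) (rule order_trans[OF f' mult_left_mono[OF p D]])
      also have "\<dots> \<le> 2 * exp A * D * \<nu>" using mult_right_mono[OF exp_A, of "2 * D * \<nu>"] D \<nu> by (simp add: mult_ac)
      also have "\<dots> \<le> 2 * exp A * D * (prof a i x + \<nu>)"
        using D prof_pos[of a i x] by (intro mult_left_mono) auto
      finally show ?thesis using False by (simp add: stab_def)
    qed
  qed
qed

lemma err_second:
  assumes D: "0 \<le> D" and f: "\<And>z. z \<in> {0..1} \<Longrightarrow> \<bar>f z\<bar> \<le> D * prof a i z"
    and f2: "\<And>z. z \<in> {0..1} \<Longrightarrow> \<bar>f'' z\<bar> \<le> D * r ^ (expn i * 2) * prof a i z"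
    and d: "\<And>x. x \<in> {0..1} \<Longrightarrow> (f has_vector_derivative f' x) (at x within {0..1})"
    and d2: "\<And>x. x \<in> {0..1} \<Longrightarrow> (f' has_vector_derivative f'' x) (at x within {0..1})"
    and x: "x \<in> {0..1}"
  shows "\<bar>f x - interp f x\<bar> \<le> 2 * exp A * D * tau i x"
proof -
  obtain k where k: "k < M" "x \<in> {t k..t (Suc k)}" using ex_cell x by blast
  define h where "h = t (Suc k) - t k"
  have h: "0 \<le> h" "h \<le> H" using width[OF k(1)] by (auto simp: h_def less_imp_le)
  have f': "\<bar>f z\<bar> \<le> D * prof a i z" "\<bar>f'' z\<bar> \<le> D * r ^ (expn i * 2) * prof a i z" if "z \<in> {t k..t (Suc k)}" for z
    using f f2 cell_sub[OF k(1) that] by blast+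
  show ?thesis
  proof (cases "i = 0")
    case True
    have "\<bar>f x - interp f x\<bar> \<le> h\<^sup>2 * D" unfolding h_def
      by (rule interp_err_2[OF k d d2]) (use f'(2) True in \<open>auto simp: prof_def expn_def\<close>)
    also have "\<dots> \<le> H\<^sup>2 * D" using h D by (intro mult_right_mono power_mono) auto
    also have "\<dots> \<le> (2 * exp A) * (D * H\<^sup>2)"
      using mult_right_mono[of 1 "2 * exp A" "D * H\<^sup>2"] exp_A D by (simp add: mult_ac)
    finally show ?thesis using True by (simp add: tau_def mult_ac)
  next
    case False
    from k(1) k(2) False show ?thesis
    proof (rule prof_cell_cases)
      assume p: "\<And>z. z \<in> {t k..t (Suc k)} \<Longrightarrow> prof a i z \<le> exp A * prof a i x" and dl: "(t (Suc k) - t k)\<^sup>2 * r\<^sup>2 \<le> \<delta>"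
      have "\<bar>f x - interp f x\<bar> \<le> h\<^sup>2 * (D * r\<^sup>2 * (exp A * prof a i x))" unfolding h_def
      proof (rule interp_err_2[OF k d d2])
        fix z assume z: "z \<in> {t k..t (Suc k)}"
        have "\<bar>f'' z\<bar> \<le> D * r\<^sup>2 * prof a i z" using f'(2)[OF z] False by (simp add: expn_def)
        also have "\<dots> \<le> D * r\<^sup>2 * (exp A * prof a i x)" using D by (intro mult_left_mono p z) auto
        finally show "\<bar>f'' z\<bar> \<le> D * r\<^sup>2 * (exp A * prof a i x)" .
      qed
      also have "\<dots> = (h\<^sup>2 * r\<^sup>2) * (exp A * D * prof a i x)" by (simp add: mult_ac)
      also have "\<dots> \<le> \<delta> * (exp A * D * prof a i x)"
        using dl D prof_pos[of a i x] unfolding h_def by (intro mult_right_mono) (auto simp: less_imp_le)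
      also have "\<dots> \<le> 2 * exp A * D * (\<delta> * prof a i x + \<nu>)"
      proof -
        have "0 \<le> \<delta> * (exp A * D * prof a i x)" "0 \<le> 2 * exp A * D * \<nu>" using \<delta> D \<nu> prof_pos[of a i x] by auto
        then show ?thesis by (simp add: algebra_simps)
      qed
      finally show ?thesis using False by (simp add: tau_def)
    next
      assume p: "\<And>z. z \<in> {t k..t (Suc k)} \<Longrightarrow> prof a i z \<le> \<nu>"
      have "\<bar>f x - interp f x\<bar> \<le> 2 * (D * \<nu>)"
        by (rule interp_err_0[OF k]) (rule order_trans[OF f'(1) mult_left_mono[OF p D]])
      also have "\<dots> \<le> 2 * exp A * D * \<nu>" using mult_right_mono[OF exp_A, of "2 * D * \<nu>"] D \<nu> by (simp add: mult_ac)
      also have "\<dots> \<le> 2 * exp A * D * (\<delta> * prof a i x + \<nu>)"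
        using D \<delta> prof_pos[of a i x] by (intro mult_left_mono) auto
      finally show ?thesis using False by (simp add: tau_def)
    qed
  qed
qed

lemma err_first:
  assumes f: "\<And>z. z \<in> {0..1} \<Longrightarrow> \<bar>f' z\<bar> \<le> D"
    and d: "\<And>x. x \<in> {0..1} \<Longrightarrow> (f has_vector_derivative f' x) (at x within {0..1})"
    and x: "x \<in> {0..1}"
  shows "\<bar>f x - interp f x\<bar> \<le> H * D"
proof -
  obtain k where k: "k < M" "x \<in> {t k..t (Suc k)}" using ex_cell x by blast
  have D: "0 \<le> D" using f[OF x] by linarith
  have "\<bar>f x - interp f x\<bar> \<le> (t (Suc k) - t k) * D"
    by (rule interp_err_1[OF k d]) (use f cell_sub[OF k(1)] in auto)
  also have "\<dots> \<le> H * D" by (rule mult_right_mono[OF width[OF k(1)] D])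
  finally show ?thesis .
qed

end

locale layer2 = ritz2 s t M K \<epsilon> c + X: layer_mesh s M a r A \<delta> \<nu> HX + Y: layer_mesh t K a r A \<delta> \<nu> HY
  for s t M K \<epsilon> c a r A \<delta> \<nu> HX HY +
  fixes D :: real and u :: "real \<Rightarrow> real \<Rightarrow> real" and g :: "nat \<Rightarrow> nat \<Rightarrow> nat \<Rightarrow> nat \<Rightarrow> real \<Rightarrow> real \<Rightarrow> real"
  assumes D: "0 \<le> D"
    and jet: "\<And>i j. i < 3 \<Longrightarrow> j < 3 \<Longrightarrow> jet (g i j)"
    and lb: "\<And>i j. i < 3 \<Longrightarrow> j < 3 \<Longrightarrow> layer_bound D r a i j (g i j)"
    and u: "\<And>x y. x \<in> {0..1} \<Longrightarrow> y \<in> {0..1} \<Longrightarrow> u x y = (\<Sum>i<3. \<Sum>j<3. g i j 0 0 x y)"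
begin

lemma gb:
  assumes "i < 3" "j < 3" "m + n \<le> 2 \<or> (m = 1 \<and> n = 2 \<or> m = 2 \<and> n = 1) \<and> \<not> (i = 0 \<and> j = 0)"
    "x \<in> {0..1}" "y \<in> {0..1}"
  shows "\<bar>g i j m n x y\<bar> \<le> D * r ^ (expn i * m + expn j * n) * prof a i x * prof a j y"
  using lb[OF assms(1,2)] assms(3-5) unfolding layer_bound_def by blast

definition ux :: "real \<Rightarrow> real \<Rightarrow> real"
  where "ux x y = (\<Sum>i<3. \<Sum>j<3. g i j 1 0 x y)"

lemma cont2_u: "cont2 u"
proof -
  have "cont2 (\<lambda>x y. \<Sum>i<3. \<Sum>j<3. g i j 0 0 x y)"
    by (intro cont2_sum jet_cont(1)[OF jet]) auto
  then show ?thesis unfolding cont2_def by (rule continuous_on_eq) (auto intro!: u[symmetric])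
qed

lemma cont2_ux: "cont2 ux"
  unfolding ux_def[abs_def] by (intro cont2_sum jet_cont(2)[OF jet]) auto

lemma ux_deriv:
  assumes "x \<in> {0..1}" "y \<in> {0..1}"
  shows "((\<lambda>x. u x y) has_vector_derivative ux x y) (at x within {0..1})"
proof -
  have "((\<lambda>x. \<Sum>i<3. \<Sum>j<3. g i j 0 0 x y) has_vector_derivative ux x y) (at x within {0..1})"
    unfolding ux_def using jet_dx[OF jet, of _ _ 0 0] assms
    by (intro has_vector_derivative_sum) auto
  then show ?thesis by (rule has_vector_derivative_transform[OF assms(1), rotated]) (rule u[OF _ assms(2)])
qed

lemma yerr_sum:
  assumes "\<And>y. y \<in> {0..1} \<Longrightarrow> f y = (\<Sum>i<3::nat. \<Sum>j<3::nat. h i j y)" "y \<in> {0..1}"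
  shows "f y - Y.interp f y = (\<Sum>i<3. \<Sum>j<3. h i j y - Y.interp (h i j) y)"
proof -
  have "Y.interp f y = (\<Sum>i<3. \<Sum>j<3. Y.interp (h i j) y)"
    using Y.interp_cong[of f "\<lambda>y. \<Sum>i<3. \<Sum>j<3. h i j y" y] assms(1) by (simp add: Y.interp_sum)
  then show ?thesis using assms by (simp add: sum_subtractf)
qed

lemma xerr_sum:
  assumes "\<And>y. y \<in> {0..1} \<Longrightarrow> f y = (\<Sum>i<3::nat. \<Sum>j<3::nat. h i j y)" "y \<in> {0..1}"
  shows "f y - X.interp f y = (\<Sum>i<3. \<Sum>j<3. h i j y - X.interp (h i j) y)"
proof -
  have "X.interp f y = (\<Sum>i<3. \<Sum>j<3. X.interp (h i j) y)"
    using X.interp_cong[of f "\<lambda>y. \<Sum>i<3. \<Sum>j<3. h i j y" y] assms(1) by (simp add: X.interp_sum)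
  then show ?thesis using assms by (simp add: sum_subtractf)
qed

lemma yerr_bound:
  assumes ij: "i < 3" "j < 3" and x: "x \<in> {0..1}" and y: "y \<in> {0..1}"
  shows "\<bar>g i j 0 0 x y - Y.interp (g i j 0 0 x) y\<bar> \<le> 2 * exp A * (D * prof a i x) * Y.tau j y"
proof (rule Y.err_second[where f' = "g i j 0 1 x" and f'' = "g i j 0 2 x"])
  show "0 \<le> D * prof a i x" using D prof_pos[of a i x] by simp
  show "\<bar>g i j 0 0 x z\<bar> \<le> D * prof a i x * prof a j z" if "z \<in> {0..1}" for z
    using gb[OF ij, of 0 0, OF _ x that] by simp
  show "\<bar>g i j 0 2 x z\<bar> \<le> D * prof a i x * r ^ (expn j * 2) * prof a j z" if "z \<in> {0..1}" for z
    using gb[OF ij, of 0 2, OF _ x that] by (simp add: mult_ac)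
  show "(g i j 0 0 x has_vector_derivative g i j 0 1 x z) (at z within {0..1})" if "z \<in> {0..1}" for z
    using jet_dy[OF jet[OF ij], of 0 0, OF _ _ x that] by simp
  show "(g i j 0 1 x has_vector_derivative g i j 0 2 x z) (at z within {0..1})" if "z \<in> {0..1}" for z
    using jet_dy[OF jet[OF ij], of 0 1, OF _ _ x that] by (simp add: numeral_2_eq_2)
qed (rule y)

text \<open>Two y-derivatives of an x-derivative are of third order and bounded suitably for layer
  terms only; in \<open>ux_err_bound\<close> the smooth part is treated by \<open>err_first\<close>
  instead.\<close>

lemma yerr_x_bound:
  assumes ij: "i < 3" "j < 3" and x: "x \<in> {0..1}" and y: "y \<in> {0..1}" and n0: "\<not> (i = 0 \<and> j = 0)"
  shows "\<bar>g i j 1 0 x y - Y.interp (g i j 1 0 x) y\<bar> \<le> 2 * exp A * (D * r ^ expn i * prof a i x) * Y.tau j y"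
proof (rule Y.err_second[where f' = "g i j 1 1 x" and f'' = "g i j 1 2 x"])
  show "0 \<le> D * r ^ expn i * prof a i x" using D X.r prof_pos[of a i x] by simp
  show "\<bar>g i j 1 0 x z\<bar> \<le> D * r ^ expn i * prof a i x * prof a j z" if "z \<in> {0..1}" for z
    using gb[OF ij, of 1 0, OF _ x that] by simp
  show "\<bar>g i j 1 2 x z\<bar> \<le> D * r ^ expn i * prof a i x * r ^ (expn j * 2) * prof a j z" if "z \<in> {0..1}" for z
    using gb[OF ij, of 1 2, OF _ x that] n0 by (simp add: mult_ac power_add)
  show "(g i j 1 0 x has_vector_derivative g i j 1 1 x z) (at z within {0..1})" if "z \<in> {0..1}" for z
    using jet_dy[OF jet[OF ij], of 1 0, OF _ _ x that] by simp
  show "(g i j 1 1 x has_vector_derivative g i j 1 2 x z) (at z within {0..1})" if "z \<in> {0..1}" for z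
    using jet_dy[OF jet[OF ij], of 1 1, OF _ _ x that] by (simp add: numeral_2_eq_2)
qed (rule y)

lemma xerr_bound:
  assumes ij: "i < 3" "j < 3" and x: "x \<in> {0..1}" and y: "y \<in> {0..1}"
  shows "\<bar>err1 (g i j 0 0) x y\<bar> \<le> 2 * exp A * (D * prof a j y) * X.tau i x"
  unfolding err1_def
proof (rule X.err_second[where f' = "\<lambda>x. g i j 1 0 x y" and f'' = "\<lambda>x. g i j 2 0 x y"])
  show "0 \<le> D * prof a j y" using D prof_pos[of a j y] by simp
  show "\<bar>g i j 0 0 z y\<bar> \<le> D * prof a j y * prof a i z" if "z \<in> {0..1}" for z
    using gb[OF ij, of 0 0, OF _ that y] by (simp add: mult_ac)
  show "\<bar>g i j 2 0 z y\<bar> \<le> D * prof a j y * r ^ (expn i * 2) * prof a i z" if "z \<in> {0..1}" for z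
    using gb[OF ij, of 2 0, OF _ that y] by (simp add: mult_ac)
  show "((\<lambda>x. g i j 0 0 x y) has_vector_derivative g i j 1 0 z y) (at z within {0..1})" if "z \<in> {0..1}" for z
    using jet_dx[OF jet[OF ij], of 0 0, OF _ _ that y] by simp
  show "((\<lambda>x. g i j 1 0 x y) has_vector_derivative g i j 2 0 z y) (at z within {0..1})" if "z \<in> {0..1}" for z
    using jet_dx[OF jet[OF ij], of 1 0, OF _ _ that y] by (simp add: numeral_2_eq_2)
qed (rule x)

lemma err2_bound_x:
  assumes ij: "i < 3" "j < 3" and x: "x \<in> {0..1}" and y: "y \<in> {0..1}"
  shows "\<bar>err2 (g i j 0 0) x y\<bar> \<le> 4 * (exp A)\<^sup>2 * D * (X.tau i x * Y.stab j y)"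
proof -
  have tau: "0 \<le> X.tau i x" using X.\<delta> X.\<nu> prof_pos[of a i x] by (simp add: X.tau_def)
  have "\<bar>err2 (g i j 0 0) x y\<bar> \<le> 2 * exp A * (2 * exp A * D * X.tau i x) * Y.stab j y"
    unfolding err2_def
  proof (rule Y.err_stable[OF _ _ y])
    show "0 \<le> 2 * exp A * D * X.tau i x" using D tau by simp
    show "\<bar>err1 (g i j 0 0) x z\<bar> \<le> 2 * exp A * D * X.tau i x * prof a j z" if "z \<in> {0..1}" for z
      using xerr_bound[OF ij x that] by (simp add: mult_ac)
  qed
  then show ?thesis by (simp add: power2_eq_square mult_ac)
qed

text \<open>With the order of the interpolations exchanged, the second-order gain can be taken in y,
  with mere stability in x.\<close>

lemma err2_commute:
  assumes k: "cont2 k" and x: "x \<in> {0..1}" and y: "y \<in> {0..1}"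
  shows "err2 k x y = (k x y - Y.interp (k x) y) - X.interp (\<lambda>s. k s y - Y.interp (k s) y) x"
proof -
  have "Y.interp (err1 k x) y = Y.interp (k x) y - Y.interp (\<lambda>r. X.interp (\<lambda>s. k s r) x) y"
    unfolding err1_def[abs_def]
    by (rule fin_op_diff[OF Y.fin_op_interp cont2_row[OF k x] cont2_row[OF fin_op_cont2[OF X.fin_op_interp k] x]])
  also have "Y.interp (\<lambda>r. X.interp (\<lambda>s. k s r) x) y = X.interp (\<lambda>s. Y.interp (k s) y) x"
    by (rule fin_op_commute[OF X.fin_op_interp Y.fin_op_interp k, symmetric])
  finally have 1: "Y.interp (err1 k x) y = Y.interp (k x) y - X.interp (\<lambda>s. Y.interp (k s) y) x" .
  have 2: "X.interp (\<lambda>s. k s y - Y.interp (k s) y) x = X.interp (\<lambda>s. k s y) x - X.interp (\<lambda>s. Y.interp (k s) y) x"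
    by (rule fin_op_diff[OF X.fin_op_interp cont2_col[OF k y] cont2_col[OF fin_op_cont2'[OF Y.fin_op_interp k] y]])
  show ?thesis unfolding err2_def 1 2 by (simp add: err1_def)
qed

lemma err2_bound_y:
  assumes ij: "i < 3" "j < 3" and x: "x \<in> {0..1}" and y: "y \<in> {0..1}"
  shows "\<bar>err2 (g i j 0 0) x y\<bar> \<le> 4 * (exp A)\<^sup>2 * D * (X.stab i x * Y.tau j y)"
proof -
  have tau: "0 \<le> Y.tau j y" using X.\<delta> X.\<nu> prof_pos[of a j y] by (simp add: Y.tau_def)
  have "\<bar>err2 (g i j 0 0) x y\<bar> \<le> 2 * exp A * (2 * exp A * D * Y.tau j y) * X.stab i x"
    unfolding err2_commute[OF jet_cont(1)[OF jet[OF ij]] x y]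
  proof (rule X.err_stable[OF _ _ x])
    show "0 \<le> 2 * exp A * D * Y.tau j y" using D tau by simp
    show "\<bar>g i j 0 0 z y - Y.interp (g i j 0 0 z) y\<bar> \<le> 2 * exp A * D * Y.tau j y * prof a i z" if "z \<in> {0..1}" for z
      using yerr_bound[OF ij that y] by (simp add: mult_ac)
  qed
  then show ?thesis by (simp add: power2_eq_square mult_ac)
qed

lemma err2_sum:
  assumes x: "x \<in> {0..1}" and y: "y \<in> {0..1}"
  shows "err2 u x y = (\<Sum>i<3. \<Sum>j<3. err2 (g i j 0 0) x y)"
proof -
  have "err1 u x z = (\<Sum>i<3. \<Sum>j<3. err1 (g i j 0 0) x z)" if "z \<in> {0..1}" for z
    unfolding err1_def by (rule xerr_sum[OF u[OF _ that] x])
  from yerr_sum[of "err1 u x" "\<lambda>i j. err1 (g i j 0 0) x", OF this y] show ?thesis unfolding err2_def .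
qed

definition ee :: "real \<Rightarrow> real" where "ee x = prof a 1 x + prof a 2 x"

lemma ee: "0 \<le> ee x" "x \<in> {0..1} \<Longrightarrow> ee x \<le> 2"
  using prof_pos[of a 1 x] prof_pos[of a 2 x] prof_le_1[of a x 1] prof_le_1[of a x 2] X.a unfolding ee_def by auto

lemma cont_ee: "cont ee"
  unfolding ee_def[abs_def] by (intro continuous_intros cont_prof)

lemma sum3: "(\<Sum>i<3::nat. f i) = f 0 + f 1 + (f 2 :: real)"
  by (simp add: numeral_3_eq_3 numeral_2_eq_2)

lemma err2_bound:
  assumes x: "x \<in> {0..1}" and y: "y \<in> {0..1}"
  shows "\<bar>err2 u x y\<bar> \<le> 4 * (exp A)\<^sup>2 * D *
    (HX\<^sup>2 * (1 + ee y + 2 * \<nu>) + (ee x + 2 * \<nu>) * HY\<^sup>2 + (\<delta> * ee x + 2 * \<nu>) * (ee y + 2 * \<nu>))"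
proof -
  let ?C = "4 * (exp A)\<^sup>2 * D"
  \<comment> \<open>Each component takes its gain where it is useful later. Smooth in x:
    \<open>HX\<^sup>2\<close>, to be paired with the factor \<open>M\<^sup>2\<close> of the same
    mesh. Layer in x but smooth in y: \<open>HY\<^sup>2\<close>, keeping the x-profile that is small
    in L2. Corner: \<delta> from x, keeping both profiles.\<close>
  define T where "T i j = (if i = 0 then X.tau i x * Y.stab j y else if j = 0 then X.stab i x * Y.tau j y else X.tau i x * Y.stab j y)" for i j
  have "\<bar>err2 u x y\<bar> \<le> (\<Sum>i<3. \<bar>\<Sum>j<3. err2 (g i j 0 0) x y\<bar>)"
    unfolding err2_sum[OF x y] by (rule sum_abs)
  also have "\<dots> \<le> (\<Sum>i<3. \<Sum>j<3. \<bar>err2 (g i j 0 0) x y\<bar>)"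
    by (intro sum_mono sum_abs)
  also have "\<dots> \<le> (\<Sum>i<3. \<Sum>j<3. ?C * T i j)"
    using err2_bound_x[OF _ _ x y] err2_bound_y[OF _ _ x y] unfolding T_def by (intro sum_mono) auto
  also have "\<dots> = ?C * (\<Sum>i<3. \<Sum>j<3. T i j)" by (simp only: sum_distrib_left)
  also have "(\<Sum>i<3. \<Sum>j<3. T i j)
    = HX\<^sup>2 * (1 + ee y + 2 * \<nu>) + (ee x + 2 * \<nu>) * HY\<^sup>2 + (\<delta> * ee x + 2 * \<nu>) * (ee y + 2 * \<nu>)"
    unfolding sum3 T_def X.tau_def Y.tau_def X.stab_def Y.stab_def ee_def by (simp add: algebra_simps)
  finally show ?thesis .
qed

lemma ux_err_bound:
  assumes x: "x \<in> {0..1}" and y: "y \<in> {0..1}"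
  shows "\<bar>ux x y - Y.interp (ux x) y\<bar> \<le> 2 * exp A * D *
    (HY + (\<delta> * ee y + 2 * \<nu>) + r * ee x * (HY\<^sup>2 + \<delta> * ee y + 2 * \<nu>))"
proof -
  let ?C = "2 * exp A * D"
  define T where "T i j = (if i = 0 \<and> j = 0 then HY else r ^ expn i * prof a i x * Y.tau j y)" for i j
  have b: "\<bar>g i j 1 0 x y - Y.interp (g i j 1 0 x) y\<bar> \<le> ?C * T i j" if ij: "i < 3" "j < 3" for i j
  proof (cases "i = 0 \<and> j = 0")
    case False
    then show ?thesis using yerr_x_bound[OF ij x y False] by (auto simp: T_def mult_ac)
  next
    case True
    have "\<bar>g i j 1 0 x y - Y.interp (g i j 1 0 x) y\<bar> \<le> HY * D"
    proof (rule Y.err_first[where f' = "g i j 1 1 x", OF _ _ y])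
      show "\<bar>g i j 1 1 x z\<bar> \<le> D" if "z \<in> {0..1}" for z
        using gb[OF ij, of 1 1, OF _ x that] True by (simp add: expn_def prof_def)
      show "(g i j 1 0 x has_vector_derivative g i j 1 1 x z) (at z within {0..1})" if "z \<in> {0..1}" for z
        using jet_dy[OF jet[OF ij], of 1 0, OF _ _ x that] by simp
    qed
    also have "\<dots> \<le> ?C * HY"
      using mult_right_mono[of 1 "2 * exp A" "HY * D"] X.exp_A D Y.H_nonneg by (simp add: mult_ac)
    finally show ?thesis using True by (simp add: T_def)
  qed
  have "ux x y - Y.interp (ux x) y = (\<Sum>i<3. \<Sum>j<3. g i j 1 0 x y - Y.interp (g i j 1 0 x) y)"
    by (rule yerr_sum[OF _ y]) (simp add: ux_def)
  then have "\<bar>ux x y - Y.interp (ux x) y\<bar> \<le> (\<Sum>i<3. \<bar>\<Sum>j<3. g i j 1 0 x y - Y.interp (g i j 1 0 x) y\<bar>)"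
    by (simp only: sum_abs)
  also have "\<dots> \<le> (\<Sum>i<3. \<Sum>j<3. \<bar>g i j 1 0 x y - Y.interp (g i j 1 0 x) y\<bar>)"
    by (intro sum_mono sum_abs)
  also have "\<dots> \<le> (\<Sum>i<3. \<Sum>j<3. ?C * T i j)" using b by (intro sum_mono) auto
  also have "\<dots> = ?C * (\<Sum>i<3. \<Sum>j<3. T i j)" by (simp only: sum_distrib_left)
  also have "(\<Sum>i<3. \<Sum>j<3. T i j) = HY + (\<delta> * ee y + 2 * \<nu>) + r * ee x * (HY\<^sup>2 + \<delta> * ee y + 2 * \<nu>)"
    unfolding sum3 T_def Y.tau_def ee_def expn_def by (simp add: prof_def algebra_simps)
  finally show ?thesis .
qed

lemma u_err_bound:
  assumes x: "x \<in> {0..1}" and y: "y \<in> {0..1}"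
  shows "\<bar>u x y - Y.interp (u x) y\<bar> \<le> 2 * exp A * D * ((1 + ee x) * (HY\<^sup>2 + \<delta> * ee y + 2 * \<nu>))"
proof -
  let ?C = "2 * exp A * D"
  have "u x y - Y.interp (u x) y = (\<Sum>i<3. \<Sum>j<3. g i j 0 0 x y - Y.interp (g i j 0 0 x) y)"
    by (rule yerr_sum[OF u[OF x] y])
  then have "\<bar>u x y - Y.interp (u x) y\<bar> \<le> (\<Sum>i<3. \<bar>\<Sum>j<3. g i j 0 0 x y - Y.interp (g i j 0 0 x) y\<bar>)"
    by (simp only: sum_abs)
  also have "\<dots> \<le> (\<Sum>i<3. \<Sum>j<3. \<bar>g i j 0 0 x y - Y.interp (g i j 0 0 x) y\<bar>)"
    by (intro sum_mono sum_abs)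
  also have "\<dots> \<le> (\<Sum>i<3. \<Sum>j<3. ?C * (prof a i x * Y.tau j y))"
    using yerr_bound[OF _ _ x y] by (intro sum_mono) (auto simp: mult_ac)
  also have "\<dots> = ?C * (\<Sum>i<3. \<Sum>j<3. prof a i x * Y.tau j y)" by (simp only: sum_distrib_left)
  also have "(\<Sum>i<3. \<Sum>j<3. prof a i x * Y.tau j y) = (1 + ee x) * (HY\<^sup>2 + \<delta> * ee y + 2 * \<nu>)"
    unfolding sum3 Y.tau_def ee_def by (simp add: prof_def algebra_simps)
  finally show ?thesis .
qed

text \<open>Interpolation in y commutes with the x-derivative, so \<open>brk_le_deriv\<close>
  applies with the interpolation error of \<open>ux\<close>.\<close>

lemma brk_interp_error:
  "X.brk (\<lambda>x y. u x y - Y.interp (u x) y) (\<lambda>x y. u x y - Y.interp (u x) y) \<le> II (\<lambda>x y. (ux x y - Y.interp (ux x) y)\<^sup>2)"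
proof (rule X.brk_le_deriv)
  show "cont2 (\<lambda>x y. u x y - Y.interp (u x) y)" "cont2 (\<lambda>x y. ux x y - Y.interp (ux x) y)"
    by (intro cont2_arith(2) fin_op_cont2'[OF Y.fin_op_interp] cont2_u cont2_ux)+
  fix x y :: real assume x: "x \<in> {0..1}" and y: "y \<in> {0..1}"
  have "((\<lambda>x. \<Sum>j\<le>K. u x (t j) * Y.hat j y) has_vector_derivative (\<Sum>j\<le>K. ux x (t j) * Y.hat j y)) (at x within {0..1})"
    unfolding has_real_derivative_iff_has_vector_derivative[symmetric]
    by (intro DERIV_sum DERIV_cmult_right) (use ux_deriv[OF x] Y.t_in in \<open>simp add: has_real_derivative_iff_has_vector_derivative\<close>)
  then show "((\<lambda>x. u x y - Y.interp (u x) y) has_vector_derivative ux x y - Y.interp (ux x) y) (at x within {0..1})"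
    unfolding Y.interp_def Y.pl_def by (intro has_vector_derivative_diff ux_deriv x y)
qed

text \<open>A squared profile integrates to the order of the layer width. Each factor
  \<open>1 / a\<close> gained here pays for one factor \<open>r\<close> that comes from
  differentiation or from \<open>1 / \<epsilon>\<close>.\<close>

lemma ee_sq_integral: "integral {0..1} (\<lambda>x. (ee x)\<^sup>2) \<le> 2 / a"
proof -
  have i: "integral {0..1} (\<lambda>x. (prof a i x)\<^sup>2) \<le> 1 / (2 * a)" if "i = 1 \<or> i = 2" for i
  proof -
    have "((\<lambda>x. exp (- (2 * a * x))) has_integral (- exp (- (2 * a * 1)) / (2 * a) - (- exp (- (2 * a * 0)) / (2 * a)))) {0..1}"
      using X.a by (intro fundamental_theorem_of_calculus)
        (auto intro!: derivative_eq_intros simp: has_real_derivative_iff_has_vector_derivative[symmetric])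
    from integral_unique[OF this]
    have 1: "integral {0..1} (\<lambda>x. exp (- (2 * a * x))) \<le> 1 / (2 * a)" using X.a by (simp add: divide_right_mono)
    have "((\<lambda>x. exp (- (2 * a * (1 - x)))) has_integral (exp (- (2 * a * (1 - 1))) / (2 * a) - exp (- (2 * a * (1 - 0))) / (2 * a))) {0..1}"
      using X.a by (intro fundamental_theorem_of_calculus)
        (auto intro!: derivative_eq_intros simp: has_real_derivative_iff_has_vector_derivative[symmetric])
    from integral_unique[OF this]
    have 2: "integral {0..1} (\<lambda>x. exp (- (2 * a * (1 - x)))) \<le> 1 / (2 * a)" using X.a by (simp add: divide_right_mono)
    have "(exp (- (a * z)))\<^sup>2 = exp (- (2 * a * z))" for z
      unfolding power2_eq_square exp_add[symmetric] by (simp add: algebra_simps)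
    then show ?thesis using that 1 2 by (auto simp: prof_def)
  qed
  have cp: "cont (\<lambda>x. 2 * (prof a i x)\<^sup>2)" for i by (intro continuous_intros cont_prof)
  have "integral {0..1} (\<lambda>x. (ee x)\<^sup>2) \<le> integral {0..1} (\<lambda>x. 2 * (prof a 1 x)\<^sup>2 + 2 * (prof a 2 x)\<^sup>2)"
    unfolding ee_def by (rule integral_mono_cont) (intro continuous_intros cont_prof sq_sum_le)+
  also have "\<dots> = integral {0..1} (\<lambda>x. 2 * (prof a 1 x)\<^sup>2) + integral {0..1} (\<lambda>x. 2 * (prof a 2 x)\<^sup>2)"
    by (rule Henstock_Kurzweil_Integration.integral_add) (intro integrable_continuous_real cp)+
  also have "\<dots> \<le> 2 * (1 / (2 * a)) + 2 * (1 / (2 * a))" using i[of 1] i[of 2] by simp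
  also have "\<dots> = 2 / a" using X.a by (simp add: field_simps)
  finally show ?thesis .
qed

lemma II_ee:
  "II (\<lambda>x y. (ee x)\<^sup>2) = integral {0..1} (\<lambda>x. (ee x)\<^sup>2)" "II (\<lambda>x y. (ee y)\<^sup>2) = integral {0..1} (\<lambda>x. (ee x)\<^sup>2)"
  "II (\<lambda>x y. (ee x * ee y)\<^sup>2) = (integral {0..1} (\<lambda>x. (ee x)\<^sup>2))\<^sup>2"
  unfolding II_def power_mult_distrib by (simp_all add: power2_eq_square)

end

section \<open>Explicit constants, and the projection errors measured by
  \<open>\<Theta>\<close>\<close>

lemma sq3_le: "((p::real) + q + w)\<^sup>2 \<le> 3 * (p\<^sup>2 + q\<^sup>2 + w\<^sup>2)"
  using zero_le_power2[of "p - q"] zero_le_power2[of "p - w"] zero_le_power2[of "q - w"]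
  by (simp add: power2_eq_square algebra_simps)

text \<open>The constants are explicit expressions, so that their independence of \<epsilon> and N
  can be read off. The arguments stand for \<open>exp A\<close>, the constant of the decomposition,
  the factor in \<delta> and the factor in the layer width.\<close>

definition Kgap :: "real \<Rightarrow> real \<Rightarrow> real \<Rightarrow> real \<Rightarrow> real"
  where "Kgap E D d0 k = 48 * E\<^sup>2 * D\<^sup>2 * ((4 + 2 * d0)\<^sup>2 + 36 * k + d0\<^sup>2 * k\<^sup>2)"

definition Kcorner :: "real \<Rightarrow> real \<Rightarrow> real \<Rightarrow> real \<Rightarrow> real"
  where "Kcorner E D d0 k = 16 * (E\<^sup>2)\<^sup>2 * D\<^sup>2 * (128 * k + 2 * d0\<^sup>2 * k\<^sup>2)"

definition Krest :: "real \<Rightarrow> real \<Rightarrow> real \<Rightarrow> real"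
  where "Krest E D d0 = (4 * E\<^sup>2 * D * (28 + 4 * d0))\<^sup>2"

definition Kmix :: "real \<Rightarrow> real \<Rightarrow> real \<Rightarrow> real \<Rightarrow> real \<Rightarrow> real \<Rightarrow> real"
  where "Kmix E D d0 k c q0 = 2 * Kgap E D d0 k + 16 * c * Kcorner E D d0 k + 64 * (18 + q0) * Krest E D d0"

definition Kmix0 :: "real \<Rightarrow> real \<Rightarrow> real \<Rightarrow> real \<Rightarrow> real"
  where "Kmix0 E D d0 k = 1152 * E\<^sup>2 * D\<^sup>2 * (36 + d0\<^sup>2 * k) + 48 * Kcorner E D d0 k + 192 * Krest E D d0"

context layer2 begin

text \<open>\<open>n1\<close> plays the role of the inverse root of N. The conditions on
  \<open>M\<close> place it between this root and N, so coarse and fine meshes are treated at once;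
  \<open>k\<close> records that the layer width is of order \<open>1 / r\<close>.\<close>

context
  fixes n1 d0 k L q0 :: real
  assumes n1: "0 < n1" "n1 \<le> 1" and HX: "HX \<le> 2 * n1" "HX * real M \<le> 2" and HY: "HY \<le> 2 * n1"
    and Mn: "1 \<le> real M * n1" "real M * n1\<^sup>2 \<le> 1"
    and d0: "0 \<le> d0" "\<delta> \<le> d0 * n1" and nu: "\<nu> \<le> n1 ^ 5"
    and r1: "1 \<le> r" "\<epsilon> * r\<^sup>2 = 1" and k: "0 \<le> k" "2 / a \<le> k / r" and L: "1 \<le> L" and q0: "0 \<le> q0"
    and Q: "\<And>\<kappa> \<beta>. cont \<kappa> \<Longrightarrow> (\<And>x. x \<in> {0..1} \<Longrightarrow> \<bar>\<kappa> x\<bar> \<le> \<beta>) \<Longrightarrow>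
       X.af (X.solve \<kappa>) (X.solve \<kappa>) \<le> (18 * (real M)\<^sup>2 + q0 * r * L) * \<beta>\<^sup>2"
begin

private abbreviation "J \<equiv> integral {0..1} (\<lambda>x. (ee x)\<^sup>2)"
private abbreviation "\<Theta> \<equiv> n1\<^sup>2 + n1 ^ 4 * r * L\<^sup>2"

lemma J: "0 \<le> J" "J * r \<le> k"
proof -
  show "0 \<le> J" by (intro integral_nonneg integrable_continuous_real continuous_intros cont_ee) auto
  have "J \<le> k / r" using ee_sq_integral k by linarith
  then show "J * r \<le> k" using r1 by (simp add: pos_le_divide_eq)
qed

lemma L2_ge: "1 \<le> L\<^sup>2"
  using L by simp

lemma nu_le: "\<nu> \<le> n1\<^sup>2" "\<nu> \<le> n1" "\<nu> \<le> 1"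
proof -
  have "n1 ^ 5 \<le> n1 ^ 2" "n1 ^ 2 \<le> n1 ^ 1"
    using power_decreasing[of 2 5 n1] power_decreasing[of 1 2 n1] n1 by simp_all
  then show "\<nu> \<le> n1\<^sup>2" "\<nu> \<le> n1" "\<nu> \<le> 1" using nu n1 by auto
qed

lemma H2: "HX\<^sup>2 \<le> 4 * n1\<^sup>2" "HY\<^sup>2 \<le> 4 * n1\<^sup>2" "HY\<^sup>2 \<le> 4"
proof -
  have "HX\<^sup>2 \<le> (2 * n1)\<^sup>2" "HY\<^sup>2 \<le> (2 * n1)\<^sup>2"
    by (rule power_mono[OF HX(1) X.H_nonneg], rule power_mono[OF HY Y.H_nonneg])
  then show a: "HX\<^sup>2 \<le> 4 * n1\<^sup>2" "HY\<^sup>2 \<le> 4 * n1\<^sup>2" by (simp_all only: power_mult_distrib) simp_all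
  have "n1\<^sup>2 \<le> 1" using n1 by (simp add: power_le_one)
  then show "HY\<^sup>2 \<le> 4" using a by linarith
qed

text \<open>All are regroupings based on \<open>J * r \<le> k\<close>, \<open>r \<ge> 1\<close> and
  \<open>L \<ge> 1\<close>; for instance \<open>r\<^sup>2 * (n1 ^ 4 * J)\<close> is
  \<open>(n1 ^ 4 * r) * (J * r)\<close>. The bounds with \<open>r\<^sup>2\<close> serve the
  seminorms, those with \<open>\<Theta> / r\<close> the L2 norms.\<close>

lemma rJ: "r\<^sup>2 * (n1 ^ 4 * J) \<le> k * \<Theta>" "r\<^sup>2 * (n1\<^sup>2 * J\<^sup>2) \<le> k\<^sup>2 * \<Theta>"
  "n1 ^ 4 * J \<le> k * (\<Theta> / r)" "n1\<^sup>2 * J\<^sup>2 \<le> k\<^sup>2 * (\<Theta> / r)" "n1\<^sup>2 * J \<le> k * (\<Theta> / r)" "n1 ^ 4 \<le> \<Theta> / r"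
  "n1\<^sup>2 \<le> \<Theta>" "n1 ^ 4 * r * L \<le> \<Theta>"
proof -
  have r0: "0 < r" using r1 by simp
  have n4: "0 \<le> n1 ^ 4" "0 \<le> n1\<^sup>2" by simp_all
  have "0 \<le> n1 ^ 4 * r" using r0 n4 by simp
  from mult_left_mono[OF L2_ge this] have t1: "n1 ^ 4 * r \<le> \<Theta>" using n4 by linarith
  show t2: "n1\<^sup>2 \<le> \<Theta>" using r0 n4 by simp
  have t3: "n1 ^ 4 * L\<^sup>2 + n1\<^sup>2 / r = \<Theta> / r" using r0 by (simp add: field_simps)
  show t4: "n1 ^ 4 \<le> \<Theta> / r" using mult_left_mono[OF L2_ge, of "n1 ^ 4"] n4 r0 unfolding t3[symmetric]
    by (simp add: add_increasing2)
  have t5: "n1\<^sup>2 / r \<le> \<Theta> / r" using t2 r0 by (intro divide_right_mono) auto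
  have Jk: "J \<le> k / r" using J(2) r0 by (simp add: pos_le_divide_eq)
  have Jk1: "J \<le> k" using J mult_left_mono[OF r1(1) J(1)] by simp
  have "r\<^sup>2 * (n1 ^ 4 * J) = (n1 ^ 4 * r) * (J * r)" by (simp add: power2_eq_square mult_ac)
  also have "\<dots> \<le> (n1 ^ 4 * r) * k" using J r0 n4 by (intro mult_left_mono) auto
  also have "\<dots> \<le> \<Theta> * k" using t1 k by (intro mult_right_mono) auto
  finally show "r\<^sup>2 * (n1 ^ 4 * J) \<le> k * \<Theta>" by (simp add: mult.commute)
  have J2: "(J * r)\<^sup>2 \<le> k\<^sup>2" using J r0 by (intro power_mono) auto
  have "r\<^sup>2 * (n1\<^sup>2 * J\<^sup>2) = n1\<^sup>2 * (J * r)\<^sup>2" by (simp add: power_mult_distrib mult_ac)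
  also have "\<dots> \<le> \<Theta> * k\<^sup>2" using J2 t2 n4 by (intro mult_mono) auto
  finally show "r\<^sup>2 * (n1\<^sup>2 * J\<^sup>2) \<le> k\<^sup>2 * \<Theta>" by (simp add: mult.commute)
  have "n1 ^ 4 * J \<le> (\<Theta> / r) * k" using t4 Jk1 J n4 order_trans[OF n4(1) t4] by (intro mult_mono) auto
  then show "n1 ^ 4 * J \<le> k * (\<Theta> / r)" by (simp add: mult.commute)
  have "n1\<^sup>2 * J \<le> n1\<^sup>2 * (k / r)" using Jk n4 by (intro mult_left_mono) auto
  also have "\<dots> = k * (n1\<^sup>2 / r)" by simp
  also have "\<dots> \<le> k * (\<Theta> / r)" using t5 k by (intro mult_left_mono) auto
  finally show t6: "n1\<^sup>2 * J \<le> k * (\<Theta> / r)" .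
  have "n1\<^sup>2 * J\<^sup>2 = (n1\<^sup>2 * J) * J" by (simp add: power2_eq_square)
  also have "\<dots> \<le> (k * (\<Theta> / r)) * k" by (rule mult_mono[OF t6 Jk1 _ J(1)]) (rule order_trans[OF mult_nonneg_nonneg[OF n4(2) J(1)] t6])
  finally show "n1\<^sup>2 * J\<^sup>2 \<le> k\<^sup>2 * (\<Theta> / r)" by (simp add: power2_eq_square mult_ac)
  have "n1 ^ 4 * r * L \<le> n1 ^ 4 * r * L\<^sup>2"
    using L r0 n4 mult_left_mono[of 1 L "n1 ^ 4 * r * L"] by (simp add: power2_eq_square mult_ac)
  then show "n1 ^ 4 * r * L \<le> \<Theta>" using n4 by linarith
qed

lemma delta_ee: "x \<in> {0..1} \<Longrightarrow> \<delta> * ee x \<le> d0 * n1 * ee x" "x \<in> {0..1} \<Longrightarrow> \<delta> * ee x \<le> 2 * d0"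
proof -
  assume x: "x \<in> {0..1}"
  show "\<delta> * ee x \<le> d0 * n1 * ee x" using d0 ee(1) by (intro mult_right_mono)
  have "d0 * n1 \<le> d0" using d0 n1 by (simp add: mult_left_le)
  then have "\<delta> * ee x \<le> d0 * 2" using d0 X.\<delta> ee x by (intro mult_mono) auto
  then show "\<delta> * ee x \<le> 2 * d0" by simp
qed

lemma brk_gap_bound: "X.brk (gap u) (gap u) \<le> Kgap (exp A) D d0 k * \<Theta>"
proof -
  let ?C = "2 * exp A * D"
  have C: "0 \<le> ?C" using D by simp
  define w where "w x y = ?C\<^sup>2 * 3 * ((4 + 2 * d0)\<^sup>2 * n1\<^sup>2)
     + (?C\<^sup>2 * 3 * (36 * r\<^sup>2 * n1 ^ 4) * (ee x)\<^sup>2 + ?C\<^sup>2 * 3 * (d0\<^sup>2 * r\<^sup>2 * n1\<^sup>2) * (ee x * ee y)\<^sup>2)" for x y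
  have ce: "cont2 (\<lambda>x y. ee x)" "cont2 (\<lambda>x y. ee y)" by (rule cont2_fst[OF cont_ee], rule cont2_snd[OF cont_ee])
  note c1 = cont2_cmult[OF cont2_power2[OF ce(1)]] and c2 = cont2_cmult[OF cont2_power2[OF cont2_arith(3)[OF ce]]]
  have cw: "cont2 w" unfolding w_def[abs_def] by (intro cont2_arith(1) cont2_const c1 c2)
  have "II (\<lambda>x y. (ux x y - Y.interp (ux x) y)\<^sup>2) \<le> II w"
  proof (rule II_mono[OF _ cw])
    show "cont2 (\<lambda>x y. (ux x y - Y.interp (ux x) y)\<^sup>2)"
      by (intro cont2_power2 cont2_arith(2) fin_op_cont2'[OF Y.fin_op_interp] cont2_ux)
    fix x y :: real assume x: "x \<in> {0..1}" and y: "y \<in> {0..1}"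
    \<comment> \<open>\<open>?p\<close> collects the terms without an x-profile, \<open>?q\<close>
      those of size \<open>n1\<^sup>2\<close> with an x-profile, \<open>?s\<close> those with both
      profiles. The 4 comes from \<open>HY\<close> and \<open>2 * \<nu>\<close>, the 6 from
      \<open>HY\<^sup>2\<close> and \<open>2 * \<nu>\<close>.\<close>
    let ?p = "(4 + 2 * d0) * n1" and ?q = "6 * r * n1\<^sup>2 * ee x" and ?s = "d0 * r * n1 * (ee x * ee y)"
    have 1: "\<delta> * ee y \<le> 2 * d0 * n1"
      using delta_ee(1)[OF y] mult_left_mono[OF ee(2)[OF y], of "d0 * n1"] d0 n1 by (simp add: mult_ac)
    have 2: "HY\<^sup>2 + \<delta> * ee y + 2 * \<nu> \<le> 6 * n1\<^sup>2 + d0 * n1 * ee y"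
      using H2 nu_le delta_ee(1)[OF y] by linarith
    have "HY + (\<delta> * ee y + 2 * \<nu>) + r * ee x * (HY\<^sup>2 + \<delta> * ee y + 2 * \<nu>)
      \<le> (4 + 2 * d0) * n1 + r * ee x * (6 * n1\<^sup>2 + d0 * n1 * ee y)"
    proof (rule add_mono)
      show "HY + (\<delta> * ee y + 2 * \<nu>) \<le> (4 + 2 * d0) * n1" using HY nu_le 1 by (simp add: distrib_right)
      show "r * ee x * (HY\<^sup>2 + \<delta> * ee y + 2 * \<nu>) \<le> r * ee x * (6 * n1\<^sup>2 + d0 * n1 * ee y)"
        by (rule mult_left_mono[OF 2]) (use r1 ee(1)[of x] in simp)
    qed
    also have "\<dots> = ?p + ?q + ?s" by (simp add: algebra_simps)
    finally have "\<bar>ux x y - Y.interp (ux x) y\<bar> \<le> ?C * (?p + ?q + ?s)"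
      using ux_err_bound[OF x y] C by (meson mult_left_mono order_trans)
    moreover have "\<bar>?C * (?p + ?q + ?s)\<bar> = ?C * (?p + ?q + ?s)"
      using C d0 n1 r1 ee(1)[of x] ee(1)[of y] by simp
    ultimately have "(ux x y - Y.interp (ux x) y)\<^sup>2 \<le> (?C * (?p + ?q + ?s))\<^sup>2"
      by (simp only: abs_le_square_iff[symmetric])
    also have "\<dots> = ?C\<^sup>2 * (?p + ?q + ?s)\<^sup>2" by (simp only: power_mult_distrib)
    also have "\<dots> \<le> ?C\<^sup>2 * (3 * (?p\<^sup>2 + ?q\<^sup>2 + ?s\<^sup>2))" by (intro mult_left_mono sq3_le) simp
    also have "\<dots> = w x y"
    proof -
      have e1: "?p\<^sup>2 = (4 + 2 * d0)\<^sup>2 * n1\<^sup>2" by (rule power_mult_distrib)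
      have e2: "?q\<^sup>2 = (36 * r\<^sup>2 * n1 ^ 4) * (ee x)\<^sup>2" by (simp add: power_mult_distrib flip: power_mult)
      have e3: "?s\<^sup>2 = (d0\<^sup>2 * r\<^sup>2 * n1\<^sup>2) * (ee x * ee y)\<^sup>2" by (simp only: power_mult_distrib)
      show ?thesis unfolding w_def e1 e2 e3 by (simp only: distrib_left mult.assoc add.assoc)
    qed
    finally show "(ux x y - Y.interp (ux x) y)\<^sup>2 \<le> w x y" .
  qed
  also have "II w = ?C\<^sup>2 * 3 * ((4 + 2 * d0)\<^sup>2 * n1\<^sup>2)
     + (?C\<^sup>2 * 3 * (36 * r\<^sup>2 * n1 ^ 4) * J + ?C\<^sup>2 * 3 * (d0\<^sup>2 * r\<^sup>2 * n1\<^sup>2) * J\<^sup>2)"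
    unfolding w_def[abs_def] II_add[OF cont2_const cont2_arith(1)[OF c1 c2]] II_add[OF c1 c2] II_cmult II_const II_ee ..
  also have "\<dots> = 3 * ?C\<^sup>2 * ((4 + 2 * d0)\<^sup>2 * n1\<^sup>2 + 36 * (r\<^sup>2 * (n1 ^ 4 * J)) + d0\<^sup>2 * (r\<^sup>2 * (n1\<^sup>2 * J\<^sup>2)))"
    by (simp add: algebra_simps)
  also have "\<dots> \<le> 3 * ?C\<^sup>2 * ((4 + 2 * d0)\<^sup>2 * \<Theta> + 36 * (k * \<Theta>) + d0\<^sup>2 * (k\<^sup>2 * \<Theta>))"
    by (intro mult_left_mono add_mono rJ) auto
  finally have 1: "II (\<lambda>x y. (ux x y - Y.interp (ux x) y)\<^sup>2) \<le> 3 * ?C\<^sup>2 * ((4 + 2 * d0)\<^sup>2 * \<Theta> + 36 * (k * \<Theta>) + d0\<^sup>2 * (k\<^sup>2 * \<Theta>))" .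
  have "4 * (3 * ?C\<^sup>2 * ((4 + 2 * d0)\<^sup>2 * T + 36 * (k * T) + d0\<^sup>2 * (k\<^sup>2 * T))) = Kgap (exp A) D d0 k * T" for T
    unfolding Kgap_def by (simp add: power_mult_distrib algebra_simps)
  from this[of \<Theta>, symmetric] show ?thesis
    using order_trans[OF brk_gap[OF cont2_u] mult_left_mono[OF order_trans[OF brk_interp_error 1], of 4]]
    by simp
qed

definition FF :: "real \<Rightarrow> real \<Rightarrow> real"
  where "FF x y = 4 * (exp A)\<^sup>2 * D * (4 * n1\<^sup>2 * (ee x + ee y) + d0 * n1 * (ee x * ee y))"

text \<open>The part of the mixed error that is small only pointwise; \<open>FF\<close> has the
  terms with a profile. \<open>BB\<close> keeps \<open>HX\<close> instead of \<open>n1\<close>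
  because it will be multiplied by \<open>M\<close>. The 16 is 8 from \<nu> against
  \<open>HY\<^sup>2 \<le> 4\<close> plus 8 from the corner terms.\<close>

definition BB :: real
  where "BB = 4 * (exp A)\<^sup>2 * D * (3 * HX\<^sup>2 + (16 + 4 * d0) * \<nu>)"

lemma cont2_FF: "cont2 FF"
  unfolding FF_def[abs_def]
  by (intro cont2_cmult cont2_arith(1) cont2_arith(3)[OF cont2_fst cont2_snd] cont2_fst cont2_snd cont_ee)

lemma FF_nonneg: "0 \<le> FF x y"
  unfolding FF_def using D n1 d0 ee(1)[of x] ee(1)[of y] by simp

lemma BB_nonneg: "0 \<le> BB"
  unfolding BB_def using D d0 X.\<nu> by simp

lemma err2_FF_BB:
  assumes x: "x \<in> {0..1}" and y: "y \<in> {0..1}"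
  shows "\<bar>err2 u x y\<bar> \<le> FF x y + BB"
proof -
  have e: "0 \<le> ee x" "0 \<le> ee y" "ee x \<le> 2" "ee y \<le> 2" using ee x y by auto
  have "HX\<^sup>2 * (1 + ee y + 2 * \<nu>) = HX\<^sup>2 * (1 + 2 * \<nu>) + HX\<^sup>2 * ee y" by (simp add: algebra_simps)
  also have "\<dots> \<le> HX\<^sup>2 * 3 + 4 * n1\<^sup>2 * ee y"
    using nu_le H2 e by (intro add_mono mult_left_mono mult_right_mono) auto
  finally have 1: "HX\<^sup>2 * (1 + ee y + 2 * \<nu>) \<le> 3 * HX\<^sup>2 + 4 * n1\<^sup>2 * ee y" by simp
  have "(ee x + 2 * \<nu>) * HY\<^sup>2 = HY\<^sup>2 * ee x + HY\<^sup>2 * (2 * \<nu>)" by (simp add: algebra_simps)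
  also have "\<dots> \<le> 4 * n1\<^sup>2 * ee x + 4 * (2 * \<nu>)"
    using H2 e X.\<nu> by (intro add_mono mult_right_mono) auto
  finally have 2: "(ee x + 2 * \<nu>) * HY\<^sup>2 \<le> 4 * n1\<^sup>2 * ee x + 8 * \<nu>" by simp
  have "(\<delta> * ee x + 2 * \<nu>) * (ee y + 2 * \<nu>) = \<delta> * ee x * ee y + \<delta> * ee x * (2 * \<nu>) + ee y * (2 * \<nu>) + (2 * \<nu>) * (2 * \<nu>)"
    by (simp add: algebra_simps)
  also have "\<dots> \<le> d0 * n1 * ee x * ee y + 2 * d0 * (2 * \<nu>) + 2 * (2 * \<nu>) + 2 * (2 * \<nu>)"
  proof (intro add_mono)
    show "\<delta> * ee x * ee y \<le> d0 * n1 * ee x * ee y" by (rule mult_right_mono[OF delta_ee(1)[OF x] e(2)])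
    show "\<delta> * ee x * (2 * \<nu>) \<le> 2 * d0 * (2 * \<nu>)" by (rule mult_right_mono[OF delta_ee(2)[OF x]]) (use X.\<nu> in simp)
    show "ee y * (2 * \<nu>) \<le> 2 * (2 * \<nu>)" by (rule mult_right_mono[OF e(4)]) (use X.\<nu> in simp)
    show "(2 * \<nu>) * (2 * \<nu>) \<le> 2 * (2 * \<nu>)" by (rule mult_right_mono) (use X.\<nu> nu_le in simp_all)
  qed
  finally have 3: "(\<delta> * ee x + 2 * \<nu>) * (ee y + 2 * \<nu>) \<le> d0 * n1 * (ee x * ee y) + (4 * d0 + 8) * \<nu>"
    by (simp add: algebra_simps)
  have "HX\<^sup>2 * (1 + ee y + 2 * \<nu>) + (ee x + 2 * \<nu>) * HY\<^sup>2 + (\<delta> * ee x + 2 * \<nu>) * (ee y + 2 * \<nu>)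
    \<le> (4 * n1\<^sup>2 * (ee x + ee y) + d0 * n1 * (ee x * ee y)) + (3 * HX\<^sup>2 + (16 + 4 * d0) * \<nu>)"
    using 1 2 3 by (simp add: algebra_simps)
  from order_trans[OF err2_bound[OF x y] mult_left_mono[OF this, of "4 * (exp A)\<^sup>2 * D"]]
  show ?thesis unfolding FF_def BB_def using D by (simp add: distrib_left)
qed

lemma II_FF: "II (\<lambda>x y. (FF x y)\<^sup>2) \<le> 16 * ((exp A)\<^sup>2)\<^sup>2 * D\<^sup>2 * (128 * (n1 ^ 4 * J) + 2 * d0\<^sup>2 * (n1\<^sup>2 * J\<^sup>2))"
proof -
  let ?C = "4 * (exp A)\<^sup>2 * D"
  define w where "w x y = ?C\<^sup>2 * (64 * n1 ^ 4) * (ee x)\<^sup>2 + (?C\<^sup>2 * (64 * n1 ^ 4) * (ee y)\<^sup>2 + ?C\<^sup>2 * (2 * d0\<^sup>2 * n1\<^sup>2) * (ee x * ee y)\<^sup>2)" for x y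
  have ce: "cont2 (\<lambda>x y. ee x)" "cont2 (\<lambda>x y. ee y)" by (rule cont2_fst[OF cont_ee], rule cont2_snd[OF cont_ee])
  note c1 = cont2_cmult[OF cont2_power2[OF ce(1)]] and c2 = cont2_cmult[OF cont2_power2[OF ce(2)]]
    and c3 = cont2_cmult[OF cont2_power2[OF cont2_arith(3)[OF ce]]]
  have cw: "cont2 w" unfolding w_def[abs_def] by (intro cont2_arith(1) c1 c2 c3)
  have "II (\<lambda>x y. (FF x y)\<^sup>2) \<le> II w"
  proof (rule II_mono[OF cont2_power2[OF cont2_FF] cw])
    fix x y :: real
    have "(4 * n1\<^sup>2 * (ee x + ee y) + d0 * n1 * (ee x * ee y))\<^sup>2
      \<le> 2 * (4 * n1\<^sup>2 * (ee x + ee y))\<^sup>2 + 2 * (d0 * n1 * (ee x * ee y))\<^sup>2" by (rule sq_sum_le)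
    also have "(4 * n1\<^sup>2 * (ee x + ee y))\<^sup>2 = 16 * n1 ^ 4 * (ee x + ee y)\<^sup>2" by (simp add: power_mult_distrib flip: power_mult)
    also have "\<dots> \<le> 16 * n1 ^ 4 * (2 * (ee x)\<^sup>2 + 2 * (ee y)\<^sup>2)" by (intro mult_left_mono sq_sum_le) simp
    finally have "(4 * n1\<^sup>2 * (ee x + ee y) + d0 * n1 * (ee x * ee y))\<^sup>2
      \<le> 64 * n1 ^ 4 * (ee x)\<^sup>2 + 64 * n1 ^ 4 * (ee y)\<^sup>2 + 2 * d0\<^sup>2 * n1\<^sup>2 * (ee x * ee y)\<^sup>2"
      by (simp add: power_mult_distrib algebra_simps)
    from mult_left_mono[OF this, of "?C\<^sup>2"]
    show "(FF x y)\<^sup>2 \<le> w x y" unfolding FF_def w_def power_mult_distrib[of ?C] by (simp add: algebra_simps)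
  qed
  also have "II w = ?C\<^sup>2 * (64 * n1 ^ 4) * J + (?C\<^sup>2 * (64 * n1 ^ 4) * J + ?C\<^sup>2 * (2 * d0\<^sup>2 * n1\<^sup>2) * J\<^sup>2)"
    unfolding w_def[abs_def] II_add[OF c1 cont2_arith(1)[OF c2 c3]] II_add[OF c2 c3] II_cmult II_ee ..
  also have "\<dots> = 16 * ((exp A)\<^sup>2)\<^sup>2 * D\<^sup>2 * (128 * (n1 ^ 4 * J) + 2 * d0\<^sup>2 * (n1\<^sup>2 * J\<^sup>2))"
    by (simp add: power_mult_distrib algebra_simps)
  finally show ?thesis .
qed

lemma II_FF_bounds:
  "r\<^sup>2 * II (\<lambda>x y. (FF x y)\<^sup>2) \<le> Kcorner (exp A) D d0 k * \<Theta>"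
  "II (\<lambda>x y. (FF x y)\<^sup>2) \<le> Kcorner (exp A) D d0 k * (\<Theta> / r)"
proof -
  let ?C = "16 * ((exp A)\<^sup>2)\<^sup>2 * D\<^sup>2"
  have "r\<^sup>2 * II (\<lambda>x y. (FF x y)\<^sup>2) \<le> r\<^sup>2 * (?C * (128 * (n1 ^ 4 * J) + 2 * d0\<^sup>2 * (n1\<^sup>2 * J\<^sup>2)))"
    by (intro mult_left_mono II_FF) simp
  also have "\<dots> = ?C * (128 * (r\<^sup>2 * (n1 ^ 4 * J)) + 2 * d0\<^sup>2 * (r\<^sup>2 * (n1\<^sup>2 * J\<^sup>2)))"
    by (simp add: algebra_simps)
  also have "\<dots> \<le> ?C * (128 * (k * \<Theta>) + 2 * d0\<^sup>2 * (k\<^sup>2 * \<Theta>))"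
    by (intro mult_left_mono add_mono rJ) auto
  also have "\<dots> = Kcorner (exp A) D d0 k * \<Theta>" unfolding Kcorner_def by (simp only: distrib_left distrib_right mult_ac)
  finally show "r\<^sup>2 * II (\<lambda>x y. (FF x y)\<^sup>2) \<le> Kcorner (exp A) D d0 k * \<Theta>" .
  have "II (\<lambda>x y. (FF x y)\<^sup>2) \<le> ?C * (128 * (k * (\<Theta> / r)) + 2 * d0\<^sup>2 * (k\<^sup>2 * (\<Theta> / r)))"
    by (rule order_trans[OF II_FF]) (intro mult_left_mono add_mono rJ; simp)
  also have "\<dots> = Kcorner (exp A) D d0 k * (\<Theta> / r)" unfolding Kcorner_def by (simp only: distrib_left distrib_right mult_ac)
  finally show "II (\<lambda>x y. (FF x y)\<^sup>2) \<le> Kcorner (exp A) D d0 k * (\<Theta> / r)" .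
qed

text \<open>\<open>M * HX\<^sup>2\<close> is at most \<open>2 * HX\<close>, and the fifth power in
  the bound of \<nu> outweighs \<open>M\<close>, which is at most \<open>1 / n1\<^sup>2\<close>. The
  second bound follows from the first since \<open>M * n1\<close> is at least 1. In
  \<open>Krest\<close>, 28 is \<open>3 * 4 + 16\<close>.\<close>

lemma BB_bounds:
  "(real M * BB)\<^sup>2 \<le> Krest (exp A) D d0 * n1\<^sup>2" "BB\<^sup>2 \<le> Krest (exp A) D d0 * n1 ^ 4"
proof -
  let ?C = "4 * (exp A)\<^sup>2 * D" and ?G = "4 * (exp A)\<^sup>2 * D * (28 + 4 * d0)"
  have "real M * HX\<^sup>2 = (HX * real M) * HX" by (simp add: power2_eq_square)
  also have "\<dots> \<le> 2 * (2 * n1)" using HX X.H_nonneg n1 by (intro mult_mono) auto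
  finally have 1: "real M * HX\<^sup>2 \<le> 4 * n1" by simp
  have "real M * \<nu> \<le> real M * n1 ^ 5" using nu by (intro mult_left_mono) auto
  also have "\<dots> = (real M * n1\<^sup>2) * n1 ^ 3" by (simp add: power_numeral_reduce)
  also have "\<dots> \<le> 1 * n1 ^ 1" using Mn n1 by (intro mult_mono power_decreasing) auto
  finally have 2: "real M * \<nu> \<le> n1" by simp
  have "real M * (3 * HX\<^sup>2 + (16 + 4 * d0) * \<nu>) = 3 * (real M * HX\<^sup>2) + (16 + 4 * d0) * (real M * \<nu>)"
    by (simp add: algebra_simps)
  also have "\<dots> \<le> 3 * (4 * n1) + (16 + 4 * d0) * n1" using 1 2 d0 by (intro add_mono mult_left_mono) auto
  also have "\<dots> = (28 + 4 * d0) * n1" by (simp add: algebra_simps)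
  finally have "real M * BB \<le> ?G * n1" unfolding BB_def using D
    by (simp add: mult.left_commute[of "real M"] mult.assoc mult_left_mono)
  moreover have MB: "0 \<le> real M * BB" using BB_nonneg by simp
  ultimately have "(real M * BB)\<^sup>2 \<le> (?G * n1)\<^sup>2" by (intro power_mono)
  then show 3: "(real M * BB)\<^sup>2 \<le> Krest (exp A) D d0 * n1\<^sup>2" unfolding Krest_def by (simp only: power_mult_distrib)
  have "BB\<^sup>2 = 1 * BB\<^sup>2" by simp
  also have "\<dots> \<le> (real M * n1)\<^sup>2 * BB\<^sup>2" using Mn by (intro mult_right_mono) auto
  also have "\<dots> = (real M * BB)\<^sup>2 * n1\<^sup>2" by (simp add: power_mult_distrib mult_ac)
  also have "\<dots> \<le> (Krest (exp A) D d0 * n1\<^sup>2) * n1\<^sup>2" by (intro mult_right_mono 3) simp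
  also have "\<dots> = Krest (exp A) D d0 * n1 ^ 4" by (simp add: power_numeral_reduce)
  finally show "BB\<^sup>2 \<le> Krest (exp A) D d0 * n1 ^ 4" .
qed

lemma Krest_nonneg: "0 \<le> Krest (exp A) D d0"
  unfolding Krest_def by simp

text \<open>Here \<open>1 / \<epsilon>\<close> is \<open>r\<^sup>2\<close>. Against
  \<open>BB\<close> the summand with \<open>M\<^sup>2\<close> yields \<open>n1\<^sup>2\<close>, and
  the one with \<open>r * L\<close> yields \<open>n1 ^ 4 * r * L\<close>; this is where the
  logarithm of \<open>\<Theta>\<close> is used.\<close>

lemma brk_mix_bound: "X.brk (mix u) (mix u) \<le> Kmix (exp A) D d0 k c q0 * \<Theta>"
proof -
  have ce: "c / \<epsilon> = c * r\<^sup>2" using r1(2) X.eps by (simp add: field_simps)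
  have mixb: "X.brk (mix u) (mix u) \<le> 2 * X.brk (gap u) (gap u) + 16 * (c * r\<^sup>2) * II (\<lambda>x y. (FF x y)\<^sup>2)
      + 64 * (18 * (real M)\<^sup>2 + q0 * r * L) * BB\<^sup>2"
    unfolding ce[symmetric] by (rule brk_mix[OF cont2_u cont2_FF FF_nonneg BB_nonneg err2_FF_BB Q])
  have "(18 * (real M)\<^sup>2 + q0 * r * L) * BB\<^sup>2 = 18 * (real M * BB)\<^sup>2 + q0 * r * L * BB\<^sup>2"
    by (simp add: power_mult_distrib algebra_simps)
  also have "\<dots> \<le> 18 * (Krest (exp A) D d0 * n1\<^sup>2) + q0 * r * L * (Krest (exp A) D d0 * n1 ^ 4)"
    using q0 r1 L by (intro add_mono mult_left_mono BB_bounds) auto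
  also have "\<dots> = 18 * Krest (exp A) D d0 * n1\<^sup>2 + q0 * Krest (exp A) D d0 * (n1 ^ 4 * r * L)"
    by (simp add: mult_ac)
  also have "\<dots> \<le> 18 * Krest (exp A) D d0 * \<Theta> + q0 * Krest (exp A) D d0 * \<Theta>"
    using Krest_nonneg q0 by (intro add_mono mult_left_mono rJ(7,8)) auto
  finally have 1: "(18 * (real M)\<^sup>2 + q0 * r * L) * BB\<^sup>2 \<le> (18 + q0) * Krest (exp A) D d0 * \<Theta>"
    by (simp add: algebra_simps)
  have 2: "c * (r\<^sup>2 * II (\<lambda>x y. (FF x y)\<^sup>2)) \<le> c * (Kcorner (exp A) D d0 k * \<Theta>)"
    using X.c by (intro mult_left_mono II_FF_bounds) auto
  have "Kmix (exp A) D d0 k c q0 * T = 2 * (Kgap (exp A) D d0 k * T) + 16 * (c * (Kcorner (exp A) D d0 k * T))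
      + 64 * ((18 + q0) * Krest (exp A) D d0 * T)" for T
    unfolding Kmix_def by (simp only: distrib_right mult.assoc)
  then show ?thesis using mixb brk_gap_bound 1 2 by (simp only: mult.assoc)
qed

lemma L2_mix_bound: "II (\<lambda>x y. (mix u x y)\<^sup>2) \<le> Kmix0 (exp A) D d0 k * (\<Theta> / r)"
proof -
  let ?C = "2 * exp A * D"
  have mixb: "II (\<lambda>x y. (mix u x y)\<^sup>2) \<le> 16 * II (\<lambda>x y. (u x y - Y.interp (u x) y)\<^sup>2) + 48 * II (\<lambda>x y. (FF x y)\<^sup>2) + 192 * BB\<^sup>2"
    by (rule L2_mix[OF cont2_u cont2_FF FF_nonneg BB_nonneg err2_FF_BB Q])
  define w where "w x y = ?C\<^sup>2 * 18 * (36 * n1 ^ 4) + ?C\<^sup>2 * 18 * (d0\<^sup>2 * n1\<^sup>2) * (ee y)\<^sup>2" for x y :: real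
  have c1: "cont2 (\<lambda>x y. ?C\<^sup>2 * 18 * (d0\<^sup>2 * n1\<^sup>2) * (ee y)\<^sup>2)" by (intro cont2_cmult cont2_power2 cont2_snd cont_ee)
  have cw: "cont2 w" unfolding w_def[abs_def] by (intro cont2_arith(1) cont2_const c1)
  have "II (\<lambda>x y. (u x y - Y.interp (u x) y)\<^sup>2) \<le> II w"
  proof (rule II_mono[OF _ cw])
    show "cont2 (\<lambda>x y. (u x y - Y.interp (u x) y)\<^sup>2)"
      by (intro cont2_power2 cont2_arith(2) fin_op_cont2'[OF Y.fin_op_interp] cont2_u)
    fix x y :: real assume x: "x \<in> {0..1}" and y: "y \<in> {0..1}"
    let ?q = "6 * n1\<^sup>2" and ?s = "d0 * n1 * ee y"
    have C: "0 \<le> ?C" using D by simp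
    have "HY\<^sup>2 + \<delta> * ee y + 2 * \<nu> \<le> ?q + ?s" using H2 nu_le delta_ee(1)[OF y] by linarith
    then have "(1 + ee x) * (HY\<^sup>2 + \<delta> * ee y + 2 * \<nu>) \<le> 3 * (?q + ?s)"
      using ee(2)[OF x] ee(1)[of x] ee(1)[of y] X.\<delta> X.\<nu> by (intro mult_mono) auto
    then have "\<bar>u x y - Y.interp (u x) y\<bar> \<le> ?C * (3 * (?q + ?s))"
      using u_err_bound[OF x y] C by (meson mult_left_mono order_trans)
    moreover have "\<bar>?C * (3 * (?q + ?s))\<bar> = ?C * (3 * (?q + ?s))"
      using C d0 n1 ee(1)[of y] by simp
    ultimately have "(u x y - Y.interp (u x) y)\<^sup>2 \<le> (?C * (3 * (?q + ?s)))\<^sup>2"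
      by (simp only: abs_le_square_iff[symmetric])
    also have "\<dots> = ?C\<^sup>2 * 9 * (?q + ?s)\<^sup>2" unfolding power_mult_distrib by simp
    also have "\<dots> \<le> ?C\<^sup>2 * 9 * (2 * ?q\<^sup>2 + 2 * ?s\<^sup>2)" by (intro mult_left_mono sq_sum_le) simp
    also have "\<dots> = w x y" unfolding w_def by (simp add: power_mult_distrib algebra_simps flip: power_mult)
    finally show "(u x y - Y.interp (u x) y)\<^sup>2 \<le> w x y" .
  qed
  also have "II w = ?C\<^sup>2 * 18 * (36 * n1 ^ 4) + ?C\<^sup>2 * 18 * (d0\<^sup>2 * n1\<^sup>2) * J"
    unfolding w_def[abs_def] II_add[OF cont2_const c1] II_cmult II_const II_ee ..
  also have "\<dots> = 18 * ?C\<^sup>2 * (36 * n1 ^ 4 + d0\<^sup>2 * (n1\<^sup>2 * J))" by (simp add: algebra_simps)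
  also have "\<dots> \<le> 18 * ?C\<^sup>2 * (36 * (\<Theta> / r) + d0\<^sup>2 * (k * (\<Theta> / r)))"
    by (intro mult_left_mono add_mono rJ) auto
  finally have 1: "II (\<lambda>x y. (u x y - Y.interp (u x) y)\<^sup>2) \<le> 18 * ?C\<^sup>2 * (36 * (\<Theta> / r) + d0\<^sup>2 * (k * (\<Theta> / r)))" .
  have 2: "BB\<^sup>2 \<le> Krest (exp A) D d0 * (\<Theta> / r)"
    using BB_bounds(2) mult_left_mono[OF rJ(6) Krest_nonneg] by linarith
  have "Kmix0 (exp A) D d0 k * T = 16 * (18 * ?C\<^sup>2 * (36 * T + d0\<^sup>2 * (k * T))) + 48 * (Kcorner (exp A) D d0 k * T) + 192 * (Krest (exp A) D d0 * T)" for T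
    unfolding Kmix0_def by (simp add: power_mult_distrib algebra_simps)
  from this[of "\<Theta> / r"] show ?thesis using mixb 1 2 II_FF_bounds(2) by linarith
qed

end

end

section \<open>Galerkin solutions on Shishkin meshes\<close>

lemma ln_le_sqrt: "x > 0 \<Longrightarrow> ln x \<le> 2 * sqrt x"
proof -
  assume x: "x > 0"
  have "ln x = 2 * ln (sqrt x)" using x by (simp add: ln_sqrt)
  also have "\<dots> \<le> 2 * sqrt x" using ln_le_minus_one[of "sqrt x"] x by simp
  finally show ?thesis .
qed

text \<open>The two layer regions serve as blocks of length \<open>lam\<close> in
  \<open>solve_block\<close>. A block as long as the interior would bring back
  \<open>1 / \<epsilon>\<close>, so there each cell is bounded by its jump of at most
  \<open>6 * \<beta>\<close> alone: \<open>2 * q\<close> cells of width at least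
  \<open>1 / (4 * q)\<close> give \<open>36 * (2 * q) * (4 * q) = 18 * M\<^sup>2\<close>.\<close>

lemma (in ritz) solve_shishkin:
  assumes t: "t = shishkin_node lam (4 * q)" "M = 4 * q" and lam: "0 < lam" "lam \<le> 1/4" and q: "0 < q"
    and \<kappa>: "cont \<kappa>" "\<And>x. x \<in> {0..1} \<Longrightarrow> \<bar>\<kappa> x\<bar> \<le> \<beta>"
  shows "af (solve \<kappa>) (solve \<kappa>) \<le> (18 * (real M)\<^sup>2 + 2 * (36 / lam + 24 * c * lam / \<epsilon>)) * \<beta>\<^sup>2"
proof -
  define T where "T i = (solve \<kappa> (t (Suc i)) - solve \<kappa> (t i))\<^sup>2 / (t (Suc i) - t i)" for i
  note nv = node_values[OF lam q, folded t(1)]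
  have b: "sum T {p..<p'} \<le> \<beta>\<^sup>2 * (36 / (t p' - t p) + 24 * c * (t p' - t p) / \<epsilon>)" if "p < p'" "p' \<le> M" for p p'
    using solve_block[OF \<kappa> that] unfolding T_def .
  have 1: "sum T {0..<q} \<le> \<beta>\<^sup>2 * (36 / lam + 24 * c * lam / \<epsilon>)"
    using b[of 0 q] q t(2) nv by simp
  have 3: "sum T {3 * q..<4 * q} \<le> \<beta>\<^sup>2 * (36 / lam + 24 * c * lam / \<epsilon>)"
    using b[of "3 * q" "4 * q"] q t(2) nv by simp
  have 2: "sum T {q..<3 * q} \<le> (\<Sum>i=q..<3 * q. 36 * \<beta>\<^sup>2 * (4 * real q))"
  proof (rule sum_mono)
    fix i assume i: "i \<in> {q..<3 * q}"
    define h where "h = t (Suc i) - t i"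
    have hw: "h = (1 - 2 * lam) / (2 * real q)" unfolding h_def t(1) node_width[OF lam q] using i by simp
    have h: "1 / (4 * real q) \<le> h" unfolding hw using lam q by (simp add: field_simps)
    have h0: "0 < h" unfolding h_def by simp
    have z: "\<bar>solve \<kappa> (t j)\<bar> \<le> 3 * \<beta>" if "j \<le> M" for j by (rule solve_sup[OF \<kappa> t_in[OF that]])
    have "\<bar>solve \<kappa> (t (Suc i)) - solve \<kappa> (t i)\<bar> \<le> \<bar>6 * \<beta>\<bar>" using z[of i] z[of "Suc i"] i t(2) by auto
    then have "(solve \<kappa> (t (Suc i)) - solve \<kappa> (t i))\<^sup>2 \<le> (6 * \<beta>)\<^sup>2" by (simp only: abs_le_square_iff)
    then have "T i \<le> 36 * \<beta>\<^sup>2 / h" unfolding T_def h_def[symmetric] using h0 by (intro divide_right_mono) (auto simp: power_mult_distrib)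
    also have "\<dots> = 36 * \<beta>\<^sup>2 * (1 / h)" by simp
    also have "1 / h \<le> 4 * real q" using h h0 q by (simp add: field_simps)
    finally show "T i \<le> 36 * \<beta>\<^sup>2 * (4 * real q)" by (simp add: mult_left_mono)
  qed
  have "af (solve \<kappa>) (solve \<kappa>) = sum T {0..<4 * q}" unfolding af_self_sq by (simp add: T_def t(2) atLeast0LessThan)
  also have "\<dots> = sum T {0..<q} + sum T {q..<3 * q} + sum T {3 * q..<4 * q}"
    by (simp add: sum.atLeastLessThan_concat)
  also have "\<dots> \<le> \<beta>\<^sup>2 * (36 / lam + 24 * c * lam / \<epsilon>) + 18 * (real M)\<^sup>2 * \<beta>\<^sup>2 + \<beta>\<^sup>2 * (36 / lam + 24 * c * lam / \<epsilon>)"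
  proof (intro add_mono 1 3 order_trans[OF 2])
    show "(\<Sum>i=q..<3 * q. 36 * \<beta>\<^sup>2 * (4 * real q)) \<le> 18 * (real M)\<^sup>2 * \<beta>\<^sup>2"
      unfolding t(2) by (simp add: power2_eq_square)
  qed
  also have "\<dots> = (18 * (real M)\<^sup>2 + 2 * (36 / lam + 24 * c * lam / \<epsilon>)) * \<beta>\<^sup>2"
    by (simp only: mult_2 distrib_right distrib_left ac_simps)
  finally show ?thesis .
qed

locale shishkin_setting =
  fixes c cs lam0 \<epsilon> lam :: real and Nh :: nat
  assumes c: "0 < c" and cs: "0 < cs" and lam0: "5/2 \<le> lam0" and eps: "0 < \<epsilon>" "\<epsilon> \<le> 1" and Nh: "4 \<le> Nh"
    and lam_eq: "lam = min (1/4) (lam0 * sqrt (\<epsilon> / cs) * ln ((real Nh)\<^sup>2))"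
begin

abbreviation "aa \<equiv> sqrt (cs / \<epsilon>)"
abbreviation "rr \<equiv> \<epsilon> powr (- 1 / 2)"
abbreviation "n1 \<equiv> 1 / real Nh"
abbreviation "L \<equiv> ln ((real Nh)\<^sup>2)"
text \<open>The square of \<open>16 * lam0\<close>, divided by \<open>cs\<close>. In
  \<open>layer_mesh_node\<close>, 16 is 4 from the \<open>4 * q\<close> intervals times 4 from
  \<open>L \<le> 4 * sqrt Nh\<close>, which trades the logarithm of the fine mesh width for half a
  power of \<open>Nh\<close>.\<close>

abbreviation "d0 \<equiv> 256 * lam0\<^sup>2 / cs"
abbreviation "kk \<equiv> 2 / sqrt cs"
abbreviation "q0 \<equiv> 72 * (4 + sqrt cs) + 48 * c * lam0 / sqrt cs"
abbreviation "\<Theta> \<equiv> n1\<^sup>2 + n1 ^ 4 * rr * L\<^sup>2"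

lemma rr: "rr = 1 / sqrt \<epsilon>" "1 \<le> rr" "\<epsilon> * rr\<^sup>2 = 1" "aa = sqrt cs * rr"
proof -
  have "\<epsilon> powr (- (1 / 2)) = inverse (\<epsilon> powr (1 / 2))" by (rule powr_minus)
  then show r: "rr = 1 / sqrt \<epsilon>" using eps by (simp add: powr_half_sqrt field_simps)
  show "1 \<le> rr" unfolding r using eps by simp
  show "\<epsilon> * rr\<^sup>2 = 1" unfolding r using eps by (simp add: power_divide)
  show "aa = sqrt cs * rr" unfolding r by (simp add: real_sqrt_divide)
qed

lemma n1: "0 < n1" "n1 \<le> 1"
  using Nh by auto

lemma \<Theta>: "0 \<le> \<Theta>" "0 \<le> \<Theta> / rr"
  using rr(2) by simp_all

lemma L: "1 \<le> L" "L \<le> 4 * sqrt (real Nh)" "L = 2 * ln (real Nh)"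
proof -
  have n: "0 < real Nh" using Nh by simp
  show e: "L = 2 * ln (real Nh)" using n by (simp add: ln_realpow)
  show "L \<le> 4 * sqrt (real Nh)" unfolding e using ln_le_sqrt[OF n] by simp
  have "exp 1 \<le> (real Nh)\<^sup>2"
  proof -
    have "exp (1::real) \<le> 3" by (rule exp_le)
    also have "\<dots> \<le> 4\<^sup>2" by simp
    also have "(4::real)\<^sup>2 \<le> (real Nh)\<^sup>2" using Nh by (intro power_mono) auto
    finally show ?thesis .
  qed
  then show "1 \<le> L" using n by (simp add: ln_ge_iff)
qed

lemma lam: "0 < lam" "lam \<le> 1/4" "lam \<le> lam0 * sqrt (\<epsilon> / cs) * L"
  using lam0 eps cs L(1) unfolding lam_eq by auto

lemma aa_lam: "aa * (lam0 * sqrt (\<epsilon> / cs) * L) = lam0 * L" "aa * lam \<le> lam0 * L"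
proof -
  have "aa * sqrt (\<epsilon> / cs) = 1" using eps cs by (simp add: real_sqrt_mult[symmetric])
  then have "(aa * sqrt (\<epsilon> / cs)) * (lam0 * L) = 1 * (lam0 * L)" by (simp only:)
  then show 1: "aa * (lam0 * sqrt (\<epsilon> / cs) * L) = lam0 * L" by (simp only: mult_ac mult_1_left mult_1_right)
  show "aa * lam \<le> lam0 * L" unfolding 1[symmetric] using lam(3) cs eps by (intro mult_left_mono) auto
qed

text \<open>If \<open>lam = 1/4\<close> its inverse is 4; otherwise
  \<open>aa * lam = lam0 * L \<ge> 1\<close>, so the inverse is at most \<open>aa\<close>. In both
  cases \<open>lam / \<epsilon>\<close> is at most a multiple of \<open>rr * L\<close>.\<close>

lemma q0_bound: "2 * (36 / lam + 24 * c * lam / \<epsilon>) \<le> q0 * rr * L"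
proof -
  have r0: "0 < rr" using rr(2) by linarith
  have rL: "1 \<le> rr * L" using mult_mono[OF rr(2) L(1)] r0 by simp
  have "1 / lam \<le> (4 + sqrt cs) * (rr * L)"
  proof (cases "1/4 \<le> lam0 * sqrt (\<epsilon> / cs) * L")
    case True
    then have "1 / lam = 4" unfolding lam_eq by simp
    moreover have "4 * 1 \<le> (4 + sqrt cs) * (rr * L)" using rL cs by (intro mult_mono) auto
    ultimately show ?thesis by simp
  next
    case False
    then have l: "lam = lam0 * sqrt (\<epsilon> / cs) * L" unfolding lam_eq by simp
    have "1 \<le> lam0 * L" using mult_mono[of 1 lam0 1 L] lam0 L(1) by simp
    then have "1 \<le> aa * lam" unfolding l aa_lam(1) .
    then have "1 / lam \<le> aa" using lam(1) by (simp add: field_simps)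
    also have "\<dots> = sqrt cs * rr * 1" using rr(4) by simp
    also have "\<dots> \<le> sqrt cs * rr * L" using L(1) cs r0 by (intro mult_left_mono) auto
    also have "\<dots> \<le> (4 + sqrt cs) * (rr * L)" using rL by (simp add: distrib_right mult.assoc)
    finally show ?thesis .
  qed
  moreover have "lam / \<epsilon> \<le> lam0 / sqrt cs * (rr * L)"
  proof -
    have "lam / \<epsilon> \<le> (lam0 * sqrt (\<epsilon> / cs) * L) / \<epsilon>" using lam(3) eps by (intro divide_right_mono) auto
    also have "\<dots> = lam0 / sqrt cs * (rr * L)"
      using eps cs unfolding rr(1) by (simp add: real_sqrt_divide field_simps)
    finally show ?thesis .
  qed
  ultimately have "72 * (1 / lam) + 48 * c * (lam / \<epsilon>)
    \<le> 72 * ((4 + sqrt cs) * (rr * L)) + 48 * c * (lam0 / sqrt cs * (rr * L))"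
    using c by (intro add_mono mult_left_mono) auto
  then show ?thesis by (simp add: algebra_simps)
qed

lemma layer_mesh_node:
  assumes q: "Nh \<le> 4 * q"
  shows "layer_mesh (shishkin_node lam (4 * q)) (4 * q) aa rr (16 * lam0) (d0 * n1) (n1 ^ 5) (2 / real (4 * q))"
proof -
  have q0: "0 < q" using q Nh by simp
  interpret mesh "shishkin_node lam (4 * q)" "4 * q" by (rule shishkin_mesh[OF lam(1,2) q0])
  let ?t = "shishkin_node lam (4 * q)"
  have n0: "0 < real Nh" using Nh by simp
  have aa0: "0 < aa" using cs eps by simp
  have rr_aa: "rr\<^sup>2 = aa\<^sup>2 / cs" unfolding rr(4) power_mult_distrib using cs by simp
  have fine: "lam / real q * aa \<le> 16 * lam0 / sqrt (real Nh)"
  proof -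
    have "lam / real q * aa = 4 * (aa * lam) / (4 * real q)" using q0 by simp
    also have "\<dots> \<le> 4 * (lam0 * L) / (4 * real q)" using aa_lam(2) by (intro divide_right_mono mult_left_mono) auto
    also have "\<dots> \<le> 4 * (lam0 * (4 * sqrt (real Nh))) / real Nh"
      using L lam0 q n0 by (intro frac_le mult_left_mono mult_nonneg_nonneg) (auto simp flip: of_nat_mult)
    also have "\<dots> = 16 * lam0 * (sqrt (real Nh) / real Nh)" by simp
    also have "sqrt (real Nh) / real Nh = 1 / sqrt (real Nh)" using n0 by (simp add: field_simps)
    finally show ?thesis by simp
  qed
  have fineA: "lam / real q * aa \<le> 16 * lam0"
  proof -
    have "16 * lam0 / sqrt (real Nh) \<le> 16 * lam0" using lam0 Nh by (simp add: divide_le_eq)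
    then show ?thesis using fine by linarith
  qed
  have fine\<delta>: "(lam / real q)\<^sup>2 * rr\<^sup>2 \<le> d0 * n1"
  proof -
    have "(lam / real q)\<^sup>2 * rr\<^sup>2 = (lam / real q * aa)\<^sup>2 / cs" unfolding rr_aa power_mult_distrib[of "lam / real q"] by simp
    also have "\<dots> \<le> (16 * lam0 / sqrt (real Nh))\<^sup>2 / cs"
      using fine lam(1) aa0 cs q0 by (intro divide_right_mono power_mono) auto
    also have "\<dots> = d0 * n1" using n0 cs by (simp add: power_divide power_mult_distrib)
    finally show ?thesis .
  qed
  show ?thesis
  proof
    show "0 < aa" by (rule aa0)
    show "0 \<le> rr" by simp
    show "0 \<le> 16 * lam0" using lam0 by simp
    show "0 \<le> d0 * n1" using cs by simp
    show "0 \<le> n1 ^ 5" by simp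
    fix k assume k: "k < 4 * q"
    note w = node_width[OF lam(1,2) q0, of k]
    show "?t (Suc k) - ?t k \<le> 2 / real (4 * q)"
      unfolding w using lam q0 by (auto simp: field_simps)
    show "((?t (Suc k) - ?t k) * aa \<le> 16 * lam0 \<and> (?t (Suc k) - ?t k)\<^sup>2 * rr\<^sup>2 \<le> d0 * n1) \<or>
      (\<forall>x\<in>{?t k..?t (Suc k)}. exp (- (aa * x)) \<le> n1 ^ 5 \<and> exp (- (aa * (1 - x))) \<le> n1 ^ 5)"
    \<comment> \<open>A width other than \<open>lam / q\<close> means an interior cell of a
      nonuniform mesh. Then \<open>lam\<close> is the logarithmic value, and the layers have decayed
      at the transition points.\<close>
    proof (cases "?t (Suc k) - ?t k = lam / real q")
      case True
      then show ?thesis using fineA fine\<delta> by simp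
    next
      case False
      then have kq: "q \<le> k" "k < 3 * q" and "(1 - 2 * lam) / (2 * real q) \<noteq> lam / real q"
        unfolding w by (auto split: if_splits)
      then have "lam \<noteq> 1/4" using q0 by (auto simp: field_simps)
      then have l: "lam = lam0 * sqrt (\<epsilon> / cs) * L" using lam(2) unfolding lam_eq by (auto simp: min_def split: if_splits)
      have small: "exp (- (aa * x)) \<le> n1 ^ 5" if "lam \<le> x" for x
      proof -
        \<comment> \<open>Here \<open>lam0 \<ge> 5/2\<close> enters: \<open>lam0 * L\<close> is
          \<open>2 * lam0 * ln Nh\<close>, which yields the fifth power of
          \<open>n1\<close>.\<close>
        have "5 * ln (real Nh) \<le> lam0 * L" unfolding L(3) using lam0 Nh mult_right_mono[OF lam0, of "2 * ln (real Nh)"] by simp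
        also have "\<dots> = aa * lam" unfolding l aa_lam(1) ..
        also have "\<dots> \<le> aa * x" using that aa0 by (intro mult_left_mono) auto
        finally have "exp (- (aa * x)) \<le> exp (- (5 * ln (real Nh)))" by simp
        also have "\<dots> = inverse (exp (ln (real Nh)) ^ 5)" by (simp add: exp_minus exp_of_nat_mult[symmetric])
        also have "\<dots> = n1 ^ 5" using n0 by (simp add: power_divide field_simps)
        finally show ?thesis .
      qed
      have "?t q \<le> ?t k" "?t (Suc k) \<le> ?t (3 * q)" using kq by (simp_all only: t_le)
      then have "lam \<le> ?t k" "?t (Suc k) \<le> 1 - lam" using node_values[OF lam(1,2) q0] by simp_all
      then show ?thesis using small by auto
    qed
  qed
qed

end

definition Kall :: "real \<Rightarrow> real \<Rightarrow> real \<Rightarrow> real \<Rightarrow> real"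
  where "Kall c cs lam0 D = (let E = exp (16 * lam0); d0 = 256 * lam0\<^sup>2 / cs; k = 2 / sqrt cs;
      q0 = 72 * (4 + sqrt cs) + 48 * c * lam0 / sqrt cs
    in Kgap E D d0 k + Kmix E D d0 k c q0 + Kmix0 E D d0 k)"

locale shishkin_pair = shishkin_setting +
  fixes qx qy :: nat and D :: real and u :: "real \<Rightarrow> real \<Rightarrow> real" and g :: "nat \<Rightarrow> nat \<Rightarrow> nat \<Rightarrow> nat \<Rightarrow> real \<Rightarrow> real \<Rightarrow> real"
  assumes qx: "Nh \<le> 4 * qx" "4 * qx \<le> Nh\<^sup>2" and qy: "Nh \<le> 4 * qy" "4 * qy \<le> Nh\<^sup>2"
    and D: "0 \<le> D"
    and jet: "\<And>i j. i < 3 \<Longrightarrow> j < 3 \<Longrightarrow> jet (g i j)"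
    and lb: "\<And>i j. i < 3 \<Longrightarrow> j < 3 \<Longrightarrow> layer_bound D (\<epsilon> powr (- 1 / 2)) (sqrt (cs / \<epsilon>)) i j (g i j)"
    and u: "\<And>x y. x \<in> {0..1} \<Longrightarrow> y \<in> {0..1} \<Longrightarrow> u x y = (\<Sum>i<3. \<Sum>j<3. g i j 0 0 x y)"
begin

abbreviation "sx \<equiv> shishkin_node lam (4 * qx)"
abbreviation "sy \<equiv> shishkin_node lam (4 * qy)"

sublocale P: layer2 sx sy "4 * qx" "4 * qy" \<epsilon> c aa rr "16 * lam0" "d0 * n1" "n1 ^ 5" "2 / real (4 * qx)" "2 / real (4 * qy)" D u g
proof -
  interpret X: layer_mesh sx "4 * qx" aa rr "16 * lam0" "d0 * n1" "n1 ^ 5" "2 / real (4 * qx)" by (rule layer_mesh_node[OF qx(1)])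
  interpret Y: layer_mesh sy "4 * qy" aa rr "16 * lam0" "d0 * n1" "n1 ^ 5" "2 / real (4 * qy)" by (rule layer_mesh_node[OF qy(1)])
  show "layer2 sx sy (4 * qx) (4 * qy) \<epsilon> c aa rr (16 * lam0) (d0 * n1) (n1 ^ 5) (2 / real (4 * qx)) (2 / real (4 * qy)) D u g"
    by unfold_locales (use eps c D jet lb u in auto)
qed

text \<open>The same situation with x and y exchanged: its bounds for x-derivatives are the bounds
  for y-derivatives of the original one.\<close>

sublocale F: layer2 sy sx "4 * qy" "4 * qx" \<epsilon> c aa rr "16 * lam0" "d0 * n1" "n1 ^ 5" "2 / real (4 * qy)" "2 / real (4 * qx)" D
  "\<lambda>x y. u y x" "\<lambda>i j m n x y. g j i n m y x"
proof unfold_locales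
  show "i < 3 \<Longrightarrow> j < 3 \<Longrightarrow> jet (\<lambda>m n x y. g j i n m y x)" for i j by (rule jet_flip[OF jet])
  show "i < 3 \<Longrightarrow> j < 3 \<Longrightarrow> layer_bound D rr aa i j (\<lambda>m n x y. g j i n m y x)" for i j by (rule layer_bound_flip[OF lb])
  show "x \<in> {0..1} \<Longrightarrow> y \<in> {0..1} \<Longrightarrow> u y x = (\<Sum>i<3. \<Sum>j<3. g j i 0 0 y x)" for x y by (subst sum.swap) (rule u)
qed (use D in auto)

abbreviation "KK \<equiv> Kall c cs lam0 D"

lemma numbers:
  assumes "Nh \<le> 4 * q" "4 * q \<le> Nh\<^sup>2"
  shows "2 / real (4 * q) \<le> 2 * n1" "2 / real (4 * q) * real (4 * q) \<le> 2" "1 \<le> real (4 * q) * n1" "real (4 * q) * n1\<^sup>2 \<le> 1"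
proof -
  have n0: "0 < real Nh" using Nh by simp
  have 1: "real Nh \<le> real (4 * q)" using assms by (simp only: of_nat_le_iff)
  have 2: "real (4 * q) \<le> (real Nh)\<^sup>2" using assms(2) by (simp only: of_nat_le_iff of_nat_power[symmetric])
  show "2 / real (4 * q) \<le> 2 * n1" using divide_left_mono[OF 1, of 2] n0 assms(1) by (simp del: of_nat_mult)
  show "2 / real (4 * q) * real (4 * q) \<le> 2" by simp
  show "1 \<le> real (4 * q) * n1" using 1 n0 by (simp add: field_simps)
  show "real (4 * q) * n1\<^sup>2 \<le> 1" using 2 n0 by (simp add: power_divide divide_le_eq)
qed

lemma kk: "0 \<le> kk" "2 / aa \<le> kk / rr"
  using cs eps unfolding rr(4) by (auto simp: field_simps)

lemma d0: "0 \<le> d0" using cs by simp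

lemma q0: "0 \<le> q0" using cs c lam0 by simp

lemma QX:
  assumes "cont \<kappa>" "\<And>x. x \<in> {0..1} \<Longrightarrow> \<bar>\<kappa> x\<bar> \<le> \<beta>"
  shows "P.X.af (P.X.solve \<kappa>) (P.X.solve \<kappa>) \<le> (18 * (real (4 * qx))\<^sup>2 + q0 * rr * L) * \<beta>\<^sup>2"
    "P.Y.af (P.Y.solve \<kappa>) (P.Y.solve \<kappa>) \<le> (18 * (real (4 * qy))\<^sup>2 + q0 * rr * L) * \<beta>\<^sup>2"
proof -
  have q: "0 < qx" "0 < qy" using qx qy Nh by auto
  have "(18 * (real (4 * qx))\<^sup>2 + 2 * (36 / lam + 24 * c * lam / \<epsilon>)) * \<beta>\<^sup>2 \<le> (18 * (real (4 * qx))\<^sup>2 + q0 * rr * L) * \<beta>\<^sup>2"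
    by (intro mult_right_mono add_mono q0_bound) auto
  with P.X.solve_shishkin[OF refl refl lam(1,2) q(1) assms]
  show "P.X.af (P.X.solve \<kappa>) (P.X.solve \<kappa>) \<le> (18 * (real (4 * qx))\<^sup>2 + q0 * rr * L) * \<beta>\<^sup>2" by linarith
  have "(18 * (real (4 * qy))\<^sup>2 + 2 * (36 / lam + 24 * c * lam / \<epsilon>)) * \<beta>\<^sup>2 \<le> (18 * (real (4 * qy))\<^sup>2 + q0 * rr * L) * \<beta>\<^sup>2"
    by (intro mult_right_mono add_mono q0_bound) auto
  with P.Y.solve_shishkin[OF refl refl lam(1,2) q(2) assms]
  show "P.Y.af (P.Y.solve \<kappa>) (P.Y.solve \<kappa>) \<le> (18 * (real (4 * qy))\<^sup>2 + q0 * rr * L) * \<beta>\<^sup>2" by linarith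
qed

text \<open>The two instances of \<open>order_refl\<close> reflect that \<delta> and \<nu> are
  instantiated by \<open>d0 * n1\<close> and \<open>n1 ^ 5\<close> themselves.\<close>

lemmas P_hyps = n1 numbers(1,2)[OF qx] numbers(1)[OF qy] numbers(3,4)[OF qx] d0 order_refl order_refl rr(2,3) kk L(1) q0 QX(1)
lemmas F_hyps = n1 numbers(1,2)[OF qy] numbers(1)[OF qx] numbers(3,4)[OF qy] d0 order_refl order_refl rr(2,3) kk L(1) q0 QX(2)

lemma KK_parts:
  "Kgap (exp (16 * lam0)) D d0 kk \<le> KK" "Kmix (exp (16 * lam0)) D d0 kk c q0 \<le> KK" "Kmix0 (exp (16 * lam0)) D d0 kk \<le> KK"
  "0 \<le> KK"
proof -
  have 1: "0 \<le> Kgap (exp (16 * lam0)) D d0 kk" "0 \<le> Kcorner (exp (16 * lam0)) D d0 kk" "0 \<le> Krest (exp (16 * lam0)) D d0"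
    unfolding Kgap_def Kcorner_def Krest_def using kk(1) D by auto
  then have 2: "0 \<le> Kmix (exp (16 * lam0)) D d0 kk c q0" "0 \<le> Kmix0 (exp (16 * lam0)) D d0 kk"
    unfolding Kmix_def Kmix0_def using c q0 kk(1) by auto
  show "Kgap (exp (16 * lam0)) D d0 kk \<le> KK" "Kmix (exp (16 * lam0)) D d0 kk c q0 \<le> KK" "Kmix0 (exp (16 * lam0)) D d0 kk \<le> KK" "0 \<le> KK"
    unfolding Kall_def Let_def using 1 2 by linarith+
qed

lemma mix_bounds:
  "P.X.brk (P.mix u) (P.mix u) \<le> KK * \<Theta>"
  "P.Y.brk (F.mix (\<lambda>x y. u y x)) (F.mix (\<lambda>x y. u y x)) \<le> KK * \<Theta>"
  "P.Y.brk (F.gap (\<lambda>x y. u y x)) (F.gap (\<lambda>x y. u y x)) \<le> KK * \<Theta>"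
  "II (\<lambda>x y. (P.mix u x y)\<^sup>2) \<le> KK * (\<Theta> / rr)"
proof -
  note m = mult_right_mono[OF KK_parts(1) \<Theta>(1)] mult_right_mono[OF KK_parts(2) \<Theta>(1)] mult_right_mono[OF KK_parts(3) \<Theta>(2)]
  show "P.X.brk (P.mix u) (P.mix u) \<le> KK * \<Theta>" by (rule order_trans[OF P.brk_mix_bound[OF P_hyps] m(2)])
  show "P.Y.brk (F.mix (\<lambda>x y. u y x)) (F.mix (\<lambda>x y. u y x)) \<le> KK * \<Theta>" by (rule order_trans[OF F.brk_mix_bound[OF F_hyps] m(2)])
  show "P.Y.brk (F.gap (\<lambda>x y. u y x)) (F.gap (\<lambda>x y. u y x)) \<le> KK * \<Theta>" by (rule order_trans[OF F.brk_gap_bound[OF F_hyps] m(1)])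
  show "II (\<lambda>x y. (P.mix u x y)\<^sup>2) \<le> KK * (\<Theta> / rr)" by (rule order_trans[OF P.L2_mix_bound[OF P_hyps] m(3)])
qed

text \<open>The terms with a single projection depend on one of the two meshes only and are the ones
  that cancel later. The second equation uses that the product of the projections is the same in
  either order.\<close>

lemma mix_eq:
  assumes "x \<in> {0..1}" "y \<in> {0..1}"
  shows "P.mix u x y = P.X.rproj (\<lambda>s. u s y) x - P.proj u x y"
    "F.mix (\<lambda>x y. u y x) y x = P.Y.rproj (u x) y - P.proj u x y"
proof -
  show "P.mix u x y = P.X.rproj (\<lambda>s. u s y) x - P.proj u x y"
    using P.proj_error[OF P.cont2_u assms(2), of x] unfolding P.gapx_def by linarith
  have "F.proj (\<lambda>x y. u y x) y x = P.proj u x y"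
    unfolding P.proj_commute[OF P.cont2_u] F.proj_def ..
  then show "F.mix (\<lambda>x y. u y x) y x = P.Y.rproj (u x) y - P.proj u x y"
    using F.proj_error[OF F.cont2_u assms(1), of y] unfolding F.gapx_def by linarith
qed

lemma fe_space_Vh: "v \<in> fe_space lam (4 * qx) (4 * qy) \<Longrightarrow> (\<lambda>x y. v (x, y)) \<in> P.Vh"
  unfolding fe_space_def by (rule P.Vh_if_bilinear) auto

lemma Vh_fe_space: "k \<in> P.Vh \<Longrightarrow> (\<lambda>p. k (fst p) (snd p)) \<in> fe_space lam (4 * qx) (4 * qy)"
proof -
  assume k: "k \<in> P.Vh"
  have "continuous_on (closure Omega) (\<lambda>p. k (fst p) (snd p))"
    using k unfolding P.Vh_def cont2_def closure_Omega by auto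
  then show ?thesis unfolding fe_space_def using P.bilinear_if_Vh[OF k] P.Vh_frontier[OF k] by simp
qed

lemma galerkin_bounds:
  assumes bvp: "solves_bvp \<epsilon> c f uu" and uu: "u = (\<lambda>x y. uu (x, y))"
    and gal: "is_galerkin \<epsilon> c f (fe_space lam (4 * qx) (4 * qy)) U"
  defines "\<xi> \<equiv> \<lambda>x y. U (x, y) - P.proj u x y"
  shows "\<xi> \<in> P.Vh" "P.X.brk \<xi> \<xi> \<le> 2 * KK * \<Theta>" "P.Y.brk (\<lambda>y x. \<xi> x y) (\<lambda>y x. \<xi> x y) \<le> 2 * KK * \<Theta>"
    "II (\<lambda>x y. (\<xi> x y)\<^sup>2) \<le> KK / c * (\<Theta> / rr)"
proof -
  have z: "u x 0 = 0 \<and> u x 1 = 0 \<and> u 0 x = 0 \<and> u 1 x = 0" if "x \<in> {0..1}" for x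
    using bvp that unfolding solves_bvp_def uu by (auto simp: frontier_Omega_iff)
  have UV: "(\<lambda>x y. U (x, y)) \<in> P.Vh" using gal fe_space_Vh unfolding is_galerkin_def by blast
  have B: "P.Bform (\<lambda>x y. U (x, y)) v = P.Bform u v" if v: "v \<in> P.Vh" for v
  proof -
    let ?v = "\<lambda>p. v (fst p) (snd p)"
    have v': "(\<lambda>x y. ?v (x, y)) \<in> P.Vh" using v by simp
    have "\<epsilon> * grad_inner U ?v + c * L2_inner U ?v = L2_inner f ?v"
      using gal Vh_fe_space[OF v] unfolding is_galerkin_def by blast
    then show ?thesis
      unfolding P.load_eq_Bform[OF bvp v'] P.grad_inner_brk[OF UV v'] L2_inner_II[OF P.Vh_cont[OF UV] P.Vh_cont[OF v']]
      unfolding P.Bform_def uu by simp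
  qed
  show "\<xi> \<in> P.Vh" unfolding \<xi>_def by (rule P.Vh_diff[OF UV P.proj_Vh[OF P.cont2_u z]])
  have "P.Y.brk (\<lambda>y x. P.gapx u x y) (\<lambda>y x. P.gapx u x y) \<le> KK * \<Theta>"
    using mix_bounds(3) unfolding P.gapx_def F.gap_def[abs_def] .
  then have T: "P.Y.brk (\<lambda>y x. P.gapx u x y) (\<lambda>y x. P.gapx u x y) + P.X.brk (P.mix u) (P.mix u) \<le> 2 * KK * \<Theta>"
    using mix_bounds(1) by simp
  have close: "P.X.brk \<xi> \<xi> + P.Y.brk (\<lambda>y x. \<xi> x y) (\<lambda>y x. \<xi> x y)
      \<le> P.Y.brk (\<lambda>y x. P.gapx u x y) (\<lambda>y x. P.gapx u x y) + P.X.brk (P.mix u) (P.mix u)"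
    "II (\<lambda>x y. (\<xi> x y)\<^sup>2)
      \<le> \<epsilon> / (2 * c) * (P.Y.brk (\<lambda>y x. P.gapx u x y) (\<lambda>y x. P.gapx u x y) + P.X.brk (P.mix u) (P.mix u))"
    unfolding \<xi>_def by (rule P.galerkin_close_to_proj[OF P.cont2_u z UV B]; assumption)+
  show "P.X.brk \<xi> \<xi> \<le> 2 * KK * \<Theta>" "P.Y.brk (\<lambda>y x. \<xi> x y) (\<lambda>y x. \<xi> x y) \<le> 2 * KK * \<Theta>"
    using close(1) T P.X.brk_nonneg[of \<xi>] P.Y.brk_nonneg[of "\<lambda>y x. \<xi> x y"] by linarith+
  have r0: "0 < rr" using rr(2) by linarith
  have "\<epsilon> \<le> 1 / rr" using rr(3) mult_left_mono[OF rr(2), of "\<epsilon> * rr"] eps r0 by (simp add: field_simps power2_eq_square)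
  have "II (\<lambda>x y. (\<xi> x y)\<^sup>2) \<le> \<epsilon> / (2 * c) * (2 * KK * \<Theta>)"
    using close(2) mult_left_mono[OF T, of "\<epsilon> / (2 * c)"] eps c by (meson divide_nonneg_nonneg less_imp_le mult_nonneg_nonneg order_trans zero_le_numeral)
  also have "\<dots> = \<epsilon> * (KK / c * \<Theta>)" by simp
  also have "\<dots> \<le> 1 / rr * (KK / c * \<Theta>)"
    using \<open>\<epsilon> \<le> 1 / rr\<close> KK_parts(4) c \<Theta>(1) by (intro mult_right_mono) auto
  finally show "II (\<lambda>x y. (\<xi> x y)\<^sup>2) \<le> KK / c * (\<Theta> / rr)" by (simp add: mult.commute)
qed

end

section \<open>The combination of Galerkin solutions\<close>

lemma (in mesh) brk_refined:
  assumes fine: "mesh t' (M * r)" and r: "\<And>i. t' (i * r) = t i" and k: "\<And>y. y \<in> {0..1} \<Longrightarrow> is_pl (\<lambda>x. k x y)"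
  shows "mesh.brk t' (M * r) k k = brk k k"
proof -
  interpret F: mesh t' "M * r" by (rule fine)
  show ?thesis unfolding F.brk_def brk_def by (intro integral_cong refined_af(1)[OF fine r k])
qed

lemma (in mesh) brk_sq_add4:
  assumes k: "cont2 k1" "cont2 k2" "cont2 k3" "cont2 k4"
    and e: "\<And>x y. x \<in> {0..1} \<Longrightarrow> y \<in> {0..1} \<Longrightarrow> e x y = (k1 x y + k2 x y) - (k3 x y + k4 x y)"
  shows "brk e e \<le> 4 * (brk k1 k1 + brk k2 k2 + (brk k3 k3 + brk k4 k4))"
proof -
  have "brk e e = brk (\<lambda>x y. (k1 x y + k2 x y) - (k3 x y + k4 x y)) (\<lambda>x y. (k1 x y + k2 x y) - (k3 x y + k4 x y))"
    by (rule brk_cong[OF e e])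
  also have "\<dots> \<le> 2 * brk (\<lambda>x y. k1 x y + k2 x y) (\<lambda>x y. k1 x y + k2 x y) + 2 * brk (\<lambda>x y. k3 x y + k4 x y) (\<lambda>x y. k3 x y + k4 x y)"
    by (rule brk_sq_add(2)[OF cont2_arith(1)[OF k(1,2)] cont2_arith(1)[OF k(3,4)]])
  also have "\<dots> \<le> 2 * (2 * brk k1 k1 + 2 * brk k2 k2) + 2 * (2 * brk k3 k3 + 2 * brk k4 k4)"
    by (intro add_mono mult_left_mono brk_sq_add(1) k) auto
  finally show ?thesis by simp
qed

lemma II_sq_add4:
  assumes k: "cont2 k1" "cont2 k2" "cont2 k3" "cont2 k4"
    and e: "\<And>x y. x \<in> {0..1} \<Longrightarrow> y \<in> {0..1} \<Longrightarrow> e x y = (k1 x y + k2 x y) - (k3 x y + k4 x y)"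
  shows "II (\<lambda>x y. (e x y)\<^sup>2) \<le> 4 * (II (\<lambda>x y. (k1 x y)\<^sup>2) + II (\<lambda>x y. (k2 x y)\<^sup>2) + (II (\<lambda>x y. (k3 x y)\<^sup>2) + II (\<lambda>x y. (k4 x y)\<^sup>2)))"
proof -
  have "II (\<lambda>x y. (e x y)\<^sup>2) = II (\<lambda>x y. ((k1 x y + k2 x y) - (k3 x y + k4 x y))\<^sup>2)"
    by (rule II_cong) (simp only: e)
  also have "\<dots> \<le> 2 * II (\<lambda>x y. (k1 x y + k2 x y)\<^sup>2) + 2 * II (\<lambda>x y. (k3 x y + k4 x y)\<^sup>2)"
    by (rule II_sq_add(2)[OF cont2_arith(1)[OF k(1,2)] cont2_arith(1)[OF k(3,4)]])
  also have "\<dots> \<le> 2 * (2 * II (\<lambda>x y. (k1 x y)\<^sup>2) + 2 * II (\<lambda>x y. (k2 x y)\<^sup>2)) + 2 * (2 * II (\<lambda>x y. (k3 x y)\<^sup>2) + 2 * II (\<lambda>x y. (k4 x y)\<^sup>2))"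
    by (intro add_mono mult_left_mono II_sq_add(1) k) auto
  finally show ?thesis by simp
qed

context shishkin_setting begin

abbreviation "node q \<equiv> shishkin_node lam (4 * q)"
abbreviation "ritz_op q \<equiv> ritz.rproj (node q) (4 * q) \<epsilon> c"
abbreviation "bracket q k \<equiv> mesh.brk (node q) (4 * q) k k"

lemma fine_mesh: "0 < q \<Longrightarrow> 0 < r \<Longrightarrow> mesh (node (q * r)) (4 * q * r)"
  using shishkin_mesh[OF lam(1,2), of "q * r"] by (simp only: mult.assoc nat_0_less_mult_iff simp_thms)

lemma fine_node: "0 < q \<Longrightarrow> 0 < r \<Longrightarrow> node (q * r) (i * r) = node q i"
  using node_refine[OF lam(1,2)] .

end

context shishkin_pair begin

lemma q_pos: "0 < qx" "0 < qy"
  using qx qy Nh by auto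

text \<open>The four Galerkin solutions have to be combined in one space; the meshes are nested, so
  the finest one accommodates them all.\<close>

lemma fe_space_refined:
  assumes Q: "Q = qx * rx" "0 < rx" "Q = qy * ry" "0 < ry" and U: "U \<in> fe_space lam (4 * qx) (4 * qy)"
  shows "(\<lambda>x y. U (x, y)) \<in> ritz2.Vh (node Q) (node Q) (4 * Q) (4 * Q)"
proof -
  have Q0: "0 < Q" using Q q_pos by simp
  interpret N: mesh "node Q" "4 * Q" by (rule shishkin_mesh[OF lam(1,2) Q0])
  interpret N: ritz2 "node Q" "node Q" "4 * Q" "4 * Q" \<epsilon> c by unfold_locales (use eps c in auto)
  have x: "f \<in> P.X.V0 \<Longrightarrow> f \<in> N.V0" for f
    using P.X.refined_af(2)[OF fine_mesh fine_node, OF q_pos(1) Q(2) q_pos(1) Q(2), of f]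
    unfolding P.X.V0_def N.V0_def unfolding Q(1) by (simp add: mult.assoc)
  have y: "f \<in> P.Y.V0 \<Longrightarrow> f \<in> N.V0" for f
    using P.Y.refined_af(2)[OF fine_mesh fine_node, OF q_pos(2) Q(4) q_pos(2) Q(4), of f]
    unfolding P.Y.V0_def N.V0_def unfolding Q(3) by (simp add: mult.assoc)
  show ?thesis using fe_space_Vh[OF U] x y unfolding P.Vh_def N.Vh_def by auto
qed

text \<open>By \<open>mix_eq\<close>, the Galerkin solution minus a single projection is \<xi> minus
  a mixed term, and both are bounded. This difference is piecewise linear in the projected
  direction, which suffices to measure its derivative in that direction on the finest mesh. The 6 is
  \<open>2 * 2 + 2\<close>.\<close>

lemma deviation:
  assumes Q: "Q = qx * rx" "0 < rx" "Q = qy * ry" "0 < ry"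
    and bvp: "solves_bvp \<epsilon> c f uu" and uu: "u = (\<lambda>x y. uu (x, y))"
    and gal: "is_galerkin \<epsilon> c f (fe_space lam (4 * qx) (4 * qy)) U"
  shows "cont2 (\<lambda>x y. U (x, y) - ritz_op qx (\<lambda>s. u s y) x)"
    "cont2 (\<lambda>y x. U (x, y) - ritz_op qy (u x) y)"
    "bracket Q (\<lambda>x y. U (x, y) - ritz_op qx (\<lambda>s. u s y) x) \<le> 6 * (KK * \<Theta>)"
    "bracket Q (\<lambda>y x. U (x, y) - ritz_op qy (u x) y) \<le> 6 * (KK * \<Theta>)"
    "II (\<lambda>x y. (U (x, y) - ritz_op qx (\<lambda>s. u s y) x)\<^sup>2) \<le> 2 * ((KK + KK / c) * (\<Theta> / rr))"
proof -
  define \<xi> where "\<xi> = (\<lambda>x y. U (x, y) - P.proj u x y)"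
  note G = galerkin_bounds[OF bvp uu gal, folded \<xi>_def]
  have Qx: "4 * Q = 4 * qx * rx" and Qy: "4 * Q = 4 * qy * ry" using Q(1,3) by simp_all
  have UV: "(\<lambda>x y. U (x, y)) \<in> P.Vh" using gal fe_space_Vh unfolding is_galerkin_def by blast
  have cU: "cont2 (\<lambda>x y. U (x, y))" using UV unfolding P.Vh_def by simp
  have c\<xi>: "cont2 \<xi>" using G(1) unfolding P.Vh_def by simp
  have uf: "cont2 (\<lambda>x y. u y x)" by (rule F.cont2_u)
  note cm = P.cont2_mix[OF P.cont2_u] F.cont2_mix[OF F.cont2_u]
  let ?dx = "\<lambda>x y. U (x, y) - P.X.rproj (\<lambda>s. u s y) x" and ?dy = "\<lambda>y x. U (x, y) - P.Y.rproj (u x) y"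
  show "cont2 ?dx" by (rule cont2_arith(2)[OF cU fin_op_cont2[OF P.X.fin_op_rproj P.cont2_u]])
  show "cont2 ?dy" by (rule cont2_arith(2)[OF cont2_flip[OF cU] fin_op_cont2[OF P.Y.fin_op_rproj uf]])
  have dx: "?dx x y = \<xi> x y - P.mix u x y" if "x \<in> {0..1}" "y \<in> {0..1}" for x y
    unfolding mix_eq(1)[OF that] \<xi>_def by simp
  have dy: "?dy y x = \<xi> x y - F.mix (\<lambda>x y. u y x) y x" if "y \<in> {0..1}" "x \<in> {0..1}" for x y
    unfolding mix_eq(2)[OF that(2,1)] \<xi>_def by simp
  have px: "P.X.is_pl (\<lambda>x. ?dx x y)" if "y \<in> {0..1}" for y
    using UV that unfolding P.Vh_def P.X.V0_def by (auto intro: P.X.is_pl_diff P.X.is_pl_rproj)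
  have py: "P.Y.is_pl (\<lambda>y. ?dy y x)" if "x \<in> {0..1}" for x
    using UV that unfolding P.Vh_def P.Y.V0_def by (auto intro: P.Y.is_pl_diff P.Y.is_pl_rproj)
  have "bracket Q ?dx = P.X.brk ?dx ?dx"
    unfolding Q(1) using P.X.brk_refined[OF fine_mesh fine_node px, OF q_pos(1) Q(2) q_pos(1) Q(2)] by (simp only: mult.assoc)
  also have "\<dots> = P.X.brk (\<lambda>x y. \<xi> x y - P.mix u x y) (\<lambda>x y. \<xi> x y - P.mix u x y)" by (rule P.X.brk_cong[OF dx dx])
  also have "\<dots> \<le> 2 * P.X.brk \<xi> \<xi> + 2 * P.X.brk (P.mix u) (P.mix u)" by (rule P.X.brk_sq_add(2)[OF c\<xi> cm(1)])
  also have "\<dots> \<le> 6 * (KK * \<Theta>)" using G(2) mix_bounds(1) by linarith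
  finally show "bracket Q ?dx \<le> 6 * (KK * \<Theta>)" .
  have "bracket Q ?dy = P.Y.brk ?dy ?dy"
    unfolding Q(3) using P.Y.brk_refined[OF fine_mesh fine_node py, OF q_pos(2) Q(4) q_pos(2) Q(4)] by (simp only: mult.assoc)
  also have "\<dots> = P.Y.brk (\<lambda>y x. \<xi> x y - F.mix (\<lambda>x y. u y x) y x) (\<lambda>y x. \<xi> x y - F.mix (\<lambda>x y. u y x) y x)"
    by (rule P.Y.brk_cong[OF dy dy])
  also have "\<dots> \<le> 2 * P.Y.brk (\<lambda>y x. \<xi> x y) (\<lambda>y x. \<xi> x y)
      + 2 * P.Y.brk (F.mix (\<lambda>x y. u y x)) (F.mix (\<lambda>x y. u y x))" by (rule P.Y.brk_sq_add(2)[OF cont2_flip[OF c\<xi>] cm(2)])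
  also have "\<dots> \<le> 6 * (KK * \<Theta>)" using galerkin_bounds(3)[OF bvp uu gal] mix_bounds(2) unfolding \<xi>_def by linarith
  finally show "bracket Q ?dy \<le> 6 * (KK * \<Theta>)" .
  have "II (\<lambda>x y. (?dx x y)\<^sup>2) = II (\<lambda>x y. (\<xi> x y - P.mix u x y)\<^sup>2)" by (rule II_cong) (simp only: dx)
  also have "\<dots> \<le> 2 * II (\<lambda>x y. (\<xi> x y)\<^sup>2) + 2 * II (\<lambda>x y. (P.mix u x y)\<^sup>2)" by (rule II_sq_add(2)[OF c\<xi> cm(1)])
  also have "\<dots> \<le> 2 * (KK / c * (\<Theta> / rr)) + 2 * (KK * (\<Theta> / rr))" using galerkin_bounds(4)[OF bvp uu gal] mix_bounds(4) unfolding \<xi>_def by linarith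
  also have "\<dots> = 2 * ((KK + KK / c) * (\<Theta> / rr))" by (simp only: distrib_right distrib_left add.commute)
  finally show "II (\<lambda>x y. (?dx x y)\<^sup>2) \<le> 2 * ((KK + KK / c) * (\<Theta> / rr))" .
qed

end

context shishkin_setting begin

lemma combination_bound:
  assumes Nh4: "Nh = 4 * q" and D: "0 \<le> D" and dec: "decomposed D rr aa (\<lambda>x y. u (x, y))" and bvp: "solves_bvp \<epsilon> c f u"
    and gal: "is_galerkin \<epsilon> c f (fe_space lam (Nh * Nh) Nh) U1" "is_galerkin \<epsilon> c f (fe_space lam Nh (Nh * Nh)) U2"
      "is_galerkin \<epsilon> c f (fe_space lam Nh Nh) U3" "is_galerkin \<epsilon> c f (fe_space lam (Nh * Nh) (Nh * Nh)) U4"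
  shows "balanced_norm \<epsilon> (\<lambda>p. (U1 p + U2 p - U3 p) - U4 p)
    \<le> (sqrt (192 * Kall c cs lam0 D) + sqrt (32 * (Kall c cs lam0 D + Kall c cs lam0 D / c))) * (\<epsilon> powr (1/4) * n1 + L * n1\<^sup>2)"
proof -
  define K where "K = Kall c cs lam0 D"
  define Q where "Q = q * Nh"
  have NN: "Nh * Nh = 4 * Q" unfolding Q_def Nh4 by simp
  have q: "Nh \<le> 4 * q" "4 * q \<le> Nh\<^sup>2" "Nh \<le> 4 * Q" "4 * Q \<le> Nh\<^sup>2"
    unfolding NN[symmetric] Nh4[symmetric] using Nh by (auto simp: power2_eq_square)
  have Q0: "0 < Q" "0 < Nh" "0 < (1::nat)" and Q1: "Q = Q * 1" using Nh q unfolding Q_def by auto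
  obtain g where g: "\<And>i j. i < 3 \<Longrightarrow> j < 3 \<Longrightarrow> jet (g i j)" "\<And>i j. i < 3 \<Longrightarrow> j < 3 \<Longrightarrow> layer_bound D rr aa i j (g i j)"
    "\<And>x y. x \<in> {0..1} \<Longrightarrow> y \<in> {0..1} \<Longrightarrow> u (x, y) = (\<Sum>i<3. \<Sum>j<3. g i j 0 0 x y)"
    using decomposedE[OF dec] by blast
  let ?u = "\<lambda>x y. u (x, y)"
  have pair: "shishkin_pair c cs lam0 \<epsilon> lam Nh qx qy D ?u g"
    if "Nh \<le> 4 * qx" "4 * qx \<le> Nh\<^sup>2" "Nh \<le> 4 * qy" "4 * qy \<le> Nh\<^sup>2" for qx qy
    by unfold_locales (use that D g in auto)
  note p1 = pair[OF q(3,4) q(1,2)] and p2 = pair[OF q(1,2) q(3,4)] and p3 = pair[OF q(1,2) q(1,2)] and p4 = pair[OF q(3,4) q(3,4)]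
  have gal': "is_galerkin \<epsilon> c f (fe_space lam (4 * Q) (4 * q)) U1" "is_galerkin \<epsilon> c f (fe_space lam (4 * q) (4 * Q)) U2"
      "is_galerkin \<epsilon> c f (fe_space lam (4 * q) (4 * q)) U3" "is_galerkin \<epsilon> c f (fe_space lam (4 * Q) (4 * Q)) U4"
    using gal unfolding NN unfolding Nh4 .
  note d1 = shishkin_pair.deviation[OF p1 Q1 Q0(3) Q_def Q0(2) bvp refl gal'(1), folded K_def]
    and d2 = shishkin_pair.deviation[OF p2 Q_def Q0(2) Q1 Q0(3) bvp refl gal'(2), folded K_def]
    and d3 = shishkin_pair.deviation[OF p3 Q_def Q0(2) Q_def Q0(2) bvp refl gal'(3), folded K_def]
    and d4 = shishkin_pair.deviation[OF p4 Q1 Q0(3) Q1 Q0(3) bvp refl gal'(4), folded K_def]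
  have U: "U1 \<in> fe_space lam (4 * Q) (4 * q)" "U2 \<in> fe_space lam (4 * q) (4 * Q)"
    "U3 \<in> fe_space lam (4 * q) (4 * q)" "U4 \<in> fe_space lam (4 * Q) (4 * Q)"
    using gal' unfolding is_galerkin_def by blast+
  interpret N: mesh "node Q" "4 * Q" by (rule shishkin_mesh[OF lam(1,2) Q0(1)])
  interpret N: ritz2 "node Q" "node Q" "4 * Q" "4 * Q" \<epsilon> c by unfold_locales (use eps c in auto)
  note V = shishkin_pair.fe_space_refined[OF p1 Q1 Q0(3) Q_def Q0(2) U(1)]
    shishkin_pair.fe_space_refined[OF p2 Q_def Q0(2) Q1 Q0(3) U(2)]
    shishkin_pair.fe_space_refined[OF p3 Q_def Q0(2) Q_def Q0(2) U(3)]
    shishkin_pair.fe_space_refined[OF p4 Q1 Q0(3) Q1 Q0(3) U(4)]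
  define e where "e = (\<lambda>p. (U1 p + U2 p - U3 p) - U4 p)"
  have "(\<lambda>x y. ((U1 (x, y) - U3 (x, y)) - (U4 (x, y) - U2 (x, y)))) \<in> N.Vh"
    by (intro N.Vh_diff V)
  moreover have "(\<lambda>x y. ((U1 (x, y) - U3 (x, y)) - (U4 (x, y) - U2 (x, y)))) = (\<lambda>x y. e (x, y))" unfolding e_def by (intro ext) simp
  ultimately have eV: "(\<lambda>x y. e (x, y)) \<in> N.Vh" by simp
  \<comment> \<open>The single projections cancel because \<open>U1\<close> and \<open>U4\<close>
    share the x-mesh, as do \<open>U2\<close> and \<open>U3\<close>. In \<open>ey\<close> the pairs
    with a common y-mesh are \<open>U1\<close>, \<open>U3\<close> and \<open>U2\<close>,
    \<open>U4\<close>.\<close>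
  have ex: "bracket Q (\<lambda>x y. e (x, y)) \<le> 4 * (6 * (K * \<Theta>) + 6 * (K * \<Theta>) + (6 * (K * \<Theta>) + 6 * (K * \<Theta>)))"
    using N.brk_sq_add4[OF d1(1) d2(1) d3(1) d4(1), of "\<lambda>x y. e (x, y)"] d1(3) d2(3) d3(3) d4(3)
    unfolding e_def by simp
  have ey: "bracket Q (\<lambda>y x. e (x, y)) \<le> 4 * (6 * (K * \<Theta>) + 6 * (K * \<Theta>) + (6 * (K * \<Theta>) + 6 * (K * \<Theta>)))"
    using N.brk_sq_add4[OF d1(2) d2(2) d3(2) d4(2), of "\<lambda>y x. e (x, y)"] d1(4) d2(4) d3(4) d4(4)
    unfolding e_def by simp
  have eII: "II (\<lambda>x y. (e (x, y))\<^sup>2) \<le> 32 * ((K + K / c) * (\<Theta> / rr))"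
    using II_sq_add4[OF d1(1) d2(1) d3(1) d4(1), of "\<lambda>x y. e (x, y)"] d1(5) d2(5) d3(5) d4(5)
    unfolding e_def by simp
  have H1: "grad_inner e e \<le> 192 * (K * \<Theta>)" unfolding N.grad_inner_brk[OF eV eV] using ex ey by simp
  have L2: "L2_inner e e \<le> 32 * ((K + K / c) * (\<Theta> / rr))"
    unfolding L2_inner_II[OF N.Vh_cont[OF eV] N.Vh_cont[OF eV]] using eII by (simp only: power2_eq_square)
  define t where "t = \<epsilon> powr (1/4) * n1 + L * n1\<^sup>2"
  have r0: "0 < rr" using rr(2) by linarith
  have e4: "(\<epsilon> powr (1/4))\<^sup>2 = 1 / rr" "0 < \<epsilon> powr (1/4)"
    using eps rr(1) by (simp_all add: power2_eq_square powr_half_sqrt flip: powr_add)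
  have t0: "0 \<le> t" unfolding t_def using n1 L(1) e4(2) by simp
  \<comment> \<open>Division by \<open>rr\<close> turns \<open>\<Theta>\<close> into the sum of the
    squares of the two summands of \<open>t\<close>; the mixed term of \<open>t\<^sup>2\<close> is
    nonnegative.\<close>
  have \<Theta>t: "\<Theta> / rr \<le> t\<^sup>2"
  proof -
    have "\<Theta> / rr = (\<epsilon> powr (1/4))\<^sup>2 * n1\<^sup>2 + L\<^sup>2 * (n1\<^sup>2)\<^sup>2"
      unfolding e4 using r0 by (simp add: field_simps flip: power_mult)
    also have "\<dots> \<le> t\<^sup>2"
      unfolding t_def power2_sum power_mult_distrib using n1 L(1) e4(2) by simp
    finally show ?thesis .
  qed
  have K0: "0 \<le> K" unfolding K_def by (rule shishkin_pair.KK_parts(4)[OF p1])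
  have "\<epsilon> powr (1/4) * sqrt (grad_inner e e) = sqrt ((1 / rr) * grad_inner e e)"
    unfolding e4(1)[symmetric] using e4(2) by (simp add: real_sqrt_mult)
  also have "\<dots> \<le> sqrt (192 * K * t\<^sup>2)"
  proof (rule real_sqrt_le_mono)
    have "(1 / rr) * grad_inner e e \<le> (1 / rr) * (192 * (K * \<Theta>))" using H1 r0 by (intro mult_left_mono) auto
    also have "\<dots> = 192 * K * (\<Theta> / rr)" by simp
    also have "\<dots> \<le> 192 * K * t\<^sup>2" using \<Theta>t K0 by (intro mult_left_mono) auto
    finally show "(1 / rr) * grad_inner e e \<le> 192 * K * t\<^sup>2" .
  qed
  finally have 1: "\<epsilon> powr (1/4) * sqrt (grad_inner e e) \<le> sqrt (192 * K) * t"
    unfolding real_sqrt_mult[of "192 * K"] using t0 by simp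
  have "sqrt (L2_inner e e) \<le> sqrt (32 * (K + K / c) * t\<^sup>2)"
  proof (rule real_sqrt_le_mono)
    have "32 * (K + K / c) * (\<Theta> / rr) \<le> 32 * (K + K / c) * t\<^sup>2" using \<Theta>t K0 c by (intro mult_left_mono) auto
    then show "L2_inner e e \<le> 32 * (K + K / c) * t\<^sup>2" using L2 by (simp only: mult.assoc)
  qed
  then have 2: "sqrt (L2_inner e e) \<le> sqrt (32 * (K + K / c)) * t"
    unfolding real_sqrt_mult[of "32 * (K + K / c)"] using t0 by simp
  show ?thesis
    unfolding balanced_norm_def H1_seminorm_def L2_nrm_def e_def[symmetric] K_def[symmetric] t_def[symmetric] distrib_right
    using 1 2 by (rule add_mono)
qed

end

theorem mainTheorem5:
  fixes c cs lam0 \<epsilon>\<^sub>0 :: real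
    and f :: "real \<times> real \<Rightarrow> real"
    and u S :: "real \<Rightarrow> real \<times> real \<Rightarrow> real"
    and w z :: "real \<Rightarrow> nat \<Rightarrow> real \<times> real \<Rightarrow> real"
  assumes "c > 0" and "0 < cs" and "cs < c"
    and "lam0 \<ge> 5/2"
    and "0 < \<epsilon>\<^sub>0" and "\<epsilon>\<^sub>0 \<le> 1"
    and "Ck_closure 2 f"
    and "\<And>\<epsilon>. \<epsilon> \<in> {0<..\<epsilon>\<^sub>0} \<Longrightarrow> solves_bvp \<epsilon> c f (u \<epsilon>)"
    and "\<exists>C. \<forall>\<epsilon>\<in>{0<..\<epsilon>\<^sub>0}. layer_decomposition cs C \<epsilon> (u \<epsilon>) (S \<epsilon>) (w \<epsilon>) (z \<epsilon>)"
  shows "\<exists>C. \<forall>\<epsilon>\<in>{0<..\<epsilon>\<^sub>0}. \<forall>N Nh :: nat.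
           N > 0 \<and> sqrt (real N) = real Nh \<and> 4 dvd Nh \<longrightarrow>
           (\<forall>lam U_N_Nh U_Nh_N U_Nh_Nh U_N_N.
              lam = transition cs lam0 \<epsilon> N \<and>
              is_galerkin \<epsilon> c f (fe_space lam N Nh) U_N_Nh \<and>
              is_galerkin \<epsilon> c f (fe_space lam Nh N) U_Nh_N \<and>
              is_galerkin \<epsilon> c f (fe_space lam Nh Nh) U_Nh_Nh \<and>
              is_galerkin \<epsilon> c f (fe_space lam N N) U_N_N \<longrightarrow>
              balanced_norm \<epsilon> (\<lambda>p. (U_N_Nh p + U_Nh_N p - U_Nh_Nh p) - U_N_N p)
                \<le> C * (\<epsilon> powr (1/4) * real N powr (-1/2) + ln (real N) / real N))"
proof -
  obtain C where C: "layer_decomposition cs C \<epsilon> (u \<epsilon>) (S \<epsilon>) (w \<epsilon>) (z \<epsilon>)" if "\<epsilon> \<in> {0<..\<epsilon>\<^sub>0}" for \<epsilon>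
    using assms(9) by blast
  \<comment> \<open>\<open>C\<close> was fixed before \<epsilon> and N, so \<open>K\<close> depends
    on neither. The factor 2 is the one of \<open>layer_bound_pd\<close>.\<close>
  define K where "K = Kall c cs lam0 (2 * C)"
  show ?thesis
  proof (intro exI[of _ "sqrt (192 * K) + sqrt (32 * (K + K / c))"] ballI allI impI, elim conjE)
    fix \<epsilon> lam and N Nh :: nat and U1 U2 U3 U4
    assume \<epsilon>: "\<epsilon> \<in> {0<..\<epsilon>\<^sub>0}" and N0: "0 < N" and sq: "sqrt (real N) = real Nh" and "4 dvd Nh"
      and lam: "lam = transition cs lam0 \<epsilon> N"
      and gal: "is_galerkin \<epsilon> c f (fe_space lam N Nh) U1" "is_galerkin \<epsilon> c f (fe_space lam Nh N) U2"
        "is_galerkin \<epsilon> c f (fe_space lam Nh Nh) U3" "is_galerkin \<epsilon> c f (fe_space lam N N) U4"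
    obtain q where q: "Nh = 4 * q" using \<open>4 dvd Nh\<close> by blast
    have Nr: "real N = (real Nh)\<^sup>2" unfolding sq[symmetric] by simp
    then have "real N = real (Nh * Nh)" by (simp add: power2_eq_square)
    then have N: "N = Nh * Nh" by (simp only: of_nat_eq_iff)
    then have Nh0: "0 < Nh" using N0 by simp
    have e: "0 < \<epsilon>" "\<epsilon> \<le> 1" using \<epsilon> assms(6) by auto
    \<comment> \<open>\<open>Nh\<close> is positive and divisible by 4, hence at least 4.\<close>
    interpret shishkin_setting c cs lam0 \<epsilon> lam Nh
      by unfold_locales (use assms e Nh0 q lam in \<open>auto simp: transition_def Nr\<close>)
    note ld = decomposed_if_layer_decomposition[OF C[OF \<epsilon>] e]
    have s: "n1 = real N powr (- 1 / 2)" "L * n1\<^sup>2 = ln (real N) / real N"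
    proof -
      have "real N powr (- (1 / 2)) = inverse (real N powr (1 / 2))" by (rule powr_minus)
      then show "n1 = real N powr (- 1 / 2)" using sq by (simp add: powr_half_sqrt inverse_eq_divide)
      show "L * n1\<^sup>2 = ln (real N) / real N" unfolding Nr by (simp add: power_divide)
    qed
    have "balanced_norm \<epsilon> (\<lambda>p. (U1 p + U2 p - U3 p) - U4 p)
        \<le> (sqrt (192 * K) + sqrt (32 * (K + K / c))) * (\<epsilon> powr (1/4) * n1 + L * n1\<^sup>2)"
      unfolding K_def
      by (rule combination_bound[OF q _ ld(2) assms(8)[OF \<epsilon>] gal[unfolded N]]) (use ld(1) in simp)
    then show "balanced_norm \<epsilon> (\<lambda>p. (U1 p + U2 p - U3 p) - U4 p)
        \<le> (sqrt (192 * K) + sqrt (32 * (K + K / c))) * (\<epsilon> powr (1/4) * real N powr (-1/2) + ln (real N) / real N)"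
      unfolding s(2) unfolding s(1) .
  qed
qed

end
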